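(* Let $d \neq 0,1$ be a square-free integer and let $m\geq 1$ be an integer. Then, as $\mathbb{Z}$-group schemes, $$\widetilde{\underline{\mathbf{O}}}_{d,m}/\underline{\mathbf{O}}_{d,m}^+ \simeq \begin{cases}\underline{\mathbb{Z}/2} & \text{in Case (I)} \\ \underline{\mu}_2 & \text{in Case (II)}.\end{cases}$$
   Context: Case (I) means that $d\equiv 1\pmod 4$ and $m$ is odd; Case (II) covers all other pairs $(d,m)$. Let $k=\mathbb{Q}(\sqrt d)$ and let $\mathcal{O}_{d,m}$ be the unique order of index $m$ in $\mathcal{O}_k$. With respect to a fixed $\mathbb{Z}$-basis, its norm form is $q_{d,m}(x,y)=x^2+xy+c_{d,m}y^2$ in Case (I) and $q_{d,m}(x,y)=x^2-c_{d,m}y^2$ in Case (II), where $$c_{d,m}=\begin{cases}\frac{1-m^2d}{4} & d\equiv 1 \pmod 4,\ m \text{ odd}\\ \frac{m^2d}{4} & d\equiv 1\pmod 4,\ m\text{ even}\\ m^2d & d\equiv 2,3\pmod 4.\end{cases}$$ $\underline{\mathbf{O}}_{d,m}$ is the affine $\mathbb{Z}$-group scheme $\{A\in\mathbf{GL}_2 : q_{d,m}\circ A=q_{d,m}\}$ (it may fail to be flat over $\mathbb{Z}$); $\widetilde{\underline{\mathbf{O}}}_{d,m}$ is the schematic closure in $\underline{\mathbf{O}}_{d,m}$ of its generic fiber; $\underline{\mathbf{O}}_{d,m}^+$ is the schematic closure in $\underline{\mathbf{O}}_{d,m}$ of $\ker[\det:\underline{\mathbf{O}}_{d,m}\otimes\mathbb{Q}\to\mu_2]$.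 The quotient is the fppf quotient, which is representable by an affine flat $\mathbb{Z}$-group scheme. $\underline{\mathbb{Z}/2}=\mathrm{Spec}\,\mathbb{Z}[t]/(t^2-t)$ is the constant group scheme of order 2 and $\underline{\mu}_2=\mathrm{Spec}\,\mathbb{Z}[t]/(t^2-1)$. *)

theory Defs
  imports
    "HOL-Algebra.Algebra"
    "HOL-Library.Multiset"
    "HOL-Library.Poly_Mapping"
    "HOL-Computational_Algebra.Squarefree"
begin

text \<open>
  Group schemes over \<open>\<int>\<close> are treated through their functors of points. All test rings are
  commutative rings carried by subsets of one type \<open>'u\<close>. When \<open>'u\<close> is infinite, this
  class of rings contains, up to isomorphism, every finitely generated ring and is closed under
  algebras of finite presentation; so it contains the coordinate rings of all the schemes below,
  the Yoneda lemma applies to them, and fppf coverings do not leave the class.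
\<close>

section \<open>The fppf topology on commutative rings\<close>

text \<open>Maps are made extensional, so that equal morphisms are equal functions; composition is
  \<^const>\<open>compose\<close>.\<close>

definition ring_maps :: "'u ring \<Rightarrow> 'u ring \<Rightarrow> ('u \<Rightarrow> 'u) set" where
  "ring_maps R S = ring_hom R S \<inter> extensional (carrier R)"

text \<open>\<open>M \<otimes>\<^sub>R N\<close> is the free abelian group on \<open>M \<times> N\<close> modulo the following subgroup.\<close>

definition tensor_relations ::
  "'u ring \<Rightarrow> ('u, 'u) module \<Rightarrow> ('u, 'u) module \<Rightarrow> ('u \<times> 'u \<Rightarrow>\<^sub>0 int) set" where
  "tensor_relations R M N =
     generate (free_Abelian_group (carrier M \<times> carrier N))
       ({frag_of (x \<oplus>\<^bsub>M\<^esub> x', y) - frag_of (x, y) - frag_of (x', y) | x x' y.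
           x \<in> carrier M \<and> x' \<in> carrier M \<and> y \<in> carrier N}
      \<union> {frag_of (x, y \<oplus>\<^bsub>N\<^esub> y') - frag_of (x, y) - frag_of (x, y') | x y y'.
           x \<in> carrier M \<and> y \<in> carrier N \<and> y' \<in> carrier N}
      \<union> {frag_of (r \<odot>\<^bsub>M\<^esub> x, y) - frag_of (x, r \<odot>\<^bsub>N\<^esub> y) | r x y.
           r \<in> carrier R \<and> x \<in> carrier M \<and> y \<in> carrier N})"

definition linear_maps ::
  "'u ring \<Rightarrow> ('u, 'u) module \<Rightarrow> ('u, 'u) module \<Rightarrow> ('u \<Rightarrow> 'u) set" where
  "linear_maps R M N =
     {h \<in> hom (add_monoid M) (add_monoid N).
        \<forall>r \<in> carrier R. \<forall>x \<in> carrier M. h (r \<odot>\<^bsub>M\<^esub> x) = r \<odot>\<^bsub>N\<^esub> h x}"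

definition algebra_module :: "'u ring \<Rightarrow> ('u \<Rightarrow> 'u) \<Rightarrow> ('u, 'u) module" where
  "algebra_module S f =
     \<lparr>carrier = carrier S, monoid.mult = monoid.mult S, one = one S, ring.zero = ring.zero S, ring.add = ring.add S,
      smult = (\<lambda>r s. f r \<otimes>\<^bsub>S\<^esub> s)\<rparr>"

text \<open>For every injective linear map \<open>h : M \<rightarrow> N\<close>, the map \<open>h \<otimes> S : M \<otimes>\<^sub>R S \<rightarrow> N \<otimes>\<^sub>R S\<close> is
  injective; the last line says that its kernel is zero.\<close>

definition flat_map :: "'u ring \<Rightarrow> 'u ring \<Rightarrow> ('u \<Rightarrow> 'u) \<Rightarrow> bool" where
  "flat_map R S f \<longleftrightarrow>
     (\<forall>M N h. module R M \<and> module R N \<and> h \<in> linear_maps R M N \<and> inj_on h (carrier M) \<longrightarrow>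
        (\<forall>t \<in> carrier (free_Abelian_group (carrier M \<times> carrier S)).
           frag_extend (\<lambda>(x, s). frag_of (h x, s)) t \<in> tensor_relations R N (algebra_module S f)
             \<longrightarrow> t \<in> tensor_relations R M (algebra_module S f)))"

text \<open>The polynomial ring \<open>R[X\<^sub>0, \<dots>, X\<^sub>n\<^sub>-\<^sub>1]\<close>; monomials are multisets of indices, as in
  \<^theory>\<open>HOL-Algebra.Indexed_Polynomials\<close>.\<close>

definition poly_const :: "'u ring \<Rightarrow> 'u \<Rightarrow> nat multiset \<Rightarrow> 'u" where
  "poly_const R r = (\<lambda>m. if m = {#} then r else \<zero>\<^bsub>R\<^esub>)"

definition mpoly_ring :: "'u ring \<Rightarrow> nat \<Rightarrow> (nat multiset \<Rightarrow> 'u) ring" where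
  "mpoly_ring R n =
     \<lparr>carrier = {p. (\<forall>m. p m \<in> carrier R) \<and> finite {m. p m \<noteq> \<zero>\<^bsub>R\<^esub>} \<and>
                    (\<forall>m. p m \<noteq> \<zero>\<^bsub>R\<^esub> \<longrightarrow> set_mset m \<subseteq> {..<n})},
      monoid.mult = (\<lambda>p q m. \<Oplus>\<^bsub>R\<^esub> a \<in> {a. a \<subseteq># m}. p a \<otimes>\<^bsub>R\<^esub> q (m - a)),
      one = poly_const R \<one>\<^bsub>R\<^esub>,
      ring.zero = poly_const R \<zero>\<^bsub>R\<^esub>,
      ring.add = (\<lambda>p q m. p m \<oplus>\<^bsub>R\<^esub> q m)\<rparr>"

definition finitely_presented_map :: "'u ring \<Rightarrow> 'u ring \<Rightarrow> ('u \<Rightarrow> 'u) \<Rightarrow> bool" where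
  "finitely_presented_map R S f \<longleftrightarrow>
     (\<exists>n \<phi> F. \<phi> \<in> ring_hom (mpoly_ring R n) S \<and>
        \<phi> ` carrier (mpoly_ring R n) = carrier S \<and>
        (\<forall>r \<in> carrier R. \<phi> (poly_const R r) = f r) \<and>
        finite F \<and> F \<subseteq> carrier (mpoly_ring R n) \<and>
        a_kernel (mpoly_ring R n) S \<phi> = Idl\<^bsub>mpoly_ring R n\<^esub> F)"

text \<open>A pair \<open>(S, f)\<close> stands for an \<open>R\<close>-algebra, i.e. for \<open>Spec S \<rightarrow> Spec R\<close>.\<close>

type_synonym 'u arrow = "'u ring \<times> ('u \<Rightarrow> 'u)"

definition arrows :: "'u ring \<Rightarrow> 'u arrow set" where
  "arrows R = {(S, f). cring S \<and> f \<in> ring_maps R S}"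

text \<open>Finite families suffice, since flat morphisms of finite presentation are open and
  spectra are quasi-compact.\<close>

definition fppf_family :: "'u ring \<Rightarrow> 'u arrow set \<Rightarrow> bool" where
  "fppf_family R C \<longleftrightarrow>
     finite C \<and> C \<subseteq> arrows R \<and>
     (\<forall>(S, f) \<in> C. flat_map R S f \<and> finitely_presented_map R S f) \<and>
     (\<forall>P. primeideal P R \<longrightarrow>
        (\<exists>(S, f) \<in> C. \<exists>Q. primeideal Q S \<and> P = {r \<in> carrier R. f r \<in> Q}))"

definition sieve :: "'u ring \<Rightarrow> 'u arrow set \<Rightarrow> bool" where
  "sieve R U \<longleftrightarrow>
     U \<subseteq> arrows R \<and>
     (\<forall>(S, f) \<in> U. \<forall>(T, g) \<in> arrows S. (T, compose (carrier R) g f) \<in> U)"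

definition fppf_sieve :: "'u ring \<Rightarrow> 'u arrow set \<Rightarrow> bool" where
  "fppf_sieve R U \<longleftrightarrow> sieve R U \<and> (\<exists>C \<subseteq> U. fppf_family R C)"


section \<open>Group functors and fppf quotients\<close>

text \<open>\<open>grp G R\<close> is the group of \<open>R\<close>-points; \<open>res G R S f\<close> is the map induced by \<open>f : R \<rightarrow> S\<close>.\<close>

record ('u, 'g) group_functor =
  grp :: "'u ring \<Rightarrow> 'g monoid"
  res :: "'u ring \<Rightarrow> 'u ring \<Rightarrow> ('u \<Rightarrow> 'u) \<Rightarrow> 'g \<Rightarrow> 'g"

definition subfunctor ::
  "('u, 'g) group_functor \<Rightarrow> ('u ring \<Rightarrow> 'g set) \<Rightarrow> ('u, 'g) group_functor" where
  "subfunctor G Z = G\<lparr>grp := (\<lambda>R. (grp G R)\<lparr>carrier := Z R\<rparr>)\<rparr>"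

definition isomorphic_functors ::
  "('u, 'g) group_functor \<Rightarrow> ('u, 'h) group_functor \<Rightarrow> bool" where
  "isomorphic_functors G H \<longleftrightarrow>
     (\<exists>\<phi>. (\<forall>R. cring R \<longrightarrow> \<phi> R \<in> iso (grp G R) (grp H R)) \<and>
          (\<forall>R. cring R \<longrightarrow> (\<forall>(S, f) \<in> arrows R. \<forall>x \<in> carrier (grp G R).
             \<phi> S (res G R S f x) = res H R S f (\<phi> R x))))"

text \<open>The presheaf \<open>R \<mapsto> G(R)/H(R)\<close>. The class \<open>H(R) g\<close> restricts to \<open>H(S) f(g)\<close>.\<close>

definition quotient_presheaf ::
  "('u, 'g) group_functor \<Rightarrow> ('u, 'g) group_functor \<Rightarrow> ('u, 'g set) group_functor" where
  "quotient_presheaf G H =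
     \<lparr>grp = (\<lambda>R. grp G R Mod carrier (grp H R)),
      res = (\<lambda>R S f K. carrier (grp H S) <#>\<^bsub>grp G S\<^esub> (res G R S f ` K))\<rparr>"

text \<open>The sheaf associated with a presheaf \<open>P\<close>. A section over \<open>R\<close> is represented by sections of
  \<open>P\<close> on the members of a covering sieve that are compatible locally; two representatives are
  identified when they agree locally on a common covering sieve. Requiring only local agreement
  does both steps of the plus construction at once.\<close>

definition locally_equal :: "('u, 'g) group_functor \<Rightarrow> 'u ring \<Rightarrow> 'g \<Rightarrow> 'g \<Rightarrow> bool" where
  "locally_equal P R x y \<longleftrightarrow>
     (\<exists>U. fppf_sieve R U \<and> (\<forall>(S, f) \<in> U. res P R S f x = res P R S f y))"

type_synonym ('u, 'g) local_section = "'u arrow set \<times> ('u arrow \<Rightarrow> 'g)"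

definition local_sections ::
  "('u, 'g) group_functor \<Rightarrow> 'u ring \<Rightarrow> ('u, 'g) local_section set" where
  "local_sections P R =
     {(U, x). fppf_sieve R U \<and>
        (\<forall>(S, f) \<in> U. x (S, f) \<in> carrier (grp P S)) \<and>
        (\<forall>(S, f) \<in> U. \<forall>(T, g) \<in> arrows S.
           locally_equal P T (x (T, compose (carrier R) g f)) (res P S T g (x (S, f))))}"

definition section_class ::
  "('u, 'g) group_functor \<Rightarrow> 'u ring \<Rightarrow> ('u, 'g) local_section \<Rightarrow> ('u, 'g) local_section set" where
  "section_class P R = (\<lambda>(U, x).
     {(V, y) \<in> local_sections P R. \<exists>W. fppf_sieve R W \<and> W \<subseteq> U \<inter> V \<and>
        (\<forall>(S, f) \<in> W. locally_equal P S (x (S, f)) (y (S, f)))})"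

text \<open>Operations on classes are given by representatives; since the result does not depend on the
  choice, the union over all representatives is a single class.\<close>

definition fppf_sheafification ::
  "('u, 'g) group_functor \<Rightarrow> ('u, ('u, 'g) local_section set) group_functor" where
  "fppf_sheafification P =
     \<lparr>grp = (\<lambda>R.
        \<lparr>carrier = section_class P R ` local_sections P R,
         monoid.mult = (\<lambda>A B. \<Union>(U, x) \<in> A. \<Union>(V, y) \<in> B.
           section_class P R (U \<inter> V, \<lambda>(S, f). x (S, f) \<otimes>\<^bsub>grp P S\<^esub> y (S, f))),
         one = section_class P R (arrows R, \<lambda>(S, f). \<one>\<^bsub>grp P S\<^esub>)\<rparr>),
      res = (\<lambda>R S f A. \<Union>(U, x) \<in> A.
        section_class P S
          ({(T, g) \<in> arrows S. (T, compose (carrier R) g f) \<in> U},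
           \<lambda>(T, g). x (T, compose (carrier R) g f)))\<rparr>"

definition fppf_quotient ::
  "('u, 'g) group_functor \<Rightarrow> ('u, 'g) group_functor
     \<Rightarrow> ('u, ('u, 'g set) local_section set) group_functor" where
  "fppf_quotient G H = fppf_sheafification (quotient_presheaf G H)"


section \<open>Schematic closure\<close>

text \<open>Regular functions on \<open>Z\<close> are the morphisms from \<open>Z\<close> to the affine line. For \<open>Z\<close> affine and
  \<open>Y\<close> a subfunctor of \<open>Z\<close>, the schematic closure of \<open>Y\<close> in \<open>Z\<close> is the closed subscheme cut out by
  the ideal of those regular functions on \<open>Z\<close> that restrict to zero on \<open>Y\<close>.\<close>

definition regular_functions :: "('u, 'g) group_functor \<Rightarrow> ('u ring \<Rightarrow> 'g \<Rightarrow> 'u) set" where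
  "regular_functions Z =
     {\<phi>. (\<forall>R. cring R \<longrightarrow> \<phi> R \<in> carrier (grp Z R) \<rightarrow> carrier R) \<and>
         (\<forall>R. cring R \<longrightarrow> (\<forall>(S, f) \<in> arrows R. \<forall>x \<in> carrier (grp Z R).
            \<phi> S (res Z R S f x) = f (\<phi> R x)))}"

definition schematic_closure ::
  "('u, 'g) group_functor \<Rightarrow> ('u ring \<Rightarrow> 'g set) \<Rightarrow> ('u, 'g) group_functor" where
  "schematic_closure Z Y = subfunctor Z (\<lambda>R.
     {x \<in> carrier (grp Z R). \<forall>\<phi> \<in> regular_functions Z.
        (\<forall>S. cring S \<longrightarrow> (\<forall>y \<in> Y S. \<phi> S y = \<zero>\<^bsub>S\<^esub>)) \<longrightarrow> \<phi> R x = \<zero>\<^bsub>R\<^esub>})"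

text \<open>\<open>Z \<otimes> \<rat>\<close> as a subfunctor of \<open>Z\<close>: since \<open>Spec \<rat> \<rightarrow> Spec \<int>\<close> is a monomorphism, its \<open>R\<close>-points
  are those of \<open>Z\<close> when \<open>R\<close> is a \<open>\<rat>\<close>-algebra, and there are none otherwise.\<close>

definition rational_algebra :: "'u ring \<Rightarrow> bool" where
  "rational_algebra R \<longleftrightarrow> (\<forall>n::nat. n > 0 \<longrightarrow> [n] \<cdot>\<^bsub>R\<^esub> \<one>\<^bsub>R\<^esub> \<in> Units R)"

definition generic_fibre :: "('u, 'g) group_functor \<Rightarrow> 'u ring \<Rightarrow> 'g set" where
  "generic_fibre Z R = {x \<in> carrier (grp Z R). rational_algebra R}"


section \<open>The orthogonal group schemes\<close>

text \<open>\<open>(a, b, c, d)\<close> is the matrix with rows \<open>(a, b)\<close> and \<open>(c, d)\<close>, acting on column vectors.\<close>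

type_synonym 'u mat2 = "'u \<times> 'u \<times> 'u \<times> 'u"

definition mat2_det :: "'u ring \<Rightarrow> 'u mat2 \<Rightarrow> 'u" where
  "mat2_det R = (\<lambda>(a, b, c, d). a \<otimes>\<^bsub>R\<^esub> d \<ominus>\<^bsub>R\<^esub> b \<otimes>\<^bsub>R\<^esub> c)"

definition mat2_apply :: "'u ring \<Rightarrow> 'u mat2 \<Rightarrow> 'u \<times> 'u \<Rightarrow> 'u \<times> 'u" where
  "mat2_apply R = (\<lambda>(a, b, c, d) (x, y).
     (a \<otimes>\<^bsub>R\<^esub> x \<oplus>\<^bsub>R\<^esub> b \<otimes>\<^bsub>R\<^esub> y, c \<otimes>\<^bsub>R\<^esub> x \<oplus>\<^bsub>R\<^esub> d \<otimes>\<^bsub>R\<^esub> y))"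

definition mat2_map :: "('u \<Rightarrow> 'u) \<Rightarrow> 'u mat2 \<Rightarrow> 'u mat2" where
  "mat2_map f = (\<lambda>(a, b, c, d). (f a, f b, f c, f d))"

definition GL2 :: "('u, 'u mat2) group_functor" where
  "GL2 =
     \<lparr>grp = (\<lambda>R.
        \<lparr>carrier = {A. A \<in> carrier R \<times> carrier R \<times> carrier R \<times> carrier R \<and> mat2_det R A \<in> Units R},
         monoid.mult = (\<lambda>(a, b, c, d) (a', b', c', d').
           (a \<otimes>\<^bsub>R\<^esub> a' \<oplus>\<^bsub>R\<^esub> b \<otimes>\<^bsub>R\<^esub> c', a \<otimes>\<^bsub>R\<^esub> b' \<oplus>\<^bsub>R\<^esub> b \<otimes>\<^bsub>R\<^esub> d',
            c \<otimes>\<^bsub>R\<^esub> a' \<oplus>\<^bsub>R\<^esub> d \<otimes>\<^bsub>R\<^esub> c', c \<otimes>\<^bsub>R\<^esub> b' \<oplus>\<^bsub>R\<^esub> d \<otimes>\<^bsub>R\<^esub> d')),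
         one = (\<one>\<^bsub>R\<^esub>, \<zero>\<^bsub>R\<^esub>, \<zero>\<^bsub>R\<^esub>, \<one>\<^bsub>R\<^esub>)\<rparr>),
      res = (\<lambda>R S. mat2_map)\<rparr>"

definition case_I :: "int \<Rightarrow> nat \<Rightarrow> bool" where
  "case_I d m \<longleftrightarrow> d mod 4 = 1 \<and> odd m"

text \<open>Both divisions by 4 are exact.\<close>

definition c_const :: "int \<Rightarrow> nat \<Rightarrow> int" where
  "c_const d m =
     (if d mod 4 = 1
      then if odd m then (1 - (int m)\<^sup>2 * d) div 4 else ((int m)\<^sup>2 * d) div 4
      else (int m)\<^sup>2 * d)"

definition norm_form :: "int \<Rightarrow> nat \<Rightarrow> 'u ring \<Rightarrow> 'u \<times> 'u \<Rightarrow> 'u" where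
  "norm_form d m R = (\<lambda>(x, y).
     if case_I d m
     then x \<otimes>\<^bsub>R\<^esub> x \<oplus>\<^bsub>R\<^esub> x \<otimes>\<^bsub>R\<^esub> y \<oplus>\<^bsub>R\<^esub> [c_const d m] \<cdot>\<^bsub>R\<^esub> (y \<otimes>\<^bsub>R\<^esub> y)
     else x \<otimes>\<^bsub>R\<^esub> x \<ominus>\<^bsub>R\<^esub> [c_const d m] \<cdot>\<^bsub>R\<^esub> (y \<otimes>\<^bsub>R\<^esub> y))"

text \<open>The identity \<open>q \<circ> A = q\<close> over \<open>R\<close> is one of morphisms of \<open>R\<close>-schemes, so it is tested on the
  points of all \<open>R\<close>-algebras.\<close>

definition O_scheme :: "int \<Rightarrow> nat \<Rightarrow> ('u, 'u mat2) group_functor" where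
  "O_scheme d m = subfunctor GL2 (\<lambda>R.
     {A \<in> carrier (grp GL2 R). \<forall>(S, f) \<in> arrows R. \<forall>v \<in> carrier S \<times> carrier S.
        norm_form d m S (mat2_apply S (mat2_map f A) v) = norm_form d m S v})"

definition O_tilde :: "int \<Rightarrow> nat \<Rightarrow> ('u, 'u mat2) group_functor" where
  "O_tilde d m = schematic_closure (O_scheme d m) (generic_fibre (O_scheme d m))"

definition O_plus :: "int \<Rightarrow> nat \<Rightarrow> ('u, 'u mat2) group_functor" where
  "O_plus d m = schematic_closure (O_scheme d m)
     (\<lambda>R. {A \<in> generic_fibre (O_scheme d m) R. mat2_det R A = \<one>\<^bsub>R\<^esub>})"

text \<open>\<open>R\<close>-points of \<open>Spec \<int>[t]/(t\<^sup>2 - t)\<close> are the idempotents of \<open>R\<close>, i.e. the locally constant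
  functions from \<open>Spec R\<close> to \<open>{0, 1}\<close>; addition of such functions modulo 2 is the group law.\<close>

definition Z2_scheme :: "('u, 'u) group_functor" where
  "Z2_scheme =
     \<lparr>grp = (\<lambda>R.
        \<lparr>carrier = {e \<in> carrier R. e \<otimes>\<^bsub>R\<^esub> e = e},
         monoid.mult = (\<lambda>e e'. (e \<oplus>\<^bsub>R\<^esub> e') \<ominus>\<^bsub>R\<^esub> [(2::nat)] \<cdot>\<^bsub>R\<^esub> (e \<otimes>\<^bsub>R\<^esub> e')),
         one = \<zero>\<^bsub>R\<^esub>\<rparr>),
      res = (\<lambda>R S f. f)\<rparr>"

definition mu2_scheme :: "('u, 'u) group_functor" where
  "mu2_scheme =
     \<lparr>grp = (\<lambda>R.
        \<lparr>carrier = {r \<in> carrier R. r \<otimes>\<^bsub>R\<^esub> r = \<one>\<^bsub>R\<^esub>}, monoid.mult = monoid.mult R, one = \<one>\<^bsub>R\<^esub>\<rparr>),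
      res = (\<lambda>R S f. f)\<rparr>"

end

theory Submission
  imports Defs "HOL-Decision_Procs.Commutative_Ring" "HOL-Computational_Algebra.Polynomial"
begin

text \<open>Write the norm form as \<open>q(x, y) = x\<^sup>2 + e x y + k y\<^sup>2\<close>, with \<open>e = 1\<close> in Case (I) and \<open>e = 0\<close> in Case (II),
  and let \<open>\<omega>\<close> be the generator with \<open>\<omega>\<^sup>2 = e \<omega> - k\<close>, so that \<open>q(x, y)\<close> is the norm of \<open>x + y \<omega>\<close>.
  The first column \<open>(a, b)\<close> of an orthogonal matrix has norm 1, and the matrix is then uniquely the product
  of multiplication by \<open>a + b \<omega>\<close> and of the upper triangular matrix with columns \<open>(1, 0)\<close> and \<open>(u, t)\<close>
  (this product is \<open>par a b u t\<close>). The whole question thus concerns the pairs \<open>(u, t)\<close>.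

  Over a \<open>\<rat>\<close>-algebra, \<open>(u, t)\<close> comes from an orthogonal matrix only if \<open>u\<^sup>2 = u\<close> and \<open>t = 1 - 2 u\<close> in Case (I),
  \<open>u = 0\<close> and \<open>t\<^sup>2 = 1\<close> in Case (II) (\<open>rational_O_subset_Gset\<close>; here the discriminant has to be nonzero). Let
  \<open>Gset R\<close> be the set of the matrices over \<open>R\<close> that satisfy these equations, and \<open>Kset R\<close> its subset
  \<open>u = 0, t = 1\<close>. Since \<open>u\<close> and \<open>t\<close> are regular functions, \<open>O_tilde(R) \<subseteq> Gset R\<close> and
  \<open>O_plus(R) \<subseteq> Kset R\<close>. Conversely each point of \<open>Gset R\<close> is the image of a point over a ring that is free
  as a \<open>\<int>[x]\<close>-module, hence embeds into a \<open>\<rat>\<close>-algebra; a regular function vanishing on all rational points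
  vanishes at that point, so also at its image (\<open>Gset_subset_O_tilde\<close>, \<open>Kset_subset_O_plus\<close>).

  The map \<open>A \<mapsto> u\<close> in Case (I), \<open>A \<mapsto> t\<close> in Case (II), is a homomorphism from \<open>O_tilde(R)\<close> to the
  group \<open>\<int>/2(R)\<close>, respectively \<open>\<mu>\<^sub>2(R)\<close>, with kernel \<open>O_plus(R)\<close>, and it is onto for every \<open>R\<close>: take
  \<open>a = 1\<close> and \<open>b = 0\<close>. So the presheaf quotient is already isomorphic to the functor of points of an affine
  scheme, and it remains to see that sheafification does not change such a functor
  (\<open>sheaf_comparison.sheafification_isomorphic\<close>). This is faithfully flat descent for elements: a
  compatible family on a covering sieve comes from a unique element of the base ring (\<open>fppf_descent\<close>,
  \<open>fppf_separated\<close>). Descent, and the fact that two covering sieves intersect in a covering sieve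
  (\<open>fppf_sieve_Int\<close>), need tensor products of algebras inside the given type of ring elements, and
  these are constructed first; they fit because the type is infinite. The form of flatness used
  for descent is \<open>flat_annihilator\<close>: if \<open>n \<otimes> s\<close> lies in the image of \<open>K \<otimes> S\<close> in \<open>N \<otimes> S\<close>, then \<open>s\<close> lies in the
  ideal of \<open>S\<close> generated by the \<open>r\<close> with \<open>r n \<in> K\<close>.\<close>

section \<open>Tensor products\<close>

text \<open>An injection of the formal sums of pairs of elements of \<open>'u\<close> into \<open>'u\<close>. It exists when \<open>'u\<close> is
  infinite, since both types then have the same cardinality; it makes tensor products of
  modules carried by \<open>'u\<close> into modules carried by \<open>'u\<close>.\<close>

definition frag_code :: "('u \<times> 'u \<Rightarrow>\<^sub>0 int) \<Rightarrow> 'u" where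
  "frag_code = (SOME e. inj e)"

lemma inj_frag_code:
  assumes "infinite (UNIV :: 'u set)"
  shows "inj (frag_code :: ('u \<times> 'u \<Rightarrow>\<^sub>0 int) \<Rightarrow> 'u)"
proof -
  have inf: "infinite (UNIV :: ('u \<times> 'u) set)"
    using assms by (simp add: finite_prod)
  have "carrier (free_Abelian_group (UNIV :: ('u \<times> 'u) set)) \<approx> (UNIV :: ('u \<times> 'u) set)"
    by (rule eqpoll_free_Abelian_group_infinite[OF inf])
  moreover have "carrier (free_Abelian_group (UNIV :: ('u \<times> 'u) set)) = UNIV"
    by auto
  moreover have "(UNIV :: ('u \<times> 'u) set) \<approx> (UNIV :: 'u set)"
    using eqpoll_iff_card_of_ordIso card_of_Times_same_infinite[OF assms] by (metis UNIV_Times_UNIV)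
  ultimately have "(UNIV :: ('u \<times> 'u \<Rightarrow>\<^sub>0 int) set) \<approx> (UNIV :: 'u set)"
    using eqpoll_trans by metis
  then have "\<exists>e :: ('u \<times> 'u \<Rightarrow>\<^sub>0 int) \<Rightarrow> 'u. inj e"
    unfolding eqpoll_def bij_betw_def by blast
  then show ?thesis
    unfolding frag_code_def by (rule someI_ex)
qed

text \<open>The class of a formal sum \<open>t\<close> modulo the tensor relations, encoded by the code of a chosen
  representative; the choice depends on the class of \<open>t\<close> only.\<close>

definition tensor_class ::
  "'u ring \<Rightarrow> ('u, 'u) module \<Rightarrow> ('u, 'u) module \<Rightarrow> ('u \<times> 'u \<Rightarrow>\<^sub>0 int) \<Rightarrow> 'u" where
  "tensor_class R M N t =
     frag_code (SOME t'. t' \<in> carrier (free_Abelian_group (carrier M \<times> carrier N)) \<and>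
                         t' - t \<in> tensor_relations R M N)"

text \<open>The map \<open>\<Sum> (x, s) \<mapsto> \<Sum> (h x, s)\<close> on formal sums.\<close>

definition frag_lift :: "('u \<Rightarrow> 'u) \<Rightarrow> ('u \<times> 'u \<Rightarrow>\<^sub>0 int) \<Rightarrow> ('u \<times> 'u \<Rightarrow>\<^sub>0 int)" where
  "frag_lift h = frag_extend (\<lambda>(x, s). frag_of (h x, s))"

text \<open>The biadditive extension of the componentwise product of pairs.\<close>

definition frag_mult ::
  "('u, 'e) monoid_scheme \<Rightarrow> ('u, 'e) monoid_scheme \<Rightarrow> ('u \<times> 'u \<Rightarrow>\<^sub>0 int) \<Rightarrow> ('u \<times> 'u \<Rightarrow>\<^sub>0 int) \<Rightarrow> ('u \<times> 'u \<Rightarrow>\<^sub>0 int)" where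
  "frag_mult S S' t t' = frag_extend (\<lambda>(a, b). frag_extend (\<lambda>(a', b').
     frag_of (a \<otimes>\<^bsub>S\<^esub> a', b \<otimes>\<^bsub>S'\<^esub> b')) t') t"

abbreviation frag_decode :: "'u \<Rightarrow> ('u \<times> 'u \<Rightarrow>\<^sub>0 int)" where
  "frag_decode \<equiv> inv_into UNIV frag_code"

text \<open>The tensor product \<open>M \<otimes>\<^sub>R N\<close>, with \<open>r (x \<otimes> y) = (r x) \<otimes> y\<close>. The multiplication and the unit
  are those of the tensor product of algebras, and have no meaning unless \<open>M\<close> and \<open>N\<close> come from
  \<open>R\<close>-algebras.\<close>

definition tensor ::
  "'u ring \<Rightarrow> ('u, 'u) module \<Rightarrow> ('u, 'u) module \<Rightarrow> ('u, 'u) module" where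
  "tensor R M N =
     \<lparr>carrier = tensor_class R M N ` carrier (free_Abelian_group (carrier M \<times> carrier N)),
      monoid.mult = (\<lambda>x y. tensor_class R M N
        (frag_mult M N (frag_decode x) (frag_decode y))),
      one = tensor_class R M N (frag_of (\<one>\<^bsub>M\<^esub>, \<one>\<^bsub>N\<^esub>)),
      ring.zero = tensor_class R M N 0,
      ring.add = (\<lambda>x y. tensor_class R M N (frag_decode x + frag_decode y)),
      module.smult = (\<lambda>r x. tensor_class R M N (frag_lift (\<lambda>m. r \<odot>\<^bsub>M\<^esub> m) (frag_decode x)))\<rparr>"

text \<open>The pure tensor \<open>x \<otimes> y\<close>.\<close>

definition pure :: "'u ring \<Rightarrow> ('u, 'u) module \<Rightarrow> ('u, 'u) module \<Rightarrow> 'u \<Rightarrow> 'u \<Rightarrow> 'u" where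
  "pure R M N x y = tensor_class R M N (frag_of (x, y))"

text \<open>Biadditive maps \<open>b\<close> with \<open>b (r x) y = b x (r y)\<close>, with values in an abelian group.\<close>

definition balanced ::
  "'u ring \<Rightarrow> ('u, 'u) module \<Rightarrow> ('u, 'u) module \<Rightarrow> ('g, 'e) ring_scheme \<Rightarrow> ('u \<Rightarrow> 'u \<Rightarrow> 'g) \<Rightarrow> bool" where
  "balanced R M N G b \<longleftrightarrow>
     (\<forall>x \<in> carrier M. \<forall>y \<in> carrier N. b x y \<in> carrier G) \<and>
     (\<forall>x \<in> carrier M. \<forall>x' \<in> carrier M. \<forall>y \<in> carrier N. b (x \<oplus>\<^bsub>M\<^esub> x') y = b x y \<oplus>\<^bsub>G\<^esub> b x' y) \<and>
     (\<forall>x \<in> carrier M. \<forall>y \<in> carrier N. \<forall>y' \<in> carrier N. b x (y \<oplus>\<^bsub>N\<^esub> y') = b x y \<oplus>\<^bsub>G\<^esub> b x y') \<and>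
     (\<forall>r \<in> carrier R. \<forall>x \<in> carrier M. \<forall>y \<in> carrier N. b (r \<odot>\<^bsub>M\<^esub> x) y = b x (r \<odot>\<^bsub>N\<^esub> y))"

lemma (in abelian_group) diff_eq_zero_iff:
  assumes "a \<in> carrier G" "b \<in> carrier G"
  shows "a \<ominus> b = \<zero> \<longleftrightarrow> a = b"
  using assms by (metis a_minus_def add.inv_closed minus_equality minus_minus r_neg)

text \<open>Two modules over \<open>R\<close>, carried by an infinite type, and their tensor product \<open>T\<close>. A tensor is either
  the class \<open>cls t\<close> of a formal sum \<open>t \<in> F\<close>, or a sum of pure tensors \<open>pt x y\<close>.\<close>

locale tensor_pair = M: module R M + N: module R N
  for R :: "'u ring" and M :: "('u, 'u) module" and N :: "('u, 'u) module" +
  assumes infinite_UNIV: "infinite (UNIV :: 'u set)"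
begin

abbreviation F where "F \<equiv> free_Abelian_group (carrier M \<times> carrier N)"
abbreviation rel where "rel \<equiv> tensor_relations R M N"
abbreviation cls where "cls \<equiv> tensor_class R M N"
abbreviation T where "T \<equiv> tensor R M N"
abbreviation pt where "pt \<equiv> pure R M N"

lemma F_closed [simp, intro]:
  "0 \<in> carrier F"
  "t \<in> carrier F \<Longrightarrow> t' \<in> carrier F \<Longrightarrow> t + t' \<in> carrier F"
  "t \<in> carrier F \<Longrightarrow> t' \<in> carrier F \<Longrightarrow> t - t' \<in> carrier F"
  "t \<in> carrier F \<Longrightarrow> - t \<in> carrier F"
  "x \<in> carrier M \<Longrightarrow> y \<in> carrier N \<Longrightarrow> frag_of (x, y) \<in> carrier F"
  using keys_add[of t t'] keys_diff[of t t'] by (auto simp: keys_minus)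

lemma F_induct [consumes 1, case_names zero pure diff]:
  assumes "t \<in> carrier F" "P 0"
    and "\<And>x y. x \<in> carrier M \<Longrightarrow> y \<in> carrier N \<Longrightarrow> P (frag_of (x, y))"
    and "\<And>t t'. t \<in> carrier F \<Longrightarrow> t' \<in> carrier F \<Longrightarrow> P t \<Longrightarrow> P t' \<Longrightarrow> P (t - t')"
  shows "P t"
proof (rule free_Abelian_group_induct[where S = "carrier M \<times> carrier N"])
  show "Poly_Mapping.keys t \<subseteq> carrier M \<times> carrier N" using assms(1) by simp
qed (use assms in auto)

lemma rel_subgroup: "subgroup rel F"
  unfolding tensor_relations_def
  by (rule group.generate_is_subgroup[OF group_free_Abelian_group])
     (auto simp del: carrier_free_Abelian_group_iff)

lemma rel_carrier: "t \<in> rel \<Longrightarrow> t \<in> carrier F"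
  using subgroup.subset[OF rel_subgroup] by blast

lemma rel_closed [simp, intro]:
  "0 \<in> rel" "t \<in> rel \<Longrightarrow> t' \<in> rel \<Longrightarrow> t + t' \<in> rel"
  "t \<in> rel \<Longrightarrow> - t \<in> rel" "t \<in> rel \<Longrightarrow> t' \<in> rel \<Longrightarrow> t - t' \<in> rel"
proof -
  show z: "0 \<in> rel" using subgroup.one_closed[OF rel_subgroup] by simp
  show p: "t + t' \<in> rel" if "t \<in> rel" "t' \<in> rel" for t t'
    using subgroup.m_closed[OF rel_subgroup that] by simp
  show m: "- t \<in> rel" if "t \<in> rel" for t
    using subgroup.m_inv_closed[OF rel_subgroup that] rel_carrier[OF that] by simp
  show "t - t' \<in> rel" if "t \<in> rel" "t' \<in> rel"
    using p[OF that(1) m[OF that(2)]] by simp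
qed

lemma rel_induct [consumes 1, case_names zero left right scalar diff]:
  assumes "t \<in> rel" and z: "P 0"
    and a: "\<And>x x' y. x \<in> carrier M \<Longrightarrow> x' \<in> carrier M \<Longrightarrow> y \<in> carrier N \<Longrightarrow>
      P (frag_of (x \<oplus>\<^bsub>M\<^esub> x', y) - frag_of (x, y) - frag_of (x', y))"
    and b: "\<And>x y y'. x \<in> carrier M \<Longrightarrow> y \<in> carrier N \<Longrightarrow> y' \<in> carrier N \<Longrightarrow>
      P (frag_of (x, y \<oplus>\<^bsub>N\<^esub> y') - frag_of (x, y) - frag_of (x, y'))"
    and c: "\<And>r x y. r \<in> carrier R \<Longrightarrow> x \<in> carrier M \<Longrightarrow> y \<in> carrier N \<Longrightarrow>
      P (frag_of (r \<odot>\<^bsub>M\<^esub> x, y) - frag_of (x, r \<odot>\<^bsub>N\<^esub> y))"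
    and d: "\<And>t t'. t \<in> rel \<Longrightarrow> t' \<in> rel \<Longrightarrow> P t \<Longrightarrow> P t' \<Longrightarrow> P (t - t')"
  shows "P t"
proof -
  let ?G = "{frag_of (x \<oplus>\<^bsub>M\<^esub> x', y) - frag_of (x, y) - frag_of (x', y) | x x' y.
           x \<in> carrier M \<and> x' \<in> carrier M \<and> y \<in> carrier N}
      \<union> {frag_of (x, y \<oplus>\<^bsub>N\<^esub> y') - frag_of (x, y) - frag_of (x, y') | x y y'.
           x \<in> carrier M \<and> y \<in> carrier N \<and> y' \<in> carrier N}
      \<union> {frag_of (r \<odot>\<^bsub>M\<^esub> x, y) - frag_of (x, r \<odot>\<^bsub>N\<^esub> y) | r x y.
           r \<in> carrier R \<and> x \<in> carrier M \<and> y \<in> carrier N}"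
  have G: "?G \<subseteq> rel" unfolding tensor_relations_def using generate.incl by (metis (lifting) subsetI)
  have PG: "P h" if "h \<in> ?G" for h
    using that by (elim UnE CollectE exE conjE; simp add: a b c)
  have rel: "rel = generate F ?G" unfolding tensor_relations_def ..
  have "t \<in> generate F ?G" using assms(1) rel by simp
  then have "t \<in> rel \<and> P t"
  proof (induction rule: generate.induct)
    case one show ?case unfolding one_free_Abelian_group using z rel_closed(1) by blast
  next
    case (incl h) show ?case by (rule conjI[OF subsetD[OF G incl] PG[OF incl]])
  next
    case (inv h)
    have h: "h \<in> rel" "P h" by (rule subsetD[OF G inv], rule PG[OF inv])
    have "inv\<^bsub>F\<^esub> h = - h" using rel_carrier[OF h(1)] by simp
    moreover have "- h \<in> rel" using rel_closed(3) h(1) by blast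
    moreover have "P (- h)" using d[OF rel_closed(1) h(1) z h(2)] by simp
    ultimately show ?case by metis
  next
    case (eng h1 h2)
    have n: "- h2 \<in> rel" "P (- h2)"
      using d[OF rel_closed(1) _ z, of h2] rel_closed(3)[of h2] eng by simp_all
    have "h1 - - h2 \<in> rel \<and> P (h1 - - h2)"
      using d[OF _ n(1) _ n(2), of h1] rel_closed(4)[OF _ n(1), of h1] eng by blast
    then show ?case by simp
  qed
  then show ?thesis ..
qed

lemma rel_generators [simp, intro]:
  "x \<in> carrier M \<Longrightarrow> x' \<in> carrier M \<Longrightarrow> y \<in> carrier N \<Longrightarrow>
     frag_of (x \<oplus>\<^bsub>M\<^esub> x', y) - frag_of (x, y) - frag_of (x', y) \<in> rel"
  "x \<in> carrier M \<Longrightarrow> y \<in> carrier N \<Longrightarrow> y' \<in> carrier N \<Longrightarrow>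
     frag_of (x, y \<oplus>\<^bsub>N\<^esub> y') - frag_of (x, y) - frag_of (x, y') \<in> rel"
  "r \<in> carrier R \<Longrightarrow> x \<in> carrier M \<Longrightarrow> y \<in> carrier N \<Longrightarrow>
     frag_of (r \<odot>\<^bsub>M\<^esub> x, y) - frag_of (x, r \<odot>\<^bsub>N\<^esub> y) \<in> rel"
proof -
  show "frag_of (x \<oplus>\<^bsub>M\<^esub> x', y) - frag_of (x, y) - frag_of (x', y) \<in> rel"
    if "x \<in> carrier M" "x' \<in> carrier M" "y \<in> carrier N"
    unfolding tensor_relations_def by (rule generate.incl, rule UnI1, rule UnI1) (use that in blast)
  show "frag_of (x, y \<oplus>\<^bsub>N\<^esub> y') - frag_of (x, y) - frag_of (x, y') \<in> rel"
    if "x \<in> carrier M" "y \<in> carrier N" "y' \<in> carrier N"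
    unfolding tensor_relations_def by (rule generate.incl, rule UnI1, rule UnI2) (use that in blast)
  show "frag_of (r \<odot>\<^bsub>M\<^esub> x, y) - frag_of (x, r \<odot>\<^bsub>N\<^esub> y) \<in> rel"
    if "r \<in> carrier R" "x \<in> carrier M" "y \<in> carrier N"
    unfolding tensor_relations_def by (rule generate.incl, rule UnI2) (use that in blast)
qed

lemma rep:
  assumes "t \<in> carrier F"
  shows "frag_decode (cls t) \<in> carrier F" "frag_decode (cls t) - t \<in> rel"
proof -
  have "\<exists>t'. t' \<in> carrier F \<and> t' - t \<in> rel" using assms by (intro exI[of _ t]) simp
  from someI_ex[OF this]
  show "frag_decode (cls t) \<in> carrier F" "frag_decode (cls t) - t \<in> rel"
    unfolding tensor_class_def by (simp_all only: inv_f_f[OF inj_frag_code[OF infinite_UNIV]])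
qed

lemma cls_eq_iff:
  assumes "t \<in> carrier F" "t' \<in> carrier F"
  shows "cls t = cls t' \<longleftrightarrow> t - t' \<in> rel"
proof
  assume "cls t = cls t'"
  then have "frag_decode (cls t) - t \<in> rel" "frag_decode (cls t) - t' \<in> rel"
    using rep assms by metis+
  from rel_closed(4)[OF this(2,1)] show "t - t' \<in> rel" by simp
next
  assume d: "t - t' \<in> rel"
  have "s - t \<in> rel \<longleftrightarrow> s - t' \<in> rel" for s
    using rel_closed(2)[of "s - t" "t - t'"] rel_closed(4)[of "s - t'" "t - t'"] d by auto
  then show "cls t = cls t'" unfolding tensor_class_def by simp
qed

lemma carrier_T: "carrier T = cls ` carrier F"
  by (simp add: tensor_def)

lemma T_cases [consumes 1]:
  assumes "x \<in> carrier T" obtains t where "t \<in> carrier F" "x = cls t"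
  using assms by (auto simp: carrier_T simp del: carrier_free_Abelian_group_iff)

lemma cls_closed [simp, intro]: "t \<in> carrier F \<Longrightarrow> cls t \<in> carrier T"
  by (simp add: carrier_T del: carrier_free_Abelian_group_iff)

lemma cls_add: 
  assumes "t \<in> carrier F" "t' \<in> carrier F"
  shows "cls t \<oplus>\<^bsub>T\<^esub> cls t' = cls (t + t')"
proof -
  have "(frag_decode (cls t) - t) + (frag_decode (cls t') - t') \<in> rel"
    using rep assms by blast
  then have "cls (frag_decode (cls t) + frag_decode (cls t')) = cls (t + t')"
    using assms rep by (subst cls_eq_iff) (auto simp: algebra_simps simp del: carrier_free_Abelian_group_iff)
  then show ?thesis by (simp add: tensor_def)
qed

lemma cls_zero: "\<zero>\<^bsub>T\<^esub> = cls 0"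
  by (simp add: tensor_def)

sublocale T: abelian_group T
proof (rule abelian_groupI)
  fix x y z assume "x \<in> carrier T" "y \<in> carrier T" "z \<in> carrier T"
  then obtain a b c where abc: "a \<in> carrier F" "b \<in> carrier F" "c \<in> carrier F" 
    "x = cls a" "y = cls b" "z = cls c"
    by (metis T_cases)
  show "x \<oplus>\<^bsub>T\<^esub> y \<oplus>\<^bsub>T\<^esub> z = x \<oplus>\<^bsub>T\<^esub> (y \<oplus>\<^bsub>T\<^esub> z)"
    using abc by (simp add: cls_add add.assoc del: carrier_free_Abelian_group_iff)
next
  fix x y assume "x \<in> carrier T" "y \<in> carrier T"
  then obtain a b where ab: "a \<in> carrier F" "b \<in> carrier F" "x = cls a" "y = cls b"
    by (metis T_cases)
  show "x \<oplus>\<^bsub>T\<^esub> y \<in> carrier T" "x \<oplus>\<^bsub>T\<^esub> y = y \<oplus>\<^bsub>T\<^esub> x"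
    using ab by (simp_all add: cls_add add.commute del: carrier_free_Abelian_group_iff)
next
  show "\<zero>\<^bsub>T\<^esub> \<in> carrier T" by (simp add: cls_zero)
next
  fix x assume "x \<in> carrier T"
  then obtain a where a: "a \<in> carrier F" "x = cls a" by (metis T_cases)
  show "\<zero>\<^bsub>T\<^esub> \<oplus>\<^bsub>T\<^esub> x = x" using a by (simp add: cls_zero cls_add del: carrier_free_Abelian_group_iff)
  show "\<exists>y\<in>carrier T. y \<oplus>\<^bsub>T\<^esub> x = \<zero>\<^bsub>T\<^esub>"
    using a by (intro bexI[of _ "cls (- a)"]) (simp_all add: cls_zero cls_add del: carrier_free_Abelian_group_iff)
qed

lemma cls_minus: "t \<in> carrier F \<Longrightarrow> \<ominus>\<^bsub>T\<^esub> cls t = cls (- t)"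
  by (rule T.minus_equality) (simp_all add: cls_add cls_zero del: carrier_free_Abelian_group_iff)

lemma cls_diff: "t \<in> carrier F \<Longrightarrow> t' \<in> carrier F \<Longrightarrow> cls t \<ominus>\<^bsub>T\<^esub> cls t' = cls (t - t')"
  by (simp add: a_minus_def cls_minus cls_add del: carrier_free_Abelian_group_iff)

lemma cls_eq_zero: "t \<in> carrier F \<Longrightarrow> cls t = \<zero>\<^bsub>T\<^esub> \<longleftrightarrow> t \<in> rel"
  by (simp add: cls_zero cls_eq_iff del: carrier_free_Abelian_group_iff)

lemma pt_closed [simp, intro]: "x \<in> carrier M \<Longrightarrow> y \<in> carrier N \<Longrightarrow> pt x y \<in> carrier T"
  unfolding pure_def by blast

lemma T_induct [consumes 1, case_names zero pure diff]:
  assumes "x \<in> carrier T" "P \<zero>\<^bsub>T\<^esub>"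
    and "\<And>x y. x \<in> carrier M \<Longrightarrow> y \<in> carrier N \<Longrightarrow> P (pt x y)"
    and "\<And>x y. x \<in> carrier T \<Longrightarrow> y \<in> carrier T \<Longrightarrow> P x \<Longrightarrow> P y \<Longrightarrow> P (x \<ominus>\<^bsub>T\<^esub> y)"
  shows "P x"
proof -
  obtain t where t: "t \<in> carrier F" "x = cls t" using assms(1) by (rule T_cases)
  from t(1) have "P (cls t)"
  proof (induction rule: F_induct)
    case (diff t t')
    then show ?case using assms(4)[of "cls t" "cls t'"] by (simp add: cls_diff del: carrier_free_Abelian_group_iff)
  qed (use assms(2,3) in \<open>auto simp: cls_zero pure_def\<close>)
  with t show ?thesis by simp
qed

lemma pt_balanced: "balanced R M N T pt"
proof -
  have diff3: "cls a = cls b \<oplus>\<^bsub>T\<^esub> cls c" if "a - b - c \<in> rel" "a \<in> carrier F" "b \<in> carrier F" "c \<in> carrier F" for a b c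
    using that by (simp add: cls_add cls_eq_iff diff_diff_eq del: carrier_free_Abelian_group_iff)
  show ?thesis
    unfolding balanced_def
    by (auto simp: pure_def cls_eq_iff intro!: diff3 simp del: carrier_free_Abelian_group_iff)
qed

lemma pt_add_left: "x \<in> carrier M \<Longrightarrow> x' \<in> carrier M \<Longrightarrow> y \<in> carrier N \<Longrightarrow> 
    pt (x \<oplus>\<^bsub>M\<^esub> x') y = pt x y \<oplus>\<^bsub>T\<^esub> pt x' y"
  and pt_add_right: "x \<in> carrier M \<Longrightarrow> y \<in> carrier N \<Longrightarrow> y' \<in> carrier N \<Longrightarrow> 
    pt x (y \<oplus>\<^bsub>N\<^esub> y') = pt x y \<oplus>\<^bsub>T\<^esub> pt x y'"
  and pt_smult: "r \<in> carrier R \<Longrightarrow> x \<in> carrier M \<Longrightarrow> y \<in> carrier N \<Longrightarrow> 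
    pt (r \<odot>\<^bsub>M\<^esub> x) y = pt x (r \<odot>\<^bsub>N\<^esub> y)"
  using pt_balanced unfolding balanced_def by auto

lemma hom_eqI:
  assumes "abelian_group G" "h \<in> hom (add_monoid T) (add_monoid G)" "h' \<in> hom (add_monoid T) (add_monoid G)"
    and "\<And>x y. x \<in> carrier M \<Longrightarrow> y \<in> carrier N \<Longrightarrow> h (pt x y) = h' (pt x y)" and "z \<in> carrier T"
  shows "h z = h' z"
proof -
  interpret G: abelian_group G by fact
  interpret h: abelian_group_hom T G h
    using assms(2) by (intro abelian_group_homI) (auto simp: group_hom_def group_hom_axioms_def T.a_group G.a_group T.abelian_group_axioms G.abelian_group_axioms)
  interpret h': abelian_group_hom T G h'
    using assms(3) by (intro abelian_group_homI) (auto simp: group_hom_def group_hom_axioms_def T.a_group G.a_group T.abelian_group_axioms G.abelian_group_axioms)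
  show ?thesis using assms(5)
    by (induction rule: T_induct) (simp_all add: assms(4) a_minus_def)
qed

text \<open>A homomorphism on formal sums that is balanced on pairs factors through the tensor product;
  the factorisation is given explicitly by evaluation at chosen representatives.\<close>

lemma free_hom_factors:
  assumes G: "abelian_group G" and g: "g \<in> hom F (add_monoid G)"
    and b: "balanced R M N G (\<lambda>x y. g (frag_of (x, y)))"
  shows "(\<forall>t \<in> rel. g t = \<zero>\<^bsub>G\<^esub>) \<and> (\<lambda>z. g (frag_decode z)) \<in> hom (add_monoid T) (add_monoid G) \<and>
    (\<forall>t \<in> carrier F. g (frag_decode (cls t)) = g t)"
proof -
  interpret G: abelian_group G by fact
  interpret g: group_hom F "add_monoid G" g
    using g by (simp add: group_hom_def group_hom_axioms_def G.a_group)
  have add: "g (t + t') = g t \<oplus>\<^bsub>G\<^esub> g t'" if "t \<in> carrier F" "t' \<in> carrier F" for t t'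
    using g.hom_mult[OF that] by simp
  have cl: "g t \<in> carrier G" if "t \<in> carrier F" for t using g.hom_closed[OF that] by simp
  have g0: "g 0 = \<zero>\<^bsub>G\<^esub>" using g.hom_one by simp
  have neg: "g (- t) = \<ominus>\<^bsub>G\<^esub> g t" if "t \<in> carrier F" for t
    using g.hom_inv[OF that] that by (simp add: a_inv_def)
  have gdiff: "g (t - t') = g t \<ominus>\<^bsub>G\<^esub> g t'" if "t \<in> carrier F" "t' \<in> carrier F" for t t'
    using add[OF that(1) F_closed(4)[OF that(2)]] neg that by (simp add: a_minus_def)
  have bb: "g (frag_of (x \<oplus>\<^bsub>M\<^esub> x', y)) = g (frag_of (x, y)) \<oplus>\<^bsub>G\<^esub> g (frag_of (x', y))"
    if "x \<in> carrier M" "x' \<in> carrier M" "y \<in> carrier N" for x x' y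
    using b that unfolding balanced_def by auto
  have bb': "g (frag_of (x, y \<oplus>\<^bsub>N\<^esub> y')) = g (frag_of (x, y)) \<oplus>\<^bsub>G\<^esub> g (frag_of (x, y'))"
    if "x \<in> carrier M" "y' \<in> carrier N" "y \<in> carrier N" for x y y'
    using b that unfolding balanced_def by auto
  have bs: "g (frag_of (r \<odot>\<^bsub>M\<^esub> x, y)) = g (frag_of (x, r \<odot>\<^bsub>N\<^esub> y))"
    if "r \<in> carrier R" "x \<in> carrier M" "y \<in> carrier N" for r x y
    using b that unfolding balanced_def by auto
  have cancel: "(u \<oplus>\<^bsub>G\<^esub> v) \<ominus>\<^bsub>G\<^esub> u \<ominus>\<^bsub>G\<^esub> v = \<zero>\<^bsub>G\<^esub>" if "u \<in> carrier G" "v \<in> carrier G" for u v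
    using that by (simp add: a_minus_def G.add.m_assoc G.add.m_lcomm[of u v] G.r_neg G.r_neg1)
  have kill: "g t = \<zero>\<^bsub>G\<^esub>" if "t \<in> rel" for t
    using that
  proof (induction rule: rel_induct)
    case zero show ?case by (rule g0)
  next
    case (left x x' y)
    then show ?case
      by (simp add: gdiff bb cl cancel del: carrier_free_Abelian_group_iff)
  next
    case (right x y y')
    then show ?case
      by (simp add: gdiff bb' cl cancel del: carrier_free_Abelian_group_iff)
  next
    case (scalar r x y)
    then show ?case
      by (simp add: gdiff bs cl G.diff_eq_zero_iff del: carrier_free_Abelian_group_iff)
  next
    case (diff t t')
    then show ?case using rel_carrier by (simp add: gdiff G.diff_eq_zero_iff del: carrier_free_Abelian_group_iff)
  qed
  have eq: "g (frag_decode (cls t)) = g t" if t: "t \<in> carrier F" for t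
  proof -
    have "g (frag_decode (cls t) - t) = \<zero>\<^bsub>G\<^esub>" using kill rep[OF t] by blast
    then show ?thesis using gdiff[OF rep(1)[OF t] t] cl rep(1)[OF t] t
      by (simp add: G.diff_eq_zero_iff del: carrier_free_Abelian_group_iff)
  qed
  moreover have "(\<lambda>z. g (frag_decode z)) \<in> hom (add_monoid T) (add_monoid G)"
    by (rule homI) (auto elim!: T_cases simp: eq cls_add add cl simp del: carrier_free_Abelian_group_iff)
  ultimately show ?thesis using kill by blast
qed

lemma universal:
  assumes G: "abelian_group G" and b: "balanced R M N G b"
  obtains h where "h \<in> hom (add_monoid T) (add_monoid G)"
    "\<And>x y. x \<in> carrier M \<Longrightarrow> y \<in> carrier N \<Longrightarrow> h (pt x y) = b x y"
proof -
  interpret G: abelian_group G by fact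
  have "(\<lambda>(x, y). b x y) ` (carrier M \<times> carrier N) \<subseteq> carrier (add_monoid G)"
    using b unfolding balanced_def by auto
  then obtain g where g: "g \<in> hom F (add_monoid G)" 
      "\<And>p. p \<in> carrier M \<times> carrier N \<Longrightarrow> g (frag_of p) = (\<lambda>(x, y). b x y) p"
    using comm_group.free_Abelian_group_universal[OF G.a_comm_group] by metis
  have "balanced R M N G (\<lambda>x y. g (frag_of (x, y)))"
    using b unfolding balanced_def by (simp add: g(2))
  note f = free_hom_factors[OF G g(1) this]
  show ?thesis
    by (rule that[of "\<lambda>z. g (frag_decode z)"]) (use f g(2) in \<open>auto simp: pure_def\<close>)
qed

end

lemma (in ring) quot_eq_iff:
  assumes "ideal I R" "x \<in> carrier R" "y \<in> carrier R"
  shows "I +> x = I +> y \<longleftrightarrow> x \<ominus> y \<in> I"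
proof -
  interpret I: ideal I R by fact
  show ?thesis
    using I.a_rcos_module_minus[OF ring_axioms assms(3,2)] I.a_rcos_self[OF assms(2)]
      I.a_repr_independence'[OF _ assms(3)] by blast
qed

lemma algebra_module_simps [simp]:
  "carrier (algebra_module S f) = carrier S"
  "x \<otimes>\<^bsub>algebra_module S f\<^esub> y = x \<otimes>\<^bsub>S\<^esub> y"
  "\<one>\<^bsub>algebra_module S f\<^esub> = \<one>\<^bsub>S\<^esub>"
  "\<zero>\<^bsub>algebra_module S f\<^esub> = \<zero>\<^bsub>S\<^esub>"
  "x \<oplus>\<^bsub>algebra_module S f\<^esub> y = x \<oplus>\<^bsub>S\<^esub> y"
  "r \<odot>\<^bsub>algebra_module S f\<^esub> y = f r \<otimes>\<^bsub>S\<^esub> y"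
  by (simp_all add: algebra_module_def)

lemma abelian_group_algebra_module:
  assumes "abelian_group S" shows "abelian_group (algebra_module S f)"
proof -
  interpret abelian_group S by fact
  show ?thesis
    by (rule abelian_groupI) (auto simp: a_ac intro: bexI[where x = "\<ominus>\<^bsub>S\<^esub> _"] l_neg)
qed

lemma module_algebra_module:
  assumes "cring R" "cring S" "f \<in> ring_hom R S"
  shows "module R (algebra_module S f)"
proof -
  interpret R: cring R by fact
  interpret S: cring S by fact
  interpret f: ring_hom_cring R S f
    using assms by (simp add: ring_hom_cring_def ring_hom_cring_axioms_def)
  show ?thesis
    by (rule moduleI)
       (simp_all add: assms abelian_group_algebra_module S.abelian_group_axioms
          S.l_distr S.r_distr S.m_assoc)
qed

lemma linear_mapsD:
  assumes "h \<in> linear_maps R M N"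
  shows "x \<in> carrier M \<Longrightarrow> h x \<in> carrier N"
    "x \<in> carrier M \<Longrightarrow> y \<in> carrier M \<Longrightarrow> h (x \<oplus>\<^bsub>M\<^esub> y) = h x \<oplus>\<^bsub>N\<^esub> h y"
    "r \<in> carrier R \<Longrightarrow> x \<in> carrier M \<Longrightarrow> h (r \<odot>\<^bsub>M\<^esub> x) = r \<odot>\<^bsub>N\<^esub> h x"
  using assms by (auto simp: linear_maps_def hom_def)

lemma frag_lift_simps [simp]:
  "frag_lift h 0 = 0"
  "frag_lift h (frag_of (x, y)) = frag_of (h x, y)"
  "frag_lift h (t + t') = frag_lift h t + frag_lift h t'"
  "frag_lift h (t - t') = frag_lift h t - frag_lift h t'"
  by (simp_all add: frag_lift_def frag_extend_add frag_extend_diff)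

lemma frag_lift_ident [simp]: "frag_lift (\<lambda>x. x) t = t"
  unfolding frag_lift_def using frag_expansion[of t] by (simp add: case_prod_unfold)

lemma (in tensor_pair) hom_of_abelian:
  assumes "abelian_group G" "h \<in> hom (add_monoid T) (add_monoid G)"
  shows "abelian_group_hom T G h"
  by (intro abelian_group_homI group_hom.intro group_hom_axioms.intro T.abelian_group_axioms
      T.a_group abelian_group.a_group assms)

text \<open>The map \<open>h \<otimes> N : M \<otimes>\<^sub>R N \<rightarrow> M' \<otimes>\<^sub>R N\<close>. The source \<open>M\<close> does not occur, as \<open>z\<close> determines a formal sum.\<close>

definition tensor_map ::
  "'u ring \<Rightarrow> ('u, 'u) module \<Rightarrow> ('u, 'u) module \<Rightarrow> ('u \<Rightarrow> 'u) \<Rightarrow> 'u \<Rightarrow> 'u" where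
  "tensor_map R M' N h z = tensor_class R M' N (frag_lift h (frag_decode z))"

locale tensor_pair_map = tensor_pair R M N + M': module R M'
  for R :: "'u ring" and M N M' :: "('u, 'u) module" +
  fixes h assumes linear: "h \<in> linear_maps R M M'"
begin

sublocale P: tensor_pair R M' N
  by unfold_locales (rule infinite_UNIV)

lemma frag_lift_closed: 
  assumes "t \<in> carrier F" shows "frag_lift h t \<in> carrier P.F"
  using assms
proof (induction rule: F_induct)
  case (diff t t') then show ?case by (simp add: P.F_closed(3) del: carrier_free_Abelian_group_iff)
qed (simp_all add: linear_mapsD[OF linear] P.F_closed del: carrier_free_Abelian_group_iff)

lemma class_frag_lift_hom: "(\<lambda>t. P.cls (frag_lift h t)) \<in> hom F (add_monoid P.T)"
  by (rule homI) (auto simp: frag_lift_closed P.cls_add simp del: carrier_free_Abelian_group_iff)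

lemma class_frag_lift_balanced: "balanced R M N P.T (\<lambda>x y. P.cls (frag_lift h (frag_of (x, y))))"
  using P.pt_balanced by (auto simp: balanced_def pure_def linear_mapsD[OF linear])

lemmas factors = free_hom_factors[OF P.T.abelian_group_axioms class_frag_lift_hom class_frag_lift_balanced]

lemma tensor_map_hom: "tensor_map R M' N h \<in> hom (add_monoid T) (add_monoid P.T)"
  using factors unfolding tensor_map_def by simp

lemma tensor_map_cls: "t \<in> carrier F \<Longrightarrow> tensor_map R M' N h (cls t) = P.cls (frag_lift h t)"
  using factors unfolding tensor_map_def by simp

lemma tensor_map_pure: 
  "x \<in> carrier M \<Longrightarrow> y \<in> carrier N \<Longrightarrow> tensor_map R M' N h (pt x y) = P.pt (h x) y"
  unfolding pure_def by (subst tensor_map_cls) auto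

lemma tensor_map_closed: "x \<in> carrier T \<Longrightarrow> tensor_map R M' N h x \<in> carrier P.T"
  using tensor_map_hom by (auto simp: hom_def)

text \<open>The kernel condition in the definition of flatness says that \<open>h \<otimes> N\<close> is injective.\<close>

lemma tensor_map_inj_iff:
  "inj_on (tensor_map R M' N h) (carrier T) \<longleftrightarrow>
     (\<forall>t \<in> carrier F. frag_lift h t \<in> P.rel \<longrightarrow> t \<in> rel)"
proof
  assume inj: "inj_on (tensor_map R M' N h) (carrier T)"
  show "\<forall>t \<in> carrier F. frag_lift h t \<in> P.rel \<longrightarrow> t \<in> rel"
  proof (intro ballI impI)
    fix t assume t: "t \<in> carrier F" "frag_lift h t \<in> P.rel"
    then have "tensor_map R M' N h (cls t) = P.cls 0"
      using P.cls_eq_zero frag_lift_closed by (simp add: tensor_map_cls P.cls_zero del: carrier_free_Abelian_group_iff)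
    also have "\<dots> = tensor_map R M' N h (cls 0)"
      by (subst tensor_map_cls) auto
    finally show "t \<in> rel" using inj t cls_eq_zero by (auto simp: inj_on_def cls_zero simp del: carrier_free_Abelian_group_iff)
  qed
next
  assume *: "\<forall>t \<in> carrier F. frag_lift h t \<in> P.rel \<longrightarrow> t \<in> rel"
  show "inj_on (tensor_map R M' N h) (carrier T)"
  proof (rule inj_onI)
    fix x y assume "x \<in> carrier T" "y \<in> carrier T" and e: "tensor_map R M' N h x = tensor_map R M' N h y"
    then obtain t t' where t: "t \<in> carrier F" "t' \<in> carrier F" "x = cls t" "y = cls t'"
      by (metis T_cases)
    then have "frag_lift h (t - t') \<in> P.rel"
      using e by (simp add: tensor_map_cls P.cls_eq_iff frag_lift_closed del: carrier_free_Abelian_group_iff)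
    then show "x = y" using t * by (simp add: cls_eq_iff del: carrier_free_Abelian_group_iff)
  qed
qed

end

lemma flat_mapI:
  assumes inf: "infinite (UNIV :: 'u set)" and "cring R" "cring S" "f \<in> ring_hom R S"
    and inj: "\<And>M N h. module R M \<Longrightarrow> module R N \<Longrightarrow> h \<in> linear_maps R M N \<Longrightarrow> inj_on h (carrier M) \<Longrightarrow>
      inj_on (tensor_map R N (algebra_module S f) h) (carrier (tensor R M (algebra_module S f)))"
  shows "flat_map R (S :: 'u ring) f"
  unfolding flat_map_def
proof (intro allI impI, elim conjE)
  fix M N :: "('u, 'u) module" and h
  assume M: "module R M" "module R N" "h \<in> linear_maps R M N" "inj_on h (carrier M)"
  interpret A: module R "algebra_module S f" using module_algebra_module assms by blast
  interpret M: module R M by fact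
  interpret N: module R N by fact
  interpret tensor_pair_map R M "algebra_module S f" N h by unfold_locales (rule inf M)+
  show "\<forall>t\<in>carrier (free_Abelian_group (carrier M \<times> carrier S)).
             frag_extend (\<lambda>(x, s). frag_of (h x, s)) t \<in> tensor_relations R N (algebra_module S f) \<longrightarrow>
             t \<in> tensor_relations R M (algebra_module S f)"
    using inj[OF M] unfolding tensor_map_inj_iff frag_lift_def by simp
qed

lemma flat_mapD:
  assumes inf: "infinite (UNIV :: 'u set)" and "cring R" "cring S" "f \<in> ring_hom R S"
    and flat: "flat_map R (S :: 'u ring) f" 
    and M: "module R M" "module R N" "h \<in> linear_maps R M N" "inj_on h (carrier M)"
  shows "inj_on (tensor_map R N (algebra_module S f) h) (carrier (tensor R M (algebra_module S f)))"
proof -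
  interpret A: module R "algebra_module S f" using module_algebra_module assms by blast
  interpret M: module R M by fact
  interpret N: module R N by fact
  interpret tensor_pair_map R M "algebra_module S f" N h by unfold_locales (rule inf M)+
  show ?thesis
    using flat M unfolding tensor_map_inj_iff flat_map_def frag_lift_def by simp
qed

subsection \<open>Flatness and conductors\<close>

text \<open>The form in which flatness is used for descent: if \<open>n \<otimes> s\<close> lies in the image of \<open>K \<otimes> S\<close> in \<open>N \<otimes> S\<close>, then
  \<open>s\<close> lies in the extension to \<open>S\<close> of the ideal \<open>(K : n)\<close>. The hypothesis \<open>rel\<close> holds in \<open>N\<close>, hence by
  flatness in the submodule \<open>M = K + R n\<close>. There the coefficient of \<open>n\<close> is well defined modulo \<open>J = (K : n)\<close>, which
  gives a map from \<open>M \<otimes> S\<close> to \<open>S / J S\<close> that kills \<open>K \<otimes> S\<close> and sends \<open>n \<otimes> s\<close> to the class of \<open>s\<close>.\<close>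

lemma flat_annihilator:
  fixes R S :: "'u ring"
  assumes inf: "infinite (UNIV :: 'u set)" and R: "cring R" and S: "cring S" and f: "f \<in> ring_hom R S"
    and flat: "flat_map R S f" and N: "module R N" and K: "submodule K R N"
    and n: "n \<in> carrier N" and s: "s \<in> carrier S"
    and t: "t \<in> carrier (free_Abelian_group (K \<times> carrier S))"
    and rel: "frag_of (n, s) - t \<in> tensor_relations R N (algebra_module S f)"
  shows "s \<in> Idl\<^bsub>S\<^esub> (f ` {r \<in> carrier R. r \<odot>\<^bsub>N\<^esub> n \<in> K})"
proof -
  interpret R: cring R by fact
  interpret S: cring S by fact
  interpret f: ring_hom_cring R S f
    using assms by (simp add: ring_hom_cring_def ring_hom_cring_axioms_def)
  interpret N: module R N by fact
  interpret A: module R "algebra_module S f" using module_algebra_module assms by blast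
  note K' = N.submoduleE[OF K]
  have zK: "\<zero>\<^bsub>N\<^esub> \<in> K"
    using subgroup.one_closed[OF submodule.axioms(1)[OF K]] by simp
  define J where "J = {r \<in> carrier R. r \<odot>\<^bsub>N\<^esub> n \<in> K}"
  define I where "I = Idl\<^bsub>S\<^esub> (f ` J)"
  have JR: "f ` J \<subseteq> carrier S" unfolding J_def by auto
  have I: "ideal I S" unfolding I_def by (rule S.genideal_ideal[OF JR])
  have fJ: "f r \<in> I" if "r \<in> J" for r
    using S.genideal_self[OF JR] that unfolding I_def by blast
  have J_diff: "r \<ominus>\<^bsub>R\<^esub> r' \<in> J" if "r \<in> carrier R" "r' \<in> carrier R" 
     "m \<in> carrier N" "m \<ominus>\<^bsub>N\<^esub> r \<odot>\<^bsub>N\<^esub> n \<in> K" "m \<ominus>\<^bsub>N\<^esub> r' \<odot>\<^bsub>N\<^esub> n \<in> K" for r r' m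
  proof -
    have "(m \<ominus>\<^bsub>N\<^esub> r' \<odot>\<^bsub>N\<^esub> n) \<oplus>\<^bsub>N\<^esub> \<ominus>\<^bsub>N\<^esub> (m \<ominus>\<^bsub>N\<^esub> r \<odot>\<^bsub>N\<^esub> n) \<in> K"
      using that K' by blast
    also have "(m \<ominus>\<^bsub>N\<^esub> r' \<odot>\<^bsub>N\<^esub> n) \<oplus>\<^bsub>N\<^esub> \<ominus>\<^bsub>N\<^esub> (m \<ominus>\<^bsub>N\<^esub> r \<odot>\<^bsub>N\<^esub> n) = (r \<ominus>\<^bsub>R\<^esub> r') \<odot>\<^bsub>N\<^esub> n"
      using that n
      by (simp add: a_minus_def N.smult_l_distr N.smult_l_minus N.M.minus_add N.M.add.m_ac N.M.r_neg1 N.M.r_neg2)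
    finally show ?thesis using that unfolding J_def by simp
  qed
  define M where "M = N\<lparr>carrier := {m \<in> carrier N. \<exists>r \<in> carrier R. m \<ominus>\<^bsub>N\<^esub> r \<odot>\<^bsub>N\<^esub> n \<in> K}\<rparr>"
  have Mc: "carrier M = {m \<in> carrier N. \<exists>r \<in> carrier R. m \<ominus>\<^bsub>N\<^esub> r \<odot>\<^bsub>N\<^esub> n \<in> K}"
    and [simp]: "x \<oplus>\<^bsub>M\<^esub> y = x \<oplus>\<^bsub>N\<^esub> y" "r \<odot>\<^bsub>M\<^esub> x = r \<odot>\<^bsub>N\<^esub> x" for x y r
    by (simp_all add: M_def)
  have add_K: "(m \<oplus>\<^bsub>N\<^esub> m') \<ominus>\<^bsub>N\<^esub> (r \<oplus>\<^bsub>R\<^esub> r') \<odot>\<^bsub>N\<^esub> n \<in> K"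
    if "r \<in> carrier R" "r' \<in> carrier R" "m \<in> carrier N" "m' \<in> carrier N"
     "m \<ominus>\<^bsub>N\<^esub> r \<odot>\<^bsub>N\<^esub> n \<in> K" "m' \<ominus>\<^bsub>N\<^esub> r' \<odot>\<^bsub>N\<^esub> n \<in> K" for r r' m m'
  proof -
    have "(m \<oplus>\<^bsub>N\<^esub> m') \<ominus>\<^bsub>N\<^esub> (r \<oplus>\<^bsub>R\<^esub> r') \<odot>\<^bsub>N\<^esub> n = (m \<ominus>\<^bsub>N\<^esub> r \<odot>\<^bsub>N\<^esub> n) \<oplus>\<^bsub>N\<^esub> (m' \<ominus>\<^bsub>N\<^esub> r' \<odot>\<^bsub>N\<^esub> n)"
      using that n by (simp add: a_minus_def N.smult_l_distr N.M.minus_add N.M.add.m_ac)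
    then show ?thesis using K' that by simp
  qed
  have smult_K: "(a \<odot>\<^bsub>N\<^esub> m) \<ominus>\<^bsub>N\<^esub> (a \<otimes>\<^bsub>R\<^esub> r) \<odot>\<^bsub>N\<^esub> n \<in> K"
    if "r \<in> carrier R" "a \<in> carrier R" "m \<in> carrier N" "m \<ominus>\<^bsub>N\<^esub> r \<odot>\<^bsub>N\<^esub> n \<in> K" for r a m
  proof -
    have "(a \<odot>\<^bsub>N\<^esub> m) \<ominus>\<^bsub>N\<^esub> (a \<otimes>\<^bsub>R\<^esub> r) \<odot>\<^bsub>N\<^esub> n = a \<odot>\<^bsub>N\<^esub> (m \<ominus>\<^bsub>N\<^esub> r \<odot>\<^bsub>N\<^esub> n)"
      using that n by (simp add: a_minus_def N.smult_r_distr N.smult_assoc1 N.smult_r_minus)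
    then show ?thesis using K' that by simp
  qed
  have K_M: "k \<in> carrier N" "k \<in> carrier M" "k \<ominus>\<^bsub>N\<^esub> \<zero>\<^bsub>R\<^esub> \<odot>\<^bsub>N\<^esub> n \<in> K" if "k \<in> K" for k
  proof -
    show "k \<in> carrier N" using that K'(1) by blast
    then show "k \<ominus>\<^bsub>N\<^esub> \<zero>\<^bsub>R\<^esub> \<odot>\<^bsub>N\<^esub> n \<in> K" using n that by (simp add: a_minus_def N.M.add.inv_one[unfolded a_inv_def[symmetric]])
    then show "k \<in> carrier M" using \<open>k \<in> carrier N\<close> unfolding Mc by blast
  qed
  have n_n: "n \<ominus>\<^bsub>N\<^esub> \<one>\<^bsub>R\<^esub> \<odot>\<^bsub>N\<^esub> n \<in> K"
    using n zK by (simp add: a_minus_def N.M.r_neg)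
  have n_M: "n \<in> carrier M" unfolding Mc using n n_n by blast
  have M_sub: "submodule (carrier M) R N"
  proof (rule N.submoduleI)
    show "carrier M \<subseteq> carrier N" unfolding Mc by auto
    show "\<zero>\<^bsub>N\<^esub> \<in> carrier M" by (rule K_M(2)[OF zK])
    show sm: "a \<odot>\<^bsub>N\<^esub> m \<in> carrier M" if "a \<in> carrier R" "m \<in> carrier M" for a m
      using that smult_K unfolding Mc by blast
    show "\<ominus>\<^bsub>N\<^esub> m \<in> carrier M" if "m \<in> carrier M" for m
    proof -
      have "(\<ominus>\<^bsub>R\<^esub> \<one>\<^bsub>R\<^esub>) \<odot>\<^bsub>N\<^esub> m \<in> carrier M" using that sm by simp
      then show ?thesis using that N.smult_l_minus[of "\<one>\<^bsub>R\<^esub>" m] by (simp add: Mc)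
    qed
    show "m \<oplus>\<^bsub>N\<^esub> m' \<in> carrier M" if "m \<in> carrier M" "m' \<in> carrier M" for m m'
      using that add_K unfolding Mc by blast
  qed
  have M: "module R M"
    using submodule.submodule_is_module[OF M_sub N] by (simp add: M_def)
  interpret M: module R M by fact
  have incl: "(\<lambda>x. x) \<in> linear_maps R M N"
    by (auto simp: linear_maps_def hom_def Mc)
  interpret tensor_pair_map R M "algebra_module S f" N "\<lambda>x. x" 
    by unfold_locales (rule inf incl)+
  have "inj_on (tensor_map R N (algebra_module S f) (\<lambda>x. x)) (carrier T)"
    by (rule flat_mapD) (use assms M incl in auto)
  then have inj: "t \<in> rel" if "t \<in> carrier F" "t \<in> P.rel" for t
    using that unfolding tensor_map_inj_iff by simp
  have tF: "t \<in> carrier F" using t K_M(2) by auto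
  have "frag_of (n, s) - t \<in> carrier F"
    by (rule F_closed(3)[OF F_closed(5) tF]) (simp_all add: n_M s)
  then have "frag_of (n, s) - t \<in> rel" using inj[OF _ rel] by blast
  then have cls_eq: "pt n s = cls t" unfolding pure_def using n_M s tF by (subst cls_eq_iff) auto
  define l where "l = (\<lambda>m. SOME r. r \<in> carrier R \<and> m \<ominus>\<^bsub>N\<^esub> r \<odot>\<^bsub>N\<^esub> n \<in> K)"
  have l: "l m \<in> carrier R" "m \<ominus>\<^bsub>N\<^esub> l m \<odot>\<^bsub>N\<^esub> n \<in> K" if "m \<in> carrier M" for m
  proof -
    have "\<exists>r. r \<in> carrier R \<and> m \<ominus>\<^bsub>N\<^esub> r \<odot>\<^bsub>N\<^esub> n \<in> K" using that unfolding Mc by blast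
    from someI_ex[OF this] show "l m \<in> carrier R" "m \<ominus>\<^bsub>N\<^esub> l m \<odot>\<^bsub>N\<^esub> n \<in> K" unfolding l_def by auto
  qed
  let ?p = "\<lambda>x. I +>\<^bsub>S\<^esub> x"
  interpret I: ideal I S by (rule I)
  interpret Q: cring "S Quot I" by (rule I.quotient_is_cring[OF S])
  interpret p: ring_hom_ring S "S Quot I" ?p by (rule I.rcos_ring_hom_ring)
  define b where "b = (\<lambda>m y. ?p (f (l m) \<otimes>\<^bsub>S\<^esub> y))"
  have key: "b m y = ?p (f r \<otimes>\<^bsub>S\<^esub> y)" 
    if "m \<in> carrier M" "r \<in> carrier R" "m \<ominus>\<^bsub>N\<^esub> r \<odot>\<^bsub>N\<^esub> n \<in> K" "y \<in> carrier S" for m r y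
  proof -
    have "f (l m \<ominus>\<^bsub>R\<^esub> r) \<otimes>\<^bsub>S\<^esub> y \<in> I"
      using fJ[OF J_diff[OF l(1)[OF that(1)] that(2) _ l(2)[OF that(1)] that(3)]] that I.I_r_closed Mc by auto
    moreover have "f (l m \<ominus>\<^bsub>R\<^esub> r) \<otimes>\<^bsub>S\<^esub> y = f (l m) \<otimes>\<^bsub>S\<^esub> y \<ominus>\<^bsub>S\<^esub> f r \<otimes>\<^bsub>S\<^esub> y"
      using that l by (simp add: a_minus_def S.l_distr S.l_minus)
    ultimately show ?thesis unfolding b_def using that l by (subst S.quot_eq_iff[OF I]) auto
  qed
  have MN: "m \<in> carrier N" if "m \<in> carrier M" for m using that unfolding Mc by simp
  have bal: "balanced R M (algebra_module S f) (S Quot I) b"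
    unfolding balanced_def
  proof (intro conjI ballI)
    fix x y assume "x \<in> carrier M" "y \<in> carrier (algebra_module S f)"
    then show "b x y \<in> carrier (S Quot I)" unfolding b_def using l by simp
  next
    fix x x' y assume a: "x \<in> carrier M" "x' \<in> carrier M" "y \<in> carrier (algebra_module S f)"
    then have "b (x \<oplus>\<^bsub>N\<^esub> x') y = ?p (f (l x \<oplus>\<^bsub>R\<^esub> l x') \<otimes>\<^bsub>S\<^esub> y)"
      using l MN add_K M.add.m_closed[OF a(1,2)] by (intro key) auto
    also have "\<dots> = b x y \<oplus>\<^bsub>S Quot I\<^esub> b x' y"
      unfolding b_def using a l by (simp add: S.l_distr)
    finally show "b (x \<oplus>\<^bsub>M\<^esub> x') y = b x y \<oplus>\<^bsub>S Quot I\<^esub> b x' y" by simp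
  next
    fix x y y' assume a: "x \<in> carrier M" "y \<in> carrier (algebra_module S f)" "y' \<in> carrier (algebra_module S f)"
    then show "b x (y \<oplus>\<^bsub>algebra_module S f\<^esub> y') = b x y \<oplus>\<^bsub>S Quot I\<^esub> b x y'"
      unfolding b_def using a l by (simp add: S.r_distr)
  next
    fix r x y assume a: "r \<in> carrier R" "x \<in> carrier M" "y \<in> carrier (algebra_module S f)"
    then have "b (r \<odot>\<^bsub>N\<^esub> x) y = ?p (f (r \<otimes>\<^bsub>R\<^esub> l x) \<otimes>\<^bsub>S\<^esub> y)"
      using l MN smult_K M.smult_closed[OF a(1,2)] by (intro key) auto
    also have "f (r \<otimes>\<^bsub>R\<^esub> l x) \<otimes>\<^bsub>S\<^esub> y = f (l x) \<otimes>\<^bsub>S\<^esub> (f r \<otimes>\<^bsub>S\<^esub> y)"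
      using a l by (simp add: S.m_ac)
    finally show "b (r \<odot>\<^bsub>M\<^esub> x) y = b x (r \<odot>\<^bsub>algebra_module S f\<^esub> y)"
      by (simp add: b_def)
  qed
  obtain h where h: "h \<in> hom (add_monoid T) (add_monoid (S Quot I))"
      "\<And>x y. x \<in> carrier M \<Longrightarrow> y \<in> carrier (algebra_module S f) \<Longrightarrow> h (pt x y) = b x y"
    using universal[OF Q.abelian_group_axioms bal] by blast
  interpret h: abelian_group_hom T "S Quot I" h
    by (rule hom_of_abelian[OF Q.abelian_group_axioms h(1)])
  have "h (cls t) = \<zero>\<^bsub>S Quot I\<^esub> \<and> t \<in> carrier F"
  proof (rule free_Abelian_group_induct[OF t[unfolded carrier_free_Abelian_group_iff]])
    show "h (cls 0) = \<zero>\<^bsub>S Quot I\<^esub> \<and> 0 \<in> carrier F" using h.hom_zero cls_zero by simp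
  next
    fix x y assume "h (cls x) = \<zero>\<^bsub>S Quot I\<^esub> \<and> x \<in> carrier F" "h (cls y) = \<zero>\<^bsub>S Quot I\<^esub> \<and> y \<in> carrier F"
    moreover from this have "cls (x - y) = cls x \<ominus>\<^bsub>T\<^esub> cls y" "x - y \<in> carrier F"
      using cls_diff[of x y] F_closed(3)[of x y] by simp_all
    ultimately show "h (cls (x - y)) = \<zero>\<^bsub>S Quot I\<^esub> \<and> x - y \<in> carrier F"
      by (simp add: cls_closed F_closed(3) a_minus_def Q.r_neg del: carrier_free_Abelian_group_iff)
  next
    fix a assume "a \<in> K \<times> carrier S"
    then obtain k y where a: "a = (k, y)" "k \<in> K" "y \<in> carrier S" by auto
    then have "h (pt k y) = ?p (f \<zero>\<^bsub>R\<^esub> \<otimes>\<^bsub>S\<^esub> y)" 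
      using h(2)[OF K_M(2)[OF a(2)], of y] key[OF K_M(2)[OF a(2)] _ K_M(3)[OF a(2)], of y] by simp
    then show "h (cls (frag_of a)) = \<zero>\<^bsub>S Quot I\<^esub> \<and> frag_of a \<in> carrier F"
      using a K_M by (simp add: pure_def)
  qed
  then have "?p (f \<one>\<^bsub>R\<^esub> \<otimes>\<^bsub>S\<^esub> s) = ?p \<zero>\<^bsub>S\<^esub>"
    using cls_eq h(2)[OF n_M, of s] key[OF n_M _ n_n, of s] s by simp
  then show ?thesis using s S.quot_eq_iff[OF I, of s "\<zero>\<^bsub>S\<^esub>"] 
    by (simp add: a_minus_def J_def I_def)
qed

subsection \<open>The tensor product as a module\<close>

context tensor_pair
begin

lemma smult_eq_tensor_map: "r \<odot>\<^bsub>T\<^esub> x = tensor_map R M N (\<lambda>m. r \<odot>\<^bsub>M\<^esub> m) x"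
  by (simp add: tensor_def tensor_map_def)

lemma smult_linear: "r \<in> carrier R \<Longrightarrow> (\<lambda>m. r \<odot>\<^bsub>M\<^esub> m) \<in> linear_maps R M M"
  unfolding linear_maps_def hom_def
  by (auto simp: M.smult_r_distr M.smult_assoc1[symmetric] M.R.m_comm)

lemma smult_pair_map: "r \<in> carrier R \<Longrightarrow> tensor_pair_map R M N M (\<lambda>m. r \<odot>\<^bsub>M\<^esub> m)"
  by unfold_locales (rule smult_linear)

lemma smult_pure: "r \<in> carrier R \<Longrightarrow> x \<in> carrier M \<Longrightarrow> y \<in> carrier N \<Longrightarrow> r \<odot>\<^bsub>T\<^esub> pt x y = pt (r \<odot>\<^bsub>M\<^esub> x) y"
  using tensor_pair_map.tensor_map_pure[OF smult_pair_map] by (simp add: smult_eq_tensor_map)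

lemma smult_T_closed: "r \<in> carrier R \<Longrightarrow> x \<in> carrier T \<Longrightarrow> r \<odot>\<^bsub>T\<^esub> x \<in> carrier T"
  using tensor_pair_map.tensor_map_closed[OF smult_pair_map] by (simp add: smult_eq_tensor_map)

lemma smult_T_hom: 
  assumes "r \<in> carrier R" shows "abelian_group_hom T T (\<lambda>x. r \<odot>\<^bsub>T\<^esub> x)"
  using hom_of_abelian[OF T.abelian_group_axioms tensor_pair_map.tensor_map_hom[OF smult_pair_map[OF assms]]]
  by (simp add: smult_eq_tensor_map[abs_def])

lemma T_module: "module R T"
proof (rule moduleI)
  show "cring R" "abelian_group T" by unfold_locales
  fix a b x y assume a: "a \<in> carrier R" and x: "x \<in> carrier T"
  interpret a: abelian_group_hom T T "\<lambda>x. a \<odot>\<^bsub>T\<^esub> x" by (rule smult_T_hom[OF a])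
  show "a \<odot>\<^bsub>T\<^esub> x \<in> carrier T" using a x by (rule smult_T_closed)
  { assume "y \<in> carrier T" then show "a \<odot>\<^bsub>T\<^esub> (x \<oplus>\<^bsub>T\<^esub> y) = a \<odot>\<^bsub>T\<^esub> x \<oplus>\<^bsub>T\<^esub> a \<odot>\<^bsub>T\<^esub> y" using x by simp }
  { assume b: "b \<in> carrier R"
    interpret b: abelian_group_hom T T "\<lambda>x. b \<odot>\<^bsub>T\<^esub> x" by (rule smult_T_hom[OF b])
    interpret ab: abelian_group_hom T T "\<lambda>x. (a \<oplus>\<^bsub>R\<^esub> b) \<odot>\<^bsub>T\<^esub> x" by (rule smult_T_hom) (use a b in simp)
    interpret ab': abelian_group_hom T T "\<lambda>x. (a \<otimes>\<^bsub>R\<^esub> b) \<odot>\<^bsub>T\<^esub> x" by (rule smult_T_hom) (use a b in simp)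
    show "(a \<oplus>\<^bsub>R\<^esub> b) \<odot>\<^bsub>T\<^esub> x = a \<odot>\<^bsub>T\<^esub> x \<oplus>\<^bsub>T\<^esub> b \<odot>\<^bsub>T\<^esub> x" using x
    proof (induction rule: T_induct)
      case (diff x y) then show ?case by (simp add: a_minus_def T.add.m_ac T.minus_add)
    qed (simp_all add: a b smult_pure M.smult_l_distr pt_add_left)
    show "(a \<otimes>\<^bsub>R\<^esub> b) \<odot>\<^bsub>T\<^esub> x = a \<odot>\<^bsub>T\<^esub> (b \<odot>\<^bsub>T\<^esub> x)" using x
    proof (induction rule: T_induct)
      case (diff x y) then show ?case by (simp add: a_minus_def)
    qed (simp_all add: a b smult_pure M.smult_assoc1)
  }
next
  fix x assume x: "x \<in> carrier T"
  interpret one: abelian_group_hom T T "\<lambda>x. \<one>\<^bsub>R\<^esub> \<odot>\<^bsub>T\<^esub> x" by (rule smult_T_hom) simp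
  show "\<one>\<^bsub>R\<^esub> \<odot>\<^bsub>T\<^esub> x = x" using x
  proof (induction rule: T_induct)
    case (diff x y) then show ?case by (simp add: a_minus_def)
  qed (simp_all add: smult_pure)
qed

end

subsection \<open>The tensor product of two algebras\<close>

text \<open>The tensor product of the \<open>R\<close>-algebras \<open>S\<close> and \<open>S'\<close> with structure maps \<open>f\<close> and \<open>f'\<close>, as a ring.\<close>

definition tensor_ring :: "'u ring \<Rightarrow> 'u ring \<Rightarrow> ('u \<Rightarrow> 'u) \<Rightarrow> 'u ring \<Rightarrow> ('u \<Rightarrow> 'u) \<Rightarrow> 'u ring" where
  "tensor_ring R S f S' f' = (let T = tensor R (algebra_module S f) (algebra_module S' f') in
     \<lparr>carrier = carrier T, monoid.mult = monoid.mult T, one = one T, ring.zero = ring.zero T, ring.add = ring.add T\<rparr>)"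

lemma frag_mult_simps [simp]:
  "frag_mult S S' 0 t = 0" "frag_mult S S' t 0 = 0"
  "frag_mult S S' (frag_of (a, b)) (frag_of (a', b')) = frag_of (a \<otimes>\<^bsub>S\<^esub> a', b \<otimes>\<^bsub>S'\<^esub> b')"
  "frag_mult S S' (t - u) v = frag_mult S S' t v - frag_mult S S' u v"
  by (simp_all add: frag_mult_def frag_extend_diff frag_extend_eq_0)

lemma frag_mult_diff_right [simp]:
  "frag_mult S S' v (t - u) = frag_mult S S' v t - frag_mult S S' v u"
proof -
  have "Poly_Mapping.keys v \<subseteq> UNIV" by simp
  then show ?thesis
    by (induction v rule: frag_induction) (auto simp: frag_mult_def frag_extend_diff)
qed

lemma frag_mult_add_left [simp]:
  "frag_mult S S' (t + u) v = frag_mult S S' t v + frag_mult S S' u v"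
  using frag_mult_simps(4)[of S S' t "- u" v] frag_mult_simps(4)[of S S' 0 u v] by simp

text \<open>Two \<open>R\<close>-algebras, their tensor product \<open>TR\<close>, and its structure maps \<open>left\<close> from \<open>S\<close> and \<open>right\<close> from \<open>S'\<close>.
  \<open>Fm\<close> is the product on formal sums.\<close>

locale tensor_algebras =
  fixes R S S' :: "'u ring" and f f' :: "'u \<Rightarrow> 'u"
  assumes infinite_UNIV: "infinite (UNIV :: 'u set)"
    and R: "cring R" and S: "cring S" and S': "cring S'"
    and f: "f \<in> ring_hom R S" and f': "f' \<in> ring_hom R S'"
begin

sublocale R: cring R by (rule R)
sublocale S: cring S by (rule S)
sublocale S': cring S' by (rule S')
sublocale f: ring_hom_cring R S f
  by (simp add: ring_hom_cring_def ring_hom_cring_axioms_def R S f)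
sublocale f': ring_hom_cring R S' f'
  by (simp add: ring_hom_cring_def ring_hom_cring_axioms_def R S' f')

abbreviation A where "A \<equiv> algebra_module S f"
abbreviation A' where "A' \<equiv> algebra_module S' f'"
abbreviation TR where "TR \<equiv> tensor_ring R S f S' f'"

sublocale tp: tensor_pair R A A'
  by (intro tensor_pair.intro tensor_pair_axioms.intro module_algebra_module R S S' f f' infinite_UNIV)

abbreviation Fm where "Fm \<equiv> frag_mult A A'"

lemma TR_simps:
  "carrier TR = carrier tp.T" "x \<oplus>\<^bsub>TR\<^esub> y = x \<oplus>\<^bsub>tp.T\<^esub> y" "\<zero>\<^bsub>TR\<^esub> = \<zero>\<^bsub>tp.T\<^esub>"
  "\<one>\<^bsub>TR\<^esub> = tp.pt \<one>\<^bsub>S\<^esub> \<one>\<^bsub>S'\<^esub>"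
  by (simp_all add: tensor_ring_def Let_def) (simp add: tensor_def pure_def)

lemma Fm_closed:
  assumes "t \<in> carrier tp.F" "t' \<in> carrier tp.F" shows "Fm t t' \<in> carrier tp.F"
  using assms(1)
proof (induction rule: tp.F_induct)
  case (pure x y)
  show ?case using assms(2)
  proof (induction rule: tp.F_induct)
    case (pure x' y') with \<open>x \<in> carrier A\<close> \<open>y \<in> carrier A'\<close> show ?case by simp
  next
    case (diff t t') then show ?case by (simp add: tp.F_closed(3) del: carrier_free_Abelian_group_iff algebra_module_simps(1))
  qed simp
next
  case (diff t t') then show ?case by (simp add: tp.F_closed(3) del: carrier_free_Abelian_group_iff algebra_module_simps(1))
qed simp

lemma Fm_comm: 
  assumes "t \<in> carrier tp.F" "t' \<in> carrier tp.F" shows "Fm t t' = Fm t' t"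
  using assms(1)
proof (induction rule: tp.F_induct)
  case (pure x y)
  show ?case using assms(2)
  proof (induction rule: tp.F_induct)
    case (pure x' y') with \<open>x \<in> carrier A\<close> \<open>y \<in> carrier A'\<close> show ?case 
      by (simp add: S.m_comm S'.m_comm)
  qed simp_all
qed simp_all

lemma Fm_rel_left:
  assumes "t \<in> tp.rel" "t' \<in> carrier tp.F" shows "Fm t t' \<in> tp.rel"
  using assms(2)
proof (induction rule: tp.F_induct)
  case (pure a b)
  then have ab: "a \<in> carrier S" "b \<in> carrier S'" by simp_all
  show ?case using assms(1)
  proof (induction rule: tp.rel_induct)
    case (left x x' y)
    with ab show ?case using tp.rel_generators(1)[of "x \<otimes>\<^bsub>S\<^esub> a" "x' \<otimes>\<^bsub>S\<^esub> a" "y \<otimes>\<^bsub>S'\<^esub> b"]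
      by (simp add: S.l_distr)
  next
    case (right x y y')
    with ab show ?case using tp.rel_generators(2)[of "x \<otimes>\<^bsub>S\<^esub> a" "y \<otimes>\<^bsub>S'\<^esub> b" "y' \<otimes>\<^bsub>S'\<^esub> b"]
      by (simp add: S'.l_distr)
  next
    case (scalar r x y)
    with ab show ?case using tp.rel_generators(3)[of r "x \<otimes>\<^bsub>S\<^esub> a" "y \<otimes>\<^bsub>S'\<^esub> b"]
      by (simp add: S.m_assoc S'.m_assoc)
  next
    case (diff t t') then show ?case by (simp add: tp.rel_closed(4))
  qed simp
next
  case (diff t t') then show ?case by (simp add: tp.rel_closed(4))
qed simp

lemma Fm_rel_right:
  assumes "t \<in> tp.rel" "t' \<in> carrier tp.F" shows "Fm t' t \<in> tp.rel"
  using Fm_rel_left[OF assms] Fm_comm[OF tp.rel_carrier[OF assms(1)] assms(2)] by simp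

lemma cls_mult:
  assumes "t \<in> carrier tp.F" "t' \<in> carrier tp.F"
  shows "tp.cls t \<otimes>\<^bsub>TR\<^esub> tp.cls t' = tp.cls (Fm t t')"
proof -
  let ?u = "frag_decode (tp.cls t)" and ?u' = "frag_decode (tp.cls t')"
  note u = tp.rep[OF assms(1)] and u' = tp.rep[OF assms(2)]
  have "Fm (?u - t) ?u' + Fm t (?u' - t') \<in> tp.rel"
    using Fm_rel_left[OF u(2) u'(1)] Fm_rel_right[OF u'(2) assms(1)] by blast
  also have "Fm (?u - t) ?u' + Fm t (?u' - t') = Fm ?u ?u' - Fm t t'"
    by simp
  finally have "tp.cls (Fm ?u ?u') = tp.cls (Fm t t')"
    using u u' assms by (subst tp.cls_eq_iff) (simp_all add: Fm_closed del: carrier_free_Abelian_group_iff algebra_module_simps(1))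
  then show ?thesis by (simp add: tensor_ring_def Let_def) (simp add: tensor_def)
qed

lemma pt_mult:
  "a \<in> carrier S \<Longrightarrow> b \<in> carrier S' \<Longrightarrow> a' \<in> carrier S \<Longrightarrow> b' \<in> carrier S' \<Longrightarrow>
     tp.pt a b \<otimes>\<^bsub>TR\<^esub> tp.pt a' b' = tp.pt (a \<otimes>\<^bsub>S\<^esub> a') (b \<otimes>\<^bsub>S'\<^esub> b')"
  by (simp add: pure_def cls_mult)

lemma TR_minus: "x \<ominus>\<^bsub>TR\<^esub> y = x \<ominus>\<^bsub>tp.T\<^esub> y"
  by (simp add: a_minus_def a_inv_def m_inv_def TR_simps)

lemma TR_uminus: "\<ominus>\<^bsub>TR\<^esub> x = \<ominus>\<^bsub>tp.T\<^esub> x"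
  by (simp add: a_inv_def m_inv_def TR_simps)

lemma TR_cring: "cring TR"
proof -
  have ag: "abelian_group TR"
    by (rule abelian_groupI)
       (auto simp: TR_simps tp.T.a_ac intro: bexI[where x = "\<ominus>\<^bsub>tp.T\<^esub> _"] tp.T.l_neg)
  have m: "x \<otimes>\<^bsub>TR\<^esub> y \<in> carrier tp.T" if "x \<in> carrier tp.T" "y \<in> carrier tp.T" for x y
    using that by (auto elim!: tp.T_cases simp: cls_mult Fm_closed simp del: carrier_free_Abelian_group_iff algebra_module_simps(1))
  have comm: "x \<otimes>\<^bsub>TR\<^esub> y = y \<otimes>\<^bsub>TR\<^esub> x" if "x \<in> carrier tp.T" "y \<in> carrier tp.T" for x y
    using that by (auto elim!: tp.T_cases simp: cls_mult Fm_comm simp del: carrier_free_Abelian_group_iff algebra_module_simps(1))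
  have md: "(x \<ominus>\<^bsub>tp.T\<^esub> y) \<otimes>\<^bsub>TR\<^esub> z = (x \<otimes>\<^bsub>TR\<^esub> z) \<ominus>\<^bsub>tp.T\<^esub> (y \<otimes>\<^bsub>TR\<^esub> z)"
    if "x \<in> carrier tp.T" "y \<in> carrier tp.T" "z \<in> carrier tp.T" for x y z
    using that by (auto elim!: tp.T_cases simp: tp.F_closed cls_mult tp.cls_diff Fm_closed simp del: carrier_free_Abelian_group_iff algebra_module_simps(1))
  have distr: "(x \<oplus>\<^bsub>TR\<^esub> y) \<otimes>\<^bsub>TR\<^esub> z = (x \<otimes>\<^bsub>TR\<^esub> z) \<oplus>\<^bsub>TR\<^esub> (y \<otimes>\<^bsub>TR\<^esub> z)"
    if "x \<in> carrier tp.T" "y \<in> carrier tp.T" "z \<in> carrier tp.T" for x y z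
    using that by (auto elim!: tp.T_cases simp: TR_simps tp.F_closed cls_mult tp.cls_add Fm_closed simp del: carrier_free_Abelian_group_iff algebra_module_simps(1))
  have mz: "\<zero>\<^bsub>tp.T\<^esub> \<otimes>\<^bsub>TR\<^esub> z = \<zero>\<^bsub>tp.T\<^esub>" if "z \<in> carrier tp.T" for z
    using that by (auto elim!: tp.T_cases simp: tp.cls_zero cls_mult simp del: carrier_free_Abelian_group_iff algebra_module_simps(1))
  have md': "z \<otimes>\<^bsub>TR\<^esub> (x \<ominus>\<^bsub>tp.T\<^esub> y) = (z \<otimes>\<^bsub>TR\<^esub> x) \<ominus>\<^bsub>tp.T\<^esub> (z \<otimes>\<^bsub>TR\<^esub> y)"
    if "x \<in> carrier tp.T" "y \<in> carrier tp.T" "z \<in> carrier tp.T" for x y z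
    using md[OF that] comm that by (simp add: m)
  have mz': "z \<otimes>\<^bsub>TR\<^esub> \<zero>\<^bsub>tp.T\<^esub> = \<zero>\<^bsub>tp.T\<^esub>" if "z \<in> carrier tp.T" for z
    using mz comm that by simp
  have one: "\<one>\<^bsub>TR\<^esub> \<otimes>\<^bsub>TR\<^esub> z = z" if "z \<in> carrier tp.T" for z
    using that
    by (induction rule: tp.T_induct) (simp_all add: mz' md' TR_simps(4) pt_mult tp.pt_closed)
  have assoc: "x \<otimes>\<^bsub>TR\<^esub> y \<otimes>\<^bsub>TR\<^esub> z = x \<otimes>\<^bsub>TR\<^esub> (y \<otimes>\<^bsub>TR\<^esub> z)" 
    if x: "x \<in> carrier tp.T" and y: "y \<in> carrier tp.T" and z: "z \<in> carrier tp.T" for x y z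
    using x y z
  proof (induction arbitrary: y z rule: tp.T_induct)
    case (pure a b)
    from pure(3,4) show ?case
    proof (induction arbitrary: z rule: tp.T_induct)
      case p2: (pure a' b')
      from p2(3) show ?case
      proof (induction rule: tp.T_induct)
        case (pure a'' b'')
        then show ?case using p2(1,2) \<open>a \<in> carrier A\<close> \<open>b \<in> carrier A'\<close>
          by (simp add: pt_mult S.m_assoc S'.m_assoc)
      qed (use p2(1,2) \<open>a \<in> carrier A\<close> \<open>b \<in> carrier A'\<close> in
        \<open>simp_all add: mz mz' md' m tp.pt_closed\<close>)
    qed (use \<open>a \<in> carrier A\<close> \<open>b \<in> carrier A'\<close> in
        \<open>simp_all add: mz mz' md md' m tp.pt_closed\<close>)
  qed (simp_all add: mz mz' md md' m tp.pt_closed)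
  have "Group.comm_monoid TR"
  proof (rule comm_monoidI)
    show "\<one>\<^bsub>TR\<^esub> \<in> carrier TR" by (simp add: TR_simps tp.pt_closed)
    fix x y z assume xyz: "x \<in> carrier TR" "y \<in> carrier TR" "z \<in> carrier TR"
    show "x \<otimes>\<^bsub>TR\<^esub> y \<otimes>\<^bsub>TR\<^esub> z = x \<otimes>\<^bsub>TR\<^esub> (y \<otimes>\<^bsub>TR\<^esub> z)"
      using assoc xyz by (simp add: TR_simps(1))
  qed (simp_all only: TR_simps(1) m one comm)
  then show ?thesis
    using ag distr by (intro cringI) (simp_all add: TR_simps(1))
qed

sublocale TR: cring TR by (rule TR_cring)

definition left :: "'u \<Rightarrow> 'u" where "left = (\<lambda>s \<in> carrier S. tp.pt s \<one>\<^bsub>S'\<^esub>)"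
definition right :: "'u \<Rightarrow> 'u" where "right = (\<lambda>s \<in> carrier S'. tp.pt \<one>\<^bsub>S\<^esub> s)"

lemma left_hom: "left \<in> ring_maps S TR"
  using tp.pt_add_left
  by (auto simp: ring_maps_def left_def TR_simps pt_mult tp.pt_closed intro!: ring_hom_memI)

lemma right_hom: "right \<in> ring_maps S' TR"
  using tp.pt_add_right
  by (auto simp: ring_maps_def right_def TR_simps pt_mult tp.pt_closed intro!: ring_hom_memI)

lemma pt_eq_mult: "a \<in> carrier S \<Longrightarrow> b \<in> carrier S' \<Longrightarrow> tp.pt a b = left a \<otimes>\<^bsub>TR\<^esub> right b"
  by (simp add: left_def right_def pt_mult)

lemma left_right: "r \<in> carrier R \<Longrightarrow> left (f r) = right (f' r)"
  using tp.pt_smult[of r "\<one>\<^bsub>S\<^esub>" "\<one>\<^bsub>S'\<^esub>"] by (simp add: left_def right_def)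

lemma left_f_eq: "compose (carrier R) left f = compose (carrier R) right f'"
  by (auto simp: compose_def left_right)

text \<open>The tensor product of algebras is the pushout.\<close>

lemma pushout:
  assumes Q: "cring Q" and \<alpha>: "\<alpha> \<in> ring_hom S Q" and \<beta>: "\<beta> \<in> ring_hom S' Q"
    and eq: "\<And>r. r \<in> carrier R \<Longrightarrow> \<alpha> (f r) = \<beta> (f' r)"
  obtains h where "h \<in> ring_hom TR Q" "\<And>s. s \<in> carrier S \<Longrightarrow> h (left s) = \<alpha> s"
    "\<And>s. s \<in> carrier S' \<Longrightarrow> h (right s) = \<beta> s"
proof -
  interpret Q: cring Q by fact
  interpret \<alpha>: ring_hom_cring S Q \<alpha> using \<alpha> by (simp add: ring_hom_cring_def ring_hom_cring_axioms_def S Q)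
  interpret \<beta>: ring_hom_cring S' Q \<beta> using \<beta> by (simp add: ring_hom_cring_def ring_hom_cring_axioms_def S' Q)
  have "balanced R A A' Q (\<lambda>x y. \<alpha> x \<otimes>\<^bsub>Q\<^esub> \<beta> y)"
    unfolding balanced_def by (auto simp: Q.l_distr Q.r_distr eq Q.m_ac)
  then obtain h where h: "h \<in> hom (add_monoid tp.T) (add_monoid Q)"
    "\<And>x y. x \<in> carrier A \<Longrightarrow> y \<in> carrier A' \<Longrightarrow> h (tp.pt x y) = \<alpha> x \<otimes>\<^bsub>Q\<^esub> \<beta> y"
    using tp.universal[OF Q.abelian_group_axioms] by blast
  interpret h: abelian_group_hom tp.T Q h by (rule tp.hom_of_abelian[OF Q.abelian_group_axioms h(1)])
  interpret h': abelian_group_hom TR Q h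
    using h(1) by (intro abelian_group_homI TR.abelian_group_axioms Q.abelian_group_axioms
      group_hom.intro group_hom_axioms.intro TR.a_group Q.a_group) (auto simp: hom_def TR_simps)
  have mult: "h (x \<otimes>\<^bsub>TR\<^esub> y) = h x \<otimes>\<^bsub>Q\<^esub> h y" if "x \<in> carrier TR" "y \<in> carrier TR" for x y
    using that unfolding TR_simps(1)
  proof (induction arbitrary: y rule: tp.T_induct)
    case zero
    then show ?case using TR.l_null[of y] by (simp add: TR_simps)
  next
    case (diff x x')
    have "h ((x \<ominus>\<^bsub>TR\<^esub> x') \<otimes>\<^bsub>TR\<^esub> y) = h (x \<otimes>\<^bsub>TR\<^esub> y) \<ominus>\<^bsub>Q\<^esub> h (x' \<otimes>\<^bsub>TR\<^esub> y)"
      using diff(1,2,5) by (simp add: a_minus_def TR.l_distr TR.l_minus flip: TR_simps(1))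
    then show ?case using diff h.hom_closed by (simp add: TR_uminus a_minus_def Q.l_distr Q.l_minus TR_simps)
  next
    case (pure a b)
    from pure(3) show ?case
    proof (induction rule: tp.T_induct)
      case zero
      then show ?case using pure TR.r_null[of "tp.pt a b"] by (simp add: TR_simps tp.pt_closed h(2))
    next
      case (diff x x')
      have "h (tp.pt a b \<otimes>\<^bsub>TR\<^esub> (x \<ominus>\<^bsub>TR\<^esub> x')) = h (tp.pt a b \<otimes>\<^bsub>TR\<^esub> x) \<ominus>\<^bsub>Q\<^esub> h (tp.pt a b \<otimes>\<^bsub>TR\<^esub> x')"
        using diff(1,2) tp.pt_closed[OF pure(1,2)]
        by (simp add: a_minus_def TR.r_distr TR.r_minus flip: TR_simps(1))
      then show ?case using diff tp.pt_closed[OF pure(1,2)] 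
        by (simp add: TR_uminus a_minus_def Q.r_distr Q.r_minus TR_simps)
    next
      case p2: (pure a' b')
      then show ?case using pure(1,2) by (simp add: pt_mult h(2) Q.m_ac)
    qed
  qed
  have "h \<in> ring_hom TR Q"
    by (rule ring_hom_memI) (use mult h(2) in \<open>auto simp: TR_simps\<close>)
  moreover have "h (left s) = \<alpha> s" if "s \<in> carrier S" for s
    using that by (simp add: left_def h(2))
  moreover have "h (right s) = \<beta> s" if "s \<in> carrier S'" for s
    using that by (simp add: right_def h(2))
  ultimately show ?thesis by (rule that)
qed

end

lemma ring_mapsD: "f \<in> ring_maps R S \<Longrightarrow> f \<in> ring_hom R S"
  by (simp add: ring_maps_def)

lemma compose_ring_maps:
  assumes "ring R" "f \<in> ring_hom R S" "g \<in> ring_hom S T"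
  shows "compose (carrier R) g f \<in> ring_maps R T"
proof -
  interpret ring R by fact
  show ?thesis using assms(2,3)
    by (auto simp: ring_maps_def compose_def ring_hom_def Pi_iff extensional_def)
qed

subsection \<open>Flatness of a tensor product of algebras\<close>

lemma (in tensor_pair_map) tensor_map_linear:
  "tensor_map R M' N h \<in> linear_maps R T P.T"
proof -
  interpret h: abelian_group_hom T P.T "tensor_map R M' N h"
    by (rule hom_of_abelian[OF P.T.abelian_group_axioms tensor_map_hom])
  have "tensor_map R M' N h (r \<odot>\<^bsub>T\<^esub> x) = r \<odot>\<^bsub>P.T\<^esub> tensor_map R M' N h x"
    if r: "r \<in> carrier R" and "x \<in> carrier T" for r x
  proof -
    interpret r: abelian_group_hom T T "\<lambda>x. r \<odot>\<^bsub>T\<^esub> x" by (rule smult_T_hom[OF r])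
    interpret r': abelian_group_hom P.T P.T "\<lambda>x. r \<odot>\<^bsub>P.T\<^esub> x" by (rule P.smult_T_hom[OF r])
    show ?thesis using that(2)
    proof (induction rule: T_induct)
      case (pure x y)
      then show ?case using r 
        by (simp add: smult_pure P.smult_pure tensor_map_pure linear_mapsD[OF linear])
    next
      case (diff x y) then show ?case by (simp add: a_minus_def)
    qed simp
  qed
  then show ?thesis using tensor_map_hom by (simp add: linear_maps_def)
qed

text \<open>For an \<open>R\<close>-module \<open>M\<close>, the isomorphism \<open>M \<otimes> (S \<otimes> S') = (M \<otimes> S) \<otimes> S'\<close>, with inverse maps from \<open>ex_assoc\<close> and
  \<open>ex_unassoc\<close>. The prefixes are \<open>a\<close> for \<open>M \<otimes> S\<close>, \<open>x\<close> for \<open>(M \<otimes> S) \<otimes> S'\<close> and \<open>w\<close> for \<open>M \<otimes> (S \<otimes> S')\<close>; \<open>g\<close>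
  is the structure map of \<open>S \<otimes> S'\<close> over \<open>R\<close>.\<close>

locale tensor_triple = tensor_algebras R S S' f f' + M: module R M
  for R S S' :: "'u ring" and f f' :: "'u \<Rightarrow> 'u" and M :: "('u, 'u) module"
begin

definition g :: "'u \<Rightarrow> 'u" where "g = compose (carrier R) left f"

abbreviation G where "G \<equiv> algebra_module TR g"

lemma g_eq: "r \<in> carrier R \<Longrightarrow> g r = tp.pt (f r) \<one>\<^bsub>S'\<^esub>"
  by (simp add: g_def compose_def left_def)

lemma g_hom: "g \<in> ring_hom R TR"
  unfolding g_def using compose_ring_maps R.ring_axioms f left_hom ring_mapsD by metis

sublocale a: tensor_pair R M A by unfold_locales (rule infinite_UNIV)
sublocale aM: module R a.T by (rule a.T_module)
sublocale x: tensor_pair R a.T A' by unfold_locales (rule infinite_UNIV)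
sublocale G: module R G by (rule module_algebra_module[OF R TR_cring g_hom])
sublocale w: tensor_pair R M G by unfold_locales (rule infinite_UNIV)

lemma g_pt: "r \<in> carrier R \<Longrightarrow> s \<in> carrier S \<Longrightarrow> s' \<in> carrier S' \<Longrightarrow>
    g r \<otimes>\<^bsub>TR\<^esub> tp.pt s s' = tp.pt (f r \<otimes>\<^bsub>S\<^esub> s) s'"
  by (simp add: g_eq pt_mult)

lemma ex_assoc:
  "\<exists>\<alpha> \<in> hom (add_monoid w.T) (add_monoid x.T).
     \<forall>m \<in> carrier M. \<forall>s \<in> carrier S. \<forall>s' \<in> carrier S'. \<alpha> (w.pt m (tp.pt s s')) = x.pt (a.pt m s) s'"
proof -
  have "\<exists>B. B \<in> hom (add_monoid tp.T) (add_monoid x.T) \<and>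
     (\<forall>s \<in> carrier S. \<forall>s' \<in> carrier S'. B (tp.pt s s') = x.pt (a.pt m s) s')" if m: "m \<in> carrier M" for m
  proof -
    have "balanced R A A' x.T (\<lambda>s s'. x.pt (a.pt m s) s')"
      unfolding balanced_def
    proof (intro conjI ballI, goal_cases)
      case (1 s s') then show ?case using m by (intro x.pt_closed a.pt_closed)
    next
      case (2 s t s') then show ?case using m a.pt_add_right[of m s t] x.pt_add_left[of "a.pt m s" "a.pt m t" s'] 
        by (simp add: a.pt_closed)
    next
      case (3 s s' t') then show ?case using m x.pt_add_right[of "a.pt m s" s' t']
        by (simp add: a.pt_closed)
    next
      case (4 r s s') then show ?case 
        using m a.pt_smult[of r m s] a.smult_pure[of r m s] x.pt_smult[of r "a.pt m s" s']
        by (simp add: a.pt_closed)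
    qed
    from tp.universal[OF x.T.abelian_group_axioms this] show ?thesis by (metis algebra_module_simps(1))
  qed
  then obtain B where B: "\<And>m. m \<in> carrier M \<Longrightarrow> B m \<in> hom (add_monoid tp.T) (add_monoid x.T)"
    "\<And>m s s'. m \<in> carrier M \<Longrightarrow> s \<in> carrier S \<Longrightarrow> s' \<in> carrier S' \<Longrightarrow> B m (tp.pt s s') = x.pt (a.pt m s) s'"
    by metis
  have Bh: "abelian_group_hom tp.T x.T (B m)" if "m \<in> carrier M" for m
    by (rule tp.hom_of_abelian[OF x.T.abelian_group_axioms B(1)[OF that]])
  have "balanced R M G x.T B"
    unfolding balanced_def algebra_module_simps TR_simps
  proof (intro conjI ballI)
    fix m z assume m: "m \<in> carrier M" and z: "z \<in> carrier tp.T"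
    interpret b: abelian_group_hom tp.T x.T "B m" by (rule Bh[OF m])
    show "B m z \<in> carrier x.T" using z by simp
    { fix z' assume "z' \<in> carrier tp.T"
      then show "B m (z \<oplus>\<^bsub>tp.T\<^esub> z') = B m z \<oplus>\<^bsub>x.T\<^esub> B m z'" using z by simp }
    { fix m' assume m': "m' \<in> carrier M"
      interpret b': abelian_group_hom tp.T x.T "B m'" by (rule Bh[OF m'])
      interpret b'': abelian_group_hom tp.T x.T "B (m \<oplus>\<^bsub>M\<^esub> m')" by (rule Bh) (use m m' in simp)
      show "B (m \<oplus>\<^bsub>M\<^esub> m') z = B m z \<oplus>\<^bsub>x.T\<^esub> B m' z" using z
      proof (induction rule: tp.T_induct)
        case (pure s s')
        then show ?case using m m' by (simp add: B(2) a.pt_add_left x.pt_add_left a.pt_closed)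
      next
        case (diff z z')
        then show ?case by (simp add: a_minus_def x.T.minus_add x.T.a_ac)
      qed simp
    }
    { fix r assume r: "r \<in> carrier R"
      interpret b': abelian_group_hom tp.T x.T "B (r \<odot>\<^bsub>M\<^esub> m)" by (rule Bh) (use m r in simp)
      have gr: "g r \<in> carrier TR" using g_hom r by (auto simp: ring_hom_def)
      show "B (r \<odot>\<^bsub>M\<^esub> m) z = B m (g r \<otimes>\<^bsub>TR\<^esub> z)" using z
      proof (induction rule: tp.T_induct)
        case zero then show ?case using TR.r_null[OF gr] by (simp add: TR_simps)
      next
        case (pure s s')
        then show ?case using m r a.pt_smult[of r m s] by (simp add: B(2) g_pt)
      next
        case (diff z z')
        have "g r \<otimes>\<^bsub>TR\<^esub> (z \<ominus>\<^bsub>TR\<^esub> z') = g r \<otimes>\<^bsub>TR\<^esub> z \<ominus>\<^bsub>TR\<^esub> g r \<otimes>\<^bsub>TR\<^esub> z'"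
          using diff(1,2) gr by (simp add: TR_simps(1) a_minus_def TR.r_distr TR.r_minus flip: TR_simps(1))
        moreover have "g r \<otimes>\<^bsub>TR\<^esub> z \<in> carrier tp.T" "g r \<otimes>\<^bsub>TR\<^esub> z' \<in> carrier tp.T"
          using TR.m_closed[OF gr] diff(1,2) by (auto simp: TR_simps(1))
        ultimately show ?case using diff by (simp add: TR_minus) (simp add: a_minus_def)
      qed
    }
  qed
  from w.universal[OF x.T.abelian_group_axioms this] B(2) show ?thesis
    by (metis algebra_module_simps(1) TR_simps(1) tp.pt_closed)
qed

lemma ex_unassoc:
  "\<exists>\<beta> \<in> hom (add_monoid x.T) (add_monoid w.T).
     \<forall>m \<in> carrier M. \<forall>s \<in> carrier S. \<forall>s' \<in> carrier S'. \<beta> (x.pt (a.pt m s) s') = w.pt m (tp.pt s s')"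
proof -
  have pt_w: "w.pt m (tp.pt s s') \<in> carrier w.T" if "m \<in> carrier M" "s \<in> carrier S" "s' \<in> carrier S'" for m s s'
    using that by (intro w.pt_closed) (simp_all add: TR_simps tp.pt_closed)
  have "\<exists>B. B \<in> hom (add_monoid a.T) (add_monoid w.T) \<and>
     (\<forall>m \<in> carrier M. \<forall>s \<in> carrier S. B (a.pt m s) = w.pt m (tp.pt s s'))" if s': "s' \<in> carrier S'" for s'
  proof -
    have "balanced R M A w.T (\<lambda>m s. w.pt m (tp.pt s s'))"
      unfolding balanced_def
    proof (intro conjI ballI, goal_cases)
      case (1 m s) then show ?case using pt_w s' by simp
    next
      case (2 m m' s) then show ?case using s' by (simp add: w.pt_add_left TR_simps tp.pt_closed)
    next
      case (3 m s t) then show ?case using s' w.pt_add_right[of m "tp.pt s s'" "tp.pt t s'"] tp.pt_add_left[of s t s']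
        by (simp add: TR_simps tp.pt_closed)
    next
      case (4 r m s) then show ?case using s' w.pt_smult[of r m "tp.pt s s'"]
        by (simp add: TR_simps tp.pt_closed g_pt)
    qed
    from a.universal[OF w.T.abelian_group_axioms this] show ?thesis by (metis algebra_module_simps(1))
  qed
  then obtain B where B: "\<And>s'. s' \<in> carrier S' \<Longrightarrow> B s' \<in> hom (add_monoid a.T) (add_monoid w.T)"
    "\<And>m s s'. m \<in> carrier M \<Longrightarrow> s \<in> carrier S \<Longrightarrow> s' \<in> carrier S' \<Longrightarrow> B s' (a.pt m s) = w.pt m (tp.pt s s')"
    by metis
  have Bh: "abelian_group_hom a.T w.T (B s')" if "s' \<in> carrier S'" for s'
    by (rule a.hom_of_abelian[OF w.T.abelian_group_axioms B(1)[OF that]])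
  have "balanced R a.T A' w.T (\<lambda>z s'. B s' z)"
    unfolding balanced_def algebra_module_simps
  proof (intro conjI ballI)
    fix z s' assume z: "z \<in> carrier a.T" and s': "s' \<in> carrier S'"
    interpret b: abelian_group_hom a.T w.T "B s'" by (rule Bh[OF s'])
    show "B s' z \<in> carrier w.T" using z by simp
    { fix t' assume t': "t' \<in> carrier S'"
      interpret b': abelian_group_hom a.T w.T "B t'" by (rule Bh[OF t'])
      interpret b'': abelian_group_hom a.T w.T "B (s' \<oplus>\<^bsub>S'\<^esub> t')" by (rule Bh) (use s' t' in simp)
      show "B (s' \<oplus>\<^bsub>S'\<^esub> t') z = B s' z \<oplus>\<^bsub>w.T\<^esub> B t' z" using z
      proof (induction rule: a.T_induct)
        case (pure m s)
        then show ?case using s' t' tp.pt_add_right[of s s' t'] w.pt_add_right[of m "tp.pt s s'" "tp.pt s t'"]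
          by (simp add: B(2) TR_simps tp.pt_closed)
      next
        case (diff z z')
        then show ?case by (simp add: a_minus_def w.T.minus_add w.T.a_ac)
      qed simp
    }
    { fix r assume r: "r \<in> carrier R"
      interpret b': abelian_group_hom a.T w.T "B (f' r \<otimes>\<^bsub>S'\<^esub> s')" by (rule Bh) (use s' r in simp)
      interpret r: abelian_group_hom a.T a.T "\<lambda>x. r \<odot>\<^bsub>a.T\<^esub> x" by (rule a.smult_T_hom[OF r])
      show "B s' (r \<odot>\<^bsub>a.T\<^esub> z) = B (f' r \<otimes>\<^bsub>S'\<^esub> s') z" using z
      proof (induction rule: a.T_induct)
        case (pure m s)
        then show ?case using s' r w.pt_smult[of r m "tp.pt s s'"] tp.pt_smult[of r s s']
          by (simp add: B(2) a.smult_pure TR_simps tp.pt_closed g_pt)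
      next
        case (diff z z')
        then show ?case by (simp add: a_minus_def)
      qed simp
    }
    fix z' assume "z' \<in> carrier a.T"
    then show "B s' (z \<oplus>\<^bsub>a.T\<^esub> z') = B s' z \<oplus>\<^bsub>w.T\<^esub> B s' z'" using z by simp
  qed
  from x.universal[OF w.T.abelian_group_axioms this] B(2) show ?thesis
    by (metis algebra_module_simps(1) a.pt_closed)
qed

lemma w_hom_eqI:
  assumes H: "abelian_group H" and h: "h \<in> hom (add_monoid w.T) (add_monoid H)" "h' \<in> hom (add_monoid w.T) (add_monoid H)"
    and eq: "\<And>m s s'. m \<in> carrier M \<Longrightarrow> s \<in> carrier S \<Longrightarrow> s' \<in> carrier S' \<Longrightarrow>
      h (w.pt m (tp.pt s s')) = h' (w.pt m (tp.pt s s'))" and z: "z \<in> carrier w.T"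
  shows "h z = h' z"
proof (rule w.hom_eqI[OF H h _ z])
  fix m y assume m: "m \<in> carrier M" and "y \<in> carrier G"
  interpret h: abelian_group_hom w.T H h by (rule w.hom_of_abelian[OF H h(1)])
  interpret h': abelian_group_hom w.T H h' by (rule w.hom_of_abelian[OF H h(2)])
  have p: "abelian_group_hom TR w.T (w.pt m)"
    using w.pt_add_right[OF m] w.pt_closed[OF m]
    by (intro abelian_group_homI TR.abelian_group_axioms w.T.abelian_group_axioms group_hom.intro
        group_hom_axioms.intro TR.a_group w.T.a_group) (auto simp: hom_def)
  interpret p: abelian_group_hom TR w.T "w.pt m" by (rule p)
  have "y \<in> carrier tp.T" using \<open>y \<in> carrier G\<close> by (simp add: TR_simps)
  then show "h (w.pt m y) = h' (w.pt m y)"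
  proof (induction rule: tp.T_induct)
    case zero then show ?case using p.hom_zero by (simp add: TR_simps)
  next
    case (pure s s') then show ?case using eq m by simp
  next
    case (diff y y')
    then have "y \<in> carrier TR" "y' \<in> carrier TR" by (simp_all add: TR_simps)
    then show ?case using diff unfolding TR_minus[symmetric] by (simp add: a_minus_def)
  qed
qed

end

text \<open>Tensoring with \<open>S \<otimes> S'\<close> is tensoring with \<open>S\<close> and then with \<open>S'\<close>, so it preserves injections.\<close>

lemma (in tensor_algebras) flat_tensor_ring:
  assumes flat: "flat_map R S f" "flat_map R S' f'"
  shows "flat_map R TR (compose (carrier R) left f)"
proof (rule flat_mapI[OF infinite_UNIV R TR_cring])
  show "compose (carrier R) left f \<in> ring_hom R TR"
    using compose_ring_maps R.ring_axioms f left_hom ring_mapsD by metis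
  fix M N :: "('u, 'u) module" and h
  assume M: "module R M" "module R N" "h \<in> linear_maps R M N" "inj_on h (carrier M)"
  interpret M: module R M by fact
  interpret N: module R N by fact
  interpret m: tensor_triple R S S' f f' M by unfold_locales
  interpret n: tensor_triple R S S' f f' N by unfold_locales
  interpret h1: tensor_pair_map R M A N h by unfold_locales (rule M)
  let ?h1 = "tensor_map R N A h"
  interpret h2: tensor_pair_map R m.a.T A' n.a.T ?h1 
    by unfold_locales (rule h1.tensor_map_linear)
  let ?h2 = "tensor_map R n.a.T A' ?h1"
  have g: "compose (carrier R) left f = m.g" "n.g = m.g" by (simp_all add: m.g_def n.g_def)
  interpret h3: tensor_pair_map R M m.G N h by unfold_locales (rule M)
  let ?h3 = "tensor_map R N m.G h"
  have inj1: "inj_on ?h1 (carrier m.a.T)"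
    by (rule flat_mapD[OF infinite_UNIV R S f flat(1) M])
  have inj2: "inj_on ?h2 (carrier m.x.T)"
    by (rule flat_mapD[OF infinite_UNIV R S' f' flat(2) m.a.T_module n.a.T_module h1.tensor_map_linear inj1])
  obtain \<alpha> where \<alpha>: "\<alpha> \<in> hom (add_monoid m.w.T) (add_monoid m.x.T)"
     "\<And>x s s'. x \<in> carrier M \<Longrightarrow> s \<in> carrier S \<Longrightarrow> s' \<in> carrier S' \<Longrightarrow> \<alpha> (m.w.pt x (tp.pt s s')) = m.x.pt (m.a.pt x s) s'"
    using m.ex_assoc by blast
  obtain \<beta> where \<beta>: "\<beta> \<in> hom (add_monoid m.x.T) (add_monoid m.w.T)"
     "\<And>x s s'. x \<in> carrier M \<Longrightarrow> s \<in> carrier S \<Longrightarrow> s' \<in> carrier S' \<Longrightarrow> \<beta> (m.x.pt (m.a.pt x s) s') = m.w.pt x (tp.pt s s')"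
    using m.ex_unassoc by blast
  obtain \<alpha>' where \<alpha>': "\<alpha>' \<in> hom (add_monoid n.w.T) (add_monoid n.x.T)"
     "\<And>x s s'. x \<in> carrier N \<Longrightarrow> s \<in> carrier S \<Longrightarrow> s' \<in> carrier S' \<Longrightarrow> \<alpha>' (n.w.pt x (tp.pt s s')) = n.x.pt (n.a.pt x s) s'"
    using n.ex_assoc by blast
  have hx: "h x \<in> carrier N" if "x \<in> carrier M" for x using linear_mapsD(1)[OF M(3) that] .
  have \<beta>\<alpha>: "\<beta> (\<alpha> z) = z" if z: "z \<in> carrier m.w.T" for z
    using m.w_hom_eqI[OF m.w.T.abelian_group_axioms hom_compose[OF \<alpha>(1) \<beta>(1)] _ _ z, of "\<lambda>z. z"] \<alpha>(2) \<beta>(2)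
    by (simp add: hom_def)
  have comm: "\<alpha>' (?h3 z) = ?h2 (\<alpha> z)" if z: "z \<in> carrier m.w.T" for z
  proof -
    have "(\<alpha>' \<circ> ?h3) z = (?h2 \<circ> \<alpha>) z"
    proof (rule m.w_hom_eqI[OF n.x.T.abelian_group_axioms _ _ _ z])
      show "\<alpha>' \<circ> ?h3 \<in> hom (add_monoid m.w.T) (add_monoid n.x.T)"
        by (rule hom_compose[OF h3.tensor_map_hom]) (use \<alpha>'(1) g(2) in simp)
      show "?h2 \<circ> \<alpha> \<in> hom (add_monoid m.w.T) (add_monoid n.x.T)"
        by (rule hom_compose[OF \<alpha>(1) h2.tensor_map_hom])
      show "(\<alpha>' \<circ> ?h3) (m.w.pt x (tp.pt s s')) = (?h2 \<circ> \<alpha>) (m.w.pt x (tp.pt s s'))"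
        if "x \<in> carrier M" "s \<in> carrier S" "s' \<in> carrier S'" for x s s'
        using that \<alpha>'(2)[OF hx] g(2)
        by (simp add: \<alpha>(2) h3.tensor_map_pure h2.tensor_map_pure h1.tensor_map_pure TR_simps tp.pt_closed m.a.pt_closed)
    qed
    then show ?thesis by simp
  qed
  have "inj_on ?h3 (carrier m.w.T)"
  proof (rule inj_onI)
    fix z z' assume z: "z \<in> carrier m.w.T" "z' \<in> carrier m.w.T" and "?h3 z = ?h3 z'"
    then have "?h2 (\<alpha> z) = ?h2 (\<alpha> z')" using comm by metis
    moreover have "\<alpha> z \<in> carrier m.x.T" "\<alpha> z' \<in> carrier m.x.T" using \<alpha>(1) z by (auto simp: hom_def)
    ultimately have "\<alpha> z = \<alpha> z'" using inj2 by (auto simp: inj_on_def)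
    then show "z = z'" using \<beta>\<alpha> z by metis
  qed
  then show "inj_on (tensor_map R N (algebra_module TR (compose (carrier R) left f)) h)
        (carrier (tensor R M (algebra_module TR (compose (carrier R) left f))))"
    unfolding g(1) .
qed

section \<open>Prime ideals and faithfully flat descent\<close>

lemma (in cring) cring_idealI:
  assumes "I \<subseteq> carrier R" "\<zero> \<in> I" and add: "\<And>a b. a \<in> I \<Longrightarrow> b \<in> I \<Longrightarrow> a \<oplus> b \<in> I"
    and mult: "\<And>a x. a \<in> I \<Longrightarrow> x \<in> carrier R \<Longrightarrow> x \<otimes> a \<in> I"
  shows "ideal I R"
proof (rule idealI[OF ring_axioms])
  have neg: "\<ominus> a \<in> I" if "a \<in> I" for a
    using mult[OF that, of "\<ominus> \<one>"] assms(1) that by (auto simp: l_minus)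
  show "subgroup I (add_monoid R)"
    by (intro subgroup.intro) (use assms neg in \<open>auto simp flip: a_inv_def\<close>)
  show "x \<otimes> a \<in> I" "a \<otimes> x \<in> I" if "a \<in> I" "x \<in> carrier R" for a x
    using mult[OF that] assms(1) that m_comm[of a x] by auto
qed

text \<open>Krull: an ideal disjoint from a multiplicative set lies in a prime ideal disjoint from it.\<close>

lemma (in cring) exists_prime_disjoint:
  assumes I: "ideal I R" and D: "D \<subseteq> carrier R" "\<one> \<in> D"
    and Dm: "\<And>a b. a \<in> D \<Longrightarrow> b \<in> D \<Longrightarrow> a \<otimes> b \<in> D" and ID: "I \<inter> D = {}"
  obtains Q where "primeideal Q R" "I \<subseteq> Q" "Q \<inter> D = {}"
proof -
  define \<A> where "\<A> = {J. ideal J R \<and> I \<subseteq> J \<and> J \<inter> D = {}}"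
  have "\<exists>M\<in>\<A>. \<forall>J\<in>\<A>. M \<subseteq> J \<longrightarrow> J = M"
  proof (rule subset_Zorn_nonempty)
    show "\<A> \<noteq> {}" using I ID unfolding \<A>_def by blast
    fix C assume C: "C \<noteq> {}" "subset.chain \<A> C"
    then have "subset.chain {I. ideal I R} C"
      by (auto simp: pred_on.chain_def \<A>_def)
    from chain_Union_is_ideal[OF this] C(1) have "ideal (\<Union>C) R" by simp
    moreover have "I \<subseteq> \<Union>C" "\<Union>C \<inter> D = {}"
      using C by (fastforce simp: pred_on.chain_def \<A>_def)+
    ultimately show "\<Union>C \<in> \<A>" unfolding \<A>_def by simp
  qed
  then obtain Q where Q: "ideal Q R" "I \<subseteq> Q" "Q \<inter> D = {}"
    and max: "\<And>J. ideal J R \<Longrightarrow> I \<subseteq> J \<Longrightarrow> J \<inter> D = {} \<Longrightarrow> Q \<subseteq> J \<Longrightarrow> J = Q"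
    unfolding \<A>_def by auto
  interpret Q: ideal Q R by fact
  have meets: "\<exists>q \<in> Q. \<exists>x \<in> carrier R. q \<oplus> x \<otimes> a \<in> D" if a: "a \<in> carrier R" "a \<notin> Q" for a
  proof -
    let ?Y = "Q <+>\<^bsub>R\<^esub> PIdl a"
    have X: "ideal ?Y R" by (rule add_ideals[OF Q(1) cgenideal_ideal[OF a(1)]])
    have QX: "Q \<subseteq> ?Y"
    proof
      fix q assume q: "q \<in> Q"
      then have "q = q \<oplus> \<zero> \<otimes> a" using a Q.Icarr by simp
      then show "q \<in> ?Y" using q a unfolding set_add_def' cgenideal_def by blast
    qed
    have "a = \<zero> \<oplus> \<one> \<otimes> a" using a by simp
    then have "a \<in> ?Y" using a Q.zero_closed unfolding set_add_def' cgenideal_def by blast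
    then have "?Y \<inter> D \<noteq> {}" using max[OF X] QX Q(2) a by blast
    then show ?thesis unfolding set_add_def' cgenideal_def by blast
  qed
  have "primeideal Q R"
  proof (rule primeidealI[OF Q(1) is_cring])
    show "carrier R \<noteq> Q" using Q(3) D by blast
    fix a b assume a: "a \<in> carrier R" and b: "b \<in> carrier R" and ab: "a \<otimes> b \<in> Q"
    show "a \<in> Q \<or> b \<in> Q"
    proof (rule ccontr)
      assume "\<not> ?thesis"
      then obtain q x q' y where *: "q \<in> Q" "x \<in> carrier R" "q \<oplus> x \<otimes> a \<in> D" 
        "q' \<in> Q" "y \<in> carrier R" "q' \<oplus> y \<otimes> b \<in> D"
        using meets a b by meson
      have c: "q \<in> carrier R" "q' \<in> carrier R" using * Q.Icarr by auto
      have "(q \<oplus> x \<otimes> a) \<otimes> (q' \<oplus> y \<otimes> b) = q \<otimes> (q' \<oplus> y \<otimes> b) \<oplus> ((x \<otimes> a) \<otimes> q' \<oplus> (x \<otimes> y) \<otimes> (a \<otimes> b))"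
        using a b c *(2,5) by (simp add: l_distr r_distr m_ac a_ac)
      moreover have "\<dots> \<in> Q"
        using * c a b ab by (intro Q.a_closed Q.I_r_closed[OF *(1)] Q.I_l_closed[OF *(4)] Q.I_l_closed[OF ab]) auto
      ultimately show False using Dm[OF *(3,6)] Q(3) by auto
    qed
  qed
  then show ?thesis using Q that by blast
qed

lemma (in cring) exists_prime_above:
  assumes "ideal I R" "\<one> \<notin> I"
  obtains Q where "primeideal Q R" "I \<subseteq> Q"
  using exists_prime_disjoint[of I "{\<one>}"] assms by auto

text \<open>A prime of \<open>R\<close> that lifts to \<open>S\<close> and to \<open>S'\<close> lifts to \<open>S \<otimes> S'\<close>. If \<open>E\<close> is the image of \<open>P S \<otimes> S'\<close> in
  \<open>S \<otimes> S'\<close>, and \<open>r \<in> R\<close> maps into \<open>E\<close>, then \<open>1 \<otimes> f' r\<close> lies in this image; as \<open>S'\<close> is flat, \<open>f' r\<close> lies in the ideal of \<open>S'\<close>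
  generated by the elements of \<open>R\<close> that map into \<open>P S \<subseteq> Q\<close>, that is, by elements of \<open>P\<close>. That ideal lies
  in \<open>Q'\<close>, so \<open>r \<in> P\<close>. Hence \<open>E\<close> is disjoint from the image of the complement of \<open>P\<close>.\<close>

lemma (in tensor_algebras) prime_over_pair:
  assumes flat: "flat_map R S' f'" and P: "primeideal P R"
    and Q: "primeideal Q S" "P = {r \<in> carrier R. f r \<in> Q}"
    and Q': "primeideal Q' S'" "P = {r \<in> carrier R. f' r \<in> Q'}"
  shows "\<exists>Q''. primeideal Q'' TR \<and> P = {r \<in> carrier R. left (f r) \<in> Q''}"
proof -
  interpret P: primeideal P R by fact
  interpret Q: primeideal Q S by fact
  interpret Q': primeideal Q' S' by fact
  interpret left: ring_hom_cring S TR left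
    using left_hom by (simp add: ring_hom_cring_def ring_hom_cring_axioms_def S TR_cring ring_maps_def)
  define L where "L = Idl\<^bsub>S\<^esub> (f ` P)"
  have fP: "f ` P \<subseteq> carrier S" using P.Icarr by auto
  have L: "ideal L S" unfolding L_def by (rule S.genideal_ideal[OF fP])
  interpret L: ideal L S by (rule L)
  have LQ: "L \<subseteq> Q" unfolding L_def by (rule S.genideal_minimal[OF Q.is_ideal]) (use Q(2) in blast)
  have fPL: "f ` P \<subseteq> L" unfolding L_def by (rule S.genideal_self[OF fP])
  let ?FL = "free_Abelian_group (L \<times> carrier S')"
  define E where "E = tp.cls ` carrier ?FL"
  have FLF: "t \<in> carrier tp.F" if "t \<in> carrier ?FL" for t
    using that L.Icarr by auto
  have E_pure: "tp.pt a b \<in> E" if "a \<in> L" "b \<in> carrier S'" for a b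
    unfolding E_def pure_def using that by (intro imageI) simp
  have E_diff: "x \<ominus>\<^bsub>TR\<^esub> y \<in> E" if xy: "x \<in> E" "y \<in> E" for x y
  proof -
    obtain t u where tu: "t \<in> carrier ?FL" "u \<in> carrier ?FL" "x = tp.cls t" "y = tp.cls u"
      using xy unfolding E_def by blast
    then have "x \<ominus>\<^bsub>TR\<^esub> y = tp.cls (t - u)" using FLF by (simp add: TR_minus tp.cls_diff)
    moreover have "t - u \<in> carrier ?FL" using tu(1,2) keys_diff[of t u] by auto
    ultimately show ?thesis unfolding E_def by blast
  qed
  have E_induct: "Pr x" if "x \<in> E" "Pr \<zero>\<^bsub>TR\<^esub>" "\<And>a b. a \<in> L \<Longrightarrow> b \<in> carrier S' \<Longrightarrow> Pr (tp.pt a b)"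
    "\<And>x y. x \<in> E \<Longrightarrow> y \<in> E \<Longrightarrow> Pr x \<Longrightarrow> Pr y \<Longrightarrow> Pr (x \<ominus>\<^bsub>TR\<^esub> y)" for Pr x
  proof -
    note that' = that
    obtain t where t: "t \<in> carrier ?FL" "x = tp.cls t" using that'(1) unfolding E_def by blast
    have "Poly_Mapping.keys t \<subseteq> L \<times> carrier S'" using t by simp
    then have "Pr (tp.cls t) \<and> t \<in> carrier ?FL"
    proof (rule free_Abelian_group_induct)
      show "Pr (tp.cls 0) \<and> 0 \<in> carrier ?FL" using that(2) by (simp add: TR_simps tp.cls_zero)
    next
      fix a assume "a \<in> L \<times> carrier S'"
      then show "Pr (tp.cls (frag_of a)) \<and> frag_of a \<in> carrier ?FL"
        using that(3) by (auto simp: pure_def)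
    next
      fix t u assume "Pr (tp.cls t) \<and> t \<in> carrier ?FL" "Pr (tp.cls u) \<and> u \<in> carrier ?FL"
      moreover from this have "tp.cls (t - u) = tp.cls t \<ominus>\<^bsub>TR\<^esub> tp.cls u" 
        using tp.cls_diff[of t u] FLF[of t] FLF[of u] unfolding TR_minus by simp
      moreover have "t - u \<in> carrier ?FL" using calculation(1,2) keys_diff[of t u] by auto
      ultimately show "Pr (tp.cls (t - u)) \<and> t - u \<in> carrier ?FL"
        using that(4)[of "tp.cls t" "tp.cls u"] unfolding E_def by auto
    qed
    then show ?thesis using t by simp
  qed
  have E_zero: "\<zero>\<^bsub>TR\<^esub> \<in> E" unfolding E_def TR_simps tp.cls_zero by (intro imageI) simp
  have E_carr: "x \<in> carrier TR" if "x \<in> E" for x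
    using that FLF unfolding E_def by (auto simp: TR_simps simp del: carrier_free_Abelian_group_iff)
  have E_mult: "y \<otimes>\<^bsub>TR\<^esub> x \<in> E" if "x \<in> E" "y \<in> carrier TR" for x y
  proof -
    have "y \<in> carrier tp.T" using that(2) by (simp add: TR_simps)
    then have "\<forall>x \<in> E. y \<otimes>\<^bsub>TR\<^esub> x \<in> E"
    proof (induction rule: tp.T_induct)
      case zero then show ?case using E_zero E_carr TR.l_null by (simp add: TR_simps(3)[symmetric])
    next
      case (pure a b)
      show ?case
      proof
        fix x assume "x \<in> E"
        then show "tp.pt a b \<otimes>\<^bsub>TR\<^esub> x \<in> E"
        proof (rule E_induct)
          show "tp.pt a b \<otimes>\<^bsub>TR\<^esub> \<zero>\<^bsub>TR\<^esub> \<in> E" using E_zero pure TR.r_null[of "tp.pt a b"] 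
            by (simp add: TR_simps tp.pt_closed)
        next
          fix a' b' assume "a' \<in> L" "b' \<in> carrier S'"
          then show "tp.pt a b \<otimes>\<^bsub>TR\<^esub> tp.pt a' b' \<in> E"
            using pure L.Icarr L.I_l_closed by (simp add: pt_mult E_pure)
        next
          fix x y assume xy: "x \<in> E" "y \<in> E" "tp.pt a b \<otimes>\<^bsub>TR\<^esub> x \<in> E" "tp.pt a b \<otimes>\<^bsub>TR\<^esub> y \<in> E"
          have "tp.pt a b \<in> carrier TR" using pure by (simp add: TR_simps tp.pt_closed)
          then have "tp.pt a b \<otimes>\<^bsub>TR\<^esub> (x \<ominus>\<^bsub>TR\<^esub> y) = tp.pt a b \<otimes>\<^bsub>TR\<^esub> x \<ominus>\<^bsub>TR\<^esub> tp.pt a b \<otimes>\<^bsub>TR\<^esub> y"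
            using E_carr[OF xy(1)] E_carr[OF xy(2)] by (simp add: a_minus_def TR.r_distr TR.r_minus)
          then show "tp.pt a b \<otimes>\<^bsub>TR\<^esub> (x \<ominus>\<^bsub>TR\<^esub> y) \<in> E" using E_diff xy by simp
        qed
      qed
    next
      case (diff y y')
      show ?case
      proof
        fix x assume x: "x \<in> E"
        have "(y \<ominus>\<^bsub>TR\<^esub> y') \<otimes>\<^bsub>TR\<^esub> x = y \<otimes>\<^bsub>TR\<^esub> x \<ominus>\<^bsub>TR\<^esub> y' \<otimes>\<^bsub>TR\<^esub> x"
          using diff(1,2) E_carr[OF x] by (simp add: a_minus_def TR.l_distr TR.l_minus flip: TR_simps(1))
        then show "(y \<ominus>\<^bsub>tp.T\<^esub> y') \<otimes>\<^bsub>TR\<^esub> x \<in> E" using E_diff diff x unfolding TR_minus by simp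
      qed
    qed
    then show ?thesis using that by blast
  qed
  have E_neg: "\<ominus>\<^bsub>TR\<^esub> x \<in> E" if "x \<in> E" for x
    using E_diff[OF E_zero that] E_carr[OF that] by (simp add: a_minus_def)
  have E_add: "x \<oplus>\<^bsub>TR\<^esub> y \<in> E" if "x \<in> E" "y \<in> E" for x y
    using E_diff[OF that(1) E_neg[OF that(2)]] E_carr[OF that(1)] E_carr[OF that(2)] by (simp add: a_minus_def)
  have E: "ideal E TR"
    by (rule TR.cring_idealI) (use E_add E_zero E_carr E_mult in auto)
  have key: "r \<in> P" if r: "r \<in> carrier R" and rE: "left (f r) \<in> E" for r
  proof -
    obtain t where t: "t \<in> carrier ?FL" "left (f r) = tp.cls t" using rE unfolding E_def by blast
    have "tp.cls (frag_of (\<one>\<^bsub>S\<^esub>, f' r)) = tp.cls t"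
      using t(2) left_right[OF r] r by (simp add: right_def pure_def)
    then have rel: "frag_of (\<one>\<^bsub>S\<^esub>, f' r) - t \<in> tp.rel"
      by (subst (asm) tp.cls_eq_iff) (use FLF[OF t(1)] r in auto)
    have "submodule L R A"
    proof (rule tp.M.submoduleI)
      show "\<ominus>\<^bsub>A\<^esub> a \<in> L" if "a \<in> L" for a 
        using L.a_inv_closed[OF that] by (simp add: a_inv_def m_inv_def)
    qed (auto simp: L.Icarr L.zero_closed L.I_l_closed L.a_closed)
    from flat_annihilator[OF infinite_UNIV R S' f' flat tp.M.module_axioms this _ _ t(1) rel]
    have "f' r \<in> Idl\<^bsub>S'\<^esub> (f' ` {r \<in> carrier R. f r \<in> L})" using r by (simp cong: conj_cong)
    also have "\<dots> \<subseteq> Q'"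
      by (rule S'.genideal_minimal[OF Q'.is_ideal]) (use LQ Q(2) Q'(2) in blast)
    finally show ?thesis using r Q'(2) by blast
  qed
  let ?D = "(\<lambda>r. left (f r)) ` (carrier R - P)"
  have "\<exists>Q''. primeideal Q'' TR \<and> E \<subseteq> Q'' \<and> Q'' \<inter> ?D = {}"
  proof (rule TR.exists_prime_disjoint[OF E, of ?D])
    show "?D \<subseteq> carrier TR" by auto
    have "\<one>\<^bsub>R\<^esub> \<notin> P" using P.I_notcarr P.one_imp_carrier by blast
    then show "\<one>\<^bsub>TR\<^esub> \<in> ?D" by (intro image_eqI[of _ _ "\<one>\<^bsub>R\<^esub>"]) auto
    show "a \<otimes>\<^bsub>TR\<^esub> b \<in> ?D" if ab: "a \<in> ?D" "b \<in> ?D" for a b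
    proof -
      obtain r s where rs: "r \<in> carrier R" "r \<notin> P" "s \<in> carrier R" "s \<notin> P" "a = left (f r)" "b = left (f s)"
        using ab by blast
      then have "r \<otimes>\<^bsub>R\<^esub> s \<in> carrier R - P" using P.I_prime by blast
      moreover have "a \<otimes>\<^bsub>TR\<^esub> b = left (f (r \<otimes>\<^bsub>R\<^esub> s))" using rs by simp
      ultimately show ?thesis by blast
    qed
    show "E \<inter> ?D = {}" using key by blast
  qed blast
  then obtain Q'' where Q'': "primeideal Q'' TR" "E \<subseteq> Q''" "Q'' \<inter> ?D = {}" by blast
  have "left (f r) \<in> E" if "r \<in> P" for r
    using that fPL L.Icarr by (auto simp: left_def intro!: E_pure)
  then have "P = {r \<in> carrier R. left (f r) \<in> Q''}"
    using Q'' P.Icarr by blast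
  then show ?thesis using Q''(1) by blast
qed

text \<open>An ideal is the unit ideal if its extensions to the members of a covering family are.\<close>

lemma fppf_unit_ideal:
  assumes R: "cring R" and C: "fppf_family R C" and J: "ideal J R"
    and loc: "\<And>S f. (S, f) \<in> C \<Longrightarrow> \<one>\<^bsub>S\<^esub> \<in> Idl\<^bsub>S\<^esub> (f ` J)"
  shows "\<one>\<^bsub>R\<^esub> \<in> J"
proof (rule ccontr)
  interpret R: cring R by fact
  assume "\<one>\<^bsub>R\<^esub> \<notin> J"
  then obtain P where P: "primeideal P R" "J \<subseteq> P" using R.exists_prime_above[OF J] by blast
  then obtain S f Q where S: "(S, f) \<in> C" "primeideal Q S" "P = {r \<in> carrier R. f r \<in> Q}"
    using C unfolding fppf_family_def by blast
  interpret Q: primeideal Q S by fact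
  have "Idl\<^bsub>S\<^esub> (f ` J) \<subseteq> Q" by (rule Q.genideal_minimal[OF Q.is_ideal]) (use P S in blast)
  then show False using loc[OF S(1)] Q.I_notcarr Q.one_imp_carrier by blast
qed

lemma fppf_familyD:
  assumes "fppf_family R C" "(S, f) \<in> C"
  shows "cring S" "f \<in> ring_hom R S" "flat_map R S f" "(S, f) \<in> arrows R"
  using assms by (auto simp: fppf_family_def arrows_def ring_maps_def)

text \<open>Apply \<open>flat_annihilator\<close> to \<open>n = r - r'\<close> and the zero submodule: the annihilator of \<open>n\<close> extends to the unit
  ideal in each member of the covering family, so it is the unit ideal.\<close>

lemma fppf_separated:
  fixes R :: "'u ring"
  assumes inf: "infinite (UNIV :: 'u set)" and R: "cring R" and C: "fppf_family R C" 
    and r: "r \<in> carrier R" "r' \<in> carrier R" and eq: "\<And>S f. (S, f) \<in> C \<Longrightarrow> f r = f r'"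
  shows "r = r'"
proof -
  interpret R: cring R by fact
  define n where "n = r \<ominus>\<^bsub>R\<^esub> r'"
  have n: "n \<in> carrier R" unfolding n_def using r by simp
  let ?N = "algebra_module R (\<lambda>x. x)"
  have N: "module R ?N" by (rule module_algebra_module[OF R R]) (auto simp: ring_hom_def)
  interpret N: module R ?N by (rule N)
  have K: "submodule {\<zero>\<^bsub>R\<^esub>} R ?N"
  proof (rule N.submoduleI)
    show "\<ominus>\<^bsub>?N\<^esub> a \<in> {\<zero>\<^bsub>R\<^esub>}" if "a \<in> {\<zero>\<^bsub>R\<^esub>}" for a 
      using that N.M.add.inv_one by (simp add: a_inv_def m_inv_def)
  qed auto
  let ?J = "{s \<in> carrier R. s \<otimes>\<^bsub>R\<^esub> n = \<zero>\<^bsub>R\<^esub>}"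
  have "\<one>\<^bsub>R\<^esub> \<in> ?J"
  proof (rule fppf_unit_ideal[OF R C])
    show "ideal ?J R"
      by (rule R.cring_idealI) (auto simp: n R.l_distr R.m_assoc)
    fix S f assume Sf: "(S, f) \<in> C"
    note S = fppf_familyD[OF C Sf]
    interpret S: cring S by (rule S)
    interpret f: ring_hom_cring R S f using S by (simp add: ring_hom_cring_def ring_hom_cring_axioms_def R)
    interpret T: tensor_pair R ?N "algebra_module S f"
      by (intro tensor_pair.intro tensor_pair_axioms.intro module_algebra_module R S inf N)
    have "f n = \<zero>\<^bsub>S\<^esub>" unfolding n_def using eq[OF Sf] r by (simp add: a_minus_def S.r_neg)
    then have "T.pt n \<one>\<^bsub>S\<^esub> = T.pt \<one>\<^bsub>R\<^esub> \<zero>\<^bsub>S\<^esub>"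
      using T.pt_smult[of n "\<one>\<^bsub>R\<^esub>" "\<one>\<^bsub>S\<^esub>"] n by simp
    also have "\<dots> = \<zero>\<^bsub>T.T\<^esub>"
      using T.pt_add_right[of "\<one>\<^bsub>R\<^esub>" "\<zero>\<^bsub>S\<^esub>" "\<zero>\<^bsub>S\<^esub>"] T.pt_closed[of "\<one>\<^bsub>R\<^esub>" "\<zero>\<^bsub>S\<^esub>"] by simp
    finally have "frag_of (n, \<one>\<^bsub>S\<^esub>) \<in> T.rel"
      unfolding pure_def by (subst (asm) T.cls_eq_zero) (use n in auto)
    then show "\<one>\<^bsub>S\<^esub> \<in> Idl\<^bsub>S\<^esub> (f ` ?J)"
      using flat_annihilator[OF inf R S(1,2,3) N K, of n "\<one>\<^bsub>S\<^esub>" 0] n by simp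
  qed
  then have "n = \<zero>\<^bsub>R\<^esub>" using n by simp
  then show ?thesis using r unfolding n_def by (simp add: R.diff_eq_zero_iff)
qed

subsection \<open>Descent of elements\<close>

text \<open>Transport of the module structure along a map \<open>e\<close> that is injective on the carrier of \<open>M\<close>.\<close>

definition image_module :: "('x \<Rightarrow> 'u) \<Rightarrow> ('r, 'x) module \<Rightarrow> ('r, 'u) module" where
  "image_module e M = \<lparr>carrier = e ` carrier M,
     monoid.mult = (\<lambda>x y. e (inv_into (carrier M) e x \<otimes>\<^bsub>M\<^esub> inv_into (carrier M) e y)), one = e \<one>\<^bsub>M\<^esub>,
     ring.zero = e \<zero>\<^bsub>M\<^esub>,
     ring.add = (\<lambda>x y. e (inv_into (carrier M) e x \<oplus>\<^bsub>M\<^esub> inv_into (carrier M) e y)),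
     module.smult = (\<lambda>r x. e (r \<odot>\<^bsub>M\<^esub> inv_into (carrier M) e x))\<rparr>"

lemma image_module_simps:
  assumes "inj_on e (carrier M)"
  shows "carrier (image_module e M) = e ` carrier M" "\<zero>\<^bsub>image_module e M\<^esub> = e \<zero>\<^bsub>M\<^esub>"
    "x \<in> carrier M \<Longrightarrow> y \<in> carrier M \<Longrightarrow> e x \<oplus>\<^bsub>image_module e M\<^esub> e y = e (x \<oplus>\<^bsub>M\<^esub> y)"
    "x \<in> carrier M \<Longrightarrow> r \<odot>\<^bsub>image_module e M\<^esub> e x = e (r \<odot>\<^bsub>M\<^esub> x)"
  using assms by (simp_all add: image_module_def)

lemma image_module_module:
  assumes "module R M" and inj: "inj_on e (carrier M)"
  shows "module R (image_module e M)"
proof -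
  interpret module R M by fact
  note s = image_module_simps[OF inj]
  show ?thesis
  proof (rule moduleI)
    show "abelian_group (image_module e M)"
    proof (rule abelian_groupI)
      fix x assume "x \<in> carrier (image_module e M)"
      then obtain a where "a \<in> carrier M" "x = e a" by (auto simp: s)
      then show "\<exists>y\<in>carrier (image_module e M). y \<oplus>\<^bsub>image_module e M\<^esub> x = \<zero>\<^bsub>image_module e M\<^esub>"
        by (intro bexI[of _ "e (\<ominus>\<^bsub>M\<^esub> a)"]) (auto simp: s M.l_neg)
    qed (auto simp: s M.a_ac)
  qed (auto simp: s smult_l_distr smult_r_distr smult_assoc1 is_cring)
qed

text \<open>The product of the rings of a set \<open>J\<close> of arrows from \<open>R\<close>, as an \<open>R\<close>-module.\<close>

definition arrow_product :: "'u arrow set \<Rightarrow> ('u, 'u arrow \<Rightarrow> 'u) module" where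
  "arrow_product J = \<lparr>carrier = PiE J (\<lambda>j. carrier (fst j)),
     monoid.mult = (\<lambda>a b. \<lambda>j\<in>J. a j \<otimes>\<^bsub>fst j\<^esub> b j), one = (\<lambda>j\<in>J. \<one>\<^bsub>fst j\<^esub>),
     ring.zero = (\<lambda>j\<in>J. \<zero>\<^bsub>fst j\<^esub>), ring.add = (\<lambda>a b. \<lambda>j\<in>J. a j \<oplus>\<^bsub>fst j\<^esub> b j),
     module.smult = (\<lambda>r a. \<lambda>j\<in>J. snd j r \<otimes>\<^bsub>fst j\<^esub> a j)\<rparr>"

lemma arrow_product_module:
  assumes R: "cring R" and J: "J \<subseteq> arrows R"
  shows "module R (arrow_product J)"
proof -
  interpret R: cring R by fact
  have c: "cring (fst j)" "snd j \<in> ring_hom R (fst j)" if "j \<in> J" for j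
    using that J by (auto simp: arrows_def ring_maps_def)
  have cl: "snd j r \<in> carrier (fst j)" if "j \<in> J" "r \<in> carrier R" for j r
    using c[OF that(1)] that(2) by (auto simp: ring_hom_def)
  have mon: "a j \<in> carrier (fst j)" if "a \<in> PiE J (\<lambda>j. carrier (fst j))" "j \<in> J" for a j
    using that by auto
  have ext: "a = b" if "a \<in> PiE J (\<lambda>j. carrier (fst j))" "b \<in> PiE J (\<lambda>j. carrier (fst j))"
    "\<And>j. j \<in> J \<Longrightarrow> a j = b j" for a b
    using that by (metis PiE_ext)
  show ?thesis
  proof (rule moduleI[OF R])
    show "abelian_group (arrow_product J)"
    proof (rule abelian_groupI)
      fix a b d assume "a \<in> carrier (arrow_product J)" "b \<in> carrier (arrow_product J)" "d \<in> carrier (arrow_product J)"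
      then have abd: "a \<in> PiE J (\<lambda>j. carrier (fst j))" "b \<in> PiE J (\<lambda>j. carrier (fst j))" "d \<in> PiE J (\<lambda>j. carrier (fst j))"
        by (simp_all add: arrow_product_def)
      show "(a \<oplus>\<^bsub>arrow_product J\<^esub> b) \<oplus>\<^bsub>arrow_product J\<^esub> d = a \<oplus>\<^bsub>arrow_product J\<^esub> (b \<oplus>\<^bsub>arrow_product J\<^esub> d)"
        using abd c mon by (auto simp: arrow_product_def cring_def ring_def intro!: restrict_ext abelian_monoid.a_assoc abelian_group.axioms(1))
    next
      fix a b assume "a \<in> carrier (arrow_product J)" "b \<in> carrier (arrow_product J)"
      then have ab: "a \<in> PiE J (\<lambda>j. carrier (fst j))" "b \<in> PiE J (\<lambda>j. carrier (fst j))"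
        by (simp_all add: arrow_product_def)
      show "a \<oplus>\<^bsub>arrow_product J\<^esub> b \<in> carrier (arrow_product J)" 
        using ab c mon by (auto simp: arrow_product_def cring_def ring_def intro!: abelian_monoid.a_closed abelian_group.axioms(1))
      show "a \<oplus>\<^bsub>arrow_product J\<^esub> b = b \<oplus>\<^bsub>arrow_product J\<^esub> a" 
        using ab c mon by (auto simp: arrow_product_def cring_def ring_def intro!: restrict_ext abelian_monoid.a_comm abelian_group.axioms(1))
    next
      show "\<zero>\<^bsub>arrow_product J\<^esub> \<in> carrier (arrow_product J)"
        using c by (auto simp: arrow_product_def cring_def ring_def intro!: abelian_monoid.zero_closed abelian_group.axioms(1))
    next
      fix a assume a': "a \<in> carrier (arrow_product J)"
      then have a: "a \<in> PiE J (\<lambda>j. carrier (fst j))" by (simp add: arrow_product_def)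
      have "\<zero>\<^bsub>fst j\<^esub> \<oplus>\<^bsub>fst j\<^esub> a j = a j" if "j \<in> J" for j
      proof -
        interpret cring "fst j" by (rule c[OF that])
        show ?thesis using mon[OF a that] by simp
      qed
      then have "(\<lambda>j\<in>J. \<zero>\<^bsub>fst j\<^esub> \<oplus>\<^bsub>fst j\<^esub> a j) = a"
        using a by (intro ext) (auto simp: PiE_iff)
      then show "\<zero>\<^bsub>arrow_product J\<^esub> \<oplus>\<^bsub>arrow_product J\<^esub> a = a"
        by (simp add: arrow_product_def cong: restrict_cong)
      have n: "\<ominus>\<^bsub>fst j\<^esub> a j \<in> carrier (fst j) \<and> (\<ominus>\<^bsub>fst j\<^esub> a j) \<oplus>\<^bsub>fst j\<^esub> a j = \<zero>\<^bsub>fst j\<^esub>" if "j \<in> J" for j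
      proof -
        interpret cring "fst j" by (rule c[OF that])
        show ?thesis using mon[OF a that] l_neg by simp
      qed
      show "\<exists>b\<in>carrier (arrow_product J). b \<oplus>\<^bsub>arrow_product J\<^esub> a = \<zero>\<^bsub>arrow_product J\<^esub>"
        by (rule bexI[of _ "\<lambda>j\<in>J. \<ominus>\<^bsub>fst j\<^esub> a j"])
           (use n in \<open>auto simp: arrow_product_def intro!: restrict_ext\<close>)
    qed
  next
    fix r s a b assume r: "r \<in> carrier R" and "a \<in> carrier (arrow_product J)"
    then have a: "a \<in> PiE J (\<lambda>j. carrier (fst j))" by (simp add: arrow_product_def)
    have X: "snd j r \<otimes>\<^bsub>fst j\<^esub> a j \<in> carrier (fst j)
      \<and> (s \<in> carrier R \<longrightarrow> snd j (r \<oplus>\<^bsub>R\<^esub> s) \<otimes>\<^bsub>fst j\<^esub> a j = snd j r \<otimes>\<^bsub>fst j\<^esub> a j \<oplus>\<^bsub>fst j\<^esub> snd j s \<otimes>\<^bsub>fst j\<^esub> a j)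
      \<and> (s \<in> carrier R \<longrightarrow> snd j (r \<otimes>\<^bsub>R\<^esub> s) \<otimes>\<^bsub>fst j\<^esub> a j = snd j r \<otimes>\<^bsub>fst j\<^esub> (snd j s \<otimes>\<^bsub>fst j\<^esub> a j))
      \<and> (b \<in> PiE J (\<lambda>j. carrier (fst j)) \<longrightarrow>
         snd j r \<otimes>\<^bsub>fst j\<^esub> (a j \<oplus>\<^bsub>fst j\<^esub> b j) = snd j r \<otimes>\<^bsub>fst j\<^esub> a j \<oplus>\<^bsub>fst j\<^esub> snd j r \<otimes>\<^bsub>fst j\<^esub> b j)
      \<and> snd j \<one>\<^bsub>R\<^esub> \<otimes>\<^bsub>fst j\<^esub> a j = a j" if j: "j \<in> J" for j
    proof -
      interpret cring "fst j" by (rule c[OF j])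
      interpret h: ring_hom_cring R "fst j" "snd j" 
        using c[OF j] by (simp add: ring_hom_cring_def ring_hom_cring_axioms_def R)
      show ?thesis using mon[OF a j] r mon[OF _ j, of b] by (auto simp: l_distr r_distr m_assoc)
    qed
    show "r \<odot>\<^bsub>arrow_product J\<^esub> a \<in> carrier (arrow_product J)"
      using X by (auto simp: arrow_product_def)
    show "(r \<oplus>\<^bsub>R\<^esub> s) \<odot>\<^bsub>arrow_product J\<^esub> a = r \<odot>\<^bsub>arrow_product J\<^esub> a \<oplus>\<^bsub>arrow_product J\<^esub> s \<odot>\<^bsub>arrow_product J\<^esub> a"
      if "s \<in> carrier R" using X that by (auto simp: arrow_product_def intro!: restrict_ext)
    show "(r \<otimes>\<^bsub>R\<^esub> s) \<odot>\<^bsub>arrow_product J\<^esub> a = r \<odot>\<^bsub>arrow_product J\<^esub> (s \<odot>\<^bsub>arrow_product J\<^esub> a)"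
      if "s \<in> carrier R" using X that by (auto simp: arrow_product_def intro!: restrict_ext)
    show "r \<odot>\<^bsub>arrow_product J\<^esub> (a \<oplus>\<^bsub>arrow_product J\<^esub> b) = r \<odot>\<^bsub>arrow_product J\<^esub> a \<oplus>\<^bsub>arrow_product J\<^esub> r \<odot>\<^bsub>arrow_product J\<^esub> b"
      if "b \<in> carrier (arrow_product J)" using X that by (auto simp: arrow_product_def intro!: restrict_ext)
  next
    fix a assume "a \<in> carrier (arrow_product J)"
    then have a: "a \<in> PiE J (\<lambda>j. carrier (fst j))" by (simp add: arrow_product_def)
    have "snd j \<one>\<^bsub>R\<^esub> \<otimes>\<^bsub>fst j\<^esub> a j = a j" if j: "j \<in> J" for j
    proof -
      interpret cring "fst j" by (rule c[OF j])
      interpret h: ring_hom_cring R "fst j" "snd j" 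
        using c[OF j] by (simp add: ring_hom_cring_def ring_hom_cring_axioms_def R)
      show ?thesis using mon[OF a j] by simp
    qed
    then have "(\<lambda>j\<in>J. snd j \<one>\<^bsub>R\<^esub> \<otimes>\<^bsub>fst j\<^esub> a j) = a"
      using a by (intro ext) (auto simp: PiE_iff)
    then show "\<one>\<^bsub>R\<^esub> \<odot>\<^bsub>arrow_product J\<^esub> a = a" by (simp add: arrow_product_def)
  qed
qed

lemma ex_code_functions:
  assumes "infinite (UNIV :: 'u set)" "finite J"
  shows "\<exists>e :: ('x \<Rightarrow> 'u) \<Rightarrow> 'u. inj_on e (PiE J A)"
proof -
  obtain js where js: "set js = J" using assms(2) finite_list by blast
  have "|lists (UNIV :: 'u set)| =o |UNIV :: 'u set|"
    by (rule card_of_lists_infinite[OF assms(1)])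
  then obtain l :: "'u list \<Rightarrow> 'u" where l: "inj l"
    by (metis bij_betw_def card_of_ordIso lists_UNIV)
  have "inj_on (\<lambda>a. l (map a js)) (PiE J A)"
  proof (rule inj_onI)
    fix a b assume ab: "a \<in> PiE J A" "b \<in> PiE J A" "l (map a js) = l (map b js)"
    from injD[OF l this(3)] have "map a js = map b js" .
    then show "a = b" using js ab by (metis PiE_ext map_eq_conv)
  qed
  then show ?thesis by blast
qed

text \<open>Descent of elements: a compatible family \<open>x\<close> on a sieve \<open>U\<close> that contains a covering family \<open>C\<close> is induced
  on any finite \<open>J\<close> with \<open>C \<subseteq> J \<subseteq> U\<close> by an element of \<open>R\<close>. Let \<open>N\<close> be the product of the rings in \<open>J\<close>, transported
  to \<open>'u\<close>, let \<open>i1\<close> be its unit and \<open>n\<close> the tuple of the \<open>x j\<close>. The claim is \<open>n \<in> K = R i1\<close>, that is, \<open>(K : n)\<close> is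
  the unit ideal. This may be checked after each \<open>f : R \<rightarrow> S\<close> in \<open>C\<close>, where \<open>n \<otimes> 1 = i1 \<otimes> x (S, f)\<close>, so that
  \<open>flat_annihilator\<close> applies.\<close>

lemma fppf_descent:
  fixes R :: "'u ring"
  assumes inf: "infinite (UNIV :: 'u set)" and R: "cring R" and C: "fppf_family R C" 
    and J: "finite J" "C \<subseteq> J" "J \<subseteq> U" and U: "sieve R U"
    and x: "\<And>S f. (S, f) \<in> U \<Longrightarrow> x (S, f) \<in> carrier S"
    and compat: "\<And>S f T g. (S, f) \<in> U \<Longrightarrow> (T, g) \<in> arrows S \<Longrightarrow> x (T, compose (carrier R) g f) = g (x (S, f))"
  shows "\<exists>r \<in> carrier R. \<forall>(S, f) \<in> J. f r = x (S, f)"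
proof -
  interpret R: cring R by fact
  have UR: "U \<subseteq> arrows R" using U by (simp add: sieve_def)
  have JR: "J \<subseteq> arrows R" using J UR by blast
  have c: "cring (fst j)" "snd j \<in> ring_hom R (fst j)" if "j \<in> J" for j
    using that JR by (auto simp: arrows_def ring_maps_def)
  have xj: "x j \<in> carrier (fst j)" if "j \<in> J" for j
    using x[of "fst j" "snd j"] J(3) that by auto
  let ?P = "arrow_product J"
  have PC: "carrier ?P = PiE J (\<lambda>j. carrier (fst j))" by (simp add: arrow_product_def)
  obtain e :: "('u arrow \<Rightarrow> 'u) \<Rightarrow> 'u" where e: "inj_on e (carrier ?P)"
    using ex_code_functions[OF inf J(1)] unfolding PC by metis
  let ?N = "image_module e ?P"
  note s = image_module_simps[OF e]
  have P: "module R ?P" by (rule arrow_product_module[OF R JR])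
  interpret P: module R ?P by (rule P)
  have N: "module R ?N" by (rule image_module_module[OF P e])
  interpret N: module R ?N by (rule N)
  define i1 where "i1 = e (\<lambda>j\<in>J. \<one>\<^bsub>fst j\<^esub>)"
  define n where "n = e (\<lambda>j\<in>J. x j)"
  have i1P: "(\<lambda>j\<in>J. \<one>\<^bsub>fst j\<^esub>) \<in> carrier ?P" unfolding PC using c 
    by (auto simp: cring_def ring_def intro!: monoid.one_closed)
  have nP: "(\<lambda>j\<in>J. x j) \<in> carrier ?P" unfolding PC using xj by auto
  have i1N: "i1 \<in> carrier ?N" and nN: "n \<in> carrier ?N" 
    unfolding i1_def n_def s using i1P nP by auto
  define K where "K = {r \<odot>\<^bsub>?N\<^esub> i1 | r. r \<in> carrier R}"
  have K: "submodule K R ?N"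
  proof (rule N.submoduleI)
    show "K \<subseteq> carrier ?N" unfolding K_def using i1N by auto
    have "\<zero>\<^bsub>?N\<^esub> = \<zero>\<^bsub>R\<^esub> \<odot>\<^bsub>?N\<^esub> i1" using i1N by simp
    then show "\<zero>\<^bsub>?N\<^esub> \<in> K" unfolding K_def by blast
    fix a b assume a: "a \<in> K"
    then obtain r where r: "r \<in> carrier R" "a = r \<odot>\<^bsub>?N\<^esub> i1" unfolding K_def by blast
    have "\<ominus>\<^bsub>?N\<^esub> a = (\<ominus>\<^bsub>R\<^esub> r) \<odot>\<^bsub>?N\<^esub> i1" using r i1N by (simp add: N.smult_l_minus)
    then show "\<ominus>\<^bsub>?N\<^esub> a \<in> K" unfolding K_def using r by blast
    { assume "b \<in> K"
      then obtain r' where r': "r' \<in> carrier R" "b = r' \<odot>\<^bsub>?N\<^esub> i1" unfolding K_def by blast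
      have "a \<oplus>\<^bsub>?N\<^esub> b = (r \<oplus>\<^bsub>R\<^esub> r') \<odot>\<^bsub>?N\<^esub> i1" using r r' i1N by (simp add: N.smult_l_distr)
      then show "a \<oplus>\<^bsub>?N\<^esub> b \<in> K" unfolding K_def using r r' by blast }
    { assume b: "b \<in> carrier R"
      have "b \<odot>\<^bsub>?N\<^esub> a = (b \<otimes>\<^bsub>R\<^esub> r) \<odot>\<^bsub>?N\<^esub> i1" using r b i1N by (simp add: N.smult_assoc1)
      then show "b \<odot>\<^bsub>?N\<^esub> a \<in> K" unfolding K_def using r b by blast }
  qed
  note K' = N.submoduleE[OF K]
  let ?I = "{r \<in> carrier R. r \<odot>\<^bsub>?N\<^esub> n \<in> K}"
  have "\<one>\<^bsub>R\<^esub> \<in> ?I"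
  proof (rule fppf_unit_ideal[OF R C])
    show "ideal ?I R"
    proof (rule R.cring_idealI)
      show "\<zero>\<^bsub>R\<^esub> \<in> ?I" using nN subgroup.one_closed[OF submodule.axioms(1)[OF K]] by simp
      show "a \<oplus>\<^bsub>R\<^esub> b \<in> ?I" if "a \<in> ?I" "b \<in> ?I" for a b
        using that K'(5) nN by (simp add: N.smult_l_distr)
      show "b \<otimes>\<^bsub>R\<^esub> a \<in> ?I" if "a \<in> ?I" "b \<in> carrier R" for a b
        using that K'(4) nN by (simp add: N.smult_assoc1)
    qed auto
    fix S f assume Sf: "(S, f) \<in> C"
    note S = fppf_familyD[OF C Sf]
    interpret S: cring S by (rule S)
    interpret f: ring_hom_cring R S f using S by (simp add: ring_hom_cring_def ring_hom_cring_axioms_def R)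
    interpret T: tensor_pair R ?N "algebra_module S f"
      by (intro tensor_pair.intro tensor_pair_axioms.intro module_algebra_module R S inf N)
    let ?x = "x (S, f)"
    have xS: "?x \<in> carrier S" using Sf J x by blast
    \<comment> \<open>\<open>v y B\<close> is the tuple \<open>y\<close> with its entries outside \<open>B\<close> replaced by zero.\<close>
    define v where "v = (\<lambda>y B. \<lambda>j\<in>J. if j \<in> B then y j else \<zero>\<^bsub>fst j\<^esub>)"
    have vP: "v y B \<in> carrier ?P" if "\<And>j. j \<in> J \<Longrightarrow> y j \<in> carrier (fst j)" for y B
      using c that by (auto simp: PC v_def cring_def ring_def abelian_group_def intro!: abelian_monoid.zero_closed)
    have one: "\<one>\<^bsub>fst j\<^esub> \<in> carrier (fst j)" if "j \<in> J" for j
      using c[OF that] by (auto simp: cring_def ring_def intro!: monoid.one_closed)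
    \<comment> \<open>For a single factor, both sides come from the tensor product of that factor with \<open>S\<close>, where the two restrictions of the family agree.\<close>
    have step: "T.pt (e (v x {j})) \<one>\<^bsub>S\<^esub> = T.pt (e (v (\<lambda>j. \<one>\<^bsub>fst j\<^esub>) {j})) ?x" if j: "j \<in> J" for j
    proof -
      interpret t: tensor_algebras R "fst j" S "snd j" f
        by (intro tensor_algebras.intro inf R S c[OF j])
      define \<iota> where "\<iota> = (\<lambda>y. e (\<lambda>i\<in>J. if i = j then y else \<zero>\<^bsub>fst i\<^esub>))"
      have \<iota>P: "(\<lambda>i\<in>J. if i = j then y else \<zero>\<^bsub>fst i\<^esub>) \<in> carrier ?P" if "y \<in> carrier (fst j)" for y
        using c that by (auto simp: PC cring_def ring_def abelian_group_def intro!: abelian_monoid.zero_closed)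
      have z: "\<zero>\<^bsub>fst i\<^esub> \<oplus>\<^bsub>fst i\<^esub> \<zero>\<^bsub>fst i\<^esub> = \<zero>\<^bsub>fst i\<^esub>" "\<And>r. r \<in> carrier R \<Longrightarrow> snd i r \<otimes>\<^bsub>fst i\<^esub> \<zero>\<^bsub>fst i\<^esub> = \<zero>\<^bsub>fst i\<^esub>"
        if "i \<in> J" for i
      proof -
        interpret cring "fst i" by (rule c[OF that])
        interpret h: ring_hom_cring R "fst i" "snd i" 
          using c[OF that] by (simp add: ring_hom_cring_def ring_hom_cring_axioms_def R)
        show "\<zero>\<^bsub>fst i\<^esub> \<oplus>\<^bsub>fst i\<^esub> \<zero>\<^bsub>fst i\<^esub> = \<zero>\<^bsub>fst i\<^esub>" "\<And>r. r \<in> carrier R \<Longrightarrow> snd i r \<otimes>\<^bsub>fst i\<^esub> \<zero>\<^bsub>fst i\<^esub> = \<zero>\<^bsub>fst i\<^esub>"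
          by simp_all
      qed
      note z' = z[of "(a, b)" for a b, simplified]
      have lin: "\<iota> \<in> linear_maps R t.A ?N"
        unfolding linear_maps_def hom_def
      proof (clarsimp, intro conjI ballI)
        show "\<iota> \<in> carrier (fst j) \<rightarrow> carrier ?N" unfolding \<iota>_def s using \<iota>P by auto
        fix y y' assume y: "y \<in> carrier (fst j)"
        { assume y': "y' \<in> carrier (fst j)"
          show "\<iota> (y \<oplus>\<^bsub>fst j\<^esub> y') = \<iota> y \<oplus>\<^bsub>?N\<^esub> \<iota> y'"
            unfolding \<iota>_def using y y' \<iota>P
            by (subst s) (auto simp: arrow_product_def z z' intro!: arg_cong[of _ _ e] restrict_ext) }
        { fix r assume r: "r \<in> carrier R"
          show "\<iota> (snd j r \<otimes>\<^bsub>fst j\<^esub> y) = r \<odot>\<^bsub>?N\<^esub> \<iota> y"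
            unfolding \<iota>_def using y r \<iota>P
            by (subst s) (auto simp: arrow_product_def z z' intro!: arg_cong[of _ _ e] restrict_ext) }
      qed
      interpret m: tensor_pair_map R t.A "algebra_module S f" ?N \<iota>
        by unfold_locales (rule lin)
      have v\<iota>: "e (v y {j}) = \<iota> (y j)" for y
        unfolding v_def \<iota>_def by (intro arg_cong[of _ _ e] restrict_ext) auto
      have "x (t.TR, compose (carrier R) t.left (snd j)) = t.left (x j)"
        using compat[of "fst j" "snd j" t.TR t.left] j J t.left_hom t.TR_cring by (auto simp: arrows_def)
      moreover have "x (t.TR, compose (carrier R) t.right f) = t.right ?x"
        using compat[of S f t.TR t.right] Sf J t.right_hom t.TR_cring by (auto simp: arrows_def)
      ultimately have "t.left (x j) = t.right ?x" using t.left_f_eq by simp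
      then have eq: "t.tp.pt (x j) \<one>\<^bsub>S\<^esub> = t.tp.pt \<one>\<^bsub>fst j\<^esub> ?x"
        using xj[OF j] xS by (simp add: t.left_def t.right_def)
      have "T.pt (\<iota> (x j)) \<one>\<^bsub>S\<^esub> = tensor_map R ?N (algebra_module S f) \<iota> (t.tp.pt (x j) \<one>\<^bsub>S\<^esub>)"
        using xj[OF j] by (subst m.tensor_map_pure) auto
      also have "\<dots> = T.pt (\<iota> \<one>\<^bsub>fst j\<^esub>) ?x"
        unfolding eq using xS by (subst m.tensor_map_pure) auto
      finally show ?thesis by (simp add: v\<iota>)
    qed
    have "T.pt (e (v x B)) \<one>\<^bsub>S\<^esub> = T.pt (e (v (\<lambda>j. \<one>\<^bsub>fst j\<^esub>) B)) ?x" if "finite B" "B \<subseteq> J" for B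
      using that
    proof (induction B rule: finite_induct)
      case empty
      have "v y {} = \<zero>\<^bsub>?P\<^esub>" for y by (simp add: v_def arrow_product_def)
      then have ev: "e (v y {}) = \<zero>\<^bsub>R\<^esub> \<odot>\<^bsub>?N\<^esub> i1" for y using i1N by (simp add: s)
      have "T.pt (e (v y {})) b = T.pt i1 \<zero>\<^bsub>S\<^esub>" if "b \<in> carrier S" for y b
        unfolding ev using T.pt_smult[of "\<zero>\<^bsub>R\<^esub>" i1 b] that i1N by simp
      then show ?case using xS by simp
    next
      case (insert j B)
      have split: "e (v y (insert j B)) = e (v y {j}) \<oplus>\<^bsub>?N\<^esub> e (v y B)"
        if y: "\<And>j. j \<in> J \<Longrightarrow> y j \<in> carrier (fst j)" for y
      proof -
        have "v y (insert j B) = v y {j} \<oplus>\<^bsub>?P\<^esub> v y B"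
        proof -
          have "(if i \<in> insert j B then y i else \<zero>\<^bsub>fst i\<^esub>) =
            (if i \<in> {j} then y i else \<zero>\<^bsub>fst i\<^esub>) \<oplus>\<^bsub>fst i\<^esub> (if i \<in> B then y i else \<zero>\<^bsub>fst i\<^esub>)" if "i \<in> J" for i
          proof -
            interpret cring "fst i" by (rule c[OF that])
            have "y i \<oplus>\<^bsub>fst i\<^esub> \<zero>\<^bsub>fst i\<^esub> = y i" "\<zero>\<^bsub>fst i\<^esub> \<oplus>\<^bsub>fst i\<^esub> y i = y i" 
              "\<zero>\<^bsub>fst i\<^esub> \<oplus>\<^bsub>fst i\<^esub> \<zero>\<^bsub>fst i\<^esub> = \<zero>\<^bsub>fst i\<^esub>"
              using y[OF that] by simp_all
            then show ?thesis using insert(2) by auto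
          qed
          then show ?thesis by (auto simp: v_def arrow_product_def intro!: restrict_ext)
        qed
        then show ?thesis using vP[OF y] by (simp add: s)
      qed
      have N: "e (v y B') \<in> carrier ?N" if "\<And>j. j \<in> J \<Longrightarrow> y j \<in> carrier (fst j)" for y B'
        unfolding s using vP[OF that] by blast
      have "T.pt (e (v x (insert j B))) \<one>\<^bsub>S\<^esub> = T.pt (e (v x {j})) \<one>\<^bsub>S\<^esub> \<oplus>\<^bsub>T.T\<^esub> T.pt (e (v x B)) \<one>\<^bsub>S\<^esub>"
        using split[of x] N[of x] xj by (simp add: T.pt_add_left)
      also have "\<dots> = T.pt (e (v (\<lambda>j. \<one>\<^bsub>fst j\<^esub>) {j})) ?x \<oplus>\<^bsub>T.T\<^esub> T.pt (e (v (\<lambda>j. \<one>\<^bsub>fst j\<^esub>) B)) ?x"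
        using insert step by simp
      also have "\<dots> = T.pt (e (v (\<lambda>j. \<one>\<^bsub>fst j\<^esub>) (insert j B))) ?x"
        using split[of "\<lambda>j. \<one>\<^bsub>fst j\<^esub>"] N[of "\<lambda>j. \<one>\<^bsub>fst j\<^esub>"] one xS by (simp add: T.pt_add_left)
      finally show ?case .
    qed
    from this[of J] J(1) have "T.pt n \<one>\<^bsub>S\<^esub> = T.pt i1 ?x"
      unfolding n_def i1_def v_def by (simp cong: restrict_cong)
    then have rel: "frag_of (n, \<one>\<^bsub>S\<^esub>) - frag_of (i1, ?x) \<in> T.rel"
      unfolding pure_def by (subst (asm) T.cls_eq_iff) (use nN i1N xS in auto)
    have "i1 = \<one>\<^bsub>R\<^esub> \<odot>\<^bsub>?N\<^esub> i1" using i1N by simp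
    then have "i1 \<in> K" unfolding K_def by blast
    then show "\<one>\<^bsub>S\<^esub> \<in> Idl\<^bsub>S\<^esub> (f ` ?I)"
      using flat_annihilator[OF inf R S(1,2,3) N K nN _ _ rel] xS by simp
  qed
  then have "n \<in> K" using nN by simp
  then obtain r where r: "r \<in> carrier R" "n = r \<odot>\<^bsub>?N\<^esub> i1" unfolding K_def by blast
  then have eqf: "(\<lambda>j\<in>J. x j) = r \<odot>\<^bsub>?P\<^esub> (\<lambda>j\<in>J. \<one>\<^bsub>fst j\<^esub>)"
    using e i1P nP P.smult_closed[OF r(1) i1P] unfolding n_def i1_def s(4)[OF i1P]
    by (auto simp: inj_on_def)
  have *: "x j = snd j r \<otimes>\<^bsub>fst j\<^esub> \<one>\<^bsub>fst j\<^esub>" if "j \<in> J" for j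
    using that fun_cong[OF eqf, of j] by (simp add: arrow_product_def)
  have "x j = snd j r" if j: "j \<in> J" for j
  proof -
    interpret cring "fst j" by (rule c[OF j])
    have "snd j r \<in> carrier (fst j)" using c[OF j] r by (auto simp: ring_hom_def)
    then show ?thesis using *[OF j] by simp
  qed
  then show ?thesis using r(1) by (intro bexI[of _ r]) auto
qed

section \<open>Polynomial rings\<close>

lemma finite_submultisets: "finite {a. a \<subseteq># (m :: 'a multiset)}"
proof (induction m)
  case empty then show ?case by simp
next
  case (add x m)
  have "{a. a \<subseteq># add_mset x m} \<subseteq> {a. a \<subseteq># m} \<union> add_mset x ` {a. a \<subseteq># m}"
  proof
    fix a assume a: "a \<in> {a. a \<subseteq># add_mset x m}"
    show "a \<in> {a. a \<subseteq># m} \<union> add_mset x ` {a. a \<subseteq># m}"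
    proof (cases "x \<in># a")
      case True
      then obtain b where "a = add_mset x b" by (metis multi_member_split)
      then show ?thesis using a by auto
    next
      case False
      have "count a y \<le> count m y" for y
        using mset_subset_eq_count[of a "add_mset x m" y] a False by (cases "y = x") (auto simp: not_in_iff)
      then have "a \<subseteq># m" by (rule mset_subset_eqI)
      then show ?thesis by blast
    qed
  qed
  then show ?case using add by (meson finite_Un finite_imageI finite_subset)
qed

text \<open>The monomial with coefficient \<open>r\<close> and exponent \<open>a\<close>.\<close>

definition mpoly_monom :: "'u ring \<Rightarrow> nat multiset \<Rightarrow> 'u \<Rightarrow> nat multiset \<Rightarrow> 'u" where
  "mpoly_monom R a r = (\<lambda>m. if m = a then r else \<zero>\<^bsub>R\<^esub>)"

text \<open>The polynomial ring \<open>P\<close> in \<open>n\<close> variables over \<open>R\<close>.\<close>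

locale mpolys = cring R for R :: "'u ring" (structure) + fixes n :: nat
begin

abbreviation P where "P \<equiv> mpoly_ring R n"
abbreviation mon where "mon \<equiv> mpoly_monom R"

lemma P_carrier: "p \<in> carrier P \<longleftrightarrow> (\<forall>m. p m \<in> carrier R) \<and> finite {m. p m \<noteq> \<zero>} \<and>
    (\<forall>m. p m \<noteq> \<zero> \<longrightarrow> set_mset m \<subseteq> {..<n})"
  by (simp add: mpoly_ring_def)

lemma P_coeff [simp]: "p \<in> carrier P \<Longrightarrow> p m \<in> carrier R"
  by (simp add: P_carrier)

lemma P_ops:
  "p \<oplus>\<^bsub>P\<^esub> q = (\<lambda>m. p m \<oplus> q m)" "\<zero>\<^bsub>P\<^esub> = (\<lambda>m. \<zero>)" "\<one>\<^bsub>P\<^esub> = mon {#} \<one>"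
  "p \<otimes>\<^bsub>P\<^esub> q = (\<lambda>m. \<Oplus>a \<in> {a. a \<subseteq># m}. p a \<otimes> q (m - a))"
  unfolding mpoly_ring_def poly_const_def mpoly_monom_def by simp_all

lemma poly_const_eq: "poly_const R r = mon {#} r"
  by (simp add: poly_const_def mpoly_monom_def)

lemma mon_closed: "set_mset a \<subseteq> {..<n} \<Longrightarrow> r \<in> carrier R \<Longrightarrow> mon a r \<in> carrier P"
  unfolding P_carrier mpoly_monom_def
  by (auto intro: finite_subset[of _ "{a}"])

lemma add_closed: 
  assumes "p \<in> carrier P" "q \<in> carrier P" shows "p \<oplus>\<^bsub>P\<^esub> q \<in> carrier P"
proof -
  have "{m. p m \<oplus> q m \<noteq> \<zero>} \<subseteq> {m. p m \<noteq> \<zero>} \<union> {m. q m \<noteq> \<zero>}" by auto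
  moreover have "finite ({m. p m \<noteq> \<zero>} \<union> {m. q m \<noteq> \<zero>})" using assms by (simp add: P_carrier)
  ultimately have "finite {m. p m \<oplus> q m \<noteq> \<zero>}" by (rule finite_subset)
  moreover have "set_mset m \<subseteq> {..<n}" if "p m \<oplus> q m \<noteq> \<zero>" for m
  proof -
    have "p m \<noteq> \<zero> \<or> q m \<noteq> \<zero>" using that by auto
    then show ?thesis using assms unfolding P_carrier by blast
  qed
  ultimately show ?thesis using assms
    unfolding P_ops P_carrier[of "\<lambda>m. p m \<oplus> q m"] by simp
qed

lemma mult_closed: 
  assumes p: "p \<in> carrier P" and q: "q \<in> carrier P" shows "p \<otimes>\<^bsub>P\<^esub> q \<in> carrier P"
proof -
  have nz: "\<exists>a b. p a \<noteq> \<zero> \<and> q b \<noteq> \<zero> \<and> m = a + b" if "(p \<otimes>\<^bsub>P\<^esub> q) m \<noteq> \<zero>" for m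
  proof -
    have "\<exists>a. a \<subseteq># m \<and> p a \<otimes> q (m - a) \<noteq> \<zero>"
    proof (rule ccontr)
      assume "\<not> ?thesis"
      then have "(p \<otimes>\<^bsub>P\<^esub> q) m = \<zero>" unfolding P_ops by (intro add.finprod_one_eqI) auto
      with that show False by simp
    qed
    then obtain a where a: "a \<subseteq># m" "p a \<otimes> q (m - a) \<noteq> \<zero>" by blast
    then have "p a \<noteq> \<zero>" "q (m - a) \<noteq> \<zero>" using p q by auto
    then show ?thesis using a(1) by (metis subset_mset.add_diff_inverse)
  qed
  then have "{m. (p \<otimes>\<^bsub>P\<^esub> q) m \<noteq> \<zero>} \<subseteq> (\<lambda>(a, b). a + b) ` ({a. p a \<noteq> \<zero>} \<times> {b. q b \<noteq> \<zero>})"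
    by fastforce
  then have "finite {m. (p \<otimes>\<^bsub>P\<^esub> q) m \<noteq> \<zero>}"
    by (rule finite_subset) (use p q in \<open>auto simp: P_carrier\<close>)
  moreover have "set_mset m \<subseteq> {..<n}" if m: "(p \<otimes>\<^bsub>P\<^esub> q) m \<noteq> \<zero>" for m
  proof -
    obtain a b where ab: "p a \<noteq> \<zero>" "q b \<noteq> \<zero>" "m = a + b" using nz[OF m] by blast
    have "set_mset a \<subseteq> {..<n}" using p ab(1) unfolding P_carrier by blast
    moreover have "set_mset b \<subseteq> {..<n}" using q ab(2) unfolding P_carrier by blast
    ultimately show ?thesis using ab(3) by simp
  qed
  moreover have "(p \<otimes>\<^bsub>P\<^esub> q) m \<in> carrier R" for m
    unfolding P_ops using p q by (intro finsum_closed) auto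
  ultimately show ?thesis unfolding P_carrier[of "p \<otimes>\<^bsub>P\<^esub> q"] by blast
qed

lemma P_abelian_group: "abelian_group P"
proof (rule abelian_groupI)
  show "\<zero>\<^bsub>P\<^esub> \<in> carrier P" by (simp add: P_carrier P_ops)
  fix p assume p: "p \<in> carrier P"
  show "\<zero>\<^bsub>P\<^esub> \<oplus>\<^bsub>P\<^esub> p = p" using p by (simp add: P_ops)
  have "{m. \<ominus> p m \<noteq> \<zero>} = {m. p m \<noteq> \<zero>}" using p by (metis P_coeff minus_minus minus_zero)
  then have "(\<lambda>m. \<ominus> p m) \<in> carrier P" using p unfolding P_carrier by auto
  then show "\<exists>q\<in>carrier P. q \<oplus>\<^bsub>P\<^esub> p = \<zero>\<^bsub>P\<^esub>"
    using p by (intro bexI[of _ "\<lambda>m. \<ominus> p m"]) (auto simp: P_ops l_neg)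
qed (auto simp: add_closed, auto simp: P_ops a_ac)

lemma mult_add_left:
  assumes "p \<in> carrier P" "q \<in> carrier P" "s \<in> carrier P"
  shows "(p \<oplus>\<^bsub>P\<^esub> q) \<otimes>\<^bsub>P\<^esub> s = (p \<otimes>\<^bsub>P\<^esub> s) \<oplus>\<^bsub>P\<^esub> (q \<otimes>\<^bsub>P\<^esub> s)"
  using assms by (auto simp: P_ops l_distr intro!: finsum_addf)

lemma mult_add_right:
  assumes "p \<in> carrier P" "q \<in> carrier P" "s \<in> carrier P"
  shows "s \<otimes>\<^bsub>P\<^esub> (p \<oplus>\<^bsub>P\<^esub> q) = (s \<otimes>\<^bsub>P\<^esub> p) \<oplus>\<^bsub>P\<^esub> (s \<otimes>\<^bsub>P\<^esub> q)"
  using assms by (auto simp: P_ops r_distr intro!: finsum_addf)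

lemma mult_zero: "p \<in> carrier P \<Longrightarrow> \<zero>\<^bsub>P\<^esub> \<otimes>\<^bsub>P\<^esub> p = \<zero>\<^bsub>P\<^esub>" "p \<in> carrier P \<Longrightarrow> p \<otimes>\<^bsub>P\<^esub> \<zero>\<^bsub>P\<^esub> = \<zero>\<^bsub>P\<^esub>"
  by (auto simp: P_ops intro!: add.finprod_one_eqI)

lemma mon_mult:
  assumes r: "r \<in> carrier R" and s: "s \<in> carrier R"
  shows "mon a r \<otimes>\<^bsub>P\<^esub> mon b s = mon (a + b) (r \<otimes> s)"
proof
  fix m
  have "(\<Oplus>c \<in> {c. c \<subseteq># m}. mon a r c \<otimes> mon b s (m - c)) =
    (\<Oplus>c \<in> {c. c \<subseteq># m}. if a = c then (if m = a + b then r \<otimes> s else \<zero>) else \<zero>)"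
    by (rule finsum_cong') (use r s in \<open>auto simp: mpoly_monom_def subset_mset.add_diff_inverse\<close>)
  also have "\<dots> = (if m = a + b then r \<otimes> s else \<zero>)"
  proof (cases "m = a + b")
    case True
    then have "a \<in> {c. c \<subseteq># m}" by simp
    from finsum_singleton[OF this finite_submultisets, of "\<lambda>_. r \<otimes> s"] show ?thesis using True r s by simp
  next
    case False
    then show ?thesis by (intro add.finprod_one_eqI[THEN trans]) auto
  qed
  finally show "(mon a r \<otimes>\<^bsub>P\<^esub> mon b s) m = mon (a + b) (r \<otimes> s) m"
    unfolding P_ops by (simp add: mpoly_monom_def)
qed

lemma P_induct [consumes 1, case_names zero mon add]:
  assumes "p \<in> carrier P" and z: "Q \<zero>\<^bsub>P\<^esub>"
    and m: "\<And>a r. set_mset a \<subseteq> {..<n} \<Longrightarrow> r \<in> carrier R \<Longrightarrow> Q (mon a r)"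
    and s: "\<And>p q. p \<in> carrier P \<Longrightarrow> q \<in> carrier P \<Longrightarrow> Q p \<Longrightarrow> Q q \<Longrightarrow> Q (p \<oplus>\<^bsub>P\<^esub> q)"
  shows "Q p"
proof -
  have "\<And>p. p \<in> carrier P \<Longrightarrow> {m. p m \<noteq> \<zero>} = A \<Longrightarrow> Q p" if "finite A" for A
    using that
  proof (induction A rule: finite_induct)
    case empty
    then have "p = \<zero>\<^bsub>P\<^esub>" by (auto simp: P_ops)
    then show ?case using z by simp
  next
    case (insert a A)
    define q where "q = p(a := \<zero>)"
    have qA: "{m. q m \<noteq> \<zero>} = A" using insert unfolding q_def by auto
    have pa: "p a \<noteq> \<zero>" using insert by auto
    have q: "q \<in> carrier P"
      unfolding P_carrier qA using insert by (auto simp: q_def P_carrier)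
    have "set_mset a \<subseteq> {..<n}" using insert(4) pa by (simp add: P_carrier)
    then have ma: "mon a (p a) \<in> carrier P" "Q (mon a (p a))" using insert m mon_closed by auto
    have "p = q \<oplus>\<^bsub>P\<^esub> mon a (p a)" using insert(4) by (auto simp: P_ops q_def mpoly_monom_def)
    then show ?case using s[OF q ma(1) insert.IH[OF q qA] ma(2)] by simp
  qed
  then show ?thesis using assms(1) P_carrier[of p] by blast
qed

lemma mult_comm:
  assumes "p \<in> carrier P" "q \<in> carrier P" shows "p \<otimes>\<^bsub>P\<^esub> q = q \<otimes>\<^bsub>P\<^esub> p"
  using assms
proof (induction arbitrary: q rule: P_induct)
  case (mon a r)
  from mon(3) show ?case
  proof (induction rule: P_induct)
    case (mon b s) with \<open>r \<in> carrier R\<close> show ?case by (simp add: mon_mult m_comm add.commute)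
  qed (use mon in \<open>simp_all add: mult_zero mult_add_left mult_add_right mon_closed\<close>)
qed (simp_all add: mult_zero mult_add_left mult_add_right)

lemma mult_assoc:
  assumes "p \<in> carrier P" "q \<in> carrier P" "s \<in> carrier P" 
  shows "p \<otimes>\<^bsub>P\<^esub> q \<otimes>\<^bsub>P\<^esub> s = p \<otimes>\<^bsub>P\<^esub> (q \<otimes>\<^bsub>P\<^esub> s)"
  using assms
proof (induction arbitrary: q s rule: P_induct)
  case m1: (mon a r)
  note p1 = mon_closed[OF m1(1,2)]
  from m1(3,4) show ?case
  proof (induction arbitrary: s rule: P_induct)
    case m2: (mon b r')
    note p2 = mon_closed[OF m2(1,2)]
    from m2(3) show ?case
    proof (induction rule: P_induct)
      case (mon c r'')
      then show ?case using m1 m2 by (simp add: mon_mult m_assoc add.assoc)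
    qed (use p1 p2 in \<open>simp_all add: mult_zero mult_add_left mult_add_right mult_closed\<close>)
  qed (use p1 in \<open>simp_all add: mult_zero mult_add_left mult_add_right mult_closed\<close>)
qed (simp_all add: mult_zero mult_add_left mult_add_right mult_closed)

lemma P_one: "\<one>\<^bsub>P\<^esub> \<in> carrier P" "p \<in> carrier P \<Longrightarrow> \<one>\<^bsub>P\<^esub> \<otimes>\<^bsub>P\<^esub> p = p"
proof -
  show one: "\<one>\<^bsub>P\<^esub> \<in> carrier P" unfolding P_ops by (rule mon_closed) auto
  show "\<one>\<^bsub>P\<^esub> \<otimes>\<^bsub>P\<^esub> p = p" if "p \<in> carrier P" using that
  proof (induction rule: P_induct)
    case (mon a r) then show ?case by (simp add: P_ops(3) mon_mult)
  qed (use one in \<open>simp_all add: mult_zero mult_add_right\<close>)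
qed

lemma P_cring: "cring P"
proof (rule cringI[OF P_abelian_group])
  show "Group.comm_monoid P"
    by (rule comm_monoidI) (simp_all only: mult_closed P_one mult_assoc, rule mult_comm)
qed (rule mult_add_left)

sublocale P: cring P by (rule P_cring)

lemma const_hom: "poly_const R \<in> ring_hom R P"
  unfolding poly_const_eq
  by (rule ring_hom_memI) (auto simp: mon_closed mon_mult, auto simp: P_ops mpoly_monom_def)

abbreviation var where "var i \<equiv> mon {#i#} \<one>"

lemma hom_unique:
  assumes S: "cring S" and h: "h \<in> ring_hom P S" "h' \<in> ring_hom P S"
    and const: "\<And>r. r \<in> carrier R \<Longrightarrow> h (poly_const R r) = h' (poly_const R r)"
    and var: "\<And>i. i < n \<Longrightarrow> h (var i) = h' (var i)" and p: "p \<in> carrier P"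
  shows "h p = h' p"
proof -
  interpret S: cring S by fact
  interpret h: ring_hom_cring P S h using h by (simp add: ring_hom_cring_def ring_hom_cring_axioms_def S P_cring)
  interpret h': ring_hom_cring P S h' using h by (simp add: ring_hom_cring_def ring_hom_cring_axioms_def S P_cring)
  show ?thesis using p
  proof (induction rule: P_induct)
    case (mon a r)
    then show ?case
    proof (induction a)
      case empty then show ?case using const by (simp add: poly_const_eq)
    next
      case (add i a)
      have "mon (add_mset i a) r = var i \<otimes>\<^bsub>P\<^esub> mon a r" using add by (simp add: mon_mult)
      moreover have "var i \<in> carrier P" "mon a r \<in> carrier P" using add by (auto intro!: mon_closed)
      ultimately show ?case using add var by simp
    qed
  qed simp_all
qed

end

text \<open>Evaluation at \<open>v\<close> of polynomials with coefficients mapped by \<open>f\<close>.\<close>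

locale mpoly_eval = mpolys R n + S: cring S for R S :: "_ ring" and n +
  fixes f v assumes f: "f \<in> ring_hom R S" and v: "v \<in> {..<n} \<rightarrow> carrier S"
begin

sublocale f: ring_hom_cring R S f
  by (simp add: ring_hom_cring_def ring_hom_cring_axioms_def f is_cring S.is_cring)

text \<open>The value of the monomial with exponent \<open>m\<close>.\<close>

definition monval where "monval m = finprod S (\<lambda>i. v i [^]\<^bsub>S\<^esub> count m i) {..<n}"

text \<open>The value of the polynomial \<open>p\<close>.\<close>

definition ev where "ev p = finsum S (\<lambda>m. f (p m) \<otimes>\<^bsub>S\<^esub> monval m) {m. p m \<noteq> \<zero>\<^bsub>R\<^esub>}"

lemma v_closed [simp]: "i < n \<Longrightarrow> v i \<in> carrier S" using v by auto

lemma monval_closed [simp]: "monval m \<in> carrier S"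
  unfolding monval_def by (rule S.finprod_closed) auto

lemma monval_add: "monval (a + b) = monval a \<otimes>\<^bsub>S\<^esub> monval b"
proof -
  have "monval (a + b) = finprod S (\<lambda>i. v i [^]\<^bsub>S\<^esub> count a i \<otimes>\<^bsub>S\<^esub> v i [^]\<^bsub>S\<^esub> count b i) {..<n}"
    unfolding monval_def by (rule S.finprod_cong') (auto simp: S.nat_pow_mult)
  then show ?thesis unfolding monval_def by (subst (asm) S.finprod_multf) auto
qed

lemma monval_empty: "monval {#} = \<one>\<^bsub>S\<^esub>"
  unfolding monval_def by (intro S.finprod_one_eqI) auto

lemma monval_single: assumes "i < n" shows "monval {#i#} = v i"
proof -
  have "monval {#i#} = finprod S (\<lambda>j. if i = j then v j else \<one>\<^bsub>S\<^esub>) {..<n}"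
    unfolding monval_def by (rule S.finprod_cong') (auto simp: S.nat_pow_eone)
  also have "\<dots> = v i" by (rule S.finprod_singleton) (use assms in auto)
  finally show ?thesis .
qed

lemma ev_superset:
  assumes "p \<in> carrier P" "finite A" "{m. p m \<noteq> \<zero>\<^bsub>R\<^esub>} \<subseteq> A"
  shows "ev p = finsum S (\<lambda>m. f (p m) \<otimes>\<^bsub>S\<^esub> monval m) A"
  unfolding ev_def
  by (rule S.add.finprod_mono_neutral_cong_left) (use assms in auto)

lemma ev_closed: "p \<in> carrier P \<Longrightarrow> ev p \<in> carrier S"
  unfolding ev_def by (rule S.finsum_closed) auto

lemma ev_add:
  assumes p: "p \<in> carrier P" and q: "q \<in> carrier P" shows "ev (p \<oplus>\<^bsub>P\<^esub> q) = ev p \<oplus>\<^bsub>S\<^esub> ev q"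
proof -
  let ?A = "{m. p m \<noteq> \<zero>\<^bsub>R\<^esub>} \<union> {m. q m \<noteq> \<zero>\<^bsub>R\<^esub>}"
  have fin: "finite ?A" using p q by (simp add: P_carrier)
  have "ev (p \<oplus>\<^bsub>P\<^esub> q) = finsum S (\<lambda>m. f ((p \<oplus>\<^bsub>P\<^esub> q) m) \<otimes>\<^bsub>S\<^esub> monval m) ?A"
    using add_closed[OF p q] fin by (rule ev_superset) (auto simp: P_ops)
  also have "\<dots> = finsum S (\<lambda>m. f (p m) \<otimes>\<^bsub>S\<^esub> monval m \<oplus>\<^bsub>S\<^esub> f (q m) \<otimes>\<^bsub>S\<^esub> monval m) ?A"
    by (rule S.finsum_cong') (use p q in \<open>auto simp: P_ops S.l_distr\<close>)
  also have "\<dots> = ev p \<oplus>\<^bsub>S\<^esub> ev q"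
    using p q fin by (simp add: S.finsum_addf ev_superset[OF p fin] ev_superset[OF q fin] Pi_iff)
  finally show ?thesis .
qed

lemma ev_zero: "ev \<zero>\<^bsub>P\<^esub> = \<zero>\<^bsub>S\<^esub>"
  by (simp add: ev_def P_ops)

lemma ev_mon:
  assumes a: "set_mset a \<subseteq> {..<n}" and r: "r \<in> carrier R" 
  shows "ev (mon a r) = f r \<otimes>\<^bsub>S\<^esub> monval a"
proof -
  have "ev (mon a r) = finsum S (\<lambda>m. f (mon a r m) \<otimes>\<^bsub>S\<^esub> monval m) {a}"
    by (rule ev_superset) (use mon_closed[OF a r] in \<open>auto simp: mpoly_monom_def\<close>)
  also have "\<dots> = f r \<otimes>\<^bsub>S\<^esub> monval a"
    using r by (simp add: mpoly_monom_def)
  finally show ?thesis .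
qed

lemma ev_mult:
  assumes "p \<in> carrier P" "q \<in> carrier P" shows "ev (p \<otimes>\<^bsub>P\<^esub> q) = ev p \<otimes>\<^bsub>S\<^esub> ev q"
  using assms
proof (induction arbitrary: q rule: P_induct)
  case m1: (mon a r)
  note p1 = mon_closed[OF m1(1,2)]
  from m1(3) show ?case
  proof (induction rule: P_induct)
    case (mon b s)
    then show ?case using m1 by (simp add: mon_mult ev_mon monval_add S.m_ac)
  qed (use p1 in \<open>simp_all add: ev_zero ev_add ev_closed mult_closed mult_add_right S.r_distr\<close>)
qed (simp_all add: ev_zero ev_add ev_closed mult_closed mult_add_left S.l_distr)

lemma ev_const: "r \<in> carrier R \<Longrightarrow> ev (poly_const R r) = f r"
  by (simp add: poly_const_eq ev_mon monval_empty)

lemma ev_var: "i < n \<Longrightarrow> ev (var i) = v i"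
  by (simp add: ev_mon monval_single)

lemma ev_hom: "ev \<in> ring_hom P S"
  by (rule ring_hom_memI)
     (use ev_const[of "\<one>\<^bsub>R\<^esub>"] in \<open>auto simp: ev_closed ev_mult ev_add P_ops(3) poly_const_eq\<close>)

end

declare (in mpolys) P_coeff [simp del]

section \<open>Covering sieves\<close>

lemma ring_hom_cringI': "cring R \<Longrightarrow> cring S \<Longrightarrow> h \<in> ring_hom R S \<Longrightarrow> ring_hom_cring R S h"
  by (simp add: ring_hom_cring_def ring_hom_cring_axioms_def)

lemma ring_hom_kernel_ideal: 
  "cring R \<Longrightarrow> cring S \<Longrightarrow> h \<in> ring_hom R S \<Longrightarrow> ideal (a_kernel R S h) R"
  by (intro ring_hom_ring.kernel_is_ideal ring_hom_ringI2) (simp_all add: cring.axioms(1))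

lemma factor_through_presentation:
  assumes A: "cring A" and S: "cring S" and Q: "cring Q"
    and \<phi>: "\<phi> \<in> ring_hom A S" "\<phi> ` carrier A = carrier S"
    and F: "F \<subseteq> carrier A" "a_kernel A S \<phi> = Idl\<^bsub>A\<^esub> F"
    and \<psi>: "\<psi> \<in> ring_hom A Q" "\<And>x. x \<in> F \<Longrightarrow> \<psi> x = \<zero>\<^bsub>Q\<^esub>"
  obtains \<alpha> where "\<alpha> \<in> ring_hom S Q" "\<And>p. p \<in> carrier A \<Longrightarrow> \<alpha> (\<phi> p) = \<psi> p"
proof -
  interpret A: cring A by fact
  interpret S: cring S by fact
  interpret Q: cring Q by fact
  interpret \<phi>: ring_hom_cring A S \<phi> by (rule ring_hom_cringI'[OF A S \<phi>(1)])
  interpret \<psi>: ring_hom_cring A Q \<psi> by (rule ring_hom_cringI'[OF A Q \<psi>(1)])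
  have "F \<subseteq> a_kernel A Q \<psi>" using F(1) \<psi>(2) unfolding a_kernel_def' by blast
  then have ker: "a_kernel A S \<phi> \<subseteq> a_kernel A Q \<psi>"
    unfolding F(2) by (rule A.genideal_minimal[OF ring_hom_kernel_ideal[OF A Q \<psi>(1)]])
  have kill: "\<psi> p = \<zero>\<^bsub>Q\<^esub>" if "p \<in> carrier A" "\<phi> p = \<zero>\<^bsub>S\<^esub>" for p
    using that ker unfolding a_kernel_def' by blast
  have wd: "\<psi> p = \<psi> q" if pq: "p \<in> carrier A" "q \<in> carrier A" "\<phi> p = \<phi> q" for p q
  proof -
    have "\<phi> (p \<ominus>\<^bsub>A\<^esub> q) = \<zero>\<^bsub>S\<^esub>" using pq by (simp add: a_minus_def S.r_neg)
    then have "\<psi> (p \<ominus>\<^bsub>A\<^esub> q) = \<zero>\<^bsub>Q\<^esub>" using kill pq by simp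
    moreover have "\<psi> (p \<ominus>\<^bsub>A\<^esub> q) = \<psi> p \<ominus>\<^bsub>Q\<^esub> \<psi> q" using pq by (simp add: a_minus_def)
    ultimately show ?thesis using Q.diff_eq_zero_iff[of "\<psi> p" "\<psi> q"] pq by simp
  qed
  define \<alpha> where "\<alpha> = (\<lambda>s. \<psi> (inv_into (carrier A) \<phi> s))"
  have inv: "inv_into (carrier A) \<phi> s \<in> carrier A" "\<phi> (inv_into (carrier A) \<phi> s) = s" if "s \<in> carrier S" for s
    using that \<phi>(2) inv_into_into[of s \<phi> "carrier A"] f_inv_into_f[of s \<phi> "carrier A"] by auto
  have \<alpha>: "\<alpha> (\<phi> p) = \<psi> p" if "p \<in> carrier A" for p
    unfolding \<alpha>_def using that inv by (intro wd) auto
  have "\<alpha> \<in> ring_hom S Q"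
  proof (rule ring_hom_memI)
    fix s t assume "s \<in> carrier S" "t \<in> carrier S"
    then obtain p q where pq: "p \<in> carrier A" "q \<in> carrier A" "s = \<phi> p" "t = \<phi> q" using \<phi>(2) by blast
    show "\<alpha> (s \<otimes>\<^bsub>S\<^esub> t) = \<alpha> s \<otimes>\<^bsub>Q\<^esub> \<alpha> t" "\<alpha> (s \<oplus>\<^bsub>S\<^esub> t) = \<alpha> s \<oplus>\<^bsub>Q\<^esub> \<alpha> t"
      using pq \<alpha>[of "p \<otimes>\<^bsub>A\<^esub> q"] \<alpha>[of "p \<oplus>\<^bsub>A\<^esub> q"] by (simp_all add: \<alpha>)
  next
    show "\<alpha> \<one>\<^bsub>S\<^esub> = \<one>\<^bsub>Q\<^esub>" using \<alpha>[of "\<one>\<^bsub>A\<^esub>"] by simp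
  qed (use inv in \<open>auto simp: \<alpha>_def\<close>)
  then show ?thesis using \<alpha> that by blast
qed

text \<open>If \<open>S\<close> is presented by \<open>n\<close> variables and relations \<open>F\<close>, and \<open>S'\<close> by \<open>n'\<close> variables and \<open>F'\<close>, then \<open>S \<otimes> S'\<close> is presented
  by \<open>n + n'\<close> variables and the union of \<open>F\<close> and of \<open>F'\<close> with its variables shifted by \<open>n\<close>. The kernel is no
  larger than the ideal \<open>I\<close> of these relations, since by the pushout property the projection to the quotient
  by \<open>I\<close> factors through \<open>S \<otimes> S'\<close>.\<close>

lemma (in tensor_algebras) finitely_presented_tensor_ring:
  assumes fp: "finitely_presented_map R S f" and fp': "finitely_presented_map R S' f'"
  shows "finitely_presented_map R TR (compose (carrier R) left f)"
proof -
  obtain n \<phi> F where \<phi>: "\<phi> \<in> ring_hom (mpoly_ring R n) S" "\<phi> ` carrier (mpoly_ring R n) = carrier S"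
     "\<And>r. r \<in> carrier R \<Longrightarrow> \<phi> (poly_const R r) = f r"
    and F: "finite F" "F \<subseteq> carrier (mpoly_ring R n)" "a_kernel (mpoly_ring R n) S \<phi> = Idl\<^bsub>mpoly_ring R n\<^esub> F"
    using fp unfolding finitely_presented_map_def by blast
  obtain n' \<phi>' F' where \<phi>': "\<phi>' \<in> ring_hom (mpoly_ring R n') S'" "\<phi>' ` carrier (mpoly_ring R n') = carrier S'"
     "\<And>r. r \<in> carrier R \<Longrightarrow> \<phi>' (poly_const R r) = f' r"
    and F': "finite F'" "F' \<subseteq> carrier (mpoly_ring R n')" "a_kernel (mpoly_ring R n') S' \<phi>' = Idl\<^bsub>mpoly_ring R n'\<^esub> F'"
    using fp' unfolding finitely_presented_map_def by blast
  interpret p: mpolys R n by unfold_locales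
  interpret p': mpolys R n' by unfold_locales
  interpret q: mpolys R "n + n'" by unfold_locales
  interpret \<phi>: ring_hom_cring p.P S \<phi> by (rule ring_hom_cringI'[OF p.P_cring S \<phi>(1)])
  interpret \<phi>': ring_hom_cring p'.P S' \<phi>' by (rule ring_hom_cringI'[OF p'.P_cring S' \<phi>'(1)])
  interpret left: ring_hom_cring S TR left by (rule ring_hom_cringI'[OF S TR_cring ring_mapsD[OF left_hom]])
  interpret right: ring_hom_cring S' TR right by (rule ring_hom_cringI'[OF S' TR_cring ring_mapsD[OF right_hom]])
  have sub: "x \<in> carrier q.P" if "x \<in> carrier p.P" for x
  proof -
    have "{..<n} \<subseteq> {..<n + n'}" by auto
    moreover note iffD1[OF p.P_carrier that]
    ultimately show ?thesis by (intro iffD2[OF q.P_carrier] conjI) (blast, blast, meson order_trans)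
  qed
  have ops: "x \<oplus>\<^bsub>p.P\<^esub> y = x \<oplus>\<^bsub>q.P\<^esub> y" "x \<otimes>\<^bsub>p.P\<^esub> y = x \<otimes>\<^bsub>q.P\<^esub> y" "\<one>\<^bsub>p.P\<^esub> = \<one>\<^bsub>q.P\<^esub>" for x y
    unfolding mpoly_ring_def by simp_all
  have incl: "(\<lambda>x. x) \<in> ring_hom p.P q.P"
    by (rule ring_hom_memI) (use sub ops in auto)
  have var_p: "p.var i \<in> carrier p.P" if "i < n" for i using that by (intro p.mon_closed) auto
  have var_p': "p.var i \<in> carrier p'.P" if "i < n'" for i using that by (intro p'.mon_closed) auto
  have var_q: "p.var i \<in> carrier q.P" if "i < n + n'" for i using that by (intro q.mon_closed) auto
  interpret e': mpoly_eval R q.P n' "poly_const R" "\<lambda>i. p.var (n + i)"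
    by unfold_locales (use q.const_hom var_q in auto)
  have \<iota>'_const: "e'.ev (poly_const R r) = poly_const R r" if "r \<in> carrier R" for r
    by (rule e'.ev_const[OF that])
  have \<iota>'_var: "e'.ev (p.var i) = p.var (n + i)" if "i < n'" for i
    by (rule e'.ev_var[OF that])
  define g where "g = compose (carrier R) left f"
  have g_eq: "g r = left (f r)" if "r \<in> carrier R" for r using that by (simp add: g_def compose_def)
  have g: "g \<in> ring_hom R TR"
    unfolding g_def using compose_ring_maps R.ring_axioms f left_hom ring_mapsD by metis
  define v where "v i = (if i < n then left (\<phi> (p.var i)) else right (\<phi>' (p.var (i - n))))" for i
  have v1: "v i = left (\<phi> (p.var i))" if "i < n" for i using that by (simp add: v_def)
  have v2: "v (n + i) = right (\<phi>' (p.var i))" for i by (simp add: v_def)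
  interpret \<Phi>: mpoly_eval R TR "n + n'" g v
    by unfold_locales (use g var_p var_p' in \<open>auto simp: v_def\<close>)
  interpret \<Phi>h: ring_hom_cring q.P TR \<Phi>.ev by (rule ring_hom_cringI'[OF q.P_cring TR_cring \<Phi>.ev_hom])
  have \<Phi>_incl: "\<Phi>.ev x = left (\<phi> x)" if "x \<in> carrier p.P" for x
  proof -
    have "(\<Phi>.ev \<circ> (\<lambda>x. x)) x = (left \<circ> \<phi>) x"
    proof (rule p.hom_unique[OF TR_cring _ _ _ _ that])
      show "\<Phi>.ev \<circ> (\<lambda>x. x) \<in> ring_hom p.P TR" by (rule ring_hom_trans[OF incl \<Phi>.ev_hom])
      show "left \<circ> \<phi> \<in> ring_hom p.P TR" by (rule ring_hom_trans[OF \<phi>(1) ring_mapsD[OF left_hom]])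
    qed (auto simp: \<Phi>.ev_const \<Phi>.ev_var \<phi>(3) g_eq v1)
    then show ?thesis by simp
  qed
  have \<Phi>_\<iota>': "\<Phi>.ev (e'.ev x) = right (\<phi>' x)" if "x \<in> carrier p'.P" for x
  proof -
    have "(\<Phi>.ev \<circ> e'.ev) x = (right \<circ> \<phi>') x"
    proof (rule p'.hom_unique[OF TR_cring _ _ _ _ that])
      show "\<Phi>.ev \<circ> e'.ev \<in> ring_hom p'.P TR" by (rule ring_hom_trans[OF e'.ev_hom \<Phi>.ev_hom])
      show "right \<circ> \<phi>' \<in> ring_hom p'.P TR" by (rule ring_hom_trans[OF \<phi>'(1) ring_mapsD[OF right_hom]])
    qed (auto simp: \<Phi>.ev_const \<Phi>.ev_var e'.ev_const e'.ev_var \<phi>'(3) g_eq v2 left_right)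
    then show ?thesis by simp
  qed
  have surj: "\<Phi>.ev ` carrier q.P = carrier TR"
  proof
    show "\<Phi>.ev ` carrier q.P \<subseteq> carrier TR" by auto
    have "z \<in> \<Phi>.ev ` carrier q.P" if "z \<in> carrier tp.T" for z
      using that
    proof (induction rule: tp.T_induct)
      case zero
      have "\<zero>\<^bsub>tp.T\<^esub> = \<Phi>.ev \<zero>\<^bsub>q.P\<^esub>" using \<Phi>h.hom_zero by (simp add: TR_simps)
      then show ?case by blast
    next
      case (pure a b)
      then have "a \<in> \<phi> ` carrier p.P" "b \<in> \<phi>' ` carrier p'.P" unfolding \<phi>(2) \<phi>'(2) by simp_all
      then obtain x y where xy: "x \<in> carrier p.P" "y \<in> carrier p'.P" "a = \<phi> x" "b = \<phi>' y"
        by blast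
      have "tp.pt a b = \<Phi>.ev x \<otimes>\<^bsub>TR\<^esub> \<Phi>.ev (e'.ev y)"
        using pure xy by (simp add: pt_eq_mult \<Phi>_incl \<Phi>_\<iota>')
      also have "\<dots> = \<Phi>.ev (x \<otimes>\<^bsub>q.P\<^esub> e'.ev y)" using xy sub e'.ev_closed by simp
      finally show ?case using imageI[OF q.mult_closed[OF sub[OF xy(1)] e'.ev_closed[OF xy(2)]], of \<Phi>.ev] by simp
    next
      case (diff y z)
      then obtain a b where ab: "a \<in> carrier q.P" "b \<in> carrier q.P" "y = \<Phi>.ev a" "z = \<Phi>.ev b" by blast
      then have "y \<ominus>\<^bsub>TR\<^esub> z = \<Phi>.ev (a \<ominus>\<^bsub>q.P\<^esub> b)" by (simp add: a_minus_def)
      then show ?case using ab unfolding TR_minus by blast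
    qed
    then show "carrier TR \<subseteq> \<Phi>.ev ` carrier q.P" by (auto simp: TR_simps(1))
  qed
  define F'' where "F'' = F \<union> e'.ev ` F'"
  have F''q: "F'' \<subseteq> carrier q.P" unfolding F''_def using F(2) F'(2) sub e'.ev_closed by blast
  define I where "I = Idl\<^bsub>q.P\<^esub> F''"
  have I: "ideal I q.P" unfolding I_def by (rule q.P.genideal_ideal[OF F''q])
  interpret I: ideal I q.P by (rule I)
  define Q where "Q = q.P Quot I"
  have Q: "cring Q" unfolding Q_def by (rule I.quotient_is_cring[OF q.P_cring])
  let ?p = "\<lambda>x. I +>\<^bsub>q.P\<^esub> x"
  have \<pi>: "?p \<in> ring_hom q.P Q" unfolding Q_def by (rule I.rcos_ring_hom)
  interpret \<pi>: ring_hom_cring q.P Q ?p by (rule ring_hom_cringI'[OF q.P_cring Q \<pi>])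
  have \<pi>_zero: "?p x = \<zero>\<^bsub>Q\<^esub> \<longleftrightarrow> x \<in> I" if "x \<in> carrier q.P" for x
    using q.P.quot_eq_iff[OF I that q.P.zero_closed] \<pi>.hom_zero that by (simp add: a_minus_def)
  have F''I: "F'' \<subseteq> I" unfolding I_def by (rule q.P.genideal_self[OF F''q])
  obtain \<alpha> where \<alpha>: "\<alpha> \<in> ring_hom S Q" "\<And>x. x \<in> carrier p.P \<Longrightarrow> \<alpha> (\<phi> x) = ?p x"
  proof (rule factor_through_presentation[OF p.P_cring S Q \<phi>(1,2) F(2,3)])
    show "?p \<in> ring_hom p.P Q" using ring_hom_trans[OF incl \<pi>] by (simp add: comp_def)
    show "?p x = \<zero>\<^bsub>Q\<^esub>" if "x \<in> F" for x
      using that F''I sub F(2) \<pi>_zero unfolding F''_def by blast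
  qed blast
  obtain \<beta> where \<beta>: "\<beta> \<in> ring_hom S' Q" "\<And>x. x \<in> carrier p'.P \<Longrightarrow> \<beta> (\<phi>' x) = ?p (e'.ev x)"
  proof (rule factor_through_presentation[OF p'.P_cring S' Q \<phi>'(1,2) F'(2,3)])
    show "(\<lambda>x. ?p (e'.ev x)) \<in> ring_hom p'.P Q" using ring_hom_trans[OF e'.ev_hom \<pi>] by (simp add: comp_def)
    show "?p (e'.ev x) = \<zero>\<^bsub>Q\<^esub>" if "x \<in> F'" for x
      using that F''I F'(2) \<pi>_zero e'.ev_closed unfolding F''_def by blast
  qed blast
  have const_p: "poly_const R r \<in> carrier p.P" "poly_const R r \<in> carrier p'.P" if "r \<in> carrier R" for r
    using that by (simp_all add: p.poly_const_eq p.mon_closed p'.mon_closed)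
  have "\<alpha> (f r) = \<beta> (f' r)" if "r \<in> carrier R" for r
    using \<alpha>(2)[OF const_p(1)[OF that]] \<beta>(2)[OF const_p(2)[OF that]] that by (simp add: \<phi>(3) \<phi>'(3) \<iota>'_const)
  then obtain u where u: "u \<in> ring_hom TR Q" "\<And>s. s \<in> carrier S \<Longrightarrow> u (left s) = \<alpha> s"
    "\<And>s. s \<in> carrier S' \<Longrightarrow> u (right s) = \<beta> s"
    using pushout[OF Q \<alpha>(1) \<beta>(1)] by blast
  interpret u: ring_hom_cring TR Q u by (rule ring_hom_cringI'[OF TR_cring Q u(1)])
  have u\<Phi>: "u (\<Phi>.ev x) = ?p x" if "x \<in> carrier q.P" for x
  proof -
    have "(u \<circ> \<Phi>.ev) x = ?p x"
    proof (rule q.hom_unique[OF Q _ \<pi> _ _ that])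
      show "u \<circ> \<Phi>.ev \<in> ring_hom q.P Q" by (rule ring_hom_trans[OF \<Phi>.ev_hom u(1)])
      show "(u \<circ> \<Phi>.ev) (poly_const R r) = ?p (poly_const R r)" if "r \<in> carrier R" for r
        using that \<alpha>(2)[OF const_p(1)[OF that]] by (simp add: \<Phi>.ev_const g_eq u(2) \<phi>(3))
      show "(u \<circ> \<Phi>.ev) (p.var i) = ?p (p.var i)" if "i < n + n'" for i
      proof (cases "i < n")
        case True
        then show ?thesis using that var_p[OF True] by (simp add: \<Phi>.ev_var v1 u(2) \<alpha>(2))
      next
        case False
        then have i: "i - n < n'" "n + (i - n) = i" using that by auto
        then show ?thesis using that var_p'[OF i(1)] v2[of "i - n"] \<iota>'_var[OF i(1)] 
          by (simp add: \<Phi>.ev_var u(3) \<beta>(2))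
      qed
    qed
    then show ?thesis by simp
  qed
  have "a_kernel q.P TR \<Phi>.ev = I"
  proof
    show "a_kernel q.P TR \<Phi>.ev \<subseteq> I"
    proof
      fix x assume "x \<in> a_kernel q.P TR \<Phi>.ev"
      then have x: "x \<in> carrier q.P" "\<Phi>.ev x = \<zero>\<^bsub>TR\<^esub>" unfolding a_kernel_def' by blast+
      have "?p x = u (\<Phi>.ev x)" by (rule u\<Phi>[OF x(1), symmetric])
      also have "\<dots> = \<zero>\<^bsub>Q\<^esub>" unfolding x(2) by (rule u.hom_zero)
      finally have "?p x = \<zero>\<^bsub>Q\<^esub>" .
      then show "x \<in> I" using \<pi>_zero[OF x(1)] by simp
    qed
    have F0: "\<phi> x = \<zero>\<^bsub>S\<^esub>" if "x \<in> F" for x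
      using that p.P.genideal_self[OF F(2)] unfolding F(3)[symmetric] a_kernel_def' by blast
    have F0': "\<phi>' x = \<zero>\<^bsub>S'\<^esub>" if "x \<in> F'" for x
      using that p'.P.genideal_self[OF F'(2)] unfolding F'(3)[symmetric] a_kernel_def' by blast
    have F''0: "\<Phi>.ev x = \<zero>\<^bsub>TR\<^esub>" if "x \<in> F''" for x
    proof -
      consider "x \<in> F" | y where "y \<in> F'" "x = e'.ev y" using \<open>x \<in> F''\<close> unfolding F''_def by blast
      then show ?thesis
      proof cases
        case 1 then show ?thesis using F(2) F0 by (subst \<Phi>_incl) auto
      next
        case 2 then show ?thesis using F'(2) F0' by (simp add: \<Phi>_\<iota>' subset_iff)
      qed
    qed
    show "I \<subseteq> a_kernel q.P TR \<Phi>.ev"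
      unfolding I_def
    proof (rule q.P.genideal_minimal[OF ring_hom_kernel_ideal[OF q.P_cring TR_cring \<Phi>.ev_hom]])
      show "F'' \<subseteq> a_kernel q.P TR \<Phi>.ev" using F''0 F''q unfolding a_kernel_def' by blast
    qed
  qed
  moreover have "finite F''" unfolding F''_def using F(1) F'(1) by simp
  ultimately show ?thesis
    unfolding finitely_presented_map_def I_def g_def[symmetric]
    using \<Phi>.ev_hom surj \<Phi>.ev_const F''q unfolding I_def by (intro exI[of _ "n + n'"] exI[of _ \<Phi>.ev] exI[of _ F'']) simp
qed

subsection \<open>Trivial covers and intersections\<close>

lemma ident_ring_maps: "ring R \<Longrightarrow> (\<lambda>x\<in>carrier R. x) \<in> ring_maps R R"
  by (auto simp: ring_maps_def ring_def abelian_group_def intro!: ring_hom_memI monoid.m_closed monoid.one_closed abelian_monoid.a_closed)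

text \<open>Under \<open>M \<otimes> R = M\<close> and \<open>N \<otimes> R = N\<close>, the map \<open>h \<otimes> R\<close> is \<open>h\<close>; \<open>\<rho>\<close> and \<open>\<rho>'\<close> are these isomorphisms.\<close>

lemma flat_ident:
  fixes R :: "'u ring"
  assumes inf: "infinite (UNIV :: 'u set)" and R: "cring R"
  shows "flat_map R R (\<lambda>x\<in>carrier R. x)"
proof (rule flat_mapI[OF inf R R])
  interpret R: cring R by fact
  define i where "i = (\<lambda>x\<in>carrier R. x)"
  have i_eq [simp]: "i r = r" if "r \<in> carrier R" for r using that by (simp add: i_def)
  have i: "i \<in> ring_hom R R" unfolding i_def by (rule ring_mapsD[OF ident_ring_maps[OF R.ring_axioms]])
  then show "(\<lambda>x\<in>carrier R. x) \<in> ring_hom R R" by (simp add: i_def)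
  fix M N :: "('u, 'u) module" and h
  assume M: "module R M" "module R N" "h \<in> linear_maps R M N" "inj_on h (carrier M)"
  interpret M: module R M by fact
  interpret N: module R N by fact
  interpret A: module R "algebra_module R i" by (rule module_algebra_module[OF R R i])
  interpret h: tensor_pair_map R M "algebra_module R i" N h by unfold_locales (rule inf M)+
  have bal: "balanced R M (algebra_module R i) M (\<lambda>m r. r \<odot>\<^bsub>M\<^esub> m)"
    by (auto simp: balanced_def M.smult_r_distr M.smult_l_distr M.smult_assoc1[symmetric] R.m_comm)
  obtain \<rho> where \<rho>: "\<rho> \<in> hom (add_monoid h.T) (add_monoid M)"
      "\<And>m r. m \<in> carrier M \<Longrightarrow> r \<in> carrier R \<Longrightarrow> \<rho> (h.pt m r) = r \<odot>\<^bsub>M\<^esub> m"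
    using h.universal[OF M.abelian_group_axioms bal] by auto
  have bal': "balanced R N (algebra_module R i) N (\<lambda>m r. r \<odot>\<^bsub>N\<^esub> m)"
    by (auto simp: balanced_def N.smult_r_distr N.smult_l_distr N.smult_assoc1[symmetric] R.m_comm)
  obtain \<rho>' where \<rho>': "\<rho>' \<in> hom (add_monoid h.P.T) (add_monoid N)"
      "\<And>m r. m \<in> carrier N \<Longrightarrow> r \<in> carrier R \<Longrightarrow> \<rho>' (h.P.pt m r) = r \<odot>\<^bsub>N\<^esub> m"
    using h.P.universal[OF N.abelian_group_axioms bal'] by auto
  interpret \<rho>: abelian_group_hom h.T M \<rho> by (rule h.hom_of_abelian[OF M.abelian_group_axioms \<rho>(1)])
  let ?h = "tensor_map R N (algebra_module R i) h"
  have hh: "h \<in> hom (add_monoid M) (add_monoid N)" using M(3) by (simp add: linear_maps_def)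
  have nat: "\<rho>' (?h z) = h (\<rho> z)" if "z \<in> carrier h.T" for z
  proof -
    have "(\<rho>' \<circ> ?h) z = (h \<circ> \<rho>) z"
      by (rule h.hom_eqI[OF N.abelian_group_axioms hom_compose[OF h.tensor_map_hom \<rho>'(1)] hom_compose[OF \<rho>(1) hh] _ that])
         (simp add: h.tensor_map_pure \<rho>(2) \<rho>'(2) linear_mapsD[OF M(3)])
    then show ?thesis by simp
  qed
  have ret: "h.pt (\<rho> z) \<one>\<^bsub>R\<^esub> = z" if "z \<in> carrier h.T" for z
  proof -
    have p: "abelian_group_hom M h.T (\<lambda>m. h.pt m \<one>\<^bsub>R\<^esub>)"
      by (intro abelian_group_homI M.abelian_group_axioms h.T.abelian_group_axioms group_hom.intro
        group_hom_axioms.intro M.a_group h.T.a_group) (auto simp: hom_def h.pt_add_left)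
    interpret p: abelian_group_hom M h.T "\<lambda>m. h.pt m \<one>\<^bsub>R\<^esub>" by (rule p)
    show ?thesis using that
    proof (induction rule: h.T_induct)
      case (pure m r)
      then show ?case using h.pt_smult[of r m "\<one>\<^bsub>R\<^esub>"] by (simp add: \<rho>(2))
    next
      case (diff z z') then show ?case by (simp add: a_minus_def)
    qed simp
  qed
  have "inj_on ?h (carrier h.T)"
  proof (rule inj_onI)
    fix z z' assume z: "z \<in> carrier h.T" "z' \<in> carrier h.T" "?h z = ?h z'"
    then have "h (\<rho> z) = h (\<rho> z')" using nat by metis
    then have "\<rho> z = \<rho> z'" using M(4) z by (auto simp: inj_on_def)
    then show "z = z'" using ret z by metis
  qed
  then show "inj_on (tensor_map R N (algebra_module R (\<lambda>x\<in>carrier R. x)) h)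
       (carrier (tensor R M (algebra_module R (\<lambda>x\<in>carrier R. x))))"
    unfolding i_def .
qed

lemma finitely_presented_ident:
  assumes R: "cring R"
  shows "finitely_presented_map R R (\<lambda>x\<in>carrier R. x)"
proof -
  interpret R: cring R by fact
  let ?i = "\<lambda>x\<in>carrier R. x"
  interpret e: mpoly_eval R R 0 ?i "\<lambda>_. undefined"
    by unfold_locales (use ring_mapsD[OF ident_ring_maps[OF R.ring_axioms]] in auto)
  interpret eh: ring_hom_cring e.P R e.ev by (rule ring_hom_cringI'[OF e.P_cring R e.ev_hom])
  have const: "p = poly_const R (p {#})" if "p \<in> carrier e.P" for p
  proof
    fix m show "p m = poly_const R (p {#}) m"
    proof (cases "m = {#}")
      case False
      then have "\<not> set_mset m \<subseteq> {..<0}" by auto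
      then have "p m = \<zero>\<^bsub>R\<^esub>" using that unfolding e.P_carrier by blast
      then show ?thesis using False by (simp add: poly_const_def)
    qed (simp add: poly_const_def)
  qed
  have cc: "poly_const R r \<in> carrier e.P" if "r \<in> carrier R" for r 
    using that e.const_hom by (auto simp: ring_hom_def)
  have "a_kernel e.P R e.ev = {\<zero>\<^bsub>e.P\<^esub>}"
  proof -
    have "p = \<zero>\<^bsub>e.P\<^esub>" if p: "p \<in> carrier e.P" "e.ev p = \<zero>\<^bsub>R\<^esub>" for p
    proof -
      have "e.ev p = p {#}" 
        using arg_cong[OF const[OF p(1)], of e.ev] e.ev_const[OF e.P_coeff[OF p(1), of "{#}"]]
          e.P_coeff[OF p(1), of "{#}"] by (metis restrict_apply')
      then have z: "p {#} = \<zero>\<^bsub>R\<^esub>" using p(2) by simp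
      have "p m = \<zero>\<^bsub>R\<^esub>" for m
        using fun_cong[OF const[OF p(1)], of m] z by (simp add: poly_const_def split: if_splits)
      then show ?thesis by (auto simp: e.P_ops)
    qed
    then show ?thesis unfolding a_kernel_def' using e.P.zero_closed eh.hom_zero by blast
  qed
  moreover have "e.ev ` carrier e.P = carrier R"
  proof
    show "carrier R \<subseteq> e.ev ` carrier e.P"
    proof
      fix r assume r: "r \<in> carrier R"
      then have "e.ev (poly_const R r) = r" using e.ev_const by simp
      then show "r \<in> e.ev ` carrier e.P" using cc[OF r] by (metis imageI)
    qed
  qed auto
  ultimately show ?thesis
    unfolding finitely_presented_map_def using e.ev_hom e.ev_const e.P.genideal_zero
    by (intro exI[of _ 0] exI[of _ e.ev] exI[of _ "{\<zero>\<^bsub>e.P\<^esub>}"]) simp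
qed

lemma fppf_sieve_arrows:
  fixes R :: "'u ring"
  assumes inf: "infinite (UNIV :: 'u set)" and R: "cring R"
  shows "fppf_sieve R (arrows R)"
proof -
  interpret R: cring R by fact
  let ?C = "{(R, \<lambda>x\<in>carrier R. x)}"
  have C: "?C \<subseteq> arrows R" using ident_ring_maps[OF R.ring_axioms] R by (simp add: arrows_def)
  have "fppf_family R ?C"
    unfolding fppf_family_def using C flat_ident[OF inf R] finitely_presented_ident[OF R]
    by (auto intro!: exI simp: primeideal.axioms(1)[THEN ideal.Icarr] dest: primeideal.axioms(1)[THEN ideal.Icarr] cong: conj_cong)
  moreover have "sieve R (arrows R)"
    unfolding sieve_def arrows_def
    using compose_ring_maps[OF R.ring_axioms] ring_mapsD by fastforce
  ultimately show ?thesis unfolding fppf_sieve_def using C by blast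
qed

text \<open>The tensor products of the members of two covering families form a covering family, contained
  in both sieves.\<close>

lemma fppf_sieve_Int:
  fixes R :: "'u ring"
  assumes inf: "infinite (UNIV :: 'u set)" and R: "cring R" and U: "fppf_sieve R U" and V: "fppf_sieve R V"
  shows "fppf_sieve R (U \<inter> V)"
proof -
  interpret R: cring R by fact
  obtain C C' where C: "C \<subseteq> U" "fppf_family R C" and C': "C' \<subseteq> V" "fppf_family R C'"
    using U V unfolding fppf_sieve_def by blast
  have sU: "sieve R U" and sV: "sieve R V" using U V by (simp_all add: fppf_sieve_def)
  define t where "t = (\<lambda>((S, f), (S', f')). (tensor_ring R S f S' f', compose (carrier R) (tensor_algebras.left R S S' f f') f))"
  let ?D = "t ` (C \<times> C')"
  have D: "(T, g) \<in> U \<inter> V \<and> flat_map R T g \<and> finitely_presented_map R T g" 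
    if "(S, f) \<in> C" "(S', f') \<in> C'" "(T, g) = t ((S, f), (S', f'))" for S f S' f' T g
  proof -
    note S = fppf_familyD[OF C(2) that(1)] and S' = fppf_familyD[OF C'(2) that(2)]
    interpret t: tensor_algebras R S S' f f' by (intro tensor_algebras.intro inf R S S')
    have T: "T = t.TR" "g = compose (carrier R) t.left f" using that(3) by (simp_all add: t_def)
    have "(t.TR, t.left) \<in> arrows S" "(t.TR, t.right) \<in> arrows S'"
      using t.left_hom t.right_hom t.TR_cring by (simp_all add: arrows_def)
    moreover have "(S, f) \<in> U" "(S', f') \<in> V" using that C C' by auto
    ultimately have "(t.TR, compose (carrier R) t.left f) \<in> U" "(t.TR, compose (carrier R) t.right f') \<in> V"
      using sU sV unfolding sieve_def by blast+
    moreover have "finitely_presented_map R S f" "finitely_presented_map R S' f'"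
      using that C C' by (auto simp: fppf_family_def)
    ultimately show ?thesis
      using t.flat_tensor_ring[OF S(3) S'(3)] t.finitely_presented_tensor_ring
      unfolding T t.left_f_eq by simp
  qed
  have "fppf_family R ?D"
    unfolding fppf_family_def
  proof (intro conjI allI impI)
    show "finite ?D" using C C' by (simp add: fppf_family_def)
    show "?D \<subseteq> arrows R" using D sU unfolding sieve_def by fastforce
    show "\<forall>(S, f)\<in>?D. flat_map R S f \<and> finitely_presented_map R S f" using D by fastforce
    fix P assume P: "primeideal P R"
    obtain S f Q where S: "(S, f) \<in> C" "primeideal Q S" "P = {r \<in> carrier R. f r \<in> Q}"
      using C P unfolding fppf_family_def by blast
    obtain S' f' Q' where S': "(S', f') \<in> C'" "primeideal Q' S'" "P = {r \<in> carrier R. f' r \<in> Q'}"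
      using C' P unfolding fppf_family_def by blast
    note h = fppf_familyD[OF C(2) S(1)] and h' = fppf_familyD[OF C'(2) S'(1)]
    interpret t: tensor_algebras R S S' f f' by (intro tensor_algebras.intro inf R h h')
    obtain Q'' where Q'': "primeideal Q'' t.TR" "P = {r \<in> carrier R. t.left (f r) \<in> Q''}"
      using t.prime_over_pair[OF h'(3) P S(2,3) S'(2,3)] by blast
    have "(t.TR, compose (carrier R) t.left f) \<in> ?D"
      using S(1) S'(1) by (intro image_eqI[of _ _ "((S, f), (S', f'))"]) (auto simp: t_def)
    moreover have "P = {r \<in> carrier R. compose (carrier R) t.left f r \<in> Q''}"
      unfolding Q''(2) by (auto simp: compose_def)
    ultimately show "\<exists>(S, f)\<in>?D. \<exists>Q. primeideal Q S \<and> P = {r \<in> carrier R. f r \<in> Q}"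
      using Q''(1) by (intro bexI[of _ "(t.TR, compose (carrier R) t.left f)"]) auto
  qed
  moreover have "?D \<subseteq> U \<inter> V" using D by fastforce
  moreover have "sieve R (U \<inter> V)" using sU sV unfolding sieve_def by fast
  ultimately show ?thesis unfolding fppf_sieve_def by blast
qed

section \<open>Sheafification of a presheaf that is already a sheaf\<close>

text \<open>A presheaf \<open>P\<close> with isomorphisms \<open>\<psi>\<close> to a group functor \<open>H\<close> whose points are elements of the ring, such that
  restriction is application of the ring map and membership in \<open>H\<close> is fppf local. By descent \<open>H\<close> is a
  sheaf, so \<open>P\<close> is one, and its sheafification is isomorphic to \<open>H\<close>.\<close>

locale sheaf_comparison =
  fixes P :: "('u, 'g) group_functor" and H :: "('u, 'u) group_functor" and \<psi> :: "'u ring \<Rightarrow> 'g \<Rightarrow> 'u"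
  assumes infinite_UNIV: "infinite (UNIV :: 'u set)"
    and iso: "cring R \<Longrightarrow> \<psi> R \<in> iso (grp P R) (grp H R)"
    and mult_P: "cring R \<Longrightarrow> x \<in> carrier (grp P R) \<Longrightarrow> y \<in> carrier (grp P R) \<Longrightarrow>
      x \<otimes>\<^bsub>grp P R\<^esub> y \<in> carrier (grp P R)"
    and res_P: "cring R \<Longrightarrow> (S, f) \<in> arrows R \<Longrightarrow> x \<in> carrier (grp P R) \<Longrightarrow>
      res P R S f x \<in> carrier (grp P S) \<and> \<psi> S (res P R S f x) = f (\<psi> R x)"
    and H_carrier: "cring R \<Longrightarrow> carrier (grp H R) \<subseteq> carrier R"
    and res_H: "res H R S f u = f u"
    and hom_H: "cring R \<Longrightarrow> (S, f) \<in> arrows R \<Longrightarrow> u \<in> carrier (grp H R) \<Longrightarrow> v \<in> carrier (grp H R) \<Longrightarrow>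
      f u \<in> carrier (grp H S) \<and> f (u \<otimes>\<^bsub>grp H R\<^esub> v) = f u \<otimes>\<^bsub>grp H S\<^esub> f v"
    and local_H: "cring R \<Longrightarrow> fppf_sieve R U \<Longrightarrow> u \<in> carrier R \<Longrightarrow>
      (\<And>S f. (S, f) \<in> U \<Longrightarrow> f u \<in> carrier (grp H S)) \<Longrightarrow> u \<in> carrier (grp H R)"
begin

lemma arrow_cring: "(S, f) \<in> arrows R \<Longrightarrow> cring S"
  by (simp add: arrows_def)

lemma arrow_carrier: "(S, f) \<in> arrows R \<Longrightarrow> x \<in> carrier R \<Longrightarrow> f x \<in> carrier S"
  by (auto simp: arrows_def ring_maps_def ring_hom_def)

lemma sieve_arrow: "fppf_sieve R U \<Longrightarrow> (S, f) \<in> U \<Longrightarrow> (S, f) \<in> arrows R"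
  by (auto simp: fppf_sieve_def sieve_def)

lemma sieve_compose: "fppf_sieve R U \<Longrightarrow> (S, f) \<in> U \<Longrightarrow> (T, g) \<in> arrows S \<Longrightarrow> (T, compose (carrier R) g f) \<in> U"
  by (auto simp: fppf_sieve_def sieve_def)

lemma arrow_compose: 
  "cring R \<Longrightarrow> (S, f) \<in> arrows R \<Longrightarrow> (T, g) \<in> arrows S \<Longrightarrow> (T, compose (carrier R) g f) \<in> arrows R"
  using compose_ring_maps[of R f S g T] by (simp add: arrows_def ring_mapsD cring.axioms(1))

lemma \<psi>_inj: "cring R \<Longrightarrow> x \<in> carrier (grp P R) \<Longrightarrow> y \<in> carrier (grp P R) \<Longrightarrow> \<psi> R x = \<psi> R y \<Longrightarrow> x = y"
  using iso[of R] by (auto simp: iso_def bij_betw_def inj_on_def)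

lemma \<psi>_closed: "cring R \<Longrightarrow> x \<in> carrier (grp P R) \<Longrightarrow> \<psi> R x \<in> carrier (grp H R)"
  using iso[of R] by (auto simp: iso_def bij_betw_def)

lemma \<psi>_mult: "cring R \<Longrightarrow> x \<in> carrier (grp P R) \<Longrightarrow> y \<in> carrier (grp P R) \<Longrightarrow>
    \<psi> R (x \<otimes>\<^bsub>grp P R\<^esub> y) = \<psi> R x \<otimes>\<^bsub>grp H R\<^esub> \<psi> R y"
  using iso[of R] by (auto simp: iso_def hom_def)

lemma separated:
  fixes R :: "'u ring"
  assumes "cring R" "fppf_sieve R U" "s \<in> carrier R" "t \<in> carrier R" 
    and "\<And>S f. (S, f) \<in> U \<Longrightarrow> f s = f t"
  shows "s = t"
proof -
  obtain C where "C \<subseteq> U" "fppf_family R C" using assms(2) by (auto simp: fppf_sieve_def)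
  then show ?thesis using fppf_separated[OF infinite_UNIV assms(1) _ assms(3,4), of C] assms(5) by blast
qed

lemma locally_equal_iff:
  assumes R: "cring R" and x: "x \<in> carrier (grp P R)" "y \<in> carrier (grp P R)"
  shows "locally_equal P R x y \<longleftrightarrow> x = y"
proof
  assume "locally_equal P R x y"
  then obtain U where U: "fppf_sieve R U" "\<And>S f. (S, f) \<in> U \<Longrightarrow> res P R S f x = res P R S f y"
    unfolding locally_equal_def by blast
  have "f (\<psi> R x) = f (\<psi> R y)" if "(S, f) \<in> U" for S f
    using U(2)[OF that] res_P[OF R sieve_arrow[OF U(1) that]] x by metis
  then have "\<psi> R x = \<psi> R y"
    using separated[OF R U(1)] \<psi>_closed[OF R] x H_carrier[OF R] by blast
  then show "x = y" using \<psi>_inj[OF R] x by blast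
next
  assume "x = y"
  then show "locally_equal P R x y"
    unfolding locally_equal_def using fppf_sieve_arrows[OF infinite_UNIV R] by blast
qed

text \<open>The element \<open>s\<close> induces the local section \<open>(U, x)\<close>.\<close>

definition glues :: "'u \<Rightarrow> ('u, 'g) local_section \<Rightarrow> bool" where
  "glues s = (\<lambda>(U, x). \<forall>(S, f) \<in> U. x (S, f) \<in> carrier (grp P S) \<and> \<psi> S (x (S, f)) = f s)"

lemma gluesD: 
  assumes "glues s (U, x)" "(S, f) \<in> U" 
  shows "x (S, f) \<in> carrier (grp P S)" "\<psi> S (x (S, f)) = f s"
  using assms by (auto simp: glues_def)

lemma local_sectionI:
  assumes R: "cring R" and U: "fppf_sieve R U" and s: "s \<in> carrier R" and x: "glues s (U, x)"
  shows "(U, x) \<in> local_sections P R"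
proof -
  have xP: "x (S, f) \<in> carrier (grp P S)" "\<psi> S (x (S, f)) = f s" if "(S, f) \<in> U" for S f
    using gluesD[OF x that] by simp_all
  have "locally_equal P T (x (T, compose (carrier R) g f)) (res P S T g (x (S, f)))"
    if Sf: "(S, f) \<in> U" and g: "(T, g) \<in> arrows S" for S f T g
  proof -
    note a = sieve_arrow[OF U Sf] and c = sieve_compose[OF U Sf g]
    note r = res_P[OF arrow_cring[OF a] g xP(1)[OF Sf]]
    have "\<psi> T (x (T, compose (carrier R) g f)) = \<psi> T (res P S T g (x (S, f)))"
      using xP(2)[OF c] r xP(2)[OF Sf] s by (simp add: compose_def)
    then show ?thesis
      using locally_equal_iff[OF arrow_cring[OF g] xP(1)[OF c]] r \<psi>_inj[OF arrow_cring[OF g] xP(1)[OF c]] by blast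
  qed
  then show ?thesis using U xP unfolding local_sections_def by blast
qed

text \<open>Descent gives an element inducing the section on a covering family, and on that family enlarged by any one
  arrow of \<open>U\<close>; by uniqueness all these elements coincide.\<close>

lemma local_sectionD:
  assumes R: "cring R" and x: "(U, x) \<in> local_sections P R"
  shows "fppf_sieve R U \<and> (\<exists>s \<in> carrier (grp H R). glues s (U, x))"
proof -
  have U: "fppf_sieve R U" and xP: "\<And>S f. (S, f) \<in> U \<Longrightarrow> x (S, f) \<in> carrier (grp P S)"
    and eq: "\<And>S f T g. (S, f) \<in> U \<Longrightarrow> (T, g) \<in> arrows S \<Longrightarrow>
       locally_equal P T (x (T, compose (carrier R) g f)) (res P S T g (x (S, f)))"
    using x unfolding local_sections_def by blast+
  obtain C where C: "C \<subseteq> U" "fppf_family R C" and sU: "sieve R U" using U by (auto simp: fppf_sieve_def)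
  define y where "y = (\<lambda>(S, f). \<psi> S (x (S, f)))"
  have y: "y (S, f) \<in> carrier (grp H S)" "y (S, f) \<in> carrier S" if "(S, f) \<in> U" for S f
    using \<psi>_closed[OF arrow_cring[OF sieve_arrow[OF U that]] xP[OF that]] H_carrier[OF arrow_cring[OF sieve_arrow[OF U that]]]
    unfolding y_def by auto
  have comp: "y (T, compose (carrier R) g f) = g (y (S, f))" if "(S, f) \<in> U" "(T, g) \<in> arrows S" for S f T g
  proof -
    note r = res_P[OF arrow_cring[OF sieve_arrow[OF U that(1)]] that(2) xP[OF that(1)]]
    have "x (T, compose (carrier R) g f) = res P S T g (x (S, f))"
      using eq[OF that] locally_equal_iff[OF arrow_cring[OF that(2)] xP[OF sieve_compose[OF U that]]] r by blast
    then show ?thesis using r by (simp add: y_def)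
  qed
  have ex: "\<exists>s \<in> carrier R. \<forall>(S, f) \<in> J. f s = y (S, f)" if "finite J" "C \<subseteq> J" "J \<subseteq> U" for J
    by (rule fppf_descent[OF infinite_UNIV R C(2) that sU y(2) comp])
  have finC: "finite C" using C(2) by (simp add: fppf_family_def)
  obtain s where s: "s \<in> carrier R" "\<And>S f. (S, f) \<in> C \<Longrightarrow> f s = y (S, f)"
    using ex[OF finC order_refl C(1)] by blast
  have sy: "f s = y (S, f)" if "(S, f) \<in> U" for S f
  proof -
    obtain t where t: "t \<in> carrier R" "\<And>S' f'. (S', f') \<in> insert (S, f) C \<Longrightarrow> f' t = y (S', f')"
      using ex[of "insert (S, f) C"] finC C(1) \<open>(S, f) \<in> U\<close> by blast
    have "s = t" by (rule fppf_separated[OF infinite_UNIV R C(2) s(1) t(1)]) (use s t in auto)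
    then show ?thesis using t(2) by blast
  qed
  have "s \<in> carrier (grp H R)" by (rule local_H[OF R U s(1)]) (use sy y(1) in auto)
  moreover have "glues s (U, x)" using sy xP by (auto simp: glues_def y_def)
  ultimately show ?thesis using U by blast
qed

lemma glues_unique:
  assumes "cring R" "fppf_sieve R W" "W \<subseteq> U \<inter> V" "s \<in> carrier R" "t \<in> carrier R" 
    "glues s (U, x)" "glues t (V, y)" "\<And>S f. (S, f) \<in> W \<Longrightarrow> x (S, f) = y (S, f)"
  shows "s = t"
proof (rule separated[OF assms(1,2,4,5)])
  fix S f assume Sf: "(S, f) \<in> W"
  then have "f s = \<psi> S (x (S, f))" "f t = \<psi> S (y (S, f))" using assms(3) gluesD(2)[OF assms(6)] gluesD(2)[OF assms(7)] by auto
  then show "f s = f t" using assms(8)[OF Sf] by simp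
qed

text \<open>The local sections induced by \<open>s\<close>; these are the classes of the sheafification.\<close>

definition glued :: "'u ring \<Rightarrow> 'u \<Rightarrow> ('u, 'g) local_section set" where
  "glued R s = {z \<in> local_sections P R. glues s z}"

lemma section_class_subset:
  assumes R: "cring R" and s: "s \<in> carrier R" and x: "glues s (U, x)"
  shows "section_class P R (U, x) \<subseteq> glued R s"
proof
  fix z assume z: "z \<in> section_class P R (U, x)"
  obtain V y where zv: "z = (V, y)" by (cases z)
  obtain W where y: "(V, y) \<in> local_sections P R" and W: "fppf_sieve R W" "W \<subseteq> U \<inter> V"
    "\<And>S f. (S, f) \<in> W \<Longrightarrow> locally_equal P S (x (S, f)) (y (S, f))"
    using z unfolding section_class_def zv by blast
  obtain t where t: "t \<in> carrier (grp H R)" "glues t (V, y)" using local_sectionD[OF R y] by blast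
  have "x (S, f) = y (S, f)" if "(S, f) \<in> W" for S f
    using locally_equal_iff[OF arrow_cring[OF sieve_arrow[OF W(1) that]], of "x (S, f)" "y (S, f)"] W(3)[OF that]
      gluesD(1)[OF x] gluesD(1)[OF t(2)] W(2) that by blast
  then have "s = t" using glues_unique[OF R W(1,2) s _ x t(2)] t(1) H_carrier[OF R] by blast
  then show "z \<in> glued R s" using y t zv by (simp add: glued_def)
qed

lemma section_class_eq:
  assumes R: "cring R" and U: "fppf_sieve R U" and s: "s \<in> carrier R" and x: "glues s (U, x)"
  shows "section_class P R (U, x) = glued R s"
proof
  show "section_class P R (U, x) \<subseteq> glued R s" by (rule section_class_subset[OF R s x])
  show "glued R s \<subseteq> section_class P R (U, x)"
  proof
    fix z assume z: "z \<in> glued R s"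
    obtain V y where zv: "z = (V, y)" by (cases z)
    have y: "(V, y) \<in> local_sections P R" "glues s (V, y)" using z zv by (auto simp: glued_def)
    then have V: "fppf_sieve R V" using local_sectionD[OF R] by blast
    have "locally_equal P S (x (S, f)) (y (S, f))" if "(S, f) \<in> U \<inter> V" for S f
    proof -
      have S: "cring S" using arrow_cring sieve_arrow U that by blast
      have "x (S, f) \<in> carrier (grp P S)" "y (S, f) \<in> carrier (grp P S)" "\<psi> S (x (S, f)) = \<psi> S (y (S, f))"
        using gluesD[OF x] gluesD[OF y(2)] that by auto
      then show ?thesis using locally_equal_iff[OF S] \<psi>_inj[OF S] by blast
    qed
    then show "z \<in> section_class P R (U, x)"
      unfolding section_class_def zv using y fppf_sieve_Int[OF infinite_UNIV R U V] by blast
  qed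
qed

text \<open>The local section induced by \<open>s\<close> on the maximal sieve.\<close>

definition constant_section :: "'u ring \<Rightarrow> 'u \<Rightarrow> ('u, 'g) local_section" where
  "constant_section R s = (arrows R, \<lambda>(S, f). inv_into (carrier (grp P S)) (\<psi> S) (f s))"

lemma \<psi>_inv:
  assumes "cring S" "t \<in> carrier (grp H S)"
  shows "inv_into (carrier (grp P S)) (\<psi> S) t \<in> carrier (grp P S)" "\<psi> S (inv_into (carrier (grp P S)) (\<psi> S) t) = t"
  using iso[OF assms(1)] assms(2) inv_into_into[of t "\<psi> S" "carrier (grp P S)"] f_inv_into_f[of t "\<psi> S" "carrier (grp P S)"]
  by (auto simp: iso_def bij_betw_def)

lemma constant_section_glued:
  assumes R: "cring R" and s: "s \<in> carrier (grp H R)"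
  shows "constant_section R s \<in> glued R s"
proof -
  have "f s \<in> carrier (grp H S)" if "(S, f) \<in> arrows R" for S f
    using hom_H[OF R that s s] by blast
  then have "glues s (constant_section R s)"
    using \<psi>_inv arrow_cring by (fastforce simp: constant_section_def glues_def)
  then show ?thesis
    using local_sectionI[OF R fppf_sieve_arrows[OF infinite_UNIV R]] s H_carrier[OF R]
    unfolding glued_def constant_section_def by blast
qed

lemma gluedD:
  assumes R: "cring R" and "(U, x) \<in> glued R s"
  shows "fppf_sieve R U" "glues s (U, x)" 
  using local_sectionD[OF R, of U x] assms by (auto simp: glued_def)

lemma glued_inj:
  assumes R: "cring R" and s: "s \<in> carrier (grp H R)" "t \<in> carrier (grp H R)" and eq: "glued R s = glued R t"
  shows "s = t"
proof -
  obtain U x where Ux: "constant_section R s = (U, x)" by (cases "constant_section R s")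
  then have "(U, x) \<in> glued R s" "(U, x) \<in> glued R t" using constant_section_glued[OF R s(1)] eq by simp_all
  then show ?thesis
    using glues_unique[OF R gluedD(1)[OF R], of U x s U U s t x x] gluedD[OF R] s H_carrier[OF R] by blast
qed

lemma sheaf_carrier:
  assumes R: "cring R"
  shows "section_class P R ` local_sections P R = glued R ` carrier (grp H R)"
proof
  show "section_class P R ` local_sections P R \<subseteq> glued R ` carrier (grp H R)"
    using local_sectionD[OF R] section_class_eq[OF R] H_carrier[OF R] by fast
  show "glued R ` carrier (grp H R) \<subseteq> section_class P R ` local_sections P R"
  proof
    fix A assume "A \<in> glued R ` carrier (grp H R)"
    then obtain s where s: "s \<in> carrier (grp H R)" "A = glued R s" by blast
    obtain U x where Ux: "constant_section R s = (U, x)" by (cases "constant_section R s")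
    have x: "(U, x) \<in> glued R s" using constant_section_glued[OF R s(1)] Ux by simp
    then have "A = section_class P R (U, x)"
      using section_class_eq[OF R gluedD(1)[OF R x] _ gluedD(2)[OF R x]] s H_carrier[OF R] by blast
    then show "A \<in> section_class P R ` local_sections P R" using x by (auto simp: glued_def)
  qed
qed

lemma mult_H: 
  assumes R: "cring R" and s: "s \<in> carrier (grp H R)" "t \<in> carrier (grp H R)"
  shows "s \<otimes>\<^bsub>grp H R\<^esub> t \<in> carrier (grp H R)"
  using \<psi>_mult[OF R \<psi>_inv(1)[OF R s(1)] \<psi>_inv(1)[OF R s(2)]] \<psi>_inv[OF R s(1)] \<psi>_inv[OF R s(2)]
    \<psi>_closed[OF R mult_P[OF R]] by metis

abbreviation Sh where "Sh \<equiv> fppf_sheafification P"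

lemma sheaf_mult:
  assumes R: "cring R" and s: "s \<in> carrier (grp H R)" "t \<in> carrier (grp H R)"
  shows "glued R s \<otimes>\<^bsub>grp Sh R\<^esub> glued R t = glued R (s \<otimes>\<^bsub>grp H R\<^esub> t)"
proof -
  have key: "section_class P R (U \<inter> V, \<lambda>(S, f). x (S, f) \<otimes>\<^bsub>grp P S\<^esub> y (S, f)) = glued R (s \<otimes>\<^bsub>grp H R\<^esub> t)"
    if x: "(U, x) \<in> glued R s" and y: "(V, y) \<in> glued R t" for U x V y
  proof (rule section_class_eq[OF R fppf_sieve_Int[OF infinite_UNIV R gluedD(1)[OF R x] gluedD(1)[OF R y]]])
    show "s \<otimes>\<^bsub>grp H R\<^esub> t \<in> carrier R" using mult_H[OF R s] H_carrier[OF R] by blast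
    have "x (S, f) \<otimes>\<^bsub>grp P S\<^esub> y (S, f) \<in> carrier (grp P S) \<and>
       \<psi> S (x (S, f) \<otimes>\<^bsub>grp P S\<^esub> y (S, f)) = f (s \<otimes>\<^bsub>grp H R\<^esub> t)" if "(S, f) \<in> U \<inter> V" for S f
    proof -
      have a: "(S, f) \<in> arrows R" using sieve_arrow[OF gluedD(1)[OF R x]] that by blast
      note S = arrow_cring[OF a]
      have "x (S, f) \<in> carrier (grp P S)" "\<psi> S (x (S, f)) = f s" "y (S, f) \<in> carrier (grp P S)" "\<psi> S (y (S, f)) = f t"
        using gluesD[OF gluedD(2)[OF R x]] gluesD[OF gluedD(2)[OF R y]] that by auto
      then show ?thesis using mult_P[OF S] \<psi>_mult[OF S] hom_H[OF R a s] by simp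
    qed
    then show "glues (s \<otimes>\<^bsub>grp H R\<^esub> t) (U \<inter> V, \<lambda>(S, f). x (S, f) \<otimes>\<^bsub>grp P S\<^esub> y (S, f))"
      by (auto simp: glues_def)
  qed
  have "glued R s \<otimes>\<^bsub>grp Sh R\<^esub> glued R t = (\<Union>(U, x) \<in> glued R s. \<Union>(V, y) \<in> glued R t.
     section_class P R (U \<inter> V, \<lambda>(S, f). x (S, f) \<otimes>\<^bsub>grp P S\<^esub> y (S, f)))"
    by (simp add: fppf_sheafification_def)
  also have "\<dots> = (\<Union>z \<in> glued R s. \<Union>w \<in> glued R t. glued R (s \<otimes>\<^bsub>grp H R\<^esub> t))"
    using key by (intro SUP_cong refl) (auto simp: split_paired_all)
  also have "\<dots> = glued R (s \<otimes>\<^bsub>grp H R\<^esub> t)"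
    using constant_section_glued[OF R s(1)] constant_section_glued[OF R s(2)] by auto
  finally show ?thesis .
qed

lemma sheaf_res:
  assumes R: "cring R" and a: "(S, f) \<in> arrows R" and s: "s \<in> carrier (grp H R)"
  shows "res Sh R S f (glued R s) = glued S (f s)"
proof -
  note S = arrow_cring[OF a]
  have sR: "s \<in> carrier R" using s H_carrier[OF R] by blast
  have fs: "f s \<in> carrier S" using arrow_carrier[OF a sR] .
  let ?pull = "\<lambda>(U, x). ({(T, g) \<in> arrows S. (T, compose (carrier R) g f) \<in> U}, \<lambda>(T, g). x (T, compose (carrier R) g f))"
  have gl: "glues (f s) (?pull (U, x))" if "glues s (U, x)" for U x
    using that sR by (fastforce simp: glues_def compose_def)
  have "res Sh R S f (glued R s) = (\<Union>z \<in> glued R s. section_class P S (?pull z))"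
    by (simp add: fppf_sheafification_def case_prod_unfold)
  also have "\<dots> = glued S (f s)"
  proof
    show "(\<Union>z \<in> glued R s. section_class P S (?pull z)) \<subseteq> glued S (f s)"
    proof (rule UN_least)
      fix z assume z: "z \<in> glued R s"
      obtain U x where zU: "z = (U, x)" by (cases z)
      show "section_class P S (?pull z) \<subseteq> glued S (f s)"
        unfolding zU prod.case
        by (rule section_class_subset[OF S fs]) (use gl[of U x] z zU in \<open>simp add: glued_def\<close>)
    qed
    have c: "constant_section R s \<in> glued R s" by (rule constant_section_glued[OF R s])
    have "{(T, g) \<in> arrows S. (T, compose (carrier R) g f) \<in> arrows R} = arrows S"
      using arrow_compose[OF R a] by auto
    then obtain y where y: "?pull (constant_section R s) = (arrows S, y)"
      by (simp add: constant_section_def)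
    have "glues (f s) (arrows S, y)"
      using gl[of "fst (constant_section R s)" "snd (constant_section R s)"] c y by (simp add: glued_def)
    then have "section_class P S (?pull (constant_section R s)) = glued S (f s)"
      unfolding y by (rule section_class_eq[OF S fppf_sieve_arrows[OF infinite_UNIV S] fs])
    then show "glued S (f s) \<subseteq> (\<Union>z \<in> glued R s. section_class P S (?pull z))" using c by blast
  qed
  finally show ?thesis .
qed

theorem sheafification_isomorphic: "isomorphic_functors (fppf_sheafification P) H"
proof -
  define \<Phi> where "\<Phi> = (\<lambda>R. inv_into (carrier (grp H R)) (glued R))"
  have inj: "inj_on (glued R) (carrier (grp H R))" if "cring R" for R
    using glued_inj[OF that] by (auto simp: inj_on_def)
  have \<Phi>: "\<Phi> R (glued R s) = s" if "cring R" "s \<in> carrier (grp H R)" for R s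
    unfolding \<Phi>_def by (rule inv_into_f_f[OF inj[OF that(1)] that(2)])
  have carr: "carrier (grp Sh R) = glued R ` carrier (grp H R)" if "cring R" for R
    using sheaf_carrier[OF that] by (simp add: fppf_sheafification_def)
  have "\<Phi> R \<in> iso (grp Sh R) (grp H R)" if R: "cring R" for R
  proof -
    have "\<Phi> R \<in> hom (grp Sh R) (grp H R)"
      by (rule homI) (auto simp: carr[OF R] \<Phi>[OF R] sheaf_mult[OF R] mult_H[OF R])
    moreover have "bij_betw (\<Phi> R) (carrier (grp Sh R)) (carrier (grp H R))"
      unfolding \<Phi>_def carr[OF R] by (rule bij_betw_inv_into) (simp add: bij_betw_def inj[OF R])
    ultimately show ?thesis by (simp add: iso_def)
  qed
  moreover have "\<Phi> S (res Sh R S f A) = res H R S f (\<Phi> R A)"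
    if R: "cring R" and a: "(S, f) \<in> arrows R" and A: "A \<in> carrier (grp Sh R)" for R S f A
  proof -
    obtain s where s: "s \<in> carrier (grp H R)" "A = glued R s" using A carr[OF R] by blast
    then show ?thesis using hom_H[OF R a s(1) s(1)]
      by (simp add: sheaf_res[OF R a] \<Phi>[OF R] \<Phi>[OF arrow_cring[OF a]] res_H)
  qed
  ultimately show ?thesis unfolding isomorphic_functors_def by (intro exI[of _ \<Phi>]) auto
qed

end

section \<open>Matrices preserving a binary norm form\<close>

text \<open>Used to prove \<open>x = y\<close> when \<open>x - y\<close> is, by a polynomial identity, equal to a combination \<open>z\<close> of known relations.\<close>

lemma (in cring) eq_of_diff:
  assumes "x \<ominus> y \<ominus> z = \<zero>" "z = \<zero>" "x \<in> carrier R" "y \<in> carrier R"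
  shows "x = y"
proof -
  have "x \<ominus> y = \<zero>" using assms by (simp add: a_minus_def)
  then show ?thesis using assms by (simp add: diff_eq_zero_iff)
qed

context cring
begin

text \<open>Polynomial identities: \<open>x\<close> and \<open>y\<close> are values at \<open>xs\<close> of polynomial expressions \<open>P\<close> and \<open>Q\<close> with the same
  normal form. The rules \<open>reify\<close> construct \<open>P\<close> and \<open>Q\<close> from the shape of \<open>x\<close> and \<open>y\<close>, a variable being
  replaced by its position in \<open>xs\<close>; the normal forms are computed with \<open>poly_norm\<close>.\<close>

lemma ring_eqI:
  assumes "in_carrier xs" "Ipolex xs P = x" "Ipolex xs Q = y" "norm P = norm Q"
  shows "x = y"
  using norm_eq[OF assms(1,4)] assms(2,3) by simp

lemma reify:
  "Ipolex xs P = x \<Longrightarrow> Ipolex xs Q = y \<Longrightarrow> Ipolex xs (Add P Q) = x \<oplus> y"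
  "Ipolex xs P = x \<Longrightarrow> Ipolex xs Q = y \<Longrightarrow> Ipolex xs (Sub P Q) = x \<ominus> y"
  "Ipolex xs P = x \<Longrightarrow> Ipolex xs Q = y \<Longrightarrow> Ipolex xs (Mul P Q) = x \<otimes> y"
  "Ipolex xs P = x \<Longrightarrow> Ipolex xs (Neg P) = \<ominus> x"
  "Ipolex xs (Const 0) = \<zero>" "Ipolex xs (Const 1) = \<one>" "Ipolex xs (Const i) = \<guillemotleft>i\<guillemotright>"
  "Ipolex (x # xs) (Var 0) = x"
  "Ipolex xs (Var n) = x \<Longrightarrow> Ipolex (y # xs) (Var (Suc n)) = x"
  by simp_all

end

lemmas poly_norm = mkPinj_def mkPX_def sub_def

text \<open>The binary form \<open>q(x, y) = x\<^sup>2 + e x y + k y\<^sup>2\<close>, the norm of \<open>x + y \<omega>\<close> where \<open>\<omega>\<^sup>2 = e \<omega> - k\<close>.\<close>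

locale quad = cring R for R :: "('a, 'b) ring_scheme" (structure) +
  fixes e k assumes e [simp]: "e \<in> carrier R" and k [simp]: "k \<in> carrier R"
begin

definition q :: "'a \<Rightarrow> 'a \<Rightarrow> 'a" where
  "q x y = x \<otimes> x \<oplus> e \<otimes> (x \<otimes> y) \<oplus> k \<otimes> (y \<otimes> y)"

text \<open>The product of multiplication by \<open>a + b \<omega>\<close> and of the matrix with columns \<open>(1, 0)\<close> and \<open>(u, t)\<close>.
  As everywhere, \<open>(a, b', b, d)\<close> is the matrix with rows \<open>(a, b')\<close> and \<open>(b, d)\<close>.\<close>

definition par :: "'a \<Rightarrow> 'a \<Rightarrow> 'a \<Rightarrow> 'a \<Rightarrow> 'a \<times> 'a \<times> 'a \<times> 'a" where
  "par a b u t = (a, a \<otimes> u \<ominus> k \<otimes> b \<otimes> t, b, b \<otimes> u \<oplus> (a \<oplus> e \<otimes> b) \<otimes> t)"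

text \<open>The parameters \<open>u\<close> and \<open>t\<close> of a matrix whose first column has norm one; \<open>t\<close> is the determinant.\<close>

definition upart :: "'a \<times> 'a \<times> 'a \<times> 'a \<Rightarrow> 'a" where
  "upart = (\<lambda>(a, b', b, d). (a \<oplus> e \<otimes> b) \<otimes> b' \<oplus> k \<otimes> b \<otimes> d)"

definition tpart :: "'a \<times> 'a \<times> 'a \<times> 'a \<Rightarrow> 'a" where
  "tpart = (\<lambda>(a, b', b, d). a \<otimes> d \<ominus> b' \<otimes> b)"

text \<open>The conditions on \<open>(u, t)\<close> used below: by the first two, the matrix with columns \<open>(1, 0)\<close> and
  \<open>(u, t)\<close> preserves the form. The others serve to multiply and to invert the matrices
  \<open>par a b u t\<close>. All of them hold for the pairs \<open>sgm\<close> (see \<open>sgm_aut\<close>).\<close>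

definition aut :: "'a \<Rightarrow> 'a \<Rightarrow> bool" where
  "aut u t \<longleftrightarrow> u \<otimes> u \<oplus> e \<otimes> u \<otimes> t \<oplus> k \<otimes> t \<otimes> t = k \<and> u \<oplus> u \<oplus> e \<otimes> t = e \<and>
     u \<otimes> u \<ominus> k \<otimes> t \<otimes> t = e \<otimes> u \<ominus> k \<and> u \<otimes> t \<oplus> u \<otimes> t \<oplus> e \<otimes> t \<otimes> t = e \<otimes> t \<and> t \<otimes> t = \<one> \<and> u \<oplus> u \<otimes> t = \<zero>"

lemma q_closed [simp]: "x \<in> carrier R \<Longrightarrow> y \<in> carrier R \<Longrightarrow> q x y \<in> carrier R"
  by (simp add: q_def)

text \<open>The action of \<open>par a b u t\<close> on a vector: multiplication by \<open>a + b \<omega>\<close> multiplies norms.\<close>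

lemma q_par:
  assumes [simp]: "a \<in> carrier R" "b \<in> carrier R" "u \<in> carrier R" "t \<in> carrier R" "x \<in> carrier R" "y \<in> carrier R"
  shows "q (a \<otimes> x \<oplus> (a \<otimes> u \<ominus> k \<otimes> b \<otimes> t) \<otimes> y) (b \<otimes> x \<oplus> (b \<otimes> u \<oplus> (a \<oplus> e \<otimes> b) \<otimes> t) \<otimes> y) =
     q a b \<otimes> q (x \<oplus> u \<otimes> y) (t \<otimes> y)"
  unfolding q_def by (rule ring_eqI[of "[a, b, u, t, x, y, e, k]"], simp add: in_carrier_def, (rule reify)+, simp add: poly_norm)

lemma q_aut:
  assumes [simp]: "u \<in> carrier R" "t \<in> carrier R" "x \<in> carrier R" "y \<in> carrier R" and "aut u t"
  shows "q (x \<oplus> u \<otimes> y) (t \<otimes> y) = q x y"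
proof (rule eq_of_diff)
  let ?z = "x \<otimes> y \<otimes> (u \<oplus> u \<oplus> e \<otimes> t \<ominus> e) \<oplus> y \<otimes> y \<otimes> (u \<otimes> u \<oplus> e \<otimes> u \<otimes> t \<oplus> k \<otimes> t \<otimes> t \<ominus> k)"
  show "q (x \<oplus> u \<otimes> y) (t \<otimes> y) \<ominus> q x y \<ominus> ?z = \<zero>"
    unfolding q_def by (rule ring_eqI[of "[u, t, x, y, e, k]"], simp add: in_carrier_def, (rule reify)+, simp add: poly_norm)
  show "?z = \<zero>" using assms(5) unfolding aut_def by (simp add: a_minus_def r_neg)
qed simp_all

text \<open>A matrix is recovered from its first column, of norm one, and the parameters \<open>u\<close> and \<open>t\<close>.\<close>

lemma par_parts:
  assumes [simp]: "a \<in> carrier R" "b' \<in> carrier R" "b \<in> carrier R" "d \<in> carrier R" and q: "q a b = \<one>"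
  shows "(a, b', b, d) = par a b (upart (a, b', b, d)) (tpart (a, b', b, d))"
proof -
  have "a \<otimes> ((a \<oplus> e \<otimes> b) \<otimes> b' \<oplus> k \<otimes> b \<otimes> d) \<ominus> k \<otimes> b \<otimes> (a \<otimes> d \<ominus> b' \<otimes> b) \<ominus> q a b \<otimes> b' = \<zero>"
    unfolding q_def by (rule ring_eqI[of "[a, b', b, d, e, k]"], simp add: in_carrier_def, (rule reify)+, simp add: poly_norm)
  then have 1: "a \<otimes> ((a \<oplus> e \<otimes> b) \<otimes> b' \<oplus> k \<otimes> b \<otimes> d) \<ominus> k \<otimes> b \<otimes> (a \<otimes> d \<ominus> b' \<otimes> b) = b'"
    by (simp add: diff_eq_zero_iff q)
  have "b \<otimes> ((a \<oplus> e \<otimes> b) \<otimes> b' \<oplus> k \<otimes> b \<otimes> d) \<oplus> (a \<oplus> e \<otimes> b) \<otimes> (a \<otimes> d \<ominus> b' \<otimes> b) \<ominus> q a b \<otimes> d = \<zero>"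
    unfolding q_def by (rule ring_eqI[of "[a, b', b, d, e, k]"], simp add: in_carrier_def, (rule reify)+, simp add: poly_norm)
  then have 2: "b \<otimes> ((a \<oplus> e \<otimes> b) \<otimes> b' \<oplus> k \<otimes> b \<otimes> d) \<oplus> (a \<oplus> e \<otimes> b) \<otimes> (a \<otimes> d \<ominus> b' \<otimes> b) = d"
    by (simp add: diff_eq_zero_iff q)
  show ?thesis using 1 2 by (simp add: par_def upart_def tpart_def)
qed

lemma upart_par:
  assumes [simp]: "a \<in> carrier R" "b \<in> carrier R" "u \<in> carrier R" "t \<in> carrier R" and q: "q a b = \<one>"
  shows "upart (par a b u t) = u"
proof -
  have "(a \<oplus> e \<otimes> b) \<otimes> (a \<otimes> u \<ominus> k \<otimes> b \<otimes> t) \<oplus> k \<otimes> b \<otimes> (b \<otimes> u \<oplus> (a \<oplus> e \<otimes> b) \<otimes> t) \<ominus> q a b \<otimes> u = \<zero>"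
    unfolding q_def by (rule ring_eqI[of "[a, b, u, t, e, k]"], simp add: in_carrier_def, (rule reify)+, simp add: poly_norm)
  then show ?thesis by (simp add: diff_eq_zero_iff q par_def upart_def)
qed

lemma tpart_par:
  assumes [simp]: "a \<in> carrier R" "b \<in> carrier R" "u \<in> carrier R" "t \<in> carrier R" and q: "q a b = \<one>"
  shows "tpart (par a b u t) = t"
proof -
  have "a \<otimes> (b \<otimes> u \<oplus> (a \<oplus> e \<otimes> b) \<otimes> t) \<ominus> (a \<otimes> u \<ominus> k \<otimes> b \<otimes> t) \<otimes> b \<ominus> q a b \<otimes> t = \<zero>"
    unfolding q_def by (rule ring_eqI[of "[a, b, u, t, e, k]"], simp add: in_carrier_def, (rule reify)+, simp add: poly_norm)
  then show ?thesis by (simp add: diff_eq_zero_iff q par_def tpart_def)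
qed

text \<open>The components of the vector obtained by applying \<open>par a b u t\<close> to \<open>(x, y)\<close>.\<close>

definition fst_mul where "fst_mul a b u t x y = a \<otimes> x \<oplus> (a \<otimes> u \<ominus> k \<otimes> b \<otimes> t) \<otimes> y"
definition snd_mul where "snd_mul a b u t x y = b \<otimes> x \<oplus> (b \<otimes> u \<oplus> (a \<oplus> e \<otimes> b) \<otimes> t) \<otimes> y"

text \<open>The second column of \<open>par a b u t\<close> times \<open>par x y v s\<close>. The product is again of the form \<open>par\<close>, with first
  column \<open>(fst_mul a b u t x y, snd_mul a b u t x y)\<close> and parameters \<open>v + u s\<close> and \<open>t s\<close>.\<close>

lemma par_mult_second:
  assumes [simp]: "a \<in> carrier R" "b \<in> carrier R" "u \<in> carrier R" "t \<in> carrier R" 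
    "x \<in> carrier R" "y \<in> carrier R" "v \<in> carrier R" "s \<in> carrier R" and aut: "aut u t"
  shows "a \<otimes> (x \<otimes> v \<ominus> k \<otimes> y \<otimes> s) \<oplus> (a \<otimes> u \<ominus> k \<otimes> b \<otimes> t) \<otimes> (y \<otimes> v \<oplus> (x \<oplus> e \<otimes> y) \<otimes> s) =
      fst_mul a b u t x y \<otimes> (v \<oplus> u \<otimes> s) \<ominus> k \<otimes> snd_mul a b u t x y \<otimes> (t \<otimes> s)" (is "?L1 = ?R1")
    "b \<otimes> (x \<otimes> v \<ominus> k \<otimes> y \<otimes> s) \<oplus> (b \<otimes> u \<oplus> (a \<oplus> e \<otimes> b) \<otimes> t) \<otimes> (y \<otimes> v \<oplus> (x \<oplus> e \<otimes> y) \<otimes> s) =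
      snd_mul a b u t x y \<otimes> (v \<oplus> u \<otimes> s) \<oplus> (fst_mul a b u t x y \<oplus> e \<otimes> snd_mul a b u t x y) \<otimes> (t \<otimes> s)" (is "?L2 = ?R2")
proof -
  let ?r1 = "(u \<otimes> u \<ominus> k \<otimes> t \<otimes> t) \<ominus> (e \<otimes> u \<ominus> k)"
  let ?r2 = "(u \<otimes> t \<oplus> u \<otimes> t \<oplus> e \<otimes> t \<otimes> t) \<ominus> e \<otimes> t"
  have r1: "?r1 = \<zero>" and r2: "?r2 = \<zero>" 
    using aut unfolding aut_def by (simp_all add: diff_eq_zero_iff)
  show "?L1 = ?R1"
  proof (rule eq_of_diff)
    show "?L1 \<ominus> ?R1 \<ominus> (k \<otimes> b \<otimes> y \<otimes> s \<otimes> ?r2 \<ominus> a \<otimes> y \<otimes> s \<otimes> ?r1) = \<zero>"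
      unfolding fst_mul_def snd_mul_def by (rule ring_eqI[of "[a, b, u, t, x, y, v, s, e, k]"], simp add: in_carrier_def, (rule reify)+, simp add: poly_norm)
    show "k \<otimes> b \<otimes> y \<otimes> s \<otimes> ?r2 \<ominus> a \<otimes> y \<otimes> s \<otimes> ?r1 = \<zero>" unfolding r1 r2 by (simp add: a_minus_def)
  qed (simp_all add: fst_mul_def snd_mul_def)
  show "?L2 = ?R2"
  proof (rule eq_of_diff)
    show "?L2 \<ominus> ?R2 \<ominus> (\<ominus> (b \<otimes> y \<otimes> s \<otimes> ?r1 \<oplus> (a \<oplus> e \<otimes> b) \<otimes> y \<otimes> s \<otimes> ?r2)) = \<zero>"
      unfolding fst_mul_def snd_mul_def by (rule ring_eqI[of "[a, b, u, t, x, y, v, s, e, k]"], simp add: in_carrier_def, (rule reify)+, simp add: poly_norm)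
    show "\<ominus> (b \<otimes> y \<otimes> s \<otimes> ?r1 \<oplus> (a \<oplus> e \<otimes> b) \<otimes> y \<otimes> s \<otimes> ?r2) = \<zero>" unfolding r1 r2 by simp
  qed (simp_all add: fst_mul_def snd_mul_def)
qed

text \<open>The first column of the inverse of \<open>par a b u t\<close>, up to the factor \<open>q a b\<close>: the conjugate of \<open>a + b \<omega>\<close>, moved by \<open>(u, t)\<close>.\<close>

lemma conj_mul:
  assumes [simp]: "a \<in> carrier R" "b \<in> carrier R" "u \<in> carrier R" "t \<in> carrier R" and aut: "aut u t"
  shows "fst_mul a b u t ((a \<oplus> e \<otimes> b) \<ominus> u \<otimes> b) (\<ominus> (t \<otimes> b)) = q a b"
    "snd_mul a b u t ((a \<oplus> e \<otimes> b) \<ominus> u \<otimes> b) (\<ominus> (t \<otimes> b)) = \<zero>"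
proof -
  have r: "t \<otimes> t = \<one>" "u \<oplus> u \<otimes> t = \<zero>" using aut by (simp_all add: aut_def)
  have z: "t \<otimes> t \<ominus> \<one> = \<zero>" by (simp add: r diff_eq_zero_iff)
  show "fst_mul a b u t ((a \<oplus> e \<otimes> b) \<ominus> u \<otimes> b) (\<ominus> (t \<otimes> b)) = q a b"
  proof (rule eq_of_diff)
    show "fst_mul a b u t ((a \<oplus> e \<otimes> b) \<ominus> u \<otimes> b) (\<ominus> (t \<otimes> b)) \<ominus> q a b \<ominus>
       (k \<otimes> b \<otimes> b \<otimes> (t \<otimes> t \<ominus> \<one>) \<ominus> a \<otimes> b \<otimes> (u \<oplus> u \<otimes> t)) = \<zero>"
      unfolding fst_mul_def q_def by (rule ring_eqI[of "[a, b, u, t, e, k]"], simp add: in_carrier_def, (rule reify)+, simp add: poly_norm)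
    show "k \<otimes> b \<otimes> b \<otimes> (t \<otimes> t \<ominus> \<one>) \<ominus> a \<otimes> b \<otimes> (u \<oplus> u \<otimes> t) = \<zero>"
      unfolding z r(2) by (simp add: a_minus_def)
  qed (simp_all add: fst_mul_def)
  show "snd_mul a b u t ((a \<oplus> e \<otimes> b) \<ominus> u \<otimes> b) (\<ominus> (t \<otimes> b)) = \<zero>"
  proof (rule eq_of_diff)
    show "snd_mul a b u t ((a \<oplus> e \<otimes> b) \<ominus> u \<otimes> b) (\<ominus> (t \<otimes> b)) \<ominus> \<zero> \<ominus>
       (\<ominus> ((a \<oplus> e \<otimes> b) \<otimes> b \<otimes> (t \<otimes> t \<ominus> \<one>) \<oplus> b \<otimes> b \<otimes> (u \<oplus> u \<otimes> t))) = \<zero>"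
      unfolding snd_mul_def by (rule ring_eqI[of "[a, b, u, t, e, k]"], simp add: in_carrier_def, (rule reify)+, simp add: poly_norm)
  qed (simp_all add: z r(2) snd_mul_def)
qed

end

section \<open>The orthogonal group over a ring\<close>

subsection \<open>Integer multiples\<close>

lemma (in cring) add_pow_nat_eq: "x \<in> carrier R \<Longrightarrow> [(n::nat)] \<cdot> x = \<guillemotleft>n\<guillemotright>\<^sub>\<nat> \<otimes> x"
proof (induction n)
  case 0 then show ?case by simp
next
  case (Suc n)
  then show ?case by (simp add: l_distr a_comm)
qed

lemma (in cring) add_pow_int_eq: "x \<in> carrier R \<Longrightarrow> [(i::int)] \<cdot> x = \<guillemotleft>i\<guillemotright> \<otimes> x"
  by (cases "i \<ge> 0") (simp_all add: add_pow_int_ge add_pow_int_lt add_pow_nat_eq of_integer_def l_minus)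

lemma (in ring_hom_cring) hom_of_nat: "h (\<guillemotleft>n\<guillemotright>\<^sub>\<nat>\<^bsub>R\<^esub>) = \<guillemotleft>n\<guillemotright>\<^sub>\<nat>\<^bsub>S\<^esub>"
  by (induction n) simp_all

lemma (in ring_hom_cring) hom_of_int: "h (\<guillemotleft>i\<guillemotright>\<^bsub>R\<^esub>) = \<guillemotleft>i\<guillemotright>\<^bsub>S\<^esub>"
  by (simp add: of_integer_def hom_of_nat)

lemma rational_algebra_unit:
  fixes R (structure)
  assumes "cring R" "rational_algebra R" "i \<noteq> 0"
  shows "\<guillemotleft>i\<guillemotright> \<in> Units R"
proof -
  interpret cring R by fact
  have n: "\<guillemotleft>nat \<bar>i\<bar>\<guillemotright>\<^sub>\<nat> \<in> Units R"
  proof -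
    have "[nat \<bar>i\<bar>] \<cdot> \<one> \<in> Units R" using assms(2,3) unfolding rational_algebra_def by simp
    then show ?thesis by (simp add: add_pow_nat_eq)
  qed
  show ?thesis
  proof (cases "i \<ge> 0")
    case True then show ?thesis using n by (simp add: of_integer_def)
  next
    case False 
    then have "\<guillemotleft>i\<guillemotright> = (\<ominus> \<one>) \<otimes> \<guillemotleft>nat \<bar>i\<bar>\<guillemotright>\<^sub>\<nat>" by (simp add: of_integer_def l_minus)
    moreover have "\<ominus> \<one> \<in> Units R"
      unfolding Units_def by (auto intro!: bexI[of _ "\<ominus> \<one>"] simp: l_minus)
    ultimately show ?thesis using n by simp
  qed
qed

lemma (in cring) unit_cancel_zero:
  assumes "a \<in> Units R" "x \<in> carrier R" "a \<otimes> x = \<zero>"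
  shows "x = \<zero>"
  using assms by (metis Units_closed Units_l_cancel r_null zero_closed)

lemma rational_algebra_hom:
  assumes "rational_algebra R" "cring R" "cring S" "h \<in> ring_hom R S"
  shows "rational_algebra S"
  unfolding rational_algebra_def
proof (intro allI impI)
  interpret ring_hom_cring R S h by (rule ring_hom_cringI'[OF assms(2-4)])
  fix n :: nat assume "n > 0"
  then have "[n] \<cdot>\<^bsub>R\<^esub> \<one>\<^bsub>R\<^esub> \<in> Units R" using assms by (simp add: rational_algebra_def)
  then have "\<guillemotleft>n\<guillemotright>\<^sub>\<nat>\<^bsub>R\<^esub> \<in> Units R" by (simp add: R.add_pow_nat_eq)
  then obtain y where "y \<in> carrier R" "y \<otimes>\<^bsub>R\<^esub> \<guillemotleft>n\<guillemotright>\<^sub>\<nat>\<^bsub>R\<^esub> = \<one>\<^bsub>R\<^esub>" by (auto simp: Units_def)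
  then have "h y \<otimes>\<^bsub>S\<^esub> \<guillemotleft>n\<guillemotright>\<^sub>\<nat>\<^bsub>S\<^esub> = \<one>\<^bsub>S\<^esub>" "h y \<in> carrier S"
    using hom_mult[of y "\<guillemotleft>n\<guillemotright>\<^sub>\<nat>\<^bsub>R\<^esub>"] hom_of_nat by simp_all
  then have "\<guillemotleft>n\<guillemotright>\<^sub>\<nat>\<^bsub>S\<^esub> \<in> Units S" using S.m_comm[of "h y" "\<guillemotleft>n\<guillemotright>\<^sub>\<nat>\<^bsub>S\<^esub>"] by (auto simp: Units_def)
  then show "[n] \<cdot>\<^bsub>S\<^esub> \<one>\<^bsub>S\<^esub> \<in> Units S" by (simp add: S.add_pow_nat_eq)
qed

subsection \<open>The two cases\<close>

text \<open>The norm form is \<open>x\<^sup>2 + e x y + k y\<^sup>2\<close> with \<open>e = form_e\<close> and \<open>k = form_k\<close>, the image of the integer \<open>form_int\<close>.\<close>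

definition form_e :: "int \<Rightarrow> nat \<Rightarrow> ('a, 'b) ring_scheme \<Rightarrow> 'a" where
  "form_e d m R = (if case_I d m then \<one>\<^bsub>R\<^esub> else \<zero>\<^bsub>R\<^esub>)"

definition form_int :: "int \<Rightarrow> nat \<Rightarrow> int" where
  "form_int d m = (if case_I d m then c_const d m else - c_const d m)"

definition form_k :: "int \<Rightarrow> nat \<Rightarrow> ('a, 'b) ring_scheme \<Rightarrow> 'a" where
  "form_k d m R = \<guillemotleft>form_int d m\<guillemotright>\<^bsub>R\<^esub>"

text \<open>The pairs \<open>(u, t)\<close> allowed in the schematic closure. In Case (I) they correspond to the idempotents \<open>u\<close>,
  in Case (II) to the square roots \<open>t\<close> of 1.\<close>

definition sgm :: "int \<Rightarrow> nat \<Rightarrow> ('a, 'b) ring_scheme \<Rightarrow> 'a \<Rightarrow> 'a \<Rightarrow> bool" where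
  "sgm d m R u t \<longleftrightarrow> (if case_I d m then u \<otimes>\<^bsub>R\<^esub> u = u \<and> t = \<one>\<^bsub>R\<^esub> \<ominus>\<^bsub>R\<^esub> (u \<oplus>\<^bsub>R\<^esub> u)
     else u = \<zero>\<^bsub>R\<^esub> \<and> t \<otimes>\<^bsub>R\<^esub> t = \<one>\<^bsub>R\<^esub>)"

text \<open>A commutative ring with its norm form.\<close>

locale form_ring = cring R for R :: "('a, 'b) ring_scheme" (structure) + fixes d :: int and m :: nat
begin

abbreviation e where "e \<equiv> form_e d m R"
abbreviation k where "k \<equiv> form_k d m R"

sublocale quad R e k
  by unfold_locales (simp_all add: form_e_def form_k_def)

abbreviation sg where "sg \<equiv> sgm d m R"

lemma sgm_aut:
  assumes [simp]: "u \<in> carrier R" "t \<in> carrier R" and s: "sg u t"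
  shows "aut u t"
proof (cases "case_I d m")
  case True
  then have e1: "e = \<one>" and u: "u \<otimes> u = u" and t: "t = \<one> \<ominus> (u \<oplus> u)" using s by (simp_all add: sgm_def form_e_def)
  have z: "u \<otimes> u \<ominus> u = \<zero>" by (simp add: u diff_eq_zero_iff)
  show ?thesis
    unfolding aut_def unfolding e1 t
  proof (intro conjI)
    show "u \<otimes> u \<oplus> \<one> \<otimes> u \<otimes> (\<one> \<ominus> (u \<oplus> u)) \<oplus> k \<otimes> (\<one> \<ominus> (u \<oplus> u)) \<otimes> (\<one> \<ominus> (u \<oplus> u)) = k"
    proof (rule eq_of_diff)
      show "u \<otimes> u \<oplus> \<one> \<otimes> u \<otimes> (\<one> \<ominus> (u \<oplus> u)) \<oplus> k \<otimes> (\<one> \<ominus> (u \<oplus> u)) \<otimes> (\<one> \<ominus> (u \<oplus> u)) \<ominus> k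
         \<ominus> (\<guillemotleft>4\<guillemotright> \<otimes> k \<ominus> \<one>) \<otimes> (u \<otimes> u \<ominus> u) = \<zero>" by (rule ring_eqI[of "[u, k]"], simp add: in_carrier_def, (rule reify)+, simp add: poly_norm)
    qed (simp_all add: z)
    show "u \<oplus> u \<oplus> \<one> \<otimes> (\<one> \<ominus> (u \<oplus> u)) = \<one>"
      by (simp add: a_minus_def minus_add a_ac r_neg1 r_neg)
    show "u \<otimes> u \<ominus> k \<otimes> (\<one> \<ominus> (u \<oplus> u)) \<otimes> (\<one> \<ominus> (u \<oplus> u)) = \<one> \<otimes> u \<ominus> k"
    proof (rule eq_of_diff)
      show "u \<otimes> u \<ominus> k \<otimes> (\<one> \<ominus> (u \<oplus> u)) \<otimes> (\<one> \<ominus> (u \<oplus> u)) \<ominus> (\<one> \<otimes> u \<ominus> k)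
         \<ominus> (\<one> \<ominus> \<guillemotleft>4\<guillemotright> \<otimes> k) \<otimes> (u \<otimes> u \<ominus> u) = \<zero>" by (rule ring_eqI[of "[u, k]"], simp add: in_carrier_def, (rule reify)+, simp add: poly_norm)
    qed (simp_all add: z)
    show "u \<otimes> (\<one> \<ominus> (u \<oplus> u)) \<oplus> u \<otimes> (\<one> \<ominus> (u \<oplus> u)) \<oplus> \<one> \<otimes> (\<one> \<ominus> (u \<oplus> u)) \<otimes> (\<one> \<ominus> (u \<oplus> u)) = \<one> \<otimes> (\<one> \<ominus> (u \<oplus> u))"
    proof (rule eq_of_diff)
      show "u \<otimes> (\<one> \<ominus> (u \<oplus> u)) \<oplus> u \<otimes> (\<one> \<ominus> (u \<oplus> u)) \<oplus> \<one> \<otimes> (\<one> \<ominus> (u \<oplus> u)) \<otimes> (\<one> \<ominus> (u \<oplus> u)) \<ominus> \<one> \<otimes> (\<one> \<ominus> (u \<oplus> u)) \<ominus> \<zero> = \<zero>" 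
        by (rule ring_eqI[of "[u]"], simp add: in_carrier_def, (rule reify)+, simp add: poly_norm)
    qed simp_all
    show "(\<one> \<ominus> (u \<oplus> u)) \<otimes> (\<one> \<ominus> (u \<oplus> u)) = \<one>"
    proof (rule eq_of_diff)
      show "(\<one> \<ominus> (u \<oplus> u)) \<otimes> (\<one> \<ominus> (u \<oplus> u)) \<ominus> \<one> \<ominus> \<guillemotleft>4\<guillemotright> \<otimes> (u \<otimes> u \<ominus> u) = \<zero>" by (rule ring_eqI[of "[u]"], simp add: in_carrier_def, (rule reify)+, simp add: poly_norm)
    qed (simp_all add: z)
    show "u \<oplus> u \<otimes> (\<one> \<ominus> (u \<oplus> u)) = \<zero>"
    proof (rule eq_of_diff)
      show "u \<oplus> u \<otimes> (\<one> \<ominus> (u \<oplus> u)) \<ominus> \<zero> \<ominus> (\<ominus> \<guillemotleft>2\<guillemotright>) \<otimes> (u \<otimes> u \<ominus> u) = \<zero>" by (rule ring_eqI[of "[u]"], simp add: in_carrier_def, (rule reify)+, simp add: poly_norm)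
    qed (simp_all add: z)
  qed
next
  case False
  then have "e = \<zero>" "u = \<zero>" "t \<otimes> t = \<one>" using s by (simp_all add: sgm_def form_e_def)
  then show ?thesis unfolding aut_def by (simp add: a_minus_def m_assoc)
qed

text \<open>The pairs multiply as \<open>(u, t) (v, s) = (v + u s, t s)\<close>; in Case (I) this is the group law of \<open>\<int>/2\<close>.\<close>

lemma sgm_mult:
  assumes [simp]: "u \<in> carrier R" "t \<in> carrier R" "v \<in> carrier R" "s \<in> carrier R" and "sg u t" "sg v s"
  shows "sg (v \<oplus> u \<otimes> s) (t \<otimes> s)"
    "case_I d m \<Longrightarrow> v \<oplus> u \<otimes> s = (u \<oplus> v) \<ominus> [(2::nat)] \<cdot> (u \<otimes> v)"
proof -
  have I1: "sg (v \<oplus> u \<otimes> s) (t \<otimes> s)" "v \<oplus> u \<otimes> s = (u \<oplus> v) \<ominus> [(2::nat)] \<cdot> (u \<otimes> v)"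
    if I: "case_I d m"
  proof -
    have u: "u \<otimes> u = u" "t = \<one> \<ominus> (u \<oplus> u)" and v: "v \<otimes> v = v" "s = \<one> \<ominus> (v \<oplus> v)" 
      using assms I by (simp_all add: sgm_def)
    have z: "u \<otimes> u \<ominus> u = \<zero>" "v \<otimes> v \<ominus> v = \<zero>" by (simp_all add: u v diff_eq_zero_iff)
    let ?w = "v \<oplus> u \<otimes> (\<one> \<ominus> (v \<oplus> v))"
    have "?w \<otimes> ?w = ?w"
    proof (rule eq_of_diff)
      let ?p = "u \<otimes> u \<ominus> u" and ?r = "v \<otimes> v \<ominus> v"
      show "?w \<otimes> ?w \<ominus> ?w \<ominus> (?p \<oplus> ?r \<oplus> \<guillemotleft>4\<guillemotright> \<otimes> ?p \<otimes> ?r) = \<zero>" by (rule ring_eqI[of "[u, v]"], simp add: in_carrier_def, (rule reify)+, simp add: poly_norm)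
    qed (simp_all add: z)
    moreover have "(\<one> \<ominus> (u \<oplus> u)) \<otimes> (\<one> \<ominus> (v \<oplus> v)) = \<one> \<ominus> (?w \<oplus> ?w)"
    proof (rule eq_of_diff)
      show "(\<one> \<ominus> (u \<oplus> u)) \<otimes> (\<one> \<ominus> (v \<oplus> v)) \<ominus> (\<one> \<ominus> (?w \<oplus> ?w)) \<ominus> \<zero> = \<zero>" by (rule ring_eqI[of "[u, v]"], simp add: in_carrier_def, (rule reify)+, simp add: poly_norm)
    qed simp_all
    ultimately show "sg (v \<oplus> u \<otimes> s) (t \<otimes> s)" using I by (simp add: sgm_def u(2) v(2))
    show "v \<oplus> u \<otimes> s = (u \<oplus> v) \<ominus> [(2::nat)] \<cdot> (u \<otimes> v)"
      by (simp add: v(2) add_pow_nat_eq eval_nat_numeral a_minus_def r_distr l_distr minus_add r_minus a_ac)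
  qed
  have I2: "sg (v \<oplus> u \<otimes> s) (t \<otimes> s)" if I: "\<not> case_I d m"
  proof -
    have u: "u = \<zero>" "t \<otimes> t = \<one>" and v: "v = \<zero>" "s \<otimes> s = \<one>" 
      using assms I by (simp_all add: sgm_def)
    have "t \<otimes> s \<otimes> (t \<otimes> s) = (t \<otimes> t) \<otimes> (s \<otimes> s)" by (simp add: m_ac)
    then show ?thesis using I u v by (simp add: sgm_def)
  qed
  show "sg (v \<oplus> u \<otimes> s) (t \<otimes> s)" using I1(1) I2 by blast
  show "case_I d m \<Longrightarrow> v \<oplus> u \<otimes> s = (u \<oplus> v) \<ominus> [(2::nat)] \<cdot> (u \<otimes> v)" by (rule I1(2))
qed

text \<open>The points over \<open>R\<close> of the closures of the generic fibre and of its subgroup of determinant 1, as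
  \<open>O_tilde_carrier\<close> and \<open>O_plus_carrier\<close> show.\<close>

definition Gset :: "('a \<times> 'a \<times> 'a \<times> 'a) set" where
  "Gset = {par a b u t | a b u t. a \<in> carrier R \<and> b \<in> carrier R \<and> u \<in> carrier R \<and> t \<in> carrier R \<and>
     q a b = \<one> \<and> sg u t}"

definition Kset :: "('a \<times> 'a \<times> 'a \<times> 'a) set" where
  "Kset = {par a b \<zero> \<one> | a b. a \<in> carrier R \<and> b \<in> carrier R \<and> q a b = \<one>}"

lemma sg_trivial: "sg \<zero> \<one>"
  by (simp add: sgm_def a_minus_def)

lemma Kset_Gset: "Kset \<subseteq> Gset"
  unfolding Kset_def Gset_def using sg_trivial by blast

end

lemma norm_form_eq:
  assumes R: "cring R" and "x \<in> carrier R" "y \<in> carrier R"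
  shows "norm_form d m R (x, y) = quad.q R (form_e d m R) (form_k d m R) x y"
proof -
  interpret form_ring R d m by (simp add: form_ring_def R)
  show ?thesis using assms(2,3) unfolding q_def
    by (auto simp: norm_form_def form_e_def form_k_def form_int_def add_pow_int_eq a_minus_def l_minus)
qed

text \<open>A ring homomorphism; it is compatible with the norm forms.\<close>

locale form_ring_hom = form_ring R d m + S: form_ring S d m + h: ring_hom_cring R S h 
  for R :: "('a, 'b) ring_scheme" and S :: "('c, 'f) ring_scheme" and d m h
begin

lemma hom_e: "h e = S.e" and hom_k: "h k = S.k"
  by (simp_all add: form_e_def form_k_def h.hom_of_int)

lemma hom_q: "x \<in> carrier R \<Longrightarrow> y \<in> carrier R \<Longrightarrow> h (q x y) = S.q (h x) (h y)"
  by (simp add: q_def S.q_def hom_e hom_k)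

lemma hom_par: "a \<in> carrier R \<Longrightarrow> b \<in> carrier R \<Longrightarrow> u \<in> carrier R \<Longrightarrow> t \<in> carrier R \<Longrightarrow>
   (\<lambda>(a, b, c, d). (h a, h b, h c, h d)) (par a b u t) = S.par (h a) (h b) (h u) (h t)"
  by (simp add: par_def S.par_def hom_e hom_k a_minus_def)

lemma hom_sg: "u \<in> carrier R \<Longrightarrow> t \<in> carrier R \<Longrightarrow> sg u t \<Longrightarrow> S.sg (h u) (h t)"
  by (auto simp: sgm_def a_minus_def split: if_splits simp flip: h.hom_mult)

end

lemma form_ring_homI: "cring R \<Longrightarrow> cring S \<Longrightarrow> h \<in> ring_hom R S \<Longrightarrow> form_ring_hom R S h"
  by (simp add: form_ring_hom_def form_ring_def ring_hom_cringI')

lemma arrow_form_ring_hom: "cring R \<Longrightarrow> (S, f) \<in> arrows R \<Longrightarrow> form_ring_hom R S f"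
  by (simp add: form_ring_homI arrows_def ring_maps_def)

subsection \<open>Points of the orthogonal group\<close>

lemma ident_arrow: "cring R \<Longrightarrow> (R, \<lambda>x\<in>carrier R. x) \<in> arrows R"
  using ident_ring_maps[of R] by (simp add: arrows_def cring.axioms(1))

lemma O_scheme_simps:
  "carrier (grp (O_scheme d m) R) = {A \<in> carrier (grp GL2 R). \<forall>(S, f) \<in> arrows R. \<forall>v \<in> carrier S \<times> carrier S.
        norm_form d m S (mat2_apply S (mat2_map f A) v) = norm_form d m S v}"
  "x \<otimes>\<^bsub>grp (O_scheme d m) R\<^esub> y = x \<otimes>\<^bsub>grp GL2 R\<^esub> y" "\<one>\<^bsub>grp (O_scheme d m) R\<^esub> = \<one>\<^bsub>grp GL2 R\<^esub>"
  "res (O_scheme d m) R S f = mat2_map f"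
  by (simp_all add: O_scheme_def subfunctor_def GL2_def)

lemma GL2_carrier: "A \<in> carrier (grp GL2 R) \<longleftrightarrow> 
    A \<in> carrier R \<times> carrier R \<times> carrier R \<times> carrier R \<and> mat2_det R A \<in> Units R"
  by (simp add: GL2_def)

lemma det_tpart: 
  assumes "cring R" shows "mat2_det R A = quad.tpart R A"
proof -
  interpret form_ring R d m by (simp add: form_ring_def assms)
  show ?thesis by (simp add: mat2_det_def tpart_def split: prod.split)
qed

lemma (in form_ring) par_closed: "a \<in> carrier R \<Longrightarrow> b \<in> carrier R \<Longrightarrow> u \<in> carrier R \<Longrightarrow> t \<in> carrier R \<Longrightarrow>
    par a b u t \<in> carrier R \<times> carrier R \<times> carrier R \<times> carrier R"
  by (simp add: par_def)

lemma Gset_subset_O: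
  fixes R :: "'u ring"
  assumes R: "cring R" and A: "A \<in> form_ring.Gset R d m"
  shows "A \<in> carrier (grp (O_scheme d m) R)"
proof -
  interpret form_ring R d m by (simp add: form_ring_def R)
  obtain a b u t where abut: "a \<in> carrier R" "b \<in> carrier R" "u \<in> carrier R" "t \<in> carrier R"
    "q a b = \<one>\<^bsub>R\<^esub>" "sg u t" "A = par a b u t" using A unfolding Gset_def by blast
  have "t \<otimes>\<^bsub>R\<^esub> t = \<one>\<^bsub>R\<^esub>" using sgm_aut[OF abut(3,4,6)] by (simp add: aut_def)
  then have "t \<in> Units R" using abut(4) by (auto simp: Units_def)
  then have "A \<in> carrier (grp GL2 R)"
    using par_closed abut tpart_par by (simp add: GL2_carrier det_tpart[OF R])
  moreover have "norm_form d m S (mat2_apply S (mat2_map f A) (x, y)) = norm_form d m S (x, y)"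
    if a: "(S, f) \<in> arrows R" and xy: "x \<in> carrier S" "y \<in> carrier S" for S f x y
  proof -
    interpret h: form_ring_hom R S d m f by (rule arrow_form_ring_hom[OF R a])
    have m: "mat2_map f A = h.S.par (f a) (f b) (f u) (f t)"
      using h.hom_par[OF abut(1-4)] abut(7) by (simp add: mat2_map_def)
    have q1: "h.S.q (f a) (f b) = \<one>\<^bsub>S\<^esub>" using h.hom_q[OF abut(1,2)] abut(5) by simp
    have au: "h.S.aut (f u) (f t)" by (rule h.S.sgm_aut) (use h.hom_sg abut in auto)
    show ?thesis unfolding m 
      using abut xy h.S.q_par[of "f a" "f b" "f u" "f t" x y] h.S.q_aut[OF _ _ xy au] q1
      by (simp add: norm_form_eq[OF h.S.is_cring] mat2_apply_def h.S.par_def)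
  qed
  ultimately show ?thesis unfolding O_scheme_simps by auto
qed

lemma O_points:
  fixes R :: "'u ring"
  assumes R: "cring R" and A: "(a, b', b, c) \<in> carrier (grp (O_scheme d m) R)"
  shows "a \<in> carrier R" "b' \<in> carrier R" "b \<in> carrier R" "c \<in> carrier R"
    "\<And>x y. x \<in> carrier R \<Longrightarrow> y \<in> carrier R \<Longrightarrow>
       quad.q R (form_e d m R) (form_k d m R) (a \<otimes>\<^bsub>R\<^esub> x \<oplus>\<^bsub>R\<^esub> b' \<otimes>\<^bsub>R\<^esub> y) (b \<otimes>\<^bsub>R\<^esub> x \<oplus>\<^bsub>R\<^esub> c \<otimes>\<^bsub>R\<^esub> y) =
       quad.q R (form_e d m R) (form_k d m R) x y"
    "quad.q R (form_e d m R) (form_k d m R) a b = \<one>\<^bsub>R\<^esub>"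
proof -
  interpret form_ring R d m by (simp add: form_ring_def R)
  show c: "a \<in> carrier R" "b' \<in> carrier R" "b \<in> carrier R" "c \<in> carrier R"
    using A unfolding O_scheme_simps GL2_carrier by auto
  show qq: "q (a \<otimes>\<^bsub>R\<^esub> x \<oplus>\<^bsub>R\<^esub> b' \<otimes>\<^bsub>R\<^esub> y) (b \<otimes>\<^bsub>R\<^esub> x \<oplus>\<^bsub>R\<^esub> c \<otimes>\<^bsub>R\<^esub> y) = q x y"
    if xy: "x \<in> carrier R" "y \<in> carrier R" for x y
  proof -
    have "norm_form d m R (mat2_apply R (mat2_map (\<lambda>x\<in>carrier R. x) (a, b', b, c)) (x, y)) = norm_form d m R (x, y)"
      using A ident_arrow[OF R] xy unfolding O_scheme_simps by blast
    then show ?thesis using xy c by (simp add: mat2_map_def mat2_apply_def norm_form_eq[OF R])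
  qed
  show "q a b = \<one>\<^bsub>R\<^esub>" using qq[of "\<one>\<^bsub>R\<^esub>" "\<zero>\<^bsub>R\<^esub>"] c by (simp add: q_def)
qed

lemma O_par:
  fixes R :: "'u ring"
  assumes R: "cring R" and A: "A \<in> carrier (grp (O_scheme d m) R)"
  obtains a b u t where "a \<in> carrier R" "b \<in> carrier R" "u \<in> carrier R" "t \<in> carrier R"
    "quad.q R (form_e d m R) (form_k d m R) a b = \<one>\<^bsub>R\<^esub>"
    "A = quad.par R (form_e d m R) (form_k d m R) a b u t"
    "u = quad.upart R (form_e d m R) (form_k d m R) A" "t = quad.tpart R A"
proof -
  interpret form_ring R d m by (simp add: form_ring_def R)
  obtain a b' b c where A4: "A = (a, b', b, c)" by (cases A)
  note p = O_points[OF R A[unfolded A4]]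
  have c: "upart (a, b', b, c) \<in> carrier R" "tpart (a, b', b, c) \<in> carrier R"
    using p(1-4) by (simp_all add: upart_def tpart_def)
  show ?thesis
    by (rule that[OF p(1,3) c p(6)]) (simp_all only: A4 par_parts[OF p(1-4,6), symmetric])
qed

text \<open>The discriminant of the form, \<open>1 - 4 k\<close> or \<open>- 4 k\<close>, is not zero, so it is a unit in every \<open>\<rat>\<close>-algebra.\<close>

lemma form_int_facts:
  assumes "d \<noteq> 0" "m \<ge> 1"
  shows "case_I d m \<Longrightarrow> 4 * form_int d m - 1 \<noteq> 0" "\<not> case_I d m \<Longrightarrow> form_int d m \<noteq> 0"
proof -
  have nz: "(int m)\<^sup>2 * d \<noteq> 0" using assms by simp
  show "4 * form_int d m - 1 \<noteq> 0" if I: "case_I d m"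
  proof
    assume "4 * form_int d m - 1 = 0"
    then show False by presburger
  qed
  show "form_int d m \<noteq> 0" if I: "\<not> case_I d m"
  proof (cases "d mod 4 = 1")
    case True
    then have "even m" using I by (simp add: case_I_def)
    then obtain j where j: "m = 2 * j" by blast
    then have "(int m)\<^sup>2 * d = 4 * ((int j)\<^sup>2 * d)" by (simp add: power2_eq_square)
    then show ?thesis using True \<open>even m\<close> I assms j by (simp add: form_int_def c_const_def)
  next
    case False
    then show ?thesis using I nz by (simp add: form_int_def c_const_def)
  qed
qed

text \<open>Comparing \<open>q\<close> at \<open>(0, 1)\<close> and \<open>(1, 1)\<close> before and after the action gives the relations \<open>s1\<close> and \<open>s2\<close>; after
  division by 2, in Case (II), and by the discriminant they become the conditions \<open>sgm\<close>.\<close>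

lemma rational_O_subset_Gset:
  fixes R :: "'u ring"
  assumes R: "cring R" and rat: "rational_algebra R" and dm: "d \<noteq> 0" "m \<ge> 1"
    and A: "A \<in> carrier (grp (O_scheme d m) R)"
  shows "A \<in> form_ring.Gset R d m"
proof -
  interpret form_ring R d m by (simp add: form_ring_def R)
  obtain a b u t where abut: "a \<in> carrier R" "b \<in> carrier R" "u \<in> carrier R" "t \<in> carrier R"
    "q a b = \<one>\<^bsub>R\<^esub>" "A = par a b u t" by (rule O_par[OF R A])
  note [simp] = abut(1-4)
  have A': "(a, a \<otimes>\<^bsub>R\<^esub> u \<ominus>\<^bsub>R\<^esub> k \<otimes>\<^bsub>R\<^esub> b \<otimes>\<^bsub>R\<^esub> t, b, b \<otimes>\<^bsub>R\<^esub> u \<oplus>\<^bsub>R\<^esub> (a \<oplus>\<^bsub>R\<^esub> e \<otimes>\<^bsub>R\<^esub> b) \<otimes>\<^bsub>R\<^esub> t) \<in> carrier (grp (O_scheme d m) R)"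
    using A abut(6) by (simp add: par_def)
  have qq: "q (x \<oplus>\<^bsub>R\<^esub> u \<otimes>\<^bsub>R\<^esub> y) (t \<otimes>\<^bsub>R\<^esub> y) = q x y" if "x \<in> carrier R" "y \<in> carrier R" for x y
    using O_points(5)[OF R A' that] q_par[OF abut(1-4) that] abut(5) that by simp
  have s1: "u \<otimes>\<^bsub>R\<^esub> u \<oplus>\<^bsub>R\<^esub> e \<otimes>\<^bsub>R\<^esub> (u \<otimes>\<^bsub>R\<^esub> t) \<oplus>\<^bsub>R\<^esub> k \<otimes>\<^bsub>R\<^esub> (t \<otimes>\<^bsub>R\<^esub> t) = k"
    using qq[of "\<zero>\<^bsub>R\<^esub>" "\<one>\<^bsub>R\<^esub>"] by (simp add: q_def)
  have s2: "u \<oplus>\<^bsub>R\<^esub> u \<oplus>\<^bsub>R\<^esub> e \<otimes>\<^bsub>R\<^esub> t = e"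
  proof (rule eq_of_diff)
    have e1: "q (\<one>\<^bsub>R\<^esub> \<oplus>\<^bsub>R\<^esub> u) t = q \<one>\<^bsub>R\<^esub> \<one>\<^bsub>R\<^esub>" using qq[of "\<one>\<^bsub>R\<^esub>" "\<one>\<^bsub>R\<^esub>"] by simp
    let ?z = "(q (\<one>\<^bsub>R\<^esub> \<oplus>\<^bsub>R\<^esub> u) t \<ominus>\<^bsub>R\<^esub> q \<one>\<^bsub>R\<^esub> \<one>\<^bsub>R\<^esub>) \<ominus>\<^bsub>R\<^esub> (u \<otimes>\<^bsub>R\<^esub> u \<oplus>\<^bsub>R\<^esub> e \<otimes>\<^bsub>R\<^esub> (u \<otimes>\<^bsub>R\<^esub> t) \<oplus>\<^bsub>R\<^esub> k \<otimes>\<^bsub>R\<^esub> (t \<otimes>\<^bsub>R\<^esub> t) \<ominus>\<^bsub>R\<^esub> k)"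
    show "?z = \<zero>\<^bsub>R\<^esub>" unfolding e1 s1 by (simp add: a_minus_def r_neg)
    show "u \<oplus>\<^bsub>R\<^esub> u \<oplus>\<^bsub>R\<^esub> e \<otimes>\<^bsub>R\<^esub> t \<ominus>\<^bsub>R\<^esub> e \<ominus>\<^bsub>R\<^esub> ?z = \<zero>\<^bsub>R\<^esub>" unfolding q_def by (rule ring_eqI[of "[u, t, e, k]"], simp add: in_carrier_def, (rule reify)+, simp add: poly_norm)
  qed simp_all
  have "sg u t"
  proof (cases "case_I d m")
    case True
    then have e: "e = \<one>\<^bsub>R\<^esub>" by (simp add: form_e_def)
    have t: "t = \<one>\<^bsub>R\<^esub> \<ominus>\<^bsub>R\<^esub> (u \<oplus>\<^bsub>R\<^esub> u)" 
      using s2 unfolding e by (metis (no_types, lifting) abut(3,4) a_closed a_comm l_one minus_equality one_closed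
         add.inv_solve_right a_minus_def)
    have "\<guillemotleft>4 * form_int d m - 1\<guillemotright>\<^bsub>R\<^esub> \<otimes>\<^bsub>R\<^esub> (u \<otimes>\<^bsub>R\<^esub> u \<ominus>\<^bsub>R\<^esub> u) = \<zero>\<^bsub>R\<^esub>"
    proof (rule eq_of_diff)
      let ?z = "u \<otimes>\<^bsub>R\<^esub> u \<oplus>\<^bsub>R\<^esub> e \<otimes>\<^bsub>R\<^esub> (u \<otimes>\<^bsub>R\<^esub> t) \<oplus>\<^bsub>R\<^esub> k \<otimes>\<^bsub>R\<^esub> (t \<otimes>\<^bsub>R\<^esub> t) \<ominus>\<^bsub>R\<^esub> k"
      show "?z = \<zero>\<^bsub>R\<^esub>" unfolding s1 by (simp add: diff_eq_zero_iff)
      have k4: "\<guillemotleft>4 * form_int d m - 1\<guillemotright>\<^bsub>R\<^esub> = \<guillemotleft>4\<guillemotright>\<^bsub>R\<^esub> \<otimes>\<^bsub>R\<^esub> k \<ominus>\<^bsub>R\<^esub> \<one>\<^bsub>R\<^esub>"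
        by (simp add: form_k_def)
      show "\<guillemotleft>4 * form_int d m - 1\<guillemotright>\<^bsub>R\<^esub> \<otimes>\<^bsub>R\<^esub> (u \<otimes>\<^bsub>R\<^esub> u \<ominus>\<^bsub>R\<^esub> u) \<ominus>\<^bsub>R\<^esub> \<zero>\<^bsub>R\<^esub> \<ominus>\<^bsub>R\<^esub> ?z = \<zero>\<^bsub>R\<^esub>"
        unfolding k4 e t by (rule ring_eqI[of "[u, k]"], simp add: in_carrier_def, (rule reify)+, simp add: poly_norm)
    qed simp_all
    then have "u \<otimes>\<^bsub>R\<^esub> u \<ominus>\<^bsub>R\<^esub> u = \<zero>\<^bsub>R\<^esub>"
      using unit_cancel_zero[OF rational_algebra_unit[OF R rat form_int_facts(1)[OF dm True]]] by simp
    then show ?thesis using True t by (simp add: sgm_def diff_eq_zero_iff)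
  next
    case False
    then have e: "e = \<zero>\<^bsub>R\<^esub>" by (simp add: form_e_def)
    have "\<guillemotleft>2\<guillemotright>\<^bsub>R\<^esub> \<otimes>\<^bsub>R\<^esub> u = \<zero>\<^bsub>R\<^esub>" using s2 unfolding e
      by (simp add: l_distr eval_nat_numeral of_integer_def)
    then have u: "u = \<zero>\<^bsub>R\<^esub>" using unit_cancel_zero[OF rational_algebra_unit[OF R rat, of 2]] by simp
    have "k \<otimes>\<^bsub>R\<^esub> (t \<otimes>\<^bsub>R\<^esub> t) = k" using s1 unfolding e u by simp
    then have "k \<otimes>\<^bsub>R\<^esub> (t \<otimes>\<^bsub>R\<^esub> t \<ominus>\<^bsub>R\<^esub> \<one>\<^bsub>R\<^esub>) = \<zero>\<^bsub>R\<^esub>" by (simp add: a_minus_def r_distr r_minus r_neg)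
    then have "t \<otimes>\<^bsub>R\<^esub> t \<ominus>\<^bsub>R\<^esub> \<one>\<^bsub>R\<^esub> = \<zero>\<^bsub>R\<^esub>"
      using unit_cancel_zero[OF rational_algebra_unit[OF R rat form_int_facts(2)[OF dm False]]] by (simp add: form_k_def)
    then show ?thesis using False u by (simp add: sgm_def diff_eq_zero_iff)
  qed
  then show ?thesis unfolding Gset_def using abut by blast
qed

section \<open>Schematic closures\<close>

lemma regularI:
  assumes "\<And>R x. cring R \<Longrightarrow> x \<in> carrier (grp Z R) \<Longrightarrow> \<phi> R x \<in> carrier R"
    and "\<And>R S f x. cring R \<Longrightarrow> (S, f) \<in> arrows R \<Longrightarrow> x \<in> carrier (grp Z R) \<Longrightarrow> \<phi> S (res Z R S f x) = f (\<phi> R x)"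
  shows "\<phi> \<in> regular_functions Z"
  using assms unfolding regular_functions_def by auto

lemma regularD:
  assumes "\<phi> \<in> regular_functions Z" "cring R" "x \<in> carrier (grp Z R)"
  shows "\<phi> R x \<in> carrier R" "(S, f) \<in> arrows R \<Longrightarrow> \<phi> S (res Z R S f x) = f (\<phi> R x)"
  using assms unfolding regular_functions_def by (blast, blast)

lemma arrow_ring_hom_cring: "cring R \<Longrightarrow> (S, f) \<in> arrows R \<Longrightarrow> ring_hom_cring R S f"
  by (rule ring_hom_cringI') (auto simp: arrows_def ring_maps_def)

lemma regular_mult:
  fixes Z :: "('a, 'b) group_functor"
  assumes "\<phi> \<in> regular_functions Z" "\<chi> \<in> regular_functions Z"
  shows "(\<lambda>R x. \<phi> R x \<otimes>\<^bsub>R\<^esub> \<chi> R x) \<in> regular_functions Z"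
proof (rule regularI)
  fix R :: "'a ring" and x assume R: "cring R" and x: "x \<in> carrier (grp Z R)"
  interpret cring R by fact
  note c = regularD(1)[OF assms(1) R x] regularD(1)[OF assms(2) R x]
  show "\<phi> R x \<otimes>\<^bsub>R\<^esub> \<chi> R x \<in> carrier R" using c by simp
  fix S f assume a: "(S, f) \<in> arrows R"
  interpret ring_hom_cring R S f by (rule arrow_ring_hom_cring[OF R a])
  show "\<phi> S (res Z R S f x) \<otimes>\<^bsub>S\<^esub> \<chi> S (res Z R S f x) = f (\<phi> R x \<otimes>\<^bsub>R\<^esub> \<chi> R x)"
    using c regularD(2)[OF assms(1) R x a] regularD(2)[OF assms(2) R x a] by simp
qed

lemma regular_add:
  fixes Z :: "('a, 'b) group_functor"
  assumes "\<phi> \<in> regular_functions Z" "\<chi> \<in> regular_functions Z"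
  shows "(\<lambda>R x. \<phi> R x \<oplus>\<^bsub>R\<^esub> \<chi> R x) \<in> regular_functions Z"
proof (rule regularI)
  fix R :: "'a ring" and x assume R: "cring R" and x: "x \<in> carrier (grp Z R)"
  interpret cring R by fact
  note c = regularD(1)[OF assms(1) R x] regularD(1)[OF assms(2) R x]
  show "\<phi> R x \<oplus>\<^bsub>R\<^esub> \<chi> R x \<in> carrier R" using c by simp
  fix S f assume a: "(S, f) \<in> arrows R"
  interpret ring_hom_cring R S f by (rule arrow_ring_hom_cring[OF R a])
  show "\<phi> S (res Z R S f x) \<oplus>\<^bsub>S\<^esub> \<chi> S (res Z R S f x) = f (\<phi> R x \<oplus>\<^bsub>R\<^esub> \<chi> R x)"
    using c regularD(2)[OF assms(1) R x a] regularD(2)[OF assms(2) R x a] by simp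
qed

lemma regular_diff:
  fixes Z :: "('a, 'b) group_functor"
  assumes "\<phi> \<in> regular_functions Z" "\<chi> \<in> regular_functions Z"
  shows "(\<lambda>R x. \<phi> R x \<ominus>\<^bsub>R\<^esub> \<chi> R x) \<in> regular_functions Z"
proof (rule regularI)
  fix R :: "'a ring" and x assume R: "cring R" and x: "x \<in> carrier (grp Z R)"
  interpret cring R by fact
  note c = regularD(1)[OF assms(1) R x] regularD(1)[OF assms(2) R x]
  show "\<phi> R x \<ominus>\<^bsub>R\<^esub> \<chi> R x \<in> carrier R" using c by simp
  fix S f assume a: "(S, f) \<in> arrows R"
  interpret ring_hom_cring R S f by (rule arrow_ring_hom_cring[OF R a])
  show "\<phi> S (res Z R S f x) \<ominus>\<^bsub>S\<^esub> \<chi> S (res Z R S f x) = f (\<phi> R x \<ominus>\<^bsub>R\<^esub> \<chi> R x)"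
    using c regularD(2)[OF assms(1) R x a] regularD(2)[OF assms(2) R x a] by (simp add: a_minus_def)
qed

lemma regular_one: "(\<lambda>R x. \<one>\<^bsub>R\<^esub>) \<in> regular_functions (Z :: ('b, 'c) group_functor)"
proof (rule regularI)
  fix R :: "'b ring" assume R: "cring R"
  interpret cring R by fact
  show "\<one>\<^bsub>R\<^esub> \<in> carrier R" by simp
  fix S f assume a: "(S, f) \<in> arrows R"
  interpret ring_hom_cring R S f by (rule arrow_ring_hom_cring[OF R a])
  show "\<one>\<^bsub>S\<^esub> = f \<one>\<^bsub>R\<^esub>" by simp
qed

text \<open>The parameters \<open>u\<close> and \<open>t\<close> as functions of the matrix, for all rings at once.\<close>

definition ufun :: "int \<Rightarrow> nat \<Rightarrow> 'u ring \<Rightarrow> 'u mat2 \<Rightarrow> 'u" where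
  "ufun d m R A = quad.upart R (form_e d m R) (form_k d m R) A"

definition tfun :: "'u ring \<Rightarrow> 'u mat2 \<Rightarrow> 'u" where
  "tfun R A = mat2_det R A"

lemma entries_hom:
  assumes R: "cring R" and a: "(S, f) \<in> arrows R" and A: "A \<in> carrier R \<times> carrier R \<times> carrier R \<times> carrier R"
  shows "ufun d m R A \<in> carrier R" "ufun d m S (mat2_map f A) = f (ufun d m R A)"
    "tfun R A \<in> carrier R" "tfun S (mat2_map f A) = f (tfun R A)"
proof -
  interpret form_ring_hom R S d m f by (rule arrow_form_ring_hom[OF R a])
  show "ufun d m R A \<in> carrier R" "ufun d m S (mat2_map f A) = f (ufun d m R A)"
    "tfun R A \<in> carrier R" "tfun S (mat2_map f A) = f (tfun R A)"
    using A by (auto simp: ufun_def tfun_def upart_def S.upart_def mat2_map_def mat2_det_def hom_e hom_k a_minus_def)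
qed

lemma O_entries: "A \<in> carrier (grp (O_scheme d m) R) \<Longrightarrow> A \<in> carrier R \<times> carrier R \<times> carrier R \<times> carrier R"
  unfolding O_scheme_simps GL2_carrier by blast

lemma ufun_regular: "ufun d m \<in> regular_functions (O_scheme d m)"
proof (rule regularI)
  fix R x assume R: "cring R" and x: "x \<in> carrier (grp (O_scheme d m) R)"
  show "ufun d m R x \<in> carrier R" by (rule entries_hom(1)[OF R ident_arrow[OF R] O_entries[OF x]])
  fix S f assume a: "(S, f) \<in> arrows R"
  show "ufun d m S (res (O_scheme d m) R S f x) = f (ufun d m R x)"
    unfolding O_scheme_simps(4) by (rule entries_hom(2)[OF R a O_entries[OF x]])
qed

lemma tfun_regular: "tfun \<in> regular_functions (O_scheme d m)"
proof (rule regularI)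
  fix R x assume R: "cring R" and x: "x \<in> carrier (grp (O_scheme d m) R)"
  show "tfun R x \<in> carrier R" by (rule entries_hom(3)[OF R ident_arrow[OF R] O_entries[OF x]])
  fix S f assume a: "(S, f) \<in> arrows R"
  show "tfun S (res (O_scheme d m) R S f x) = f (tfun R x)"
    unfolding O_scheme_simps(4) by (rule entries_hom(4)[OF R a O_entries[OF x]])
qed

lemma closure_carrier:
  "carrier (grp (schematic_closure Z Y) R) = {x \<in> carrier (grp Z R). \<forall>\<phi> \<in> regular_functions Z.
        (\<forall>S. cring S \<longrightarrow> (\<forall>y \<in> Y S. \<phi> S y = \<zero>\<^bsub>S\<^esub>)) \<longrightarrow> \<phi> R x = \<zero>\<^bsub>R\<^esub>}"
  "x \<otimes>\<^bsub>grp (schematic_closure Z Y) R\<^esub> y = x \<otimes>\<^bsub>grp Z R\<^esub> y"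
  "\<one>\<^bsub>grp (schematic_closure Z Y) R\<^esub> = \<one>\<^bsub>grp Z R\<^esub>"
  "res (schematic_closure Z Y) = res Z"
  by (simp_all add: schematic_closure_def subfunctor_def)

lemma Gset_parts:
  assumes R: "cring R" and A: "A \<in> form_ring.Gset R d m"
  shows "ufun d m R A \<in> carrier R" "tfun R A \<in> carrier R" "sgm d m R (ufun d m R A) (tfun R A)"
    "A \<in> carrier R \<times> carrier R \<times> carrier R \<times> carrier R"
proof -
  interpret form_ring R d m by (simp add: form_ring_def R)
  obtain a b u t where abut: "a \<in> carrier R" "b \<in> carrier R" "u \<in> carrier R" "t \<in> carrier R"
    "q a b = \<one>\<^bsub>R\<^esub>" "sg u t" "A = par a b u t" using A unfolding Gset_def by blast
  then show "ufun d m R A \<in> carrier R" "tfun R A \<in> carrier R" "sgm d m R (ufun d m R A) (tfun R A)"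
    by (simp_all add: ufun_def tfun_def upart_par tpart_par det_tpart[OF R])
  show "A \<in> carrier R \<times> carrier R \<times> carrier R \<times> carrier R" using abut par_closed by simp
qed

lemma GsetI:
  assumes R: "cring R" and A: "A \<in> carrier (grp (O_scheme d m) R)" and s: "sgm d m R (ufun d m R A) (tfun R A)"
  shows "A \<in> form_ring.Gset R d m"
proof (rule O_par[OF R A])
  interpret form_ring R d m by (simp add: form_ring_def R)
  fix a b u t
  assume abut: "a \<in> carrier R" "b \<in> carrier R" "u \<in> carrier R" "t \<in> carrier R"
    "q a b = \<one>\<^bsub>R\<^esub>" "A = par a b u t" "u = upart A" "t = tpart A"
  have "sg u t" using s unfolding ufun_def tfun_def det_tpart[OF R] abut(7,8)[symmetric] .
  then show "A \<in> Gset" unfolding Gset_def using abut(1-6) by blast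
qed

lemma Kset_iff:
  assumes R: "cring R"
  shows "A \<in> form_ring.Kset R d m \<longleftrightarrow> A \<in> form_ring.Gset R d m \<and> ufun d m R A = \<zero>\<^bsub>R\<^esub> \<and> tfun R A = \<one>\<^bsub>R\<^esub>"
proof -
  interpret form_ring R d m by (simp add: form_ring_def R)
  show ?thesis
  proof
    assume A: "A \<in> Kset"
    then obtain a b where "a \<in> carrier R" "b \<in> carrier R" "q a b = \<one>\<^bsub>R\<^esub>" "A = par a b \<zero>\<^bsub>R\<^esub> \<one>\<^bsub>R\<^esub>"
      unfolding Kset_def by blast
    then show "A \<in> Gset \<and> ufun d m R A = \<zero>\<^bsub>R\<^esub> \<and> tfun R A = \<one>\<^bsub>R\<^esub>"
      using A Kset_Gset by (auto simp: ufun_def tfun_def det_tpart[OF R] upart_par tpart_par)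
  next
    assume A: "A \<in> Gset \<and> ufun d m R A = \<zero>\<^bsub>R\<^esub> \<and> tfun R A = \<one>\<^bsub>R\<^esub>"
    then obtain a b u t where abut: "a \<in> carrier R" "b \<in> carrier R" "u \<in> carrier R" "t \<in> carrier R"
      "q a b = \<one>\<^bsub>R\<^esub>" "sg u t" "A = par a b u t" unfolding Gset_def by blast
    then have "u = \<zero>\<^bsub>R\<^esub>" "t = \<one>\<^bsub>R\<^esub>" 
      using A by (auto simp: ufun_def tfun_def det_tpart[OF R] upart_par tpart_par)
    then show "A \<in> Kset" unfolding Kset_def using abut by blast
  qed
qed

text \<open>The conditions \<open>sgm\<close> are equations between regular functions. They hold on the generic fibre, hence on
  its closure.\<close>

lemma O_tilde_subset_Gset:
  fixes R :: "'u ring"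
  assumes R: "cring R" and dm: "d \<noteq> 0" "m \<ge> 1" and A: "A \<in> carrier (grp (O_tilde d m) R)"
  shows "A \<in> form_ring.Gset R d m"
proof (rule GsetI[OF R])
  interpret form_ring R d m by (simp add: form_ring_def R)
  show AO: "A \<in> carrier (grp (O_scheme d m) R)" using A by (simp add: O_tilde_def closure_carrier)
  have vanish: "\<phi> R A = \<zero>\<^bsub>R\<^esub>" if "\<phi> \<in> regular_functions (O_scheme d m)"
    "\<And>S B. cring S \<Longrightarrow> B \<in> form_ring.Gset S d m \<Longrightarrow> \<phi> S B = \<zero>\<^bsub>S\<^esub>" for \<phi>
    using A that rational_O_subset_Gset[OF _ _ dm] unfolding O_tilde_def closure_carrier generic_fibre_def by blast
  note c = entries_hom(1,3)[OF R ident_arrow[OF R] O_entries[OF AO]]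
  note rf = regular_mult regular_add regular_diff regular_one ufun_regular tfun_regular
  show "sg (ufun d m R A) (tfun R A)"
  proof (cases "case_I d m")
    case True
    have "ufun d m R A \<otimes>\<^bsub>R\<^esub> ufun d m R A \<ominus>\<^bsub>R\<^esub> ufun d m R A = \<zero>\<^bsub>R\<^esub>"
    proof (rule vanish[of "\<lambda>R A. ufun d m R A \<otimes>\<^bsub>R\<^esub> ufun d m R A \<ominus>\<^bsub>R\<^esub> ufun d m R A"])
      show "ufun d m S B \<otimes>\<^bsub>S\<^esub> ufun d m S B \<ominus>\<^bsub>S\<^esub> ufun d m S B = \<zero>\<^bsub>S\<^esub>" 
        if "cring S" "B \<in> form_ring.Gset S d m" for S B
      proof -
        interpret S: cring S by fact
        show ?thesis using Gset_parts[OF that] True by (simp add: sgm_def S.diff_eq_zero_iff)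
      qed
    qed (intro rf)
    moreover have "tfun R A \<ominus>\<^bsub>R\<^esub> (\<one>\<^bsub>R\<^esub> \<ominus>\<^bsub>R\<^esub> (ufun d m R A \<oplus>\<^bsub>R\<^esub> ufun d m R A)) = \<zero>\<^bsub>R\<^esub>"
    proof (rule vanish[of "\<lambda>R A. tfun R A \<ominus>\<^bsub>R\<^esub> (\<one>\<^bsub>R\<^esub> \<ominus>\<^bsub>R\<^esub> (ufun d m R A \<oplus>\<^bsub>R\<^esub> ufun d m R A))"])
      show "tfun S B \<ominus>\<^bsub>S\<^esub> (\<one>\<^bsub>S\<^esub> \<ominus>\<^bsub>S\<^esub> (ufun d m S B \<oplus>\<^bsub>S\<^esub> ufun d m S B)) = \<zero>\<^bsub>S\<^esub>" 
        if "cring S" "B \<in> form_ring.Gset S d m" for S B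
      proof -
        interpret S: cring S by fact
        show ?thesis using Gset_parts[OF that] True by (simp add: sgm_def S.diff_eq_zero_iff)
      qed
    qed (intro rf)
    ultimately show ?thesis using c True by (simp add: sgm_def diff_eq_zero_iff)
  next
    case False
    have "ufun d m R A = \<zero>\<^bsub>R\<^esub>"
    proof (rule vanish[of "ufun d m"])
      show "ufun d m S B = \<zero>\<^bsub>S\<^esub>" if "cring S" "B \<in> form_ring.Gset S d m" for S B
        using Gset_parts[OF that] False by (simp add: sgm_def)
    qed (intro rf)
    moreover have "tfun R A \<otimes>\<^bsub>R\<^esub> tfun R A \<ominus>\<^bsub>R\<^esub> \<one>\<^bsub>R\<^esub> = \<zero>\<^bsub>R\<^esub>"
    proof (rule vanish[of "\<lambda>R A. tfun R A \<otimes>\<^bsub>R\<^esub> tfun R A \<ominus>\<^bsub>R\<^esub> \<one>\<^bsub>R\<^esub>"])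
      show "tfun S B \<otimes>\<^bsub>S\<^esub> tfun S B \<ominus>\<^bsub>S\<^esub> \<one>\<^bsub>S\<^esub> = \<zero>\<^bsub>S\<^esub>" if "cring S" "B \<in> form_ring.Gset S d m" for S B
      proof -
        interpret S: cring S by fact
        show ?thesis using Gset_parts[OF that] False by (simp add: sgm_def S.diff_eq_zero_iff)
      qed
    qed (intro rf)
    ultimately show ?thesis using c False by (simp add: sgm_def diff_eq_zero_iff)
  qed
qed

lemma rational_det_one:
  fixes R :: "'u ring"
  assumes R: "cring R" and rat: "rational_algebra R" and dm: "d \<noteq> 0" "m \<ge> 1"
    and A: "A \<in> carrier (grp (O_scheme d m) R)" "mat2_det R A = \<one>\<^bsub>R\<^esub>"
  shows "A \<in> form_ring.Kset R d m"
proof -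
  interpret form_ring R d m by (simp add: form_ring_def R)
  have G: "A \<in> Gset" by (rule rational_O_subset_Gset[OF R rat dm A(1)])
  note p = Gset_parts[OF R G]
  have t: "tfun R A = \<one>\<^bsub>R\<^esub>" using A(2) by (simp add: tfun_def)
  have "ufun d m R A = \<zero>\<^bsub>R\<^esub>"
  proof (cases "case_I d m")
    case True
    then have "\<one>\<^bsub>R\<^esub> = \<one>\<^bsub>R\<^esub> \<ominus>\<^bsub>R\<^esub> (ufun d m R A \<oplus>\<^bsub>R\<^esub> ufun d m R A)" using p t by (simp add: sgm_def)
    then have "ufun d m R A \<oplus>\<^bsub>R\<^esub> ufun d m R A = \<zero>\<^bsub>R\<^esub>" using p(1)
      by (metis a_closed a_minus_def add.inv_closed add.r_cancel_one' add.inv_eq_1_iff one_closed a_comm)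
    then have "\<guillemotleft>2\<guillemotright>\<^bsub>R\<^esub> \<otimes>\<^bsub>R\<^esub> ufun d m R A = \<zero>\<^bsub>R\<^esub>" using p(1)
      by (simp add: l_distr eval_nat_numeral of_integer_def)
    then show ?thesis using unit_cancel_zero[OF rational_algebra_unit[OF R rat, of 2]] p(1) by simp
  next
    case False
    then show ?thesis using p by (simp add: sgm_def)
  qed
  then show ?thesis using Kset_iff[OF R] G t by blast
qed

lemma O_plus_subset_Kset:
  fixes R :: "'u ring"
  assumes R: "cring R" and dm: "d \<noteq> 0" "m \<ge> 1" and A: "A \<in> carrier (grp (O_plus d m) R)"
  shows "A \<in> form_ring.Kset R d m"
proof -
  interpret form_ring R d m by (simp add: form_ring_def R)
  have AO: "A \<in> carrier (grp (O_scheme d m) R)" using A by (simp add: O_plus_def closure_carrier)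
  have vanish: "\<phi> R A = \<zero>\<^bsub>R\<^esub>" if "\<phi> \<in> regular_functions (O_scheme d m)"
    "\<And>S B. cring S \<Longrightarrow> B \<in> form_ring.Kset S d m \<Longrightarrow> \<phi> S B = \<zero>\<^bsub>S\<^esub>" for \<phi>
    using A that rational_det_one[OF _ _ dm] unfolding O_plus_def closure_carrier generic_fibre_def by blast
  note c = entries_hom(1,3)[OF R ident_arrow[OF R] O_entries[OF AO]]
  have u: "ufun d m R A = \<zero>\<^bsub>R\<^esub>"
    by (rule vanish[of "ufun d m", OF ufun_regular]) (use Kset_iff in blast)
  have "tfun R A \<ominus>\<^bsub>R\<^esub> \<one>\<^bsub>R\<^esub> = \<zero>\<^bsub>R\<^esub>"
  proof (rule vanish[of "\<lambda>R A. tfun R A \<ominus>\<^bsub>R\<^esub> \<one>\<^bsub>R\<^esub>"])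
    show "tfun S B \<ominus>\<^bsub>S\<^esub> \<one>\<^bsub>S\<^esub> = \<zero>\<^bsub>S\<^esub>" if "cring S" "B \<in> form_ring.Kset S d m" for S B
    proof -
      interpret S: cring S by fact
      show ?thesis using that(2) Kset_iff[OF that(1)] by (simp add: S.diff_eq_zero_iff)
    qed
  qed (intro regular_diff regular_one tfun_regular)
  then have t: "tfun R A = \<one>\<^bsub>R\<^esub>" using c by (simp add: diff_eq_zero_iff)
  have "A \<in> Gset" by (rule GsetI[OF R AO]) (simp add: u t sg_trivial)
  then show ?thesis using Kset_iff[OF R] u t by blast
qed

subsection \<open>Adjoining a root of a quadratic polynomial\<close>

text \<open>The ring \<open>B[w]/(w\<^sup>2 - p w - r)\<close>; the pair \<open>(x, y)\<close> is the class of \<open>x + y w\<close>.\<close>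

definition quad_ext :: "('a, 'b) ring_scheme \<Rightarrow> 'a \<Rightarrow> 'a \<Rightarrow> ('a \<times> 'a) ring" where
  "quad_ext B p r = \<lparr>carrier = carrier B \<times> carrier B,
     monoid.mult = (\<lambda>(x, y) (x', y'). (x \<otimes>\<^bsub>B\<^esub> x' \<oplus>\<^bsub>B\<^esub> r \<otimes>\<^bsub>B\<^esub> (y \<otimes>\<^bsub>B\<^esub> y'), x \<otimes>\<^bsub>B\<^esub> y' \<oplus>\<^bsub>B\<^esub> x' \<otimes>\<^bsub>B\<^esub> y \<oplus>\<^bsub>B\<^esub> p \<otimes>\<^bsub>B\<^esub> (y \<otimes>\<^bsub>B\<^esub> y'))),
     one = (\<one>\<^bsub>B\<^esub>, \<zero>\<^bsub>B\<^esub>), ring.zero = (\<zero>\<^bsub>B\<^esub>, \<zero>\<^bsub>B\<^esub>),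
     ring.add = (\<lambda>(x, y) (x', y'). (x \<oplus>\<^bsub>B\<^esub> x', y \<oplus>\<^bsub>B\<^esub> y'))\<rparr>"

locale quad_extension = cring B for B :: "('a, 'b) ring_scheme" (structure) +
  fixes p r assumes p [simp]: "p \<in> carrier B" and r [simp]: "r \<in> carrier B"
begin

abbreviation E where "E \<equiv> quad_ext B p r"
abbreviation gen where "gen \<equiv> (\<zero>, \<one>)"

lemma E_simps [simp]:
  "z \<in> carrier E \<longleftrightarrow> z \<in> carrier B \<times> carrier B" "\<one>\<^bsub>E\<^esub> = (\<one>, \<zero>)" "\<zero>\<^bsub>E\<^esub> = (\<zero>, \<zero>)"
  "(x, y) \<oplus>\<^bsub>E\<^esub> (x', y') = (x \<oplus> x', y \<oplus> y')"
  "(x, y) \<otimes>\<^bsub>E\<^esub> (x', y') = (x \<otimes> x' \<oplus> r \<otimes> (y \<otimes> y'), x \<otimes> y' \<oplus> x' \<otimes> y \<oplus> p \<otimes> (y \<otimes> y'))"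
  by (simp_all add: quad_ext_def)

lemma E_cring: "cring E"
proof (rule cringI)
  show "abelian_group E"
  proof (rule abelian_groupI)
    fix z assume "z \<in> carrier E"
    then obtain x y where "z = (x, y)" "x \<in> carrier B" "y \<in> carrier B" by auto
    then show "\<exists>w\<in>carrier E. w \<oplus>\<^bsub>E\<^esub> z = \<zero>\<^bsub>E\<^esub>"
      by (intro bexI[of _ "(\<ominus> x, \<ominus> y)"]) (auto simp: l_neg)
  qed (auto simp: a_ac)
  show "Group.comm_monoid E"
  proof (rule comm_monoidI)
    fix z1 z2 z3 assume "z1 \<in> carrier E" "z2 \<in> carrier E" "z3 \<in> carrier E"
    then obtain a b c d e f where z: "z1 = (a, b)" "z2 = (c, d)" "z3 = (e, f)"
      and abc: "a \<in> carrier B" "b \<in> carrier B" "c \<in> carrier B" "d \<in> carrier B" "e \<in> carrier B" "f \<in> carrier B" by auto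
    note pr = p r
    have "(a \<otimes> c \<oplus> r \<otimes> (b \<otimes> d)) \<otimes> e \<oplus> r \<otimes> ((a \<otimes> d \<oplus> c \<otimes> b \<oplus> p \<otimes> (b \<otimes> d)) \<otimes> f) \<ominus>
      (a \<otimes> (c \<otimes> e \<oplus> r \<otimes> (d \<otimes> f)) \<oplus> r \<otimes> (b \<otimes> (c \<otimes> f \<oplus> e \<otimes> d \<oplus> p \<otimes> (d \<otimes> f)))) = \<zero>"
      by (rule ring_eqI[of "[a, b, c, d, e, f, p, r]"], simp add: in_carrier_def abc, (rule reify)+, simp add: poly_norm)
    moreover have "(a \<otimes> c \<oplus> r \<otimes> (b \<otimes> d)) \<otimes> f \<oplus> e \<otimes> (a \<otimes> d \<oplus> c \<otimes> b \<oplus> p \<otimes> (b \<otimes> d)) \<oplus> p \<otimes> ((a \<otimes> d \<oplus> c \<otimes> b \<oplus> p \<otimes> (b \<otimes> d)) \<otimes> f) \<ominus>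
      (a \<otimes> (c \<otimes> f \<oplus> e \<otimes> d \<oplus> p \<otimes> (d \<otimes> f)) \<oplus> (c \<otimes> e \<oplus> r \<otimes> (d \<otimes> f)) \<otimes> b \<oplus> p \<otimes> (b \<otimes> (c \<otimes> f \<oplus> e \<otimes> d \<oplus> p \<otimes> (d \<otimes> f)))) = \<zero>"
      by (rule ring_eqI[of "[a, b, c, d, e, f, p, r]"], simp add: in_carrier_def abc, (rule reify)+, simp add: poly_norm)
    ultimately show "z1 \<otimes>\<^bsub>E\<^esub> z2 \<otimes>\<^bsub>E\<^esub> z3 = z1 \<otimes>\<^bsub>E\<^esub> (z2 \<otimes>\<^bsub>E\<^esub> z3)" using abc by (simp add: z diff_eq_zero_iff)
  next
    fix z1 z2 assume "z1 \<in> carrier E" "z2 \<in> carrier E"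
    then show "z1 \<otimes>\<^bsub>E\<^esub> z2 = z2 \<otimes>\<^bsub>E\<^esub> z1" by (auto simp: m_comm a_comm)
  qed auto
  fix z1 z2 z3 assume "z1 \<in> carrier E" "z2 \<in> carrier E" "z3 \<in> carrier E"
  then obtain a b c d e f where z: "z1 = (a, b)" "z2 = (c, d)" "z3 = (e, f)"
    and abc: "a \<in> carrier B" "b \<in> carrier B" "c \<in> carrier B" "d \<in> carrier B" "e \<in> carrier B" "f \<in> carrier B" by auto
  then show "(z1 \<oplus>\<^bsub>E\<^esub> z2) \<otimes>\<^bsub>E\<^esub> z3 = z1 \<otimes>\<^bsub>E\<^esub> z3 \<oplus>\<^bsub>E\<^esub> z2 \<otimes>\<^bsub>E\<^esub> z3"
    by (simp add: l_distr r_distr a_ac)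
qed

lemma embed_hom: "(\<lambda>x. (x, \<zero>)) \<in> ring_hom B E"
  by (rule ring_hom_memI) auto

text \<open>A homomorphism \<open>h\<close> from \<open>B\<close> and a root of the quadratic polynomial define a homomorphism from \<open>B[w]/(w\<^sup>2 - p w - r)\<close>.\<close>

lemma extend_hom:
  assumes R: "cring R" and h: "h \<in> ring_hom B R" and w: "w \<in> carrier R" 
    and eq: "w \<otimes>\<^bsub>R\<^esub> w = h p \<otimes>\<^bsub>R\<^esub> w \<oplus>\<^bsub>R\<^esub> h r"
  shows "(\<lambda>(x, y). h x \<oplus>\<^bsub>R\<^esub> h y \<otimes>\<^bsub>R\<^esub> w) \<in> ring_hom E R"
proof -
  interpret R: cring R by fact
  interpret h: ring_hom_cring B R h by (rule ring_hom_cringI'[OF is_cring R h])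
  show ?thesis
  proof (rule ring_hom_memI)
    fix z1 z2 assume "z1 \<in> carrier E" "z2 \<in> carrier E"
    then obtain a b c d where z: "z1 = (a, b)" "z2 = (c, d)"
      and abc: "a \<in> carrier B" "b \<in> carrier B" "c \<in> carrier B" "d \<in> carrier B" by auto
    define a' b' c' d' p' r' where "a' = h a" "b' = h b" "c' = h c" "d' = h d" "p' = h p" "r' = h r"
    note df = this
    have cl: "a' \<in> carrier R" "b' \<in> carrier R" "c' \<in> carrier R" "d' \<in> carrier R" "p' \<in> carrier R" "r' \<in> carrier R"
      using abc by (simp_all add: df)
    have "(a' \<otimes>\<^bsub>R\<^esub> c' \<oplus>\<^bsub>R\<^esub> r' \<otimes>\<^bsub>R\<^esub> (b' \<otimes>\<^bsub>R\<^esub> d')) \<oplus>\<^bsub>R\<^esub> (a' \<otimes>\<^bsub>R\<^esub> d' \<oplus>\<^bsub>R\<^esub> c' \<otimes>\<^bsub>R\<^esub> b' \<oplus>\<^bsub>R\<^esub> p' \<otimes>\<^bsub>R\<^esub> (b' \<otimes>\<^bsub>R\<^esub> d')) \<otimes>\<^bsub>R\<^esub> w =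
      (a' \<oplus>\<^bsub>R\<^esub> b' \<otimes>\<^bsub>R\<^esub> w) \<otimes>\<^bsub>R\<^esub> (c' \<oplus>\<^bsub>R\<^esub> d' \<otimes>\<^bsub>R\<^esub> w)"
    proof (rule R.eq_of_diff)
      let ?z = "\<ominus>\<^bsub>R\<^esub> (b' \<otimes>\<^bsub>R\<^esub> d' \<otimes>\<^bsub>R\<^esub> (w \<otimes>\<^bsub>R\<^esub> w \<ominus>\<^bsub>R\<^esub> (p' \<otimes>\<^bsub>R\<^esub> w \<oplus>\<^bsub>R\<^esub> r')))"
      show "?z = \<zero>\<^bsub>R\<^esub>" using cl w by (simp add: eq df a_minus_def R.r_neg)
      show "(a' \<otimes>\<^bsub>R\<^esub> c' \<oplus>\<^bsub>R\<^esub> r' \<otimes>\<^bsub>R\<^esub> (b' \<otimes>\<^bsub>R\<^esub> d')) \<oplus>\<^bsub>R\<^esub> (a' \<otimes>\<^bsub>R\<^esub> d' \<oplus>\<^bsub>R\<^esub> c' \<otimes>\<^bsub>R\<^esub> b' \<oplus>\<^bsub>R\<^esub> p' \<otimes>\<^bsub>R\<^esub> (b' \<otimes>\<^bsub>R\<^esub> d')) \<otimes>\<^bsub>R\<^esub> w \<ominus>\<^bsub>R\<^esub>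
        (a' \<oplus>\<^bsub>R\<^esub> b' \<otimes>\<^bsub>R\<^esub> w) \<otimes>\<^bsub>R\<^esub> (c' \<oplus>\<^bsub>R\<^esub> d' \<otimes>\<^bsub>R\<^esub> w) \<ominus>\<^bsub>R\<^esub> ?z = \<zero>\<^bsub>R\<^esub>"
        by (rule R.ring_eqI[of "[a', b', c', d', p', r', w]"], simp add: R.in_carrier_def cl w, (rule R.reify)+, simp add: poly_norm)
    qed (use cl w in simp_all)
    then show "(case z1 \<otimes>\<^bsub>E\<^esub> z2 of (x, y) \<Rightarrow> h x \<oplus>\<^bsub>R\<^esub> h y \<otimes>\<^bsub>R\<^esub> w) =
       (case z1 of (x, y) \<Rightarrow> h x \<oplus>\<^bsub>R\<^esub> h y \<otimes>\<^bsub>R\<^esub> w) \<otimes>\<^bsub>R\<^esub> (case z2 of (x, y) \<Rightarrow> h x \<oplus>\<^bsub>R\<^esub> h y \<otimes>\<^bsub>R\<^esub> w)"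
      using abc by (simp add: z df)
    show "(case z1 \<oplus>\<^bsub>E\<^esub> z2 of (x, y) \<Rightarrow> h x \<oplus>\<^bsub>R\<^esub> h y \<otimes>\<^bsub>R\<^esub> w) =
       (case z1 of (x, y) \<Rightarrow> h x \<oplus>\<^bsub>R\<^esub> h y \<otimes>\<^bsub>R\<^esub> w) \<oplus>\<^bsub>R\<^esub> (case z2 of (x, y) \<Rightarrow> h x \<oplus>\<^bsub>R\<^esub> h y \<otimes>\<^bsub>R\<^esub> w)"
      using abc w by (simp add: z R.l_distr R.a_ac)
  qed (use w in auto)
qed

text \<open>The extension of an injective homomorphism is injective, as quadratic extensions are free.\<close>

lemma extend_map:
  assumes C: "cring C" and h: "h \<in> ring_hom B C" and inj: "inj_on h (carrier B)"
  shows "map_prod h h \<in> ring_hom E (quad_ext C (h p) (h r))" "inj_on (map_prod h h) (carrier E)"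
proof -
  interpret C: cring C by fact
  interpret h: ring_hom_cring B C h by (rule ring_hom_cringI'[OF is_cring C h])
  show "map_prod h h \<in> ring_hom E (quad_ext C (h p) (h r))"
    by (rule ring_hom_memI) (auto simp: quad_ext_def)
  show "inj_on (map_prod h h) (carrier E)"
    using inj by (auto simp: inj_on_def)
qed

end

subsection \<open>Universal points\<close>

text \<open>Evaluation of an integer polynomial at an element of an arbitrary ring.\<close>

definition poly_eval :: "('a, 'b) ring_scheme \<Rightarrow> 'a \<Rightarrow> int poly \<Rightarrow> 'a" where
  "poly_eval R x p = fold_coeffs (\<lambda>a y. \<guillemotleft>a\<guillemotright>\<^bsub>R\<^esub> \<oplus>\<^bsub>R\<^esub> x \<otimes>\<^bsub>R\<^esub> y) p \<zero>\<^bsub>R\<^esub>"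

context cring
begin

lemma poly_eval_0 [simp]: "poly_eval R x 0 = \<zero>"
  by (simp add: poly_eval_def)

lemma poly_eval_pCons:
  assumes "x \<in> carrier R"
  shows "poly_eval R x (pCons a p) = \<guillemotleft>a\<guillemotright> \<oplus> x \<otimes> poly_eval R x p"
proof (cases "a = 0 \<and> p = 0")
  case True
  then show ?thesis using assms by simp
next
  case False
  then consider "a \<noteq> 0" | "p \<noteq> 0" by blast
  then show ?thesis by cases (simp_all add: poly_eval_def)
qed

lemma poly_eval_closed [simp]: "x \<in> carrier R \<Longrightarrow> poly_eval R x p \<in> carrier R"
  by (induction p) (simp_all add: poly_eval_pCons)

lemma poly_eval_add: "x \<in> carrier R \<Longrightarrow> poly_eval R x (p + q) = poly_eval R x p \<oplus> poly_eval R x q"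
  by (induction p q rule: poly_induct2) (simp_all add: poly_eval_pCons r_distr a_ac)

lemma poly_eval_smult: "x \<in> carrier R \<Longrightarrow> poly_eval R x (Polynomial.smult a p) = \<guillemotleft>a\<guillemotright> \<otimes> poly_eval R x p"
  by (induction p) (simp_all add: poly_eval_pCons r_distr m_ac)

lemma poly_eval_mult: "x \<in> carrier R \<Longrightarrow> poly_eval R x (p * q) = poly_eval R x p \<otimes> poly_eval R x q"
  by (induction p) (simp_all add: poly_eval_pCons poly_eval_add poly_eval_smult l_distr m_assoc)

lemma poly_eval_hom: 
  assumes "x \<in> carrier R" shows "poly_eval R x \<in> ring_hom cring_class_ops R"
  by (rule ring_hom_memI)
     (use assms in \<open>simp_all add: poly_eval_add poly_eval_mult plus_class times_class one_class poly_eval_pCons one_pCons\<close>)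

lemma poly_eval_X: "x \<in> carrier R \<Longrightarrow> poly_eval R x [:0, 1:] = x"
  by (simp add: poly_eval_pCons)

end

text \<open>The inclusion of \<open>\<int>[x]\<close> in \<open>\<rat>[x]\<close>, as evaluation at \<open>x\<close>.\<close>

definition rat_poly :: "int poly \<Rightarrow> rat poly" where
  "rat_poly = poly_eval cring_class_ops [:0, 1:]"

lemma coeff_rat_poly: "coeff (rat_poly p) n = of_int (coeff p n)"
proof (induction p arbitrary: n)
  case 0
  then show ?case unfolding rat_poly_def by (simp add: cring.poly_eval_0[OF cring_class] zero_class)
next
  case (pCons a p)
  have "rat_poly (pCons a p) = of_int a + [:0, 1:] * rat_poly p"
    unfolding rat_poly_def 
    by (simp add: cring.poly_eval_pCons[OF cring_class] carrier_class plus_class times_class of_int_class)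
  also have "\<dots> = pCons (of_int a) (rat_poly p)" by (simp add: of_int_poly)
  finally show ?case using pCons by (simp add: coeff_pCons split: nat.split)
qed

lemma rat_poly_hom: "rat_poly \<in> ring_hom cring_class_ops cring_class_ops"
  unfolding rat_poly_def by (rule cring.poly_eval_hom[OF cring_class carrier_class])

lemma inj_rat_poly: "inj rat_poly"
proof (rule injI)
  fix p q assume "rat_poly p = rat_poly q"
  then have "coeff (rat_poly p) n = coeff (rat_poly q) n" for n by simp
  then show "p = q" by (intro poly_eqI) (simp add: coeff_rat_poly)
qed

lemma rat_poly_X: "rat_poly [:0, 1:] = [:0, 1:]"
  unfolding rat_poly_def by (rule cring.poly_eval_X[OF cring_class carrier_class])

lemma rational_algebra_rat_poly: "rational_algebra (cring_class_ops :: rat poly ring)"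
  unfolding rational_algebra_def
proof (intro allI impI)
  fix n :: nat assume n: "n > 0"
  have "[:1 / of_nat n:] * (of_nat n :: rat poly) = 1" using n by (simp add: of_nat_poly one_pCons)
  then have "(of_nat n :: rat poly) \<in> Units cring_class_ops"
    unfolding Units_def times_class one_class
    by (auto simp: mult.commute intro!: carrier_class bexI[of _ "[:1 / of_nat n:]"] simp del: mult_pCons_left)
  then show "[n] \<cdot>\<^bsub>cring_class_ops\<^esub> \<one>\<^bsub>cring_class_ops\<^esub> \<in> Units (cring_class_ops :: rat poly ring)"
    using cring.add_pow_nat_eq[OF cring_class carrier_class, where x = "1 :: rat poly" and n = n] by (simp add: of_nat_class one_class times_class)
qed

text \<open>Adjoining to \<open>F\<close> an element \<open>w\<close> with \<open>q(w, x) = 1\<close>; for \<open>F = \<int>[x]\<close> this is the universal pair of norm one.\<close>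

definition norm_one_ring :: "int \<Rightarrow> nat \<Rightarrow> 'a ring \<Rightarrow> 'a \<Rightarrow> ('a \<times> 'a) ring" where
  "norm_one_ring d m F x = quad_ext F (\<ominus>\<^bsub>F\<^esub> (form_e d m F \<otimes>\<^bsub>F\<^esub> x)) (\<one>\<^bsub>F\<^esub> \<ominus>\<^bsub>F\<^esub> form_k d m F \<otimes>\<^bsub>F\<^esub> (x \<otimes>\<^bsub>F\<^esub> x))"

text \<open>Adjoining to \<open>F\<close> an idempotent in Case (I), a square root of 1 in Case (II): both are \<open>w\<^sup>2 = e w + (1 - e)\<close>.\<close>

definition component_ring :: "int \<Rightarrow> nat \<Rightarrow> 'a ring \<Rightarrow> ('a \<times> 'a) ring" where
  "component_ring d m F = quad_ext F (form_e d m F) (\<one>\<^bsub>F\<^esub> \<ominus>\<^bsub>F\<^esub> form_e d m F)"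

context form_ring
begin

lemma norm_one_extension:
  assumes "x \<in> carrier R" 
  shows "quad_extension R (\<ominus> (e \<otimes> x)) (\<one> \<ominus> k \<otimes> (x \<otimes> x))"
  using assms by unfold_locales auto

lemma component_extension: "quad_extension R e (\<one> \<ominus> e)"
  by unfold_locales auto

end

lemma norm_one_point:
  assumes F: "cring F" and x: "x \<in> carrier F"
  shows "cring (norm_one_ring d m F x)" "(\<lambda>y. (y, \<zero>\<^bsub>F\<^esub>)) \<in> ring_hom F (norm_one_ring d m F x)"
    "(\<zero>\<^bsub>F\<^esub>, \<one>\<^bsub>F\<^esub>) \<in> carrier (norm_one_ring d m F x)" "(x, \<zero>\<^bsub>F\<^esub>) \<in> carrier (norm_one_ring d m F x)"
    "quad.q (norm_one_ring d m F x) (form_e d m (norm_one_ring d m F x)) (form_k d m (norm_one_ring d m F x))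
       (\<zero>\<^bsub>F\<^esub>, \<one>\<^bsub>F\<^esub>) (x, \<zero>\<^bsub>F\<^esub>) = \<one>\<^bsub>norm_one_ring d m F x\<^esub>"
proof -
  interpret form_ring F d m by (simp add: form_ring_def F)
  interpret E: quad_extension F "\<ominus>\<^bsub>F\<^esub> (e \<otimes>\<^bsub>F\<^esub> x)" "\<one>\<^bsub>F\<^esub> \<ominus>\<^bsub>F\<^esub> k \<otimes>\<^bsub>F\<^esub> (x \<otimes>\<^bsub>F\<^esub> x)"
    by (rule norm_one_extension[OF x])
  have N: "norm_one_ring d m F x = E.E" by (simp add: norm_one_ring_def)
  show c: "cring (norm_one_ring d m F x)" unfolding N by (rule E.E_cring)
  show h: "(\<lambda>y. (y, \<zero>\<^bsub>F\<^esub>)) \<in> ring_hom F (norm_one_ring d m F x)" unfolding N by (rule E.embed_hom)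
  show g: "(\<zero>\<^bsub>F\<^esub>, \<one>\<^bsub>F\<^esub>) \<in> carrier (norm_one_ring d m F x)" "(x, \<zero>\<^bsub>F\<^esub>) \<in> carrier (norm_one_ring d m F x)"
    unfolding N using x by auto
  have "\<ominus>\<^bsub>F\<^esub> (e \<otimes>\<^bsub>F\<^esub> x) \<oplus>\<^bsub>F\<^esub> e \<otimes>\<^bsub>F\<^esub> x = \<zero>\<^bsub>F\<^esub>" using x by (simp add: l_neg)
  moreover have "(\<one>\<^bsub>F\<^esub> \<ominus>\<^bsub>F\<^esub> k \<otimes>\<^bsub>F\<^esub> (x \<otimes>\<^bsub>F\<^esub> x)) \<oplus>\<^bsub>F\<^esub> k \<otimes>\<^bsub>F\<^esub> (x \<otimes>\<^bsub>F\<^esub> x) = \<one>\<^bsub>F\<^esub>"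
    using x by (simp add: a_minus_def a_assoc l_neg)
  ultimately have eq: "(\<zero>\<^bsub>F\<^esub>, \<one>\<^bsub>F\<^esub>) \<otimes>\<^bsub>E.E\<^esub> (\<zero>\<^bsub>F\<^esub>, \<one>\<^bsub>F\<^esub>) \<oplus>\<^bsub>E.E\<^esub> (e, \<zero>\<^bsub>F\<^esub>) \<otimes>\<^bsub>E.E\<^esub> ((\<zero>\<^bsub>F\<^esub>, \<one>\<^bsub>F\<^esub>) \<otimes>\<^bsub>E.E\<^esub> (x, \<zero>\<^bsub>F\<^esub>)) \<oplus>\<^bsub>E.E\<^esub>
      (k, \<zero>\<^bsub>F\<^esub>) \<otimes>\<^bsub>E.E\<^esub> ((x, \<zero>\<^bsub>F\<^esub>) \<otimes>\<^bsub>E.E\<^esub> (x, \<zero>\<^bsub>F\<^esub>)) = \<one>\<^bsub>E.E\<^esub>"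
    using x by simp
  interpret h: form_ring_hom F "norm_one_ring d m F x" d m "\<lambda>y. (y, \<zero>\<^bsub>F\<^esub>)" by (rule form_ring_homI[OF F c h])
  show "h.S.q (\<zero>\<^bsub>F\<^esub>, \<one>\<^bsub>F\<^esub>) (x, \<zero>\<^bsub>F\<^esub>) = \<one>\<^bsub>norm_one_ring d m F x\<^esub>"
    unfolding h.S.q_def unfolding h.hom_e[symmetric] h.hom_k[symmetric] unfolding N by (rule eq)
qed

lemma component_point:
  assumes F: "cring F"
  shows "cring (component_ring d m F)" "(\<lambda>y. (y, \<zero>\<^bsub>F\<^esub>)) \<in> ring_hom F (component_ring d m F)"
    "(\<zero>\<^bsub>F\<^esub>, \<one>\<^bsub>F\<^esub>) \<in> carrier (component_ring d m F)"
    "case_I d m \<Longrightarrow> (\<zero>\<^bsub>F\<^esub>, \<one>\<^bsub>F\<^esub>) \<otimes>\<^bsub>component_ring d m F\<^esub> (\<zero>\<^bsub>F\<^esub>, \<one>\<^bsub>F\<^esub>) = (\<zero>\<^bsub>F\<^esub>, \<one>\<^bsub>F\<^esub>)"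
    "\<not> case_I d m \<Longrightarrow> (\<zero>\<^bsub>F\<^esub>, \<one>\<^bsub>F\<^esub>) \<otimes>\<^bsub>component_ring d m F\<^esub> (\<zero>\<^bsub>F\<^esub>, \<one>\<^bsub>F\<^esub>) = \<one>\<^bsub>component_ring d m F\<^esub>"
proof -
  interpret form_ring F d m by (simp add: form_ring_def F)
  interpret E: quad_extension F e "\<one>\<^bsub>F\<^esub> \<ominus>\<^bsub>F\<^esub> e" by (rule component_extension)
  have N: "component_ring d m F = E.E" by (simp add: component_ring_def)
  show "cring (component_ring d m F)" unfolding N by (rule E.E_cring)
  show "(\<lambda>y. (y, \<zero>\<^bsub>F\<^esub>)) \<in> ring_hom F (component_ring d m F)" unfolding N by (rule E.embed_hom)
  show "(\<zero>\<^bsub>F\<^esub>, \<one>\<^bsub>F\<^esub>) \<in> carrier (component_ring d m F)" unfolding N by simp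
  show "case_I d m \<Longrightarrow> (\<zero>\<^bsub>F\<^esub>, \<one>\<^bsub>F\<^esub>) \<otimes>\<^bsub>component_ring d m F\<^esub> (\<zero>\<^bsub>F\<^esub>, \<one>\<^bsub>F\<^esub>) = (\<zero>\<^bsub>F\<^esub>, \<one>\<^bsub>F\<^esub>)"
    "\<not> case_I d m \<Longrightarrow> (\<zero>\<^bsub>F\<^esub>, \<one>\<^bsub>F\<^esub>) \<otimes>\<^bsub>component_ring d m F\<^esub> (\<zero>\<^bsub>F\<^esub>, \<one>\<^bsub>F\<^esub>) = \<one>\<^bsub>component_ring d m F\<^esub>"
    unfolding N E.E_simps by (simp_all add: form_e_def a_minus_def r_neg)
qed

lemma norm_one_map:
  assumes F: "cring F" "cring C" and h: "h \<in> ring_hom F C" "inj_on h (carrier F)" and x: "x \<in> carrier F"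
  shows "map_prod h h \<in> ring_hom (norm_one_ring d m F x) (norm_one_ring d m C (h x))"
    "inj_on (map_prod h h) (carrier (norm_one_ring d m F x))"
proof -
  interpret h: form_ring_hom F C d m h by (rule form_ring_homI[OF F h(1)])
  interpret E: quad_extension F "\<ominus>\<^bsub>F\<^esub> (h.e \<otimes>\<^bsub>F\<^esub> x)" "\<one>\<^bsub>F\<^esub> \<ominus>\<^bsub>F\<^esub> h.k \<otimes>\<^bsub>F\<^esub> (x \<otimes>\<^bsub>F\<^esub> x)"
    by (rule h.norm_one_extension[OF x])
  have e: "h (\<ominus>\<^bsub>F\<^esub> (h.e \<otimes>\<^bsub>F\<^esub> x)) = \<ominus>\<^bsub>C\<^esub> (form_e d m C \<otimes>\<^bsub>C\<^esub> h x)"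
    "h (\<one>\<^bsub>F\<^esub> \<ominus>\<^bsub>F\<^esub> h.k \<otimes>\<^bsub>F\<^esub> (x \<otimes>\<^bsub>F\<^esub> x)) = \<one>\<^bsub>C\<^esub> \<ominus>\<^bsub>C\<^esub> form_k d m C \<otimes>\<^bsub>C\<^esub> (h x \<otimes>\<^bsub>C\<^esub> h x)"
    using x by (simp_all add: h.hom_e h.hom_k a_minus_def)
  show "map_prod h h \<in> ring_hom (norm_one_ring d m F x) (norm_one_ring d m C (h x))"
    "inj_on (map_prod h h) (carrier (norm_one_ring d m F x))"
    using E.extend_map[OF F(2) h] unfolding e norm_one_ring_def by simp_all
qed

lemma component_map:
  assumes F: "cring F" "cring C" and h: "h \<in> ring_hom F C" "inj_on h (carrier F)"
  shows "map_prod h h \<in> ring_hom (component_ring d m F) (component_ring d m C)"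
    "inj_on (map_prod h h) (carrier (component_ring d m F))"
proof -
  interpret h: form_ring_hom F C d m h by (rule form_ring_homI[OF F h(1)])
  interpret E: quad_extension F h.e "\<one>\<^bsub>F\<^esub> \<ominus>\<^bsub>F\<^esub> h.e" by (rule h.component_extension)
  have e: "h (\<one>\<^bsub>F\<^esub> \<ominus>\<^bsub>F\<^esub> h.e) = \<one>\<^bsub>C\<^esub> \<ominus>\<^bsub>C\<^esub> form_e d m C"
    by (simp add: h.hom_e a_minus_def)
  show "map_prod h h \<in> ring_hom (component_ring d m F) (component_ring d m C)"
    "inj_on (map_prod h h) (carrier (component_ring d m F))"
    using E.extend_map[OF F(2) h] unfolding e h.hom_e component_ring_def by simp_all
qed

text \<open>Each pair \<open>(a, h x)\<close> of norm one over an \<open>F\<close>-algebra \<open>R\<close> is the image of the pair \<open>(w, x)\<close>.\<close>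

lemma norm_one_eval:
  assumes F: "cring F" "cring R" and h: "h \<in> ring_hom F R" and x: "x \<in> carrier F" 
    and a: "a \<in> carrier R" and q: "quad.q R (form_e d m R) (form_k d m R) a (h x) = \<one>\<^bsub>R\<^esub>"
  obtains g where "g \<in> ring_hom (norm_one_ring d m F x) R" "g (\<zero>\<^bsub>F\<^esub>, \<one>\<^bsub>F\<^esub>) = a" "g (x, \<zero>\<^bsub>F\<^esub>) = h x"
proof -
  interpret h: form_ring_hom F R d m h by (rule form_ring_homI[OF F h])
  interpret E: quad_extension F "\<ominus>\<^bsub>F\<^esub> (h.e \<otimes>\<^bsub>F\<^esub> x)" "\<one>\<^bsub>F\<^esub> \<ominus>\<^bsub>F\<^esub> h.k \<otimes>\<^bsub>F\<^esub> (x \<otimes>\<^bsub>F\<^esub> x)"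
    by (rule h.norm_one_extension[OF x])
  obtain b e k where bek: "b = h x" "e = form_e d m R" "k = form_k d m R" "b \<in> carrier R" "e \<in> carrier R" "k \<in> carrier R"
    using x by simp
  have q': "a \<otimes>\<^bsub>R\<^esub> a \<oplus>\<^bsub>R\<^esub> e \<otimes>\<^bsub>R\<^esub> (a \<otimes>\<^bsub>R\<^esub> b) \<oplus>\<^bsub>R\<^esub> k \<otimes>\<^bsub>R\<^esub> (b \<otimes>\<^bsub>R\<^esub> b) = \<one>\<^bsub>R\<^esub>"
    using q by (simp add: h.S.q_def bek)
  have "a \<otimes>\<^bsub>R\<^esub> a = \<ominus>\<^bsub>R\<^esub> (e \<otimes>\<^bsub>R\<^esub> b) \<otimes>\<^bsub>R\<^esub> a \<oplus>\<^bsub>R\<^esub> (\<one>\<^bsub>R\<^esub> \<ominus>\<^bsub>R\<^esub> k \<otimes>\<^bsub>R\<^esub> (b \<otimes>\<^bsub>R\<^esub> b))"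
  proof (rule h.S.eq_of_diff)
    let ?z = "a \<otimes>\<^bsub>R\<^esub> a \<oplus>\<^bsub>R\<^esub> e \<otimes>\<^bsub>R\<^esub> (a \<otimes>\<^bsub>R\<^esub> b) \<oplus>\<^bsub>R\<^esub> k \<otimes>\<^bsub>R\<^esub> (b \<otimes>\<^bsub>R\<^esub> b) \<ominus>\<^bsub>R\<^esub> \<one>\<^bsub>R\<^esub>"
    show "?z = \<zero>\<^bsub>R\<^esub>" unfolding q' by (simp add: a_minus_def h.S.r_neg)
    show "a \<otimes>\<^bsub>R\<^esub> a \<ominus>\<^bsub>R\<^esub> (\<ominus>\<^bsub>R\<^esub> (e \<otimes>\<^bsub>R\<^esub> b) \<otimes>\<^bsub>R\<^esub> a \<oplus>\<^bsub>R\<^esub> (\<one>\<^bsub>R\<^esub> \<ominus>\<^bsub>R\<^esub> k \<otimes>\<^bsub>R\<^esub> (b \<otimes>\<^bsub>R\<^esub> b))) \<ominus>\<^bsub>R\<^esub> ?z = \<zero>\<^bsub>R\<^esub>"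
      by (rule h.S.ring_eqI[of "[a, b, e, k]"], simp add: h.S.in_carrier_def a bek(4-6), (rule h.S.reify)+, simp add: poly_norm)
  qed (use a bek(4-6) in simp_all)
  then have eq: "a \<otimes>\<^bsub>R\<^esub> a = h (\<ominus>\<^bsub>F\<^esub> (h.e \<otimes>\<^bsub>F\<^esub> x)) \<otimes>\<^bsub>R\<^esub> a \<oplus>\<^bsub>R\<^esub> h (\<one>\<^bsub>F\<^esub> \<ominus>\<^bsub>F\<^esub> h.k \<otimes>\<^bsub>F\<^esub> (x \<otimes>\<^bsub>F\<^esub> x))"
    using x by (simp add: h.hom_e h.hom_k a_minus_def bek)
  show ?thesis
    by (rule that[OF E.extend_hom[OF F(2) h a eq, folded norm_one_ring_def]]) (use x a in simp_all)
qed

lemma component_eval: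
  assumes F: "cring F" "cring R" and h: "h \<in> ring_hom F R" and w: "w \<in> carrier R"
    and eq: "w \<otimes>\<^bsub>R\<^esub> w = (if case_I d m then w else \<one>\<^bsub>R\<^esub>)"
  obtains g where "g \<in> ring_hom (component_ring d m F) R" "g (\<zero>\<^bsub>F\<^esub>, \<one>\<^bsub>F\<^esub>) = w"
    "\<And>y. y \<in> carrier F \<Longrightarrow> g (y, \<zero>\<^bsub>F\<^esub>) = h y"
proof -
  interpret h: form_ring_hom F R d m h by (rule form_ring_homI[OF F h])
  interpret E: quad_extension F h.e "\<one>\<^bsub>F\<^esub> \<ominus>\<^bsub>F\<^esub> h.e" by (rule h.component_extension)
  have "w \<otimes>\<^bsub>R\<^esub> w = h h.e \<otimes>\<^bsub>R\<^esub> w \<oplus>\<^bsub>R\<^esub> h (\<one>\<^bsub>F\<^esub> \<ominus>\<^bsub>F\<^esub> h.e)"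
    using w eq by (auto simp: form_e_def a_minus_def h.S.r_neg)
  note x = E.extend_hom[OF F(2) h w this, folded component_ring_def]
  show ?thesis by (rule that[OF x]) (use w in simp_all)
qed

subsection \<open>Points with flat models\<close>

lemma inj_coeffs: "inj (coeffs :: 'a::zero poly \<Rightarrow> 'a list)"
  by (rule injI) (simp add: coeffs_eq_iff)

lemma ex_code_poly: "\<exists>c :: 'a::{zero,countable} poly \<Rightarrow> nat. inj c"
  by (rule exI[of _ "to_nat \<circ> coeffs"]) (intro inj_compose inj_to_nat inj_coeffs)

lemma ex_code_pair: "\<exists>c :: 'a \<Rightarrow> nat. inj c \<Longrightarrow> \<exists>c :: 'a \<times> 'a \<Rightarrow> nat. inj c"
proof -
  assume "\<exists>c :: 'a \<Rightarrow> nat. inj c"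
  then obtain c :: "'a \<Rightarrow> nat" where "inj c" by blast
  then have "inj (\<lambda>(x, y). prod_encode (c x, c y))"
    by (auto simp: inj_def prod_encode_eq)
  then show ?thesis by blast
qed

lemma ex_code_infinite:
  assumes "infinite (UNIV :: 'u set)" "\<exists>c :: 'a \<Rightarrow> nat. inj c"
  obtains c :: "'a \<Rightarrow> 'u" where "inj c"
proof -
  obtain c :: "'a \<Rightarrow> nat" and n :: "nat \<Rightarrow> 'u" where "inj c" "inj n"
    using assms infinite_countable_subset by blast
  then show ?thesis using that[of "n \<circ> c"] inj_compose by blast
qed

lemma image_ring_facts:
  assumes B: "cring B" and c: "inj c"
  shows "cring (image_ring c B)" "c \<in> ring_hom B (image_ring c B)" 
    "inv_into (carrier B) c \<in> ring_hom (image_ring c B) B"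
    "inj_on (inv_into (carrier B) c) (carrier (image_ring c B))"
    "\<And>x. x \<in> carrier B \<Longrightarrow> inv_into (carrier B) c (c x) = x"
proof -
  interpret B: cring B by fact
  have inj: "inj_on c (carrier B)" using c by (simp add: inj_on_def inj_def)
  have iso: "c \<in> ring_iso B (image_ring c B)" by (rule inj_imp_image_ring_iso[OF inj])
  show "c \<in> ring_hom B (image_ring c B)" using iso by (simp add: ring_iso_def)
  show "cring (image_ring c B)" 
    using B.ring_iso_imp_img_cring[OF iso] by (simp add: image_ring_def image_group_def monoid.defs)
  show i: "inv_into (carrier B) c (c x) = x" if "x \<in> carrier B" for x
    using inj that by simp
  show "inv_into (carrier B) c \<in> ring_hom (image_ring c B) B"
    using ring_iso_set_sym[OF B.ring_axioms iso] by (simp add: ring_iso_def)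
  show "inj_on (inv_into (carrier B) c) (carrier (image_ring c B))"
    by (simp add: image_ring_carrier inj_on_inv_into)
qed

text \<open>A regular function that vanishes at all points of \<open>Gset\<close> over \<open>\<rat>\<close>-algebras (when \<open>t = 1\<close>, at those of determinant
  1) vanishes at each point over \<open>R\<close> that is the image under \<open>h\<close> of a point over a subring \<open>B\<close> of a \<open>\<rat>\<close>-algebra \<open>C\<close>. As
  regular functions are evaluated only on rings carried by \<open>'u\<close>, the countable rings \<open>B\<close> and \<open>C\<close> are
  first copied into \<open>'u\<close>, as \<open>U\<close> and \<open>V\<close>; then \<open>j\<close> is the inclusion of \<open>U\<close> in \<open>V\<close> and \<open>k\<close> the map from \<open>U\<close> to \<open>R\<close>.\<close>

lemma regular_zero_by_model:
  fixes R :: "'u ring" and B :: "'b0 ring" and C :: "'c0 ring"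
  assumes inf: "infinite (UNIV :: 'u set)" and R: "cring R" and B: "cring B" and C: "cring C"
    and rat: "rational_algebra C" and i: "i \<in> ring_hom B C" "inj_on i (carrier B)" and h: "h \<in> ring_hom B R"
    and cX: "\<exists>c :: 'b0 \<Rightarrow> nat. inj c" and cY: "\<exists>c :: 'c0 \<Rightarrow> nat. inj c"
    and pts: "a \<in> carrier B" "b \<in> carrier B" "u \<in> carrier B" "t \<in> carrier B"
    and q: "quad.q B (form_e d m B) (form_k d m B) a b = \<one>\<^bsub>B\<^esub>" and s: "sgm d m B u t"
    and \<phi>: "\<phi> \<in> regular_functions (O_scheme d m :: ('u, 'u mat2) group_functor)"
    and vanish: "\<And>V A. cring V \<Longrightarrow> rational_algebra V \<Longrightarrow> A \<in> form_ring.Gset V d m \<Longrightarrow>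
      (t = \<one>\<^bsub>B\<^esub> \<Longrightarrow> tfun V A = \<one>\<^bsub>V\<^esub>) \<Longrightarrow> \<phi> V A = \<zero>\<^bsub>V\<^esub>"
  shows "\<phi> R (quad.par R (form_e d m R) (form_k d m R) (h a) (h b) (h u) (h t)) = \<zero>\<^bsub>R\<^esub>"
proof -
  obtain c :: "'b0 \<Rightarrow> 'u" where c: "inj c" by (rule ex_code_infinite[OF inf cX])
  obtain c' :: "'c0 \<Rightarrow> 'u" where c': "inj c'" by (rule ex_code_infinite[OF inf cY])
  define U where "U = image_ring c B"
  define V where "V = image_ring c' C"
  define g where "g = inv_into (carrier B) c"
  note fU = image_ring_facts[OF B c, folded U_def g_def] and fV = image_ring_facts[OF C c', folded V_def]
  interpret B: form_ring B d m by (simp add: form_ring_def B)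
  interpret c: form_ring_hom B U d m c by (rule form_ring_homI[OF B fU(1,2)])
  define j where "j = restrict (c' \<circ> i \<circ> g) (carrier U)"
  define k where "k = restrict (h \<circ> g) (carrier U)"
  have j: "j \<in> ring_hom U V" "(V, j) \<in> arrows U"
  proof -
    have "c' \<circ> i \<circ> g \<in> ring_hom U V"
      using ring_hom_trans[OF ring_hom_trans[OF fU(3) i(1)] fV(2)] by (simp add: comp_assoc)
    then have "j \<in> ring_maps U V" unfolding j_def ring_maps_def
      using c.S.ring_hom_restrict[of "c' \<circ> i \<circ> g" V] by simp
    then show "j \<in> ring_hom U V" "(V, j) \<in> arrows U" using fV(1) by (auto simp: ring_maps_def arrows_def)
  qed
  have k: "k \<in> ring_hom U R" "(R, k) \<in> arrows U"
  proof -
    have "h \<circ> g \<in> ring_hom U R" using ring_hom_trans[OF fU(3) h] .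
    then have "k \<in> ring_maps U R" unfolding k_def ring_maps_def
      using c.S.ring_hom_restrict[of "h \<circ> g" R] by simp
    then show "k \<in> ring_hom U R" "(R, k) \<in> arrows U" using R by (auto simp: ring_maps_def arrows_def)
  qed
  have j_inj: "inj_on j (carrier U)"
  proof (rule inj_onI)
    fix x y assume xy: "x \<in> carrier U" "y \<in> carrier U" "j x = j y"
    then have "c' (i (g x)) = c' (i (g y))" by (simp add: j_def)
    then have "i (g x) = i (g y)" using c' by (simp add: inj_def)
    moreover have "g x \<in> carrier B" "g y \<in> carrier B" using fU(3) xy by (auto simp: ring_hom_def)
    ultimately have "g x = g y" using i(2) by (auto simp: inj_on_def)
    then show "x = y" using fU(4) xy by (auto simp: inj_on_def)
  qed
  have cc: "c x \<in> carrier U" "k (c x) = h x" if "x \<in> carrier B" for x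
    using that fU(2,5) by (auto simp: k_def ring_hom_def)
  define A where "A = c.S.par (c a) (c b) (c u) (c t)"
  have qU: "c.S.q (c a) (c b) = \<one>\<^bsub>U\<^esub>" using c.hom_q[OF pts(1,2)] q by simp
  have sU: "c.S.sg (c u) (c t)" by (rule c.hom_sg[OF pts(3,4) s])
  have A: "A \<in> c.S.Gset" unfolding A_def c.S.Gset_def using cc pts qU sU by blast
  note AO = Gset_subset_O[OF fU(1) A]
  interpret j: form_ring_hom U V d m j by (rule form_ring_homI[OF fU(1) fV(1) j(1)])
  interpret k: form_ring_hom U R d m k by (rule form_ring_homI[OF fU(1) R k(1)])
  have jA: "mat2_map j A = j.S.par (j (c a)) (j (c b)) (j (c u)) (j (c t))"
    unfolding A_def mat2_map_def by (rule j.hom_par) (simp_all add: cc pts)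
  have kA: "mat2_map k A = k.S.par (h a) (h b) (h u) (h t)"
    unfolding A_def mat2_map_def by (subst k.hom_par) (simp_all add: cc pts)
  have qV: "j.S.q (j (c a)) (j (c b)) = \<one>\<^bsub>V\<^esub>" using j.hom_q[of "c a" "c b"] cc pts qU by simp
  have "\<phi> V (mat2_map j A) = \<zero>\<^bsub>V\<^esub>"
  proof (rule vanish[OF fV(1) rational_algebra_hom[OF rat C fV(1,2)]])
    have "j.S.sg (j (c u)) (j (c t))" using j.hom_sg[OF _ _ sU] cc pts by simp
    then show "mat2_map j A \<in> j.S.Gset" unfolding jA j.S.Gset_def using cc pts qV by fastforce
    assume "t = \<one>\<^bsub>B\<^esub>"
    then have "j (c t) = \<one>\<^bsub>V\<^esub>" by simp
    moreover have "tfun V (mat2_map j A) = j (c t)"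
      unfolding jA tfun_def det_tpart[OF fV(1)] by (rule j.S.tpart_par) (simp_all add: cc pts qV)
    ultimately show "tfun V (mat2_map j A) = \<one>\<^bsub>V\<^esub>" by simp
  qed
  then have "j (\<phi> U A) = j \<zero>\<^bsub>U\<^esub>"
    using regularD(2)[OF \<phi> fU(1) AO j(2)] by (simp add: O_scheme_simps(4))
  then have "\<phi> U A = \<zero>\<^bsub>U\<^esub>"
    using j_inj regularD(1)[OF \<phi> fU(1) AO] by (auto simp: inj_on_def)
  then have "\<phi> R (mat2_map k A) = \<zero>\<^bsub>R\<^esub>"
    using regularD(2)[OF \<phi> fU(1) AO k(2)] by (simp add: O_scheme_simps(4))
  then show ?thesis unfolding kA .
qed

text \<open>The universal point of \<open>Gset\<close> lives over \<open>\<int>[x]\<close>, extended by the first column (\<open>?Z1\<close>) and by the pair \<open>(u, t)\<close> (\<open>?Z2\<close>).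
  The same construction from \<open>\<rat>[x]\<close> gives the \<open>\<rat>\<close>-algebra that contains \<open>?Z2\<close>.\<close>

lemma Gset_subset_O_tilde:
  fixes R :: "'u ring"
  assumes inf: "infinite (UNIV :: 'u set)" and R: "cring R" and A: "A \<in> form_ring.Gset R d m"
  shows "A \<in> carrier (grp (O_tilde d m) R)"
proof -
  interpret form_ring R d m by (simp add: form_ring_def R)
  obtain a b u t where abut: "a \<in> carrier R" "b \<in> carrier R" "u \<in> carrier R" "t \<in> carrier R"
    "q a b = \<one>\<^bsub>R\<^esub>" "sg u t" "A = par a b u t" using A unfolding Gset_def by blast
  let ?Z = "cring_class_ops :: int poly ring" and ?Q = "cring_class_ops :: rat poly ring"
  let ?x = "[:0, 1:] :: int poly" and ?y = "[:0, 1:] :: rat poly"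
  let ?Z1 = "norm_one_ring d m ?Z ?x" and ?Q1 = "norm_one_ring d m ?Q ?y"
  let ?Z2 = "component_ring d m ?Z1" and ?Q2 = "component_ring d m ?Q1"
  note Z1 = norm_one_point[OF cring_class carrier_class, where d = d and m = m and x = ?x]
  note Q1 = norm_one_point[OF cring_class carrier_class, where d = d and m = m and x = ?y]
  note Z2 = component_point[OF Z1(1), where d = d and m = m] and Q2 = component_point[OF Q1(1), where d = d and m = m]
  have m1: "map_prod rat_poly rat_poly \<in> ring_hom ?Z1 ?Q1" "inj_on (map_prod rat_poly rat_poly) (carrier ?Z1)"
    using norm_one_map[OF cring_class cring_class rat_poly_hom _ carrier_class, where d = d and m = m and x = ?x] inj_rat_poly
    by (auto simp: rat_poly_X inj_on_def inj_def)
  note m2 = component_map[OF Z1(1) Q1(1) m1, where d = d and m = m]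
  have rat: "rational_algebra ?Q2"
    by (rule rational_algebra_hom[OF rational_algebra_hom[OF rational_algebra_rat_poly cring_class Q1(1,2)] Q1(1) Q2(1,2)])
  obtain g1 where g1: "g1 \<in> ring_hom ?Z1 R" "g1 (\<zero>\<^bsub>?Z\<^esub>, \<one>\<^bsub>?Z\<^esub>) = a" "g1 (?x, \<zero>\<^bsub>?Z\<^esub>) = b"
    using norm_one_eval[OF cring_class R poly_eval_hom[OF abut(2)] carrier_class abut(1), where d = d and m = m and x = ?x]
      abut(2,5) poly_eval_X[OF abut(2)] by metis
  define w where "w = (if case_I d m then u else t)"
  have w: "w \<in> carrier R" "w \<otimes>\<^bsub>R\<^esub> w = (if case_I d m then w else \<one>\<^bsub>R\<^esub>)"
    using abut by (auto simp: w_def sgm_def)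
  obtain g2 where g2: "g2 \<in> ring_hom ?Z2 R" "g2 (\<zero>\<^bsub>?Z1\<^esub>, \<one>\<^bsub>?Z1\<^esub>) = w"
    "\<And>y. y \<in> carrier ?Z1 \<Longrightarrow> g2 (y, \<zero>\<^bsub>?Z1\<^esub>) = g1 y"
    using component_eval[OF Z1(1) R g1(1) w] by blast
  interpret Z1: form_ring_hom ?Z1 ?Z2 d m "\<lambda>y. (y, \<zero>\<^bsub>?Z1\<^esub>)" by (rule form_ring_homI[OF Z1(1) Z2(1,2)])
  interpret g2: form_ring_hom ?Z2 R d m g2 by (rule form_ring_homI[OF Z2(1) R g2(1)])
  let ?w = "(\<zero>\<^bsub>?Z1\<^esub>, \<one>\<^bsub>?Z1\<^esub>)"
  let ?a = "((\<zero>\<^bsub>?Z\<^esub>, \<one>\<^bsub>?Z\<^esub>), \<zero>\<^bsub>?Z1\<^esub>)" and ?b = "((?x, \<zero>\<^bsub>?Z\<^esub>), \<zero>\<^bsub>?Z1\<^esub>)"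
  define u0 where "u0 = (if case_I d m then ?w else \<zero>\<^bsub>?Z2\<^esub>)"
  define t0 where "t0 = (if case_I d m then \<one>\<^bsub>?Z2\<^esub> \<ominus>\<^bsub>?Z2\<^esub> (?w \<oplus>\<^bsub>?Z2\<^esub> ?w) else ?w)"
  have c: "?a \<in> carrier ?Z2" "?b \<in> carrier ?Z2" "u0 \<in> carrier ?Z2" "t0 \<in> carrier ?Z2"
    using Z1.h.hom_closed[OF Z1(3)] Z1.h.hom_closed[OF Z1(4)] Z2(3) by (simp_all add: u0_def t0_def)
  have q: "Z1.S.q ?a ?b = \<one>\<^bsub>?Z2\<^esub>"
    using Z1.hom_q[OF Z1(3,4)] Z1(5) Z1.h.hom_one by simp
  have s: "sgm d m ?Z2 u0 t0" using Z2(4,5) by (simp add: u0_def t0_def sgm_def)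
  have g2u: "g2 u0 = u" "g2 t0 = t"
    using abut(6) Z2(3) g2(2) by (auto simp: u0_def t0_def w_def sgm_def a_minus_def)
  have g2a: "g2 ?a = a" "g2 ?b = b" using g2(3) Z1(3,4) g1(2,3) by simp_all
  have "\<phi> R A = \<zero>\<^bsub>R\<^esub>" if \<phi>: "\<phi> \<in> regular_functions (O_scheme d m)"
    and v: "\<And>S. cring S \<Longrightarrow> \<forall>y \<in> generic_fibre (O_scheme d m) S. \<phi> S y = \<zero>\<^bsub>S\<^esub>" for \<phi>
  proof -
    have "\<phi> R (par (g2 ?a) (g2 ?b) (g2 u0) (g2 t0)) = \<zero>\<^bsub>R\<^esub>"
    proof (rule regular_zero_by_model[OF inf R Z2(1) Q2(1) rat m2 g2(1) _ _ c q s \<phi>])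
      show "\<exists>c :: (int poly \<times> int poly) \<times> (int poly \<times> int poly) \<Rightarrow> nat. inj c"
        by (intro ex_code_pair ex_code_poly)
      show "\<exists>c :: (rat poly \<times> rat poly) \<times> (rat poly \<times> rat poly) \<Rightarrow> nat. inj c"
        by (intro ex_code_pair ex_code_poly)
      show "\<phi> V A = \<zero>\<^bsub>V\<^esub>" if "cring V" "rational_algebra V" "A \<in> form_ring.Gset V d m" for V A
        using v[OF that(1)] Gset_subset_O[OF that(1,3)] that(2) by (simp add: generic_fibre_def)
    qed
    then show ?thesis unfolding g2a g2u abut(7) .
  qed
  then show ?thesis using Gset_subset_O[OF R A] unfolding O_tilde_def closure_carrier by blast
qed

text \<open>As before, with \<open>u = 0\<close> and \<open>t = 1\<close>, so that only the first column has to be adjoined.\<close>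

lemma Kset_subset_O_plus:
  fixes R :: "'u ring"
  assumes inf: "infinite (UNIV :: 'u set)" and R: "cring R" and A: "A \<in> form_ring.Kset R d m"
  shows "A \<in> carrier (grp (O_plus d m) R)"
proof -
  interpret form_ring R d m by (simp add: form_ring_def R)
  obtain a b where ab: "a \<in> carrier R" "b \<in> carrier R" "q a b = \<one>\<^bsub>R\<^esub>" "A = par a b \<zero>\<^bsub>R\<^esub> \<one>\<^bsub>R\<^esub>"
    using A unfolding Kset_def by blast
  let ?Z = "cring_class_ops :: int poly ring" and ?Q = "cring_class_ops :: rat poly ring"
  let ?x = "[:0, 1:] :: int poly" and ?y = "[:0, 1:] :: rat poly"
  let ?Z1 = "norm_one_ring d m ?Z ?x" and ?Q1 = "norm_one_ring d m ?Q ?y"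
  note Z1 = norm_one_point[OF cring_class carrier_class, where d = d and m = m and x = ?x]
  note Q1 = norm_one_point[OF cring_class carrier_class, where d = d and m = m and x = ?y]
  have m1: "map_prod rat_poly rat_poly \<in> ring_hom ?Z1 ?Q1" "inj_on (map_prod rat_poly rat_poly) (carrier ?Z1)"
    using norm_one_map[OF cring_class cring_class rat_poly_hom _ carrier_class, where d = d and m = m and x = ?x] inj_rat_poly
    by (auto simp: rat_poly_X inj_on_def inj_def)
  have rat: "rational_algebra ?Q1"
    by (rule rational_algebra_hom[OF rational_algebra_rat_poly cring_class Q1(1,2)])
  obtain g where g: "g \<in> ring_hom ?Z1 R" "g (\<zero>\<^bsub>?Z\<^esub>, \<one>\<^bsub>?Z\<^esub>) = a" "g (?x, \<zero>\<^bsub>?Z\<^esub>) = b"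
    using norm_one_eval[OF cring_class R poly_eval_hom[OF ab(2)] carrier_class ab(1), where d = d and m = m and x = ?x]
      ab(2,3) poly_eval_X[OF ab(2)] by metis
  interpret g: form_ring_hom ?Z1 R d m g by (rule form_ring_homI[OF Z1(1) R g(1)])
  have "\<phi> R A = \<zero>\<^bsub>R\<^esub>" if \<phi>: "\<phi> \<in> regular_functions (O_scheme d m)"
    and v: "\<And>S. cring S \<Longrightarrow> \<forall>y \<in> {A \<in> generic_fibre (O_scheme d m) S. mat2_det S A = \<one>\<^bsub>S\<^esub>}. \<phi> S y = \<zero>\<^bsub>S\<^esub>" for \<phi>
  proof -
    have "\<phi> R (par (g (\<zero>\<^bsub>?Z\<^esub>, \<one>\<^bsub>?Z\<^esub>)) (g (?x, \<zero>\<^bsub>?Z\<^esub>)) (g \<zero>\<^bsub>?Z1\<^esub>) (g \<one>\<^bsub>?Z1\<^esub>)) = \<zero>\<^bsub>R\<^esub>"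
    proof (rule regular_zero_by_model[OF inf R Z1(1) Q1(1) rat m1 g(1) _ _ Z1(3,4) _ _ Z1(5) _ \<phi>])
      show "\<exists>c :: int poly \<times> int poly \<Rightarrow> nat. inj c" "\<exists>c :: rat poly \<times> rat poly \<Rightarrow> nat. inj c"
        by (intro ex_code_pair ex_code_poly)+
      show "sgm d m ?Z1 \<zero>\<^bsub>?Z1\<^esub> \<one>\<^bsub>?Z1\<^esub>" by (rule g.sg_trivial)
      show "\<phi> V A = \<zero>\<^bsub>V\<^esub>" if "cring V" "rational_algebra V" "A \<in> form_ring.Gset V d m" 
        "\<one>\<^bsub>?Z1\<^esub> = \<one>\<^bsub>?Z1\<^esub> \<Longrightarrow> tfun V A = \<one>\<^bsub>V\<^esub>" for V A
        using v[OF that(1)] Gset_subset_O[OF that(1,3)] that(2) that(4)[OF refl] unfolding generic_fibre_def tfun_def by blast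
    qed simp_all
    then show ?thesis using g(2,3) ab(4) by simp
  qed
  then show ?thesis using Gset_subset_O[OF R subsetD[OF Kset_Gset A]] unfolding O_plus_def closure_carrier by blast
qed

section \<open>Quotients of group functors by kernels\<close>

text \<open>Natural homomorphisms \<open>D\<close> from \<open>G\<close> to \<open>H\<close>, with kernel \<open>K\<close>, that are surjective on \<open>R\<close>-points for each \<open>R\<close>. Elements of \<open>H\<close>
  restrict by application of the ring map. That \<open>H\<close> consists of groups follows, as it is the image of \<open>D\<close>.\<close>

locale kernel_quotient =
  fixes G K :: "('u, 'g) group_functor" and H :: "('u, 'u) group_functor" and D :: "'u ring \<Rightarrow> 'g \<Rightarrow> 'u"
  assumes group_G: "cring R \<Longrightarrow> group (grp G R)"
    and hom_D: "cring R \<Longrightarrow> D R \<in> hom (grp G R) (grp H R)"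
    and surj_D: "cring R \<Longrightarrow> D R ` carrier (grp G R) = carrier (grp H R)"
    and one_D: "cring R \<Longrightarrow> D R \<one>\<^bsub>grp G R\<^esub> = \<one>\<^bsub>grp H R\<^esub>"
    and kernel_D: "cring R \<Longrightarrow> carrier (grp K R) = {x \<in> carrier (grp G R). D R x = \<one>\<^bsub>grp H R\<^esub>}"
    and res_G: "cring R \<Longrightarrow> (S, f) \<in> arrows R \<Longrightarrow> x \<in> carrier (grp G R) \<Longrightarrow>
      res G R S f x \<in> carrier (grp G S) \<and> D S (res G R S f x) = f (D R x)"
begin

lemma group_hom_D: "cring R \<Longrightarrow> group_hom (grp G R) (grp H R) (D R)"
proof -
  assume R: "cring R"
  interpret group "grp G R" by (rule group_G[OF R])
  have "group ((grp H R)\<lparr>carrier := D R ` carrier (grp G R), one := D R \<one>\<^bsub>grp G R\<^esub>\<rparr>)"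
    by (rule hom_imp_img_group[OF hom_D[OF R]])
  then have "group (grp H R)" unfolding surj_D[OF R] one_D[OF R] by simp
  then show ?thesis by (simp add: group_hom_def group_hom_axioms_def hom_D[OF R] group_axioms)
qed

lemma kernel_K: "cring R \<Longrightarrow> kernel (grp G R) (grp H R) (D R) = carrier (grp K R)"
  by (simp add: kernel_def kernel_D)

lemma coset_eqI:
  assumes R: "cring R" and x: "x \<in> carrier (grp G R)" "y \<in> carrier (grp G R)" and eq: "D R x = D R y"
  shows "carrier (grp K R) #>\<^bsub>grp G R\<^esub> x = carrier (grp K R) #>\<^bsub>grp G R\<^esub> y"
proof -
  interpret h: group_hom "grp G R" "grp H R" "D R" by (rule group_hom_D[OF R])
  let ?k = "x \<otimes>\<^bsub>grp G R\<^esub> inv\<^bsub>grp G R\<^esub> y"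
  have "D R ?k = \<one>\<^bsub>grp H R\<^esub>" using x eq by simp
  then have "?k \<in> carrier (grp K R)" using x by (simp add: kernel_D[OF R])
  moreover have "x = ?k \<otimes>\<^bsub>grp G R\<^esub> y" using x by (simp add: h.G.m_assoc)
  ultimately have "x \<in> carrier (grp K R) #>\<^bsub>grp G R\<^esub> y" unfolding r_coset_def by blast
  then show ?thesis 
    using h.G.repr_independence[OF _ x(2)] h.subgroup_kernel unfolding kernel_K[OF R] by simp
qed

lemma image_coset:
  assumes R: "cring R" and x: "x \<in> carrier (grp G R)"
  shows "carrier (grp K R) #>\<^bsub>grp G R\<^esub> x \<subseteq> carrier (grp G R)" "x \<in> carrier (grp K R) #>\<^bsub>grp G R\<^esub> x"
    "y \<in> carrier (grp K R) #>\<^bsub>grp G R\<^esub> x \<Longrightarrow> D R y = D R x"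
    "the_elem (D R ` (carrier (grp K R) #>\<^bsub>grp G R\<^esub> x)) = D R x"
proof -
  interpret h: group_hom "grp G R" "grp H R" "D R" by (rule group_hom_D[OF R])
  show 1: "carrier (grp K R) #>\<^bsub>grp G R\<^esub> x \<subseteq> carrier (grp G R)"
    using h.G.r_coset_subset_G[OF _ x] by (simp add: kernel_D[OF R])
  show 2: "x \<in> carrier (grp K R) #>\<^bsub>grp G R\<^esub> x"
    using h.G.rcos_self[OF x] h.subgroup_kernel unfolding kernel_K[OF R] by simp
  show 3: "y \<in> carrier (grp K R) #>\<^bsub>grp G R\<^esub> x \<Longrightarrow> D R y = D R x" for y
    using x unfolding r_coset_def kernel_D[OF R] by auto
  have "D R ` (carrier (grp K R) #>\<^bsub>grp G R\<^esub> x) = {D R x}" using 2 3 by blast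
  then show "the_elem (D R ` (carrier (grp K R) #>\<^bsub>grp G R\<^esub> x)) = D R x" by simp
qed

lemma quotient_carrier: 
  "carrier (grp (quotient_presheaf G K) R) = {carrier (grp K R) #>\<^bsub>grp G R\<^esub> x | x. x \<in> carrier (grp G R)}"
  unfolding quotient_presheaf_def FactGroup_def RCOSETS_def by auto

text \<open>The restriction of a coset is a single coset: its elements have the same image under \<open>D\<close>.\<close>

lemma quotient_res:
  assumes R: "cring R" and a: "(S, f) \<in> arrows R" and x: "x \<in> carrier (grp G R)"
  shows "res (quotient_presheaf G K) R S f (carrier (grp K R) #>\<^bsub>grp G R\<^esub> x) =
    carrier (grp K S) #>\<^bsub>grp G S\<^esub> res G R S f x"
proof -
  have S: "cring S" using a by (simp add: arrows_def)
  let ?C = "carrier (grp K R) #>\<^bsub>grp G R\<^esub> x"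
  have "res (quotient_presheaf G K) R S f ?C = (\<Union>y\<in>?C. carrier (grp K S) #>\<^bsub>grp G S\<^esub> res G R S f y)"
    unfolding quotient_presheaf_def set_mult_def r_coset_def by auto
  also have "\<dots> = (\<Union>y\<in>?C. carrier (grp K S) #>\<^bsub>grp G S\<^esub> res G R S f x)"
  proof (rule SUP_cong[OF refl])
    fix y assume y: "y \<in> ?C"
    then have yG: "y \<in> carrier (grp G R)" using image_coset(1)[OF R x] by blast
    show "carrier (grp K S) #>\<^bsub>grp G S\<^esub> res G R S f y = carrier (grp K S) #>\<^bsub>grp G S\<^esub> res G R S f x"
      by (rule coset_eqI[OF S]) (use res_G[OF R a] x yG image_coset(3)[OF R x y] in simp_all)
  qed
  also have "\<dots> = carrier (grp K S) #>\<^bsub>grp G S\<^esub> res G R S f x" using image_coset(2)[OF R x] by blast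
  finally show ?thesis .
qed

lemma quotient_iso: 
  assumes R: "cring R"
  shows "(\<lambda>C. the_elem (D R ` C)) \<in> iso (grp (quotient_presheaf G K) R) (grp H R)"
proof -
  interpret h: group_hom "grp G R" "grp H R" "D R" by (rule group_hom_D[OF R])
  show ?thesis using h.FactGroup_iso_set[OF surj_D[OF R]] 
    unfolding kernel_K[OF R] by (simp add: quotient_presheaf_def)
qed

lemma quotient_mult: 
  assumes R: "cring R" and C: "C \<in> carrier (grp (quotient_presheaf G K) R)" "C' \<in> carrier (grp (quotient_presheaf G K) R)"
  shows "C \<otimes>\<^bsub>grp (quotient_presheaf G K) R\<^esub> C' \<in> carrier (grp (quotient_presheaf G K) R)"
proof -
  interpret h: group_hom "grp G R" "grp H R" "D R" by (rule group_hom_D[OF R])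
  have "group (grp G R Mod carrier (grp K R))"
    using normal.factorgroup_is_group[OF h.normal_kernel] unfolding kernel_K[OF R] .
  then have "group (grp (quotient_presheaf G K) R)" by (simp add: quotient_presheaf_def)
  then show ?thesis using C by (rule monoid.m_closed[OF group.is_monoid])
qed

theorem quotient_isomorphic:
  assumes "infinite (UNIV :: 'u set)"
    and "\<And>R :: 'u ring. cring R \<Longrightarrow> carrier (grp H R) \<subseteq> carrier R"
    and "\<And>(R :: 'u ring) S f u. res H R S f u = f u"
    and "\<And>(R :: 'u ring) S f u v. cring R \<Longrightarrow> (S, f) \<in> arrows R \<Longrightarrow> u \<in> carrier (grp H R) \<Longrightarrow> v \<in> carrier (grp H R) \<Longrightarrow>
      f u \<in> carrier (grp H S) \<and> f (u \<otimes>\<^bsub>grp H R\<^esub> v) = f u \<otimes>\<^bsub>grp H S\<^esub> f v"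
    and "\<And>(R :: 'u ring) U u. cring R \<Longrightarrow> fppf_sieve R U \<Longrightarrow> u \<in> carrier R \<Longrightarrow>
      (\<And>S f. (S, f) \<in> U \<Longrightarrow> f u \<in> carrier (grp H S)) \<Longrightarrow> u \<in> carrier (grp H R)"
  shows "isomorphic_functors (fppf_quotient G K) H"
  unfolding fppf_quotient_def
proof (rule sheaf_comparison.sheafification_isomorphic[where \<psi> = "\<lambda>R C. the_elem (D R ` C)"], rule sheaf_comparison.intro)
  fix R S :: "'u ring" and f C
  assume R: "cring R" and a: "(S, f) \<in> arrows R" and C: "C \<in> carrier (grp (quotient_presheaf G K) R)"
  then obtain x where x: "x \<in> carrier (grp G R)" "C = carrier (grp K R) #>\<^bsub>grp G R\<^esub> x"
    unfolding quotient_carrier by blast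
  have S: "cring S" using a by (simp add: arrows_def)
  note r = res_G[OF R a x(1)]
  show "res (quotient_presheaf G K) R S f C \<in> carrier (grp (quotient_presheaf G K) S) \<and>
      the_elem (D S ` res (quotient_presheaf G K) R S f C) = f (the_elem (D R ` C))"
    unfolding x(2) quotient_res[OF R a x(1)] image_coset(4)[OF R x(1)] image_coset(4)[OF S conjunct1[OF r]]
    using r unfolding quotient_carrier by blast
qed (use quotient_iso quotient_mult assms in blast)+

end

section \<open>The points of the closures\<close>

lemma O_tilde_carrier:
  fixes R :: "'u ring"
  assumes "infinite (UNIV :: 'u set)" "d \<noteq> 0" "m \<ge> 1" "cring R"
  shows "carrier (grp (O_tilde d m) R) = form_ring.Gset R d m"
  using assms Gset_subset_O_tilde O_tilde_subset_Gset by blast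

lemma O_plus_carrier:
  fixes R :: "'u ring"
  assumes "infinite (UNIV :: 'u set)" "d \<noteq> 0" "m \<ge> 1" "cring R"
  shows "carrier (grp (O_plus d m) R) = form_ring.Kset R d m"
  using assms Kset_subset_O_plus O_plus_subset_Kset by blast

lemma O_tilde_simps:
  "x \<otimes>\<^bsub>grp (O_tilde d m) R\<^esub> y = x \<otimes>\<^bsub>grp GL2 R\<^esub> y" "\<one>\<^bsub>grp (O_tilde d m) R\<^esub> = \<one>\<^bsub>grp GL2 R\<^esub>"
  "res (O_tilde d m) R S f = mat2_map f"
  by (simp_all add: O_tilde_def closure_carrier O_scheme_simps)

lemma GL2_one: 
  fixes R :: "'u ring"
  assumes R: "cring R" shows "\<one>\<^bsub>grp GL2 R\<^esub> = quad.par R (form_e d m R) (form_k d m R) \<one>\<^bsub>R\<^esub> \<zero>\<^bsub>R\<^esub> \<zero>\<^bsub>R\<^esub> \<one>\<^bsub>R\<^esub>"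
proof -
  interpret form_ring R d m by (simp add: form_ring_def R)
  show ?thesis by (simp add: GL2_def par_def a_minus_def)
qed

text \<open>The product of two matrices in parametrised form; the first column of the left factor has norm one.\<close>

lemma par_mult:
  fixes R :: "'u ring"
  assumes R: "cring R" and "a \<in> carrier R" "b \<in> carrier R" "u \<in> carrier R" "t \<in> carrier R" 
    "x \<in> carrier R" "y \<in> carrier R" "v \<in> carrier R" "s \<in> carrier R" 
    and sg: "sgm d m R u t" "sgm d m R v s" 
    and q: "quad.q R (form_e d m R) (form_k d m R) a b = \<one>\<^bsub>R\<^esub>" 
  defines "a' \<equiv> quad.fst_mul R (form_k d m R) a b u t x y" and "b' \<equiv> quad.snd_mul R (form_e d m R) a b u t x y"
  shows "quad.par R (form_e d m R) (form_k d m R) a b u t \<otimes>\<^bsub>grp GL2 R\<^esub> quad.par R (form_e d m R) (form_k d m R) x y v s =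
     quad.par R (form_e d m R) (form_k d m R) a' b' (v \<oplus>\<^bsub>R\<^esub> u \<otimes>\<^bsub>R\<^esub> s) (t \<otimes>\<^bsub>R\<^esub> s)"
    "a' \<in> carrier R" "b' \<in> carrier R"
    "quad.q R (form_e d m R) (form_k d m R) a' b' = quad.q R (form_e d m R) (form_k d m R) x y"
proof -
  interpret form_ring R d m by (simp add: form_ring_def R)
  note c = assms(2-9) and au = sgm_aut[OF assms(4,5) sg(1)]
  show "par a b u t \<otimes>\<^bsub>grp GL2 R\<^esub> par x y v s = par a' b' (v \<oplus>\<^bsub>R\<^esub> u \<otimes>\<^bsub>R\<^esub> s) (t \<otimes>\<^bsub>R\<^esub> s)"
    using par_mult_second[OF c au] unfolding a'_def b'_def
    by (simp add: GL2_def par_def fst_mul_def snd_mul_def)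
  show "a' \<in> carrier R" "b' \<in> carrier R" unfolding a'_def b'_def fst_mul_def snd_mul_def using c by simp_all
  show "q a' b' = q x y"
    unfolding a'_def b'_def fst_mul_def snd_mul_def q_par[OF c(1-6)] q q_aut[OF c(3,4,5,6) au] using c by simp
qed

lemma ufun_par:
  fixes R :: "'u ring"
  assumes R: "cring R" and "a \<in> carrier R" "b \<in> carrier R" "u \<in> carrier R" "t \<in> carrier R" 
    and q: "quad.q R (form_e d m R) (form_k d m R) a b = \<one>\<^bsub>R\<^esub>" 
  shows "ufun d m R (quad.par R (form_e d m R) (form_k d m R) a b u t) = u"
    "tfun R (quad.par R (form_e d m R) (form_k d m R) a b u t) = t"
proof -
  interpret form_ring R d m by (simp add: form_ring_def R)
  show "ufun d m R (par a b u t) = u" unfolding ufun_def by (rule upart_par[OF assms(2-5) q])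
  show "tfun R (par a b u t) = t" unfolding tfun_def det_tpart[OF R] by (rule tpart_par[OF assms(2-5) q])
qed

lemma Gset_mult:
  fixes R :: "'u ring"
  assumes R: "cring R" and A: "A \<in> form_ring.Gset R d m" "B \<in> form_ring.Gset R d m"
  shows "A \<otimes>\<^bsub>grp GL2 R\<^esub> B \<in> form_ring.Gset R d m"
    "ufun d m R (A \<otimes>\<^bsub>grp GL2 R\<^esub> B) = ufun d m R B \<oplus>\<^bsub>R\<^esub> ufun d m R A \<otimes>\<^bsub>R\<^esub> tfun R B"
    "tfun R (A \<otimes>\<^bsub>grp GL2 R\<^esub> B) = tfun R A \<otimes>\<^bsub>R\<^esub> tfun R B"
proof -
  interpret form_ring R d m by (simp add: form_ring_def R)
  obtain a b u t where A': "a \<in> carrier R" "b \<in> carrier R" "u \<in> carrier R" "t \<in> carrier R"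
    "q a b = \<one>\<^bsub>R\<^esub>" "sg u t" "A = par a b u t" using A(1) unfolding Gset_def by blast
  obtain x y v s where B': "x \<in> carrier R" "y \<in> carrier R" "v \<in> carrier R" "s \<in> carrier R"
    "q x y = \<one>\<^bsub>R\<^esub>" "sg v s" "B = par x y v s" using A(2) unfolding Gset_def by blast
  note p = par_mult[OF R A'(1-4) B'(1-4) A'(6) B'(6) A'(5)]
  have c: "v \<oplus>\<^bsub>R\<^esub> u \<otimes>\<^bsub>R\<^esub> s \<in> carrier R" "t \<otimes>\<^bsub>R\<^esub> s \<in> carrier R" using A' B' by simp_all
  note q1 = p(4)[unfolded B'(5)]
  show "A \<otimes>\<^bsub>grp GL2 R\<^esub> B \<in> Gset"
    using p(2,3) c q1 sgm_mult(1)[OF A'(3,4) B'(3,4) A'(6) B'(6)] unfolding A'(7) B'(7) p(1) Gset_def by blast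
  show "ufun d m R (A \<otimes>\<^bsub>grp GL2 R\<^esub> B) = ufun d m R B \<oplus>\<^bsub>R\<^esub> ufun d m R A \<otimes>\<^bsub>R\<^esub> tfun R B"
    "tfun R (A \<otimes>\<^bsub>grp GL2 R\<^esub> B) = tfun R A \<otimes>\<^bsub>R\<^esub> tfun R B"
    unfolding A'(7) B'(7) p(1) ufun_par[OF R p(2,3) c q1] ufun_par[OF R A'(1-5)] ufun_par[OF R B'(1-5)] by simp_all
qed

lemma GL2_assoc:
  fixes R :: "'u ring"
  assumes R: "cring R" and "A \<in> carrier R \<times> carrier R \<times> carrier R \<times> carrier R" 
    "B \<in> carrier R \<times> carrier R \<times> carrier R \<times> carrier R" "C \<in> carrier R \<times> carrier R \<times> carrier R \<times> carrier R"
  shows "A \<otimes>\<^bsub>grp GL2 R\<^esub> B \<otimes>\<^bsub>grp GL2 R\<^esub> C = A \<otimes>\<^bsub>grp GL2 R\<^esub> (B \<otimes>\<^bsub>grp GL2 R\<^esub> C)"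
    "\<one>\<^bsub>grp GL2 R\<^esub> \<otimes>\<^bsub>grp GL2 R\<^esub> A = A" "A \<otimes>\<^bsub>grp GL2 R\<^esub> \<one>\<^bsub>grp GL2 R\<^esub> = A"
proof -
  interpret cring R by fact
  obtain a b c d a' b' c' d' a'' b'' c'' d'' where "A = (a, b, c, d)" "B = (a', b', c', d')" "C = (a'', b'', c'', d'')"
    by (metis prod.exhaust)
  then show "A \<otimes>\<^bsub>grp GL2 R\<^esub> B \<otimes>\<^bsub>grp GL2 R\<^esub> C = A \<otimes>\<^bsub>grp GL2 R\<^esub> (B \<otimes>\<^bsub>grp GL2 R\<^esub> C)"
    "\<one>\<^bsub>grp GL2 R\<^esub> \<otimes>\<^bsub>grp GL2 R\<^esub> A = A" "A \<otimes>\<^bsub>grp GL2 R\<^esub> \<one>\<^bsub>grp GL2 R\<^esub> = A"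
    using assms by (simp_all add: GL2_def l_distr r_distr m_assoc a_ac)
qed

lemma Gset_one:
  fixes R :: "'u ring"
  assumes R: "cring R"
  shows "\<one>\<^bsub>grp GL2 R\<^esub> \<in> form_ring.Gset R d m" 
    "ufun d m R \<one>\<^bsub>grp GL2 R\<^esub> = \<zero>\<^bsub>R\<^esub>" "tfun R \<one>\<^bsub>grp GL2 R\<^esub> = \<one>\<^bsub>R\<^esub>"
proof -
  interpret form_ring R d m by (simp add: form_ring_def R)
  have q: "q \<one>\<^bsub>R\<^esub> \<zero>\<^bsub>R\<^esub> = \<one>\<^bsub>R\<^esub>" by (simp add: q_def)
  show "\<one>\<^bsub>grp GL2 R\<^esub> \<in> Gset" unfolding GL2_one[OF R, of d m] Gset_def using q sg_trivial by blast
  show "ufun d m R \<one>\<^bsub>grp GL2 R\<^esub> = \<zero>\<^bsub>R\<^esub>" "tfun R \<one>\<^bsub>grp GL2 R\<^esub> = \<one>\<^bsub>R\<^esub>"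
    unfolding GL2_one[OF R, of d m] by (rule ufun_par[OF R _ _ _ _ q]; simp)+
qed

lemma Gset_inverse:
  fixes R :: "'u ring"
  assumes R: "cring R" and A: "A \<in> form_ring.Gset R d m"
  shows "\<exists>B \<in> form_ring.Gset R d m. A \<otimes>\<^bsub>grp GL2 R\<^esub> B = \<one>\<^bsub>grp GL2 R\<^esub>"
proof -
  interpret form_ring R d m by (simp add: form_ring_def R)
  obtain a b u t where A': "a \<in> carrier R" "b \<in> carrier R" "u \<in> carrier R" "t \<in> carrier R"
    "q a b = \<one>\<^bsub>R\<^esub>" "sg u t" "A = par a b u t" using A(1) unfolding Gset_def by blast
  note au = sgm_aut[OF A'(3,4,6)]
  let ?x = "a \<oplus>\<^bsub>R\<^esub> e \<otimes>\<^bsub>R\<^esub> b \<ominus>\<^bsub>R\<^esub> u \<otimes>\<^bsub>R\<^esub> b" and ?y = "\<ominus>\<^bsub>R\<^esub> (t \<otimes>\<^bsub>R\<^esub> b)"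
  have c: "?x \<in> carrier R" "?y \<in> carrier R" using A' by simp_all
  note p = par_mult[OF R A'(1-4) c A'(3,4) A'(6,6,5), unfolded conj_mul[OF A'(1-4) au] A'(5)]
  have "u \<oplus>\<^bsub>R\<^esub> u \<otimes>\<^bsub>R\<^esub> t = \<zero>\<^bsub>R\<^esub>" "t \<otimes>\<^bsub>R\<^esub> t = \<one>\<^bsub>R\<^esub>" using au by (simp_all add: aut_def)
  then have "A \<otimes>\<^bsub>grp GL2 R\<^esub> par ?x ?y u t = \<one>\<^bsub>grp GL2 R\<^esub>"
    unfolding A'(7) p(1) GL2_one[OF R, of d m] by simp
  moreover have "q ?x ?y = \<one>\<^bsub>R\<^esub>" using p(4) by (simp add: q_def)
  then have "par ?x ?y u t \<in> Gset" unfolding Gset_def using c A' by blast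
  ultimately show ?thesis by blast
qed

lemma O_tilde_group:
  fixes R :: "'u ring"
  assumes inf: "infinite (UNIV :: 'u set)" and dm: "d \<noteq> 0" "m \<ge> 1" and R: "cring R"
  shows "group (grp (O_tilde d m) R)"
proof -
  note s = O_tilde_simps O_tilde_carrier[OF inf dm R] and e = Gset_parts(4)[OF R]
  have r: "\<exists>B \<in> form_ring.Gset R d m. B \<otimes>\<^bsub>grp GL2 R\<^esub> A = \<one>\<^bsub>grp GL2 R\<^esub>" if A: "A \<in> form_ring.Gset R d m" for A
  proof -
    obtain B where B: "B \<in> form_ring.Gset R d m" "A \<otimes>\<^bsub>grp GL2 R\<^esub> B = \<one>\<^bsub>grp GL2 R\<^esub>" 
      using Gset_inverse[OF R A] by blast
    obtain C where C: "C \<in> form_ring.Gset R d m" "B \<otimes>\<^bsub>grp GL2 R\<^esub> C = \<one>\<^bsub>grp GL2 R\<^esub>" 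
      using Gset_inverse[OF R B(1)] by blast
    have "A = A \<otimes>\<^bsub>grp GL2 R\<^esub> B \<otimes>\<^bsub>grp GL2 R\<^esub> C"
      unfolding GL2_assoc(1)[OF R e[OF A] e[OF B(1)] e[OF C(1)]] C(2) GL2_assoc(3)[OF R e[OF A] e[OF A] e[OF A]] ..
    also have "\<dots> = C" unfolding B(2) GL2_assoc(2)[OF R e[OF C(1)] e[OF A] e[OF A]] ..
    finally show ?thesis using B(1) C(2) by blast
  qed
  show ?thesis
  proof (rule groupI; unfold s)
    fix A B C assume A: "A \<in> form_ring.Gset R d m" and B: "B \<in> form_ring.Gset R d m" and C: "C \<in> form_ring.Gset R d m"
    show "A \<otimes>\<^bsub>grp GL2 R\<^esub> B \<in> form_ring.Gset R d m" by (rule Gset_mult(1)[OF R A B])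
    show "A \<otimes>\<^bsub>grp GL2 R\<^esub> B \<otimes>\<^bsub>grp GL2 R\<^esub> C = A \<otimes>\<^bsub>grp GL2 R\<^esub> (B \<otimes>\<^bsub>grp GL2 R\<^esub> C)"
      by (rule GL2_assoc(1)[OF R e[OF A] e[OF B] e[OF C]])
  next
    fix A assume A: "A \<in> form_ring.Gset R d m"
    show "\<one>\<^bsub>grp GL2 R\<^esub> \<otimes>\<^bsub>grp GL2 R\<^esub> A = A" by (rule GL2_assoc(2)[OF R e[OF A] e[OF A] e[OF A]])
    show "\<exists>B \<in> form_ring.Gset R d m. B \<otimes>\<^bsub>grp GL2 R\<^esub> A = \<one>\<^bsub>grp GL2 R\<^esub>" by (rule r[OF A])
  qed (rule Gset_one(1)[OF R])
qed

section \<open>The component map\<close>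

text \<open>The map that induces the isomorphism: \<open>u\<close> in Case (I), \<open>t\<close> in Case (II).\<close>

definition component_map_fun :: "int \<Rightarrow> nat \<Rightarrow> 'u ring \<Rightarrow> 'u mat2 \<Rightarrow> 'u" where
  "component_map_fun d m R A = (if case_I d m then ufun d m R A else tfun R A)"

text \<open>The group scheme of order 2 on the right of the isomorphism.\<close>

definition component_group :: "int \<Rightarrow> nat \<Rightarrow> ('u, 'u) group_functor" where
  "component_group d m = (if case_I d m then Z2_scheme else mu2_scheme)"

lemma component_group_simps:
  "carrier (grp (component_group d m) R) = {r \<in> carrier R. r \<otimes>\<^bsub>R\<^esub> r = (if case_I d m then r else \<one>\<^bsub>R\<^esub>)}"
  "x \<otimes>\<^bsub>grp (component_group d m) R\<^esub> y = (if case_I d m then (x \<oplus>\<^bsub>R\<^esub> y) \<ominus>\<^bsub>R\<^esub> [(2::nat)] \<cdot>\<^bsub>R\<^esub> (x \<otimes>\<^bsub>R\<^esub> y) else x \<otimes>\<^bsub>R\<^esub> y)"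
  "\<one>\<^bsub>grp (component_group d m) R\<^esub> = (if case_I d m then \<zero>\<^bsub>R\<^esub> else \<one>\<^bsub>R\<^esub>)"
  "res (component_group d m) R S f x = f x"
  by (simp_all add: component_group_def Z2_scheme_def mu2_scheme_def)

lemma component_map_surj:
  fixes R :: "'u ring"
  assumes R: "cring R" and w: "w \<in> carrier (grp (component_group d m) R)"
  obtains A where "A \<in> form_ring.Gset R d m" "component_map_fun d m R A = w"
proof -
  interpret form_ring R d m by (simp add: form_ring_def R)
  \<comment> \<open>The preimage is \<open>par 1 0 u t\<close>.\<close>
  define u where "u = (if case_I d m then w else \<zero>\<^bsub>R\<^esub>)"
  define t where "t = (if case_I d m then \<one>\<^bsub>R\<^esub> \<ominus>\<^bsub>R\<^esub> (w \<oplus>\<^bsub>R\<^esub> w) else w)"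
  have c: "u \<in> carrier R" "t \<in> carrier R" and sg: "sg u t"
    using w by (auto simp: u_def t_def component_group_simps sgm_def)
  have q: "q \<one>\<^bsub>R\<^esub> \<zero>\<^bsub>R\<^esub> = \<one>\<^bsub>R\<^esub>" by (simp add: q_def)
  have "component_map_fun d m R (par \<one>\<^bsub>R\<^esub> \<zero>\<^bsub>R\<^esub> u t) = w"
    unfolding component_map_fun_def ufun_par[OF R one_closed zero_closed c q] by (simp add: u_def t_def)
  moreover have "par \<one>\<^bsub>R\<^esub> \<zero>\<^bsub>R\<^esub> u t \<in> Gset" unfolding Gset_def using c sg q by blast
  ultimately show ?thesis using that by blast
qed

lemma component_map_hom:
  fixes R :: "'u ring"
  assumes R: "cring R" and A: "A \<in> form_ring.Gset R d m" 
  shows "component_map_fun d m R A \<in> carrier (grp (component_group d m) R)"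
    "B \<in> form_ring.Gset R d m \<Longrightarrow> component_map_fun d m R (A \<otimes>\<^bsub>grp GL2 R\<^esub> B) = 
      component_map_fun d m R A \<otimes>\<^bsub>grp (component_group d m) R\<^esub> component_map_fun d m R B"
proof -
  interpret form_ring R d m by (simp add: form_ring_def R)
  note a = Gset_parts[OF R A]
  show "component_map_fun d m R A \<in> carrier (grp (component_group d m) R)"
    using a(1-3) by (simp add: component_map_fun_def component_group_simps sgm_def split: if_splits)
  assume B: "B \<in> Gset"
  note b = Gset_parts[OF R B]
  show "component_map_fun d m R (A \<otimes>\<^bsub>grp GL2 R\<^esub> B) = 
      component_map_fun d m R A \<otimes>\<^bsub>grp (component_group d m) R\<^esub> component_map_fun d m R B"
    using sgm_mult(2)[OF a(1,2) b(1,2) a(3) b(3)] Gset_mult(2,3)[OF R A B]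
    by (simp add: component_map_fun_def component_group_simps)
qed

lemma component_map_kernel:
  fixes R :: "'u ring"
  assumes R: "cring R"
  shows "form_ring.Kset R d m = {A \<in> form_ring.Gset R d m. component_map_fun d m R A = \<one>\<^bsub>grp (component_group d m) R\<^esub>}"
proof -
  interpret form_ring R d m by (simp add: form_ring_def R)
  have "ufun d m R A = \<zero>\<^bsub>R\<^esub> \<and> tfun R A = \<one>\<^bsub>R\<^esub> \<longleftrightarrow> component_map_fun d m R A = \<one>\<^bsub>grp (component_group d m) R\<^esub>"
    if "A \<in> Gset" for A
    using Gset_parts(3)[OF R that] by (auto simp: component_map_fun_def component_group_simps sgm_def a_minus_def split: if_splits)
  then show ?thesis using Kset_iff[OF R] by blast
qed

lemma Gset_map:
  fixes R :: "'u ring"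
  assumes R: "cring R" and a: "(S, f) \<in> arrows R" and A: "A \<in> form_ring.Gset R d m"
  shows "mat2_map f A \<in> form_ring.Gset S d m" "component_map_fun d m S (mat2_map f A) = f (component_map_fun d m R A)"
proof -
  interpret form_ring_hom R S d m f by (rule arrow_form_ring_hom[OF R a])
  obtain a b u t where A': "a \<in> carrier R" "b \<in> carrier R" "u \<in> carrier R" "t \<in> carrier R"
    "q a b = \<one>\<^bsub>R\<^esub>" "sg u t" "A = par a b u t" using A(1) unfolding Gset_def by blast
  have "mat2_map f A = S.par (f a) (f b) (f u) (f t)"
    unfolding A'(7) mat2_map_def by (rule hom_par[OF A'(1-4)])
  moreover have "S.q (f a) (f b) = \<one>\<^bsub>S\<^esub>" using hom_q[OF A'(1,2)] A'(5) by simp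
  ultimately show "mat2_map f A \<in> S.Gset"
    unfolding S.Gset_def using A'(1-4) hom_sg[OF A'(3,4,6)] h.hom_closed by blast
  show "component_map_fun d m S (mat2_map f A) = f (component_map_fun d m R A)"
    using entries_hom(2,4)[OF R a Gset_parts(4)[OF R A]] by (simp add: component_map_fun_def)
qed

theorem proposition5p1:
  fixes d :: int and m :: nat
  assumes "infinite (UNIV :: 'u set)"
    and "d \<noteq> 0" and "d \<noteq> 1" and "squarefree d" and "m \<ge> 1"
  shows "isomorphic_functors
           (fppf_quotient (O_tilde d m :: ('u, 'u mat2) group_functor) (O_plus d m))
           (if case_I d m then Z2_scheme else mu2_scheme)"
proof -
  note inf = assms(1) and dm = assms(2,5)
  note O = O_tilde_carrier[OF inf dm] O_plus_carrier[OF inf dm] O_tilde_simps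
  interpret kernel_quotient "O_tilde d m :: ('u, 'u mat2) group_functor" "O_plus d m" "component_group d m" "component_map_fun d m"
  proof (rule kernel_quotient.intro)
    fix R :: "'u ring" assume R: "cring R"
    show "group (grp (O_tilde d m) R)" by (rule O_tilde_group[OF inf dm R])
    show "component_map_fun d m R \<in> hom (grp (O_tilde d m) R) (grp (component_group d m) R)"
      by (rule homI; unfold O(1)[OF R] O(3)) (use component_map_hom[OF R] in blast)+
    show "component_map_fun d m R ` carrier (grp (O_tilde d m) R) = carrier (grp (component_group d m) R)"
      unfolding O(1)[OF R] using component_map_hom(1)[OF R] component_map_surj[OF R] by blast
    show "component_map_fun d m R \<one>\<^bsub>grp (O_tilde d m) R\<^esub> = \<one>\<^bsub>grp (component_group d m) R\<^esub>"
      using Gset_one(2,3)[OF R] by (simp add: O component_map_fun_def component_group_simps)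
    show "carrier (grp (O_plus d m) R) = {x \<in> carrier (grp (O_tilde d m) R). component_map_fun d m R x = \<one>\<^bsub>grp (component_group d m) R\<^esub>}"
      unfolding O(1,2)[OF R] by (rule component_map_kernel[OF R])
    fix S f x assume a: "(S, f) \<in> arrows R" and x: "x \<in> carrier (grp (O_tilde d m) R)"
    have S: "cring S" using a by (simp add: arrows_def)
    show "res (O_tilde d m) R S f x \<in> carrier (grp (O_tilde d m) S) \<and>
       component_map_fun d m S (res (O_tilde d m) R S f x) = f (component_map_fun d m R x)"
      using Gset_map[OF R a] x unfolding O(1)[OF R] O(1)[OF S] O(5) by blast
  qed
  have "isomorphic_functors (fppf_quotient (O_tilde d m :: ('u, 'u mat2) group_functor) (O_plus d m)) (component_group d m)"
  proof (rule quotient_isomorphic[OF inf])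
    fix R :: "'u ring" assume R: "cring R"
    interpret cring R by fact
    show "carrier (grp (component_group d m) R) \<subseteq> carrier R" by (auto simp: component_group_simps)
    show "u \<in> carrier (grp (component_group d m) R)"
      if U: "fppf_sieve R U" and u: "u \<in> carrier R"
        and loc: "\<And>S f. (S, f) \<in> U \<Longrightarrow> f u \<in> carrier (grp (component_group d m) S)" for U u
    proof -
      obtain C where C: "C \<subseteq> U" "fppf_family R C" using U by (auto simp: fppf_sieve_def)
      have UR: "U \<subseteq> arrows R" using U by (auto simp: fppf_sieve_def sieve_def)
      \<comment> \<open>The defining equation holds on a covering family, where elements of \<open>R\<close> are separated.\<close>
      have "u \<otimes>\<^bsub>R\<^esub> u = (if case_I d m then u else \<one>\<^bsub>R\<^esub>)"
      proof (rule fppf_separated[OF inf R C(2)])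
        fix S f assume "(S, f) \<in> C"
        then have Sf: "(S, f) \<in> U" "(S, f) \<in> arrows R" using C(1) UR by auto
        interpret ring_hom_cring R S f by (rule arrow_ring_hom_cring[OF R Sf(2)])
        show "f (u \<otimes>\<^bsub>R\<^esub> u) = f (if case_I d m then u else \<one>\<^bsub>R\<^esub>)"
          using loc[OF Sf(1)] u by (simp add: component_group_simps)
      qed (use u in simp_all)
      then show ?thesis using u by (simp add: component_group_simps)
    qed
    fix S f u v assume a: "(S, f) \<in> arrows R" 
      and u: "u \<in> carrier (grp (component_group d m) R)" "v \<in> carrier (grp (component_group d m) R)"
    interpret ring_hom_cring R S f by (rule arrow_ring_hom_cring[OF R a])
    have c: "u \<in> carrier R" "v \<in> carrier R" using u by (simp_all add: component_group_simps)
    have "f u \<otimes>\<^bsub>S\<^esub> f u = (if case_I d m then f u else \<one>\<^bsub>S\<^esub>)"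
      using u c by (simp add: component_group_simps flip: hom_mult)
    moreover have "f ([(2::nat)] \<cdot>\<^bsub>R\<^esub> (u \<otimes>\<^bsub>R\<^esub> v)) = [(2::nat)] \<cdot>\<^bsub>S\<^esub> (f u \<otimes>\<^bsub>S\<^esub> f v)"
      unfolding cring.add_pow_nat_eq[OF R cring.cring_simprules(5)[OF R c]] using c by (simp add: S.add_pow_nat_eq hom_of_nat)
    ultimately show "f u \<in> carrier (grp (component_group d m) S) \<and>
      f (u \<otimes>\<^bsub>grp (component_group d m) R\<^esub> v) = f u \<otimes>\<^bsub>grp (component_group d m) S\<^esub> f v"
      using c by (simp add: component_group_simps a_minus_def)
  qed (simp add: component_group_simps)
  then show ?thesis by (simp add: component_group_def)
qed

end
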